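(* Let $\widetilde{p}_A(g_0,g_1,g_2,\dots)$ be the formal power series $$\widetilde{p}_A(g_0,g_1,g_2,\dots):=g_0+\sum_\Gamma\frac{g_0^{\mathrm{tr}(\Gamma)}}{|\mathrm{Aut}(\Gamma)|}\prod_v g_{l(v)}^{|\mathrm{out}(v)|-1},$$ where $\Gamma$ runs over the minimal representatives (isomorphism classes of levelled oriented forests without trivial tails) on at least two leaves, and $v$ runs over the non-leaf vertices of $\Gamma$. Remove from $\widetilde{p}_A$ all bad monomials, and then in the remaining monomials replace $g_0$ with $t$ and, for all $i,r\ge 1$, replace the power $g_i^r$ (where $r$ is the full exponent of $g_i$ in the monomial) with $\frac{q^r-q}{q-1}\,t^r$. The resulting series is $$\phi_A(q,t)=t+\sum_{n\ge 2}P_{\mathcal{C}_{A_{n-1}}}(q)\,\frac{t^n}{n!}\in\mathbb{Q}[q][[t]],$$ where $P_{\mathcal{C}_{A_{n-1}}}(q)=\sum_i \mathrm{rk}\big(H^{2i}(Y_{\mathcal{C}_{A_{n-1}}},\mathbb{Z})\big)q^i$ is the Poincaré polynomial of the maximal De Concini–Procesi model $Y_{\mathcal{C}_{A_{n-1}}}$ of the root arrangement of type $A_{n-1}$.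
   Context: **Models.** Let $V$ be a finite dimensional complex vector space and $\mathcal{G}$ a finite set of nonzero subspaces of $V^*$. For $A\in\mathcal{G}$ let $A^\perp\subset V$ be its annihilator, and let $\mathcal{A}_{\mathcal{G}}=V\setminus\bigcup_{A\in\mathcal{G}}A^\perp$. The De Concini–Procesi model $Y_{\mathcal{G}}$ is the closure of the image of the embedding $\mathcal{A}_{\mathcal{G}}\to V\times\prod_{A\in\mathcal{G}}\mathbb{P}(V/A^\perp)$ given by the inclusion on the first component and by the maps $V\setminus A^\perp\to\mathbb{P}(V/A^\perp)$ on the other components. The odd-degree integer cohomology of the models considered here is $0$. **Type $A_{n-1}$.** Let $n\ge2$, let $W=\mathbb{C}^n$ with coordinates $z_1,\dots,z_n$, $N=\{z_1=\dots=z_n\}$ and $V=W/N$. Let $f_{ij}\in V^*$ be the functional induced by $z_i-z_j$. $\mathcal{C}_{A_{n-1}}$ is the set of all subspaces of $V^*$ that are sums of (nonempty) collections of the lines $\langle f_{ij}\rangle$, $i\neq j$. **Forests.** A levelled oriented forest is a finite disjoint union of finite rooted trees (non-planar, leaves unlabelled), with edges directed away from the roots; the degenerate tree consisting of a single leaf is allowed as a component. Leaves are the vertices without outgoing edges. A non-leaf vertex $v$ has level $l(v)=1+$ (distance from $v$ to the root of its tree), so non-leaf roots have level $1$. $\mathrm{out}(v)$ is the set of outgoing edges of $v$; $\mathrm{tr}(\Gamma)$ is the number of trees of $\Gamma$ (including degenerate ones); $\mathrm{Aut}(\Gamma)$ is the group of automorphisms of $\Gamma$ as a rooted oriented forest.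 A trivial tail is a subtree stemming from a (non-leaf) vertex $v$ with $|\mathrm{out}(v)|=1$ and having a single leaf. Two forests are equivalent if they differ only by trivial tails (i.e. by replacing such subtrees with a single leaf, or conversely); the minimal representative of an equivalence class is the forest in it with no trivial tails (equivalently, every non-leaf vertex has at least two leaves among its descendants). **Bad monomials.** A monomial of $\widetilde{p}_A$ is bad if there exist $1\le i<j$ such that $g_j$ appears in the monomial but $g_i$ does not. *)

theory Defs
  imports
    "HOL-Homology.Homology"
    "HOL-Combinatorics.Permutations"
    "HOL-Computational_Algebra.Formal_Power_Series"
    "Jordan_Normal_Form.VS_Connect"
begin

section \<open>Complex vector spaces, duals and quotients\<close>

text \<open>Complex vector spaces are module records over \<open>class_ring :: complex ring\<close>, with explicit
  carriers, since the dimension varies inside the statement. As in \<open>module_vec\<close>, the ring fields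
  \<open>mult\<close> and \<open>one\<close> of a module record carry no information.\<close>

type_synonym 'v cspace = "(complex, 'v) module"

definition dual_space :: "'v cspace \<Rightarrow> ('v \<Rightarrow> complex) cspace" where
  "dual_space V = (ring.func_space class_ring (carrier V))
     \<lparr>carrier := {f \<in> carrier V \<rightarrow>\<^sub>E UNIV.
        (\<forall>v\<in>carrier V. \<forall>w\<in>carrier V. f (v \<oplus>\<^bsub>V\<^esub> w) = f v + f w) \<and>
        (\<forall>c. \<forall>v\<in>carrier V. f (c \<odot>\<^bsub>V\<^esub> v) = c * f v)}\<rparr>"

definition annihilator :: "'v cspace \<Rightarrow> ('v \<Rightarrow> complex) set \<Rightarrow> 'v set" where
  "annihilator V A = {v \<in> carrier V. \<forall>f\<in>A. f v = 0}"

definition quotient_space :: "'v cspace \<Rightarrow> 'v set \<Rightarrow> 'v set cspace" where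
  "quotient_space V N =
     \<lparr>carrier = A_RCOSETS V N, monoid.mult = undefined, one = undefined, zero = N, add = set_add V,
      smult = (\<lambda>c X. \<Union>x\<in>X. N +>\<^bsub>V\<^esub> (c \<odot>\<^bsub>V\<^esub> x))\<rparr>"

definition line :: "'v cspace \<Rightarrow> 'v \<Rightarrow> 'v set" where
  "line V v = {c \<odot>\<^bsub>V\<^esub> v | c. True}"


section \<open>The topology of vector spaces and projective spaces\<close>

text \<open>On a finite dimensional space the coarsest topology making all linear functionals continuous
  is the usual Euclidean one.\<close>

definition cspace_topology :: "'v cspace \<Rightarrow> 'v topology" where
  "cspace_topology V =
     topology_generated_by {{v \<in> carrier V. f v \<in> U} | f U. f \<in> carrier (dual_space V) \<and> open U}"

definition quotient_topology :: "'a topology \<Rightarrow> ('a \<Rightarrow> 'b) \<Rightarrow> 'b topology" where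
  "quotient_topology X f =
     topology (\<lambda>S. S \<subseteq> f ` topspace X \<and> openin X {x \<in> topspace X. f x \<in> S})"

lemma openin_quotient_topology:
  "openin (quotient_topology X f) S \<longleftrightarrow>
     S \<subseteq> f ` topspace X \<and> openin X {x \<in> topspace X. f x \<in> S}"
proof -
  have "istopology (\<lambda>S. S \<subseteq> f ` topspace X \<and> openin X {x \<in> topspace X. f x \<in> S})"
    unfolding istopology_def
  proof (intro conjI allI impI; (elim conjE)?)
    fix S T
    assume "openin X {x \<in> topspace X. f x \<in> S}" "openin X {x \<in> topspace X. f x \<in> T}"
    then have "openin X ({x \<in> topspace X. f x \<in> S} \<inter> {x \<in> topspace X. f x \<in> T})"
      by (rule openin_Int)
    moreover have "{x \<in> topspace X. f x \<in> S \<inter> T} =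
        {x \<in> topspace X. f x \<in> S} \<inter> {x \<in> topspace X. f x \<in> T}" by auto
    ultimately show "openin X {x \<in> topspace X. f x \<in> S \<inter> T}" by simp
  next
    fix \<K>
    assume *: "\<forall>K\<in>\<K>. K \<subseteq> f ` topspace X \<and> openin X {x \<in> topspace X. f x \<in> K}"
    then have "openin X (\<Union>K\<in>\<K>. {x \<in> topspace X. f x \<in> K})" by blast
    moreover have "{x \<in> topspace X. f x \<in> \<Union>\<K>} = (\<Union>K\<in>\<K>. {x \<in> topspace X. f x \<in> K})" by auto
    ultimately show "openin X {x \<in> topspace X. f x \<in> \<Union>\<K>}" by simp
  qed auto
  then show ?thesis unfolding quotient_topology_def by (simp add: topology_inverse')
qed

lemma topspace_quotient_topology: "topspace (quotient_topology X f) = f ` topspace X"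
proof -
  have "{x \<in> topspace X. f x \<in> f ` topspace X} = topspace X" by auto
  then have "openin (quotient_topology X f) (f ` topspace X)"
    by (simp add: openin_quotient_topology)
  then show ?thesis
    by (metis openin_quotient_topology openin_subset openin_topspace subset_antisym)
qed

lemma quotient_map_quotient_topology: "quotient_map X (quotient_topology X f) f"
  by (auto simp: quotient_map_def topspace_quotient_topology openin_quotient_topology)

definition projective_space :: "'v cspace \<Rightarrow> 'v set topology" where
  "projective_space V =
     quotient_topology (subtopology (cspace_topology V) (carrier V - {\<zero>\<^bsub>V\<^esub>})) (line V)"


section \<open>De Concini--Procesi models\<close>

context
  fixes V :: "'v cspace" and G :: "('v \<Rightarrow> complex) set set"
begin

definition dcp_complement :: "'v set" where
  "dcp_complement = carrier V - (\<Union>A\<in>G. annihilator V A)"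

definition dcp_ambient :: "('v \<times> (('v \<Rightarrow> complex) set \<Rightarrow> 'v set set)) topology" where
  "dcp_ambient = prod_topology (cspace_topology V)
     (product_topology (\<lambda>A. projective_space (quotient_space V (annihilator V A))) G)"

definition dcp_embedding :: "'v \<Rightarrow> 'v \<times> (('v \<Rightarrow> complex) set \<Rightarrow> 'v set set)" where
  "dcp_embedding v =
     (v, \<lambda>A\<in>G. line (quotient_space V (annihilator V A)) (annihilator V A +>\<^bsub>V\<^esub> v))"

definition dcp_model :: "('v \<times> (('v \<Rightarrow> complex) set \<Rightarrow> 'v set set)) topology" where
  "dcp_model = subtopology dcp_ambient (dcp_ambient closure_of (dcp_embedding ` dcp_complement))"

end


section \<open>The root arrangement of type A\<close>

text \<open>The coordinates \<open>z\<^sub>1, \<dots>, z\<^sub>n\<close> are indexed from \<open>0\<close> to \<open>n - 1\<close>.\<close>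

definition diagonal :: "nat \<Rightarrow> complex vec set" where
  "diagonal n = {z \<in> carrier_vec n. \<forall>i<n. \<forall>j<n. z $ i = z $ j}"

definition typeA_space :: "nat \<Rightarrow> complex vec set cspace" where
  "typeA_space n = quotient_space (module_vec TYPE(complex) n) (diagonal n)"

definition typeA_root :: "nat \<Rightarrow> nat \<Rightarrow> nat \<Rightarrow> (complex vec set \<Rightarrow> complex)" where
  "typeA_root n i j = (\<lambda>X\<in>carrier (typeA_space n). the_elem ((\<lambda>z. z $ i - z $ j) ` X))"

definition typeA_lines :: "nat \<Rightarrow> (complex vec set \<Rightarrow> complex) set set" where
  "typeA_lines n =
     {line (dual_space (typeA_space n)) (typeA_root n i j) | i j. i < n \<and> j < n \<and> i \<noteq> j}"

definition typeA_building_set :: "nat \<Rightarrow> (complex vec set \<Rightarrow> complex) set set" where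
  "typeA_building_set n =
     {module.span class_ring (dual_space (typeA_space n)) (\<Union>\<L>) | \<L>. \<L> \<subseteq> typeA_lines n \<and> \<L> \<noteq> {}}"

abbreviation typeA_model where
  "typeA_model n \<equiv> dcp_model (typeA_space n) (typeA_building_set n)"


section \<open>Singular cohomology and Poincare polynomials\<close>

definition cochain_group :: "nat \<Rightarrow> 'a topology \<Rightarrow> ('a chain \<Rightarrow> int) monoid" where
  "cochain_group p X =
     \<lparr>carrier = hom (chain_group p X) integer_group \<inter> extensional (carrier (chain_group p X)),
      monoid.mult = (\<lambda>\<phi> \<psi>. \<lambda>c\<in>carrier (chain_group p X). \<phi> c + \<psi> c),
      one = (\<lambda>c\<in>carrier (chain_group p X). 0)\<rparr>"

definition coboundary :: "nat \<Rightarrow> 'a topology \<Rightarrow> ('a chain \<Rightarrow> int) \<Rightarrow> ('a chain \<Rightarrow> int)" where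
  "coboundary p X \<phi> = (\<lambda>c\<in>carrier (chain_group (Suc p) X). \<phi> (chain_boundary (Suc p) c))"

definition cocycle_set :: "nat \<Rightarrow> 'a topology \<Rightarrow> ('a chain \<Rightarrow> int) set" where
  "cocycle_set p X = kernel (cochain_group p X) (cochain_group (Suc p) X) (coboundary p X)"

definition coboundary_set :: "nat \<Rightarrow> 'a topology \<Rightarrow> ('a chain \<Rightarrow> int) set" where
  "coboundary_set p X =
     (case p of 0 \<Rightarrow> {\<one>\<^bsub>cochain_group 0 X\<^esub>}
      | Suc r \<Rightarrow> coboundary r X ` carrier (cochain_group r X))"

definition cohomology_group :: "nat \<Rightarrow> 'a topology \<Rightarrow> ('a chain \<Rightarrow> int) set monoid" where
  "cohomology_group p X =
     subgroup_generated (cochain_group p X) (cocycle_set p X) Mod coboundary_set p X"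

definition integrally_independent :: "('a, 'b) monoid_scheme \<Rightarrow> 'a set \<Rightarrow> bool" where
  "integrally_independent H S \<longleftrightarrow> finite S \<and> S \<subseteq> carrier H \<and>
     (\<forall>c :: 'a \<Rightarrow> int. finprod H (\<lambda>x. x [^]\<^bsub>H\<^esub> c x) S = \<one>\<^bsub>H\<^esub> \<longrightarrow> (\<forall>x\<in>S. c x = 0))"

text \<open>Only meaningful for abelian groups of finite rank.\<close>

definition abelian_rank :: "('a, 'b) monoid_scheme \<Rightarrow> nat" where
  "abelian_rank H = Sup (card ` Collect (integrally_independent H))"

text \<open>Only even cohomology contributes: \<open>q\<close> has cohomological degree 2, and the spaces considered
  have no odd cohomology.\<close>

definition poincare_polynomial :: "'a topology \<Rightarrow> rat poly" where
  "poincare_polynomial X =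
     (\<Sum>i | abelian_rank (cohomology_group (2 * i) X) \<noteq> 0.
        Polynomial.monom (of_nat (abelian_rank (cohomology_group (2 * i) X))) i)"


section \<open>Levelled oriented forests\<close>

text \<open>A finite disjoint union of finite rooted trees, directed away from the roots, is the same as a
  finite acyclic digraph in which every vertex has at most one incoming edge; the trees correspond
  to the vertices without incoming edge. Vertices are natural numbers, so that isomorphism classes
  form a set.\<close>

type_synonym digraph = "nat set \<times> (nat \<times> nat) set"

definition forest :: "digraph \<Rightarrow> bool" where
  "forest \<Gamma> \<longleftrightarrow> (case \<Gamma> of (V, E) \<Rightarrow>
     finite V \<and> E \<subseteq> V \<times> V \<and> acyclic E \<and>
     (\<forall>u v w. (u, w) \<in> E \<and> (v, w) \<in> E \<longrightarrow> u = v))"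

definition out_edges :: "digraph \<Rightarrow> nat \<Rightarrow> (nat \<times> nat) set" where
  "out_edges \<Gamma> v = {e \<in> snd \<Gamma>. fst e = v}"

definition leaves :: "digraph \<Rightarrow> nat set" where
  "leaves \<Gamma> = {v \<in> fst \<Gamma>. out_edges \<Gamma> v = {}}"

definition nonleaves :: "digraph \<Rightarrow> nat set" where
  "nonleaves \<Gamma> = {v \<in> fst \<Gamma>. out_edges \<Gamma> v \<noteq> {}}"

definition roots :: "digraph \<Rightarrow> nat set" where
  "roots \<Gamma> = {v \<in> fst \<Gamma>. \<forall>u. (u, v) \<notin> snd \<Gamma>}"

definition num_trees :: "digraph \<Rightarrow> nat" where
  "num_trees \<Gamma> = card (roots \<Gamma>)"

definition level :: "digraph \<Rightarrow> nat \<Rightarrow> nat" where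
  "level \<Gamma> v = 1 + (LEAST d. \<exists>r\<in>roots \<Gamma>. (r, v) \<in> snd \<Gamma> ^^ d)"

definition forest_isomorphic :: "digraph \<Rightarrow> digraph \<Rightarrow> bool" where
  "forest_isomorphic \<Gamma> \<Delta> \<longleftrightarrow>
     (\<exists>f. bij_betw f (fst \<Gamma>) (fst \<Delta>) \<and> map_prod f f ` snd \<Gamma> = snd \<Delta>)"

definition automorphisms :: "digraph \<Rightarrow> (nat \<Rightarrow> nat) set" where
  "automorphisms \<Gamma> = {\<pi>. \<pi> permutes fst \<Gamma> \<and> map_prod \<pi> \<pi> ` snd \<Gamma> = snd \<Gamma>}"

definition has_trivial_tail :: "digraph \<Rightarrow> bool" where
  "has_trivial_tail \<Gamma> \<longleftrightarrow>
     (\<exists>v\<in>nonleaves \<Gamma>. card (out_edges \<Gamma> v) = 1 \<and> card {w \<in> leaves \<Gamma>. (v, w) \<in> (snd \<Gamma>)\<^sup>*} = 1)"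

definition minimal_forest_classes :: "digraph set set" where
  "minimal_forest_classes =
     {\<Gamma>. forest \<Gamma> \<and> \<not> has_trivial_tail \<Gamma> \<and> 2 \<le> card (leaves \<Gamma>)} //
     {(\<Gamma>, \<Delta>). forest_isomorphic \<Gamma> \<Delta>}"

definition class_rep :: "digraph set \<Rightarrow> digraph" where
  "class_rep C = (SOME \<Gamma>. \<Gamma> \<in> C)"


section \<open>The series in infinitely many variables\<close>

text \<open>A monomial in \<open>g\<^sub>0, g\<^sub>1, \<dots>\<close> is its finitely supported exponent map, and a formal power series
  in these variables is its family of coefficients.\<close>

type_synonym gmonomial = "nat \<Rightarrow>\<^sub>0 nat"
type_synonym gseries = "gmonomial \<Rightarrow> rat"

definition forest_monomial :: "digraph \<Rightarrow> gmonomial" where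
  "forest_monomial \<Gamma> = Poly_Mapping.single 0 (num_trees \<Gamma>) +
     (\<Sum>v\<in>nonleaves \<Gamma>. Poly_Mapping.single (level \<Gamma> v) (card (out_edges \<Gamma> v) - 1))"

text \<open>For each \<open>m\<close> only finitely many classes contribute: the number of leaves is the total degree
  of \<open>m\<close>, and, without trivial tails, a deepest non-leaf vertex has at least two outgoing edges, so
  that the variables occurring in \<open>m\<close> bound the levels.\<close>

definition ptilde_A :: gseries where
  "ptilde_A m = (if m = Poly_Mapping.single 0 1 then 1 else 0) +
     (\<Sum>C | C \<in> minimal_forest_classes \<and> forest_monomial (class_rep C) = m.
        1 / of_nat (card (automorphisms (class_rep C))))"

definition bad_monomial :: "gmonomial \<Rightarrow> bool" where
  "bad_monomial m \<longleftrightarrow>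
     (\<exists>i j. 1 \<le> i \<and> i < j \<and> j \<in> Poly_Mapping.keys m \<and> i \<notin> Poly_Mapping.keys m)"

definition remove_bad :: "gseries \<Rightarrow> gseries" where
  "remove_bad p m = (if bad_monomial m then 0 else p m)"

abbreviation q_var :: "rat poly" where
  "q_var \<equiv> [:0, 1:]"

text \<open>The polynomial division is exact for \<open>r \<ge> 1\<close>.\<close>

definition q_factor :: "nat \<Rightarrow> rat poly" where
  "q_factor r = (q_var ^ r - q_var) div (q_var - 1)"

definition subst_monomial :: "gmonomial \<Rightarrow> rat poly fps" where
  "subst_monomial m = fps_X ^ Poly_Mapping.lookup m 0 *
     (\<Prod>i\<in>Poly_Mapping.keys m - {0}.
        fps_const (q_factor (Poly_Mapping.lookup m i)) * fps_X ^ Poly_Mapping.lookup m i)"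

text \<open>For a series without bad monomials, only finitely many monomials contribute to each power
  of \<open>t\<close>, since there are finitely many monomials of given degree which are not bad.\<close>

definition subst_series :: "gseries \<Rightarrow> rat poly fps" where
  "subst_series p = Abs_fps (\<lambda>n.
     \<Sum>m | p m \<noteq> 0 \<and> fps_nth (subst_monomial m) n \<noteq> 0.
       Polynomial.smult (p m) (fps_nth (subst_monomial m) n))"

end

theory Submission
  imports Defs
begin

text \<open>The model is rewritten as the set of points \<open>(v, (l\<^sub>p))\<close>, where \<open>p\<close> runs over the nontrivial set partitions of
\<open>{0, \<dots>, n - 1}\<close>, satisfying the incidences that \<open>l\<^sub>p\<close> contains the image of \<open>v\<close> and that \<open>l\<^sub>s\<close> contains the image of
\<open>l\<^sub>p\<close> whenever \<open>s\<close> refines \<open>p\<close>. Adjoining the partitions one at a time, coarser ones first, each step blows up a center that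
is a product-like model for a smaller index set, and the homology grows by that of the center times a projective space without a
point. Hence the homology is free and even, and the Poincare polynomial counts chains of partitions
\<open>F\<^sub>1 > F\<^sub>2 > \<dots>\<close>, each weighted by the product of \<open>(q\<^sup>r - q) / (q - 1)\<close> over the codimensions \<open>r\<close> of consecutive steps.
A chain of partitions of the leaves is a leaf-labelled forest whose vertices of level \<open>i\<close> are the blocks of the \<open>i\<close>-th
partition; the exponent of \<open>g\<^sub>i\<close> is the rank jump at that step, so bad monomials are exactly those of the
forests that do not come from strict chains, and \<open>1 / |Aut|\<close> turns into \<open>1 / n!\<close> after labelling the leaves.\<close>

section \<open>Free abelian groups of finite rank\<close>

text \<open>The factor (q^r - q) / (q - 1) = q + ... + q^(r-1) is the Poincare polynomial of
  projective space of dimension r - 1 without its degree 0 term. Over the center the new line is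
  unconstrained, so the exceptional part is a product with that space, and only the kernel of its
  projection adds homology. Excision needs open neighbourhoods; the center and its preimage are
  deformation retracts of such sets under one explicit flow. The obstacle is that a contraction
  towards the center does not act on the line of a flat \<open>p\<close> that is not coarser than
  the new flat \<open>b\<close>. Near the center this line is the image of the line at
  \<open>join p b\<close>, and the flow is defined through the latter. Lines are stored as
  orthogonal projectors, so all models lie in one function space and continuity is checked
  entrywise. That the incidences cut out the closure and not more is a density statement, proved by
  perturbing a configuration along finer and finer flats. Ranks are found in homology and carried to
  cohomology by extending homomorphisms from cycles to chains.\<close>

abbreviation "HG == homology_group"
abbreviation "RHG == relative_homology_group"

lemmas continuous_on_coordD = continuous_on_product_then_coordinatewise
lemmas continuous_on_funI = continuous_on_coordinatewise_then_product

text \<open>The standard free abelian group of rank \<open>r\<close>. Forcing the values from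
  \<open>r\<close> on to be zero keeps all ranks in one type.\<close>

definition Zn :: "nat => (nat => int) monoid" where
 "Zn r = \<lparr>carrier = {c. \<forall>i\<ge>r. c i = 0}, monoid.mult = (%c d i. c i + d i), one = (%i. 0)\<rparr>"

lemma carrier_Zn: "carrier (Zn r) = {c. \<forall>i\<ge>r. c i = 0}"
 and mult_Zn [simp]: "c \<otimes>\<^bsub>Zn r\<^esub> d = (%i. c i + d i)"
 and one_Zn [simp]: "\<one>\<^bsub>Zn r\<^esub> = (%i. 0)"
 by (simp_all add: Zn_def)

lemma comm_Zn: "comm_group (Zn r)"
proof (rule comm_groupI; (simp add: carrier_Zn; fail)?)
 fix x assume x: "x : carrier (Zn r)"
 thus "\<exists>y\<in>carrier (Zn r). y \<otimes>\<^bsub>Zn r\<^esub> x = \<one>\<^bsub>Zn r\<^esub>"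
  by (intro bexI[of _ "%i. - x i"]) (auto simp: carrier_Zn)
qed (auto simp: carrier_Zn algebra_simps)

definition free_rank :: "('a, 'b) monoid_scheme => nat => bool" where
 "free_rank G r \<longleftrightarrow> comm_group G & (EX ph. ph : iso (Zn r) G)"

lemma free_rank_iso:
 assumes "free_rank G r" "h : iso G H" "comm_group H"
 shows "free_rank H r"
 using assms unfolding free_rank_def by (blast intro: iso_set_trans)

lemma free_rank_is_iso:
 assumes "free_rank G r" "G \<cong> H" "comm_group H"
 shows "free_rank H r"
 using assms free_rank_iso by (auto simp: is_iso_def)

lemma free_rank_trivial:
 assumes "trivial_group G" "comm_group G"
 shows "free_rank G 0"
proof -
 have "(%_. \<one>\<^bsub>G\<^esub>) : iso (Zn 0) G"
  using assms unfolding trivial_group_def iso_def hom_def bij_betw_def inj_on_def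
  by (auto simp: carrier_Zn comm_group_def comm_monoid_def monoid.r_one)
 thus ?thesis
  using assms by (auto simp: free_rank_def)
qed

definition Zn_unit :: "nat => nat => int" where
 "Zn_unit j = (%i. if i = j then 1 else 0)"

lemma hom_Zn_expansion:
 assumes C: "comm_group C" and ph: "ph : hom (Zn r) C" and c: "c : carrier (Zn r)"
 shows "ph c = finprod C (%j. ph (Zn_unit j) [^]\<^bsub>C\<^esub> c j) {..<r}"
proof -
 interpret C: comm_group C by fact
 interpret Z: comm_group "Zn r" by (rule comm_Zn)
 interpret ph: group_hom "Zn r" C ph
  using ph by (unfold_locales) (auto simp: hom_def)
 have u: "j < r ==> Zn_unit j : carrier (Zn r)" for j
  by (auto simp: Zn_unit_def carrier_Zn)
 have pw: "Zn_unit j [^]\<^bsub>Zn r\<^esub> (n::nat) = (%i. if i = j then int n else 0)" for j n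
  by (induct n) (auto simp: Zn_unit_def fun_eq_iff)
 have ipw: "Zn_unit j [^]\<^bsub>Zn r\<^esub> (k::int) = (%i. if i = j then k else 0)" if "j < r" for j k
 proof (cases "k >= 0")
  case True
  have "Zn_unit j [^]\<^bsub>Zn r\<^esub> nat k = (%i. if i = j then k else 0)"
   unfolding pw int_nat_eq using True by (simp only: if_True)
  thus ?thesis
   using True by (metis int_pow_int nat_0_le)
 next
  case False
  have "inv\<^bsub>Zn r\<^esub> (%i. if i = j then int (nat (-k)) else 0) = (%i. if i = j then k else 0)"
   using False that by (intro Z.inv_equality) (auto simp: carrier_Zn)
  thus ?thesis
   using False pw[of j "nat (-k)"] by (metis int_pow_def2 not_le)
 qed
 have *: "ph (%i. if i < s then c i else 0) = finprod C (%j. ph (Zn_unit j) [^]\<^bsub>C\<^esub> c j) {..<s}"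
  if "s <= r" for s
  using that
 proof (induct s)
  case 0
  thus ?case using ph.hom_one by simp
 next
  case (Suc s)
  have 1: "(%i. if i < Suc s then c i else 0) =
    (%i. if i = s then c s else 0) \<otimes>\<^bsub>Zn r\<^esub> (%i. if i < s then c i else 0)"
   by (auto simp: less_Suc_eq)
  have 2: "ph ((%i. if i = s then c s else 0) \<otimes>\<^bsub>Zn r\<^esub> (%i. if i < s then c i else 0)) = ph (Zn_unit s [^]\<^bsub>Zn r\<^esub> c s) \<otimes>\<^bsub>C\<^esub> ph (%i. if i < s then c i else 0)"
   using Suc(2) ipw[of s] by (subst ph.hom_mult) (auto simp: carrier_Zn)
  have 3: "ph (Zn_unit s [^]\<^bsub>Zn r\<^esub> c s) = ph (Zn_unit s) [^]\<^bsub>C\<^esub> c s"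
   using Suc(2) u by (simp add: ph.hom_int_pow)
  have "finprod C (%j. ph (Zn_unit j) [^]\<^bsub>C\<^esub> c j) {..<Suc s} =
    ph (Zn_unit s) [^]\<^bsub>C\<^esub> c s \<otimes>\<^bsub>C\<^esub> finprod C (%j. ph (Zn_unit j) [^]\<^bsub>C\<^esub> c j) {..<s}"
   unfolding lessThan_Suc using Suc(2) u
   by (subst C.finprod_insert) (auto intro!: C.int_pow_closed ph.hom_closed)
  thus ?case
   using Suc 1 2 3 by simp
 qed
 have "(%i. if i < r then c i else 0) = c"
  using c by (auto simp: carrier_Zn)
 with *[of r] show ?thesis by simp
qed

text \<open>Projectivity of \<open>Zn r\<close>: preimages of the images of the unit vectors are
  chosen, and by \<open>hom_Zn_expansion\<close> a homomorphism is determined by its values at those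
  vectors.\<close>

lemma hom_Zn_lift:
 assumes B: "comm_group B" and C: "comm_group C" and g: "g : hom B C"
  and surj: "g ` carrier B = carrier C" and ph: "ph : hom (Zn r) C"
 obtains s where "s : hom (Zn r) B" "!!c. c : carrier (Zn r) ==> g (s c) = ph c"
proof -
 interpret B: comm_group B by fact
 interpret C: comm_group C by fact
 interpret g: group_hom B C g
  using g by unfold_locales
 have u: "j < r ==> ph (Zn_unit j) : carrier C" for j
  using ph by (auto simp: hom_def carrier_Zn Zn_unit_def Pi_iff)
 define e where "e j = (SOME x. x : carrier B & g x = ph (Zn_unit j))" for j
 have e: "e j : carrier B & g (e j) = ph (Zn_unit j)" if "j < r" for j
  unfolding e_def by (rule someI_ex) (use u[OF that] surj[symmetric] in \<open>auto simp: image_iff\<close>)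
 define s where "s c = finprod B (%j. e j [^]\<^bsub>B\<^esub> (c j :: int)) {..<r}" for c
 have pc: "j < r ==> e j [^]\<^bsub>B\<^esub> (k::int) : carrier B" for j k
  using e by (simp)
 show ?thesis
 proof
  show "s : hom (Zn r) B"
  proof (rule homI)
   fix x y
   have "s (x \<otimes>\<^bsub>Zn r\<^esub> y) = finprod B (%j. e j [^]\<^bsub>B\<^esub> x j \<otimes>\<^bsub>B\<^esub> e j [^]\<^bsub>B\<^esub> y j) {..<r}"
    unfolding s_def using e by (intro B.finprod_cong) (auto simp: B.int_pow_mult)
   thus "s (x \<otimes>\<^bsub>Zn r\<^esub> y) = s x \<otimes>\<^bsub>B\<^esub> s y"
    using pc by (simp add: s_def)
  qed (use pc in \<open>auto simp: s_def Pi_iff intro!: B.finprod_closed\<close>)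
  fix c assume c: "c : carrier (Zn r)"
  have "g (finprod B (%j. e j [^]\<^bsub>B\<^esub> c j) A) = finprod C (%j. g (e j [^]\<^bsub>B\<^esub> c j)) A"
   if "finite A" "A \<subseteq> {..<r}" for A
   using that
  proof induct
   case (insert a A)
   thus ?case
    by (subst B.finprod_insert; (subst C.finprod_insert)?)
     (auto simp: pc Pi_iff subset_iff B.finprod_closed)
  qed simp
  from this[of "{..<r}"] have "g (s c) = finprod C (%j. g (e j [^]\<^bsub>B\<^esub> c j)) {..<r}"
   by (simp add: s_def)
  also have "... = finprod C (%j. ph (Zn_unit j) [^]\<^bsub>C\<^esub> c j) {..<r}"
   using e u by (intro C.finprod_cong) (auto simp: g.hom_int_pow C.int_pow_closed simp_implies_def)
  also have "... = ph c"
   using hom_Zn_expansion[OF C ph c] by simp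
  finally show "g (s c) = ph c" .
 qed
qed

text \<open>Since \<open>C\<close> is free, the sequence splits. With a section \<open>s\<close> of
  \<open>g\<close>, the isomorphism \<open>Ph\<close> combines \<open>f\<close> on the first
  \<open>a\<close> coordinates with \<open>s\<close> on the last \<open>c\<close>.\<close>

lemma free_rank_extension:
 assumes B: "comm_group B" and A: "free_rank A a" and C: "free_rank C c"
  and f: "f : hom A B" and inj: "inj_on f (carrier A)"
  and g: "g : hom B C" and surj: "g ` carrier B = carrier C"
  and ex: "kernel B C g = f ` carrier A"
 shows "free_rank B (a + c)"
proof -
 interpret A: comm_group A using A by (simp add: free_rank_def)
 interpret B: comm_group B by fact
 interpret C: comm_group C using C by (simp add: free_rank_def)
 interpret g: group_hom B C g using g by unfold_locales
 interpret f: group_hom A B f using f by unfold_locales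
 obtain al where al: "al : iso (Zn a) A" using A by (auto simp: free_rank_def)
 obtain \<gamma> where \<gamma>: "\<gamma> : iso (Zn c) C" using C by (auto simp: free_rank_def)
 have alh: "al : hom (Zn a) A" and \<gamma>h: "\<gamma> : hom (Zn c) C"
  using al \<gamma> by (auto simp: iso_def)
 obtain s where s: "s : hom (Zn c) B" "!!d. d : carrier (Zn c) ==> g (s d) = \<gamma> d"
  using hom_Zn_lift[OF B C.comm_group_axioms g surj \<gamma>h] by metis
 interpret s: group_hom "Zn c" B s
  using s comm_Zn by (auto simp: group_hom_def group_hom_axioms_def comm_group_def)
 interpret al: group_hom "Zn a" A al
  using alh comm_Zn by (auto simp: group_hom_def group_hom_axioms_def comm_group_def)
 interpret \<gamma>: group_hom "Zn c" C \<gamma>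
  using \<gamma>h by (auto simp: group_hom_def group_hom_axioms_def)
 define p where "p x = (%i. if i < a then x i else (0::int))" for x
 define q where "q x = (%i. x (a + i) :: int)" for x :: "nat => int"
 have p: "p x : carrier (Zn a)" for x by (auto simp: p_def carrier_Zn)
 have q: "x : carrier (Zn (a + c)) ==> q x : carrier (Zn c)" for x
  by (auto simp: q_def carrier_Zn)
 define Ph where "Ph x = f (al (p x)) \<otimes>\<^bsub>B\<^esub> s (q x)" for x
 have Phc: "Ph x : carrier B" if "x : carrier (Zn (a + c))" for x
  using p q[OF that] by (simp add: Ph_def)
 have gf: "y : carrier A ==> g (f y) = \<one>\<^bsub>C\<^esub>" for y
  using ex by (auto simp: kernel_def)
 have Phh: "Ph : hom (Zn (a + c)) B"
 proof (rule homI)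
  fix x y assume x: "x : carrier (Zn (a + c))" and y: "y : carrier (Zn (a + c))"
  have "p (x \<otimes>\<^bsub>Zn (a + c)\<^esub> y) = p x \<otimes>\<^bsub>Zn a\<^esub> p y" "q (x \<otimes>\<^bsub>Zn (a + c)\<^esub> y) = q x \<otimes>\<^bsub>Zn c\<^esub> q y"
   by (auto simp: p_def q_def)
  hence "Ph (x \<otimes>\<^bsub>Zn (a + c)\<^esub> y) =
    (f (al (p x)) \<otimes>\<^bsub>B\<^esub> f (al (p y))) \<otimes>\<^bsub>B\<^esub> (s (q x) \<otimes>\<^bsub>B\<^esub> s (q y))"
   using p q[OF x] q[OF y] s.hom_mult[of "q x" "q y"] al.hom_mult[of "p x" "p y"]
   by (simp add: Ph_def del: mult_Zn)
  thus "Ph (x \<otimes>\<^bsub>Zn (a + c)\<^esub> y) = Ph x \<otimes>\<^bsub>B\<^esub> Ph y"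
   using p q[OF x] q[OF y] by (simp add: Ph_def B.m_ac)
 qed (rule Phc)
 interpret Ph: group_hom "Zn (a + c)" B Ph
  using Phh comm_Zn by (auto simp: group_hom_def group_hom_axioms_def comm_group_def)
 have injPh: "inj_on Ph (carrier (Zn (a + c)))"
 proof (rule Ph.trivial_ker_imp_inj, rule subset_antisym; clarsimp simp: kernel_def Ph.hom_one[simplified] carrier_Zn)
  fix x assume x: "\<forall>i\<ge>a + c. x i = 0" and 1: "Ph x = \<one>\<^bsub>B\<^esub>"
  hence xc: "x : carrier (Zn (a + c))" by (simp add: carrier_Zn)
  have "g (Ph x) = \<gamma> (q x)"
   using p q[OF xc] by (simp add: Ph_def gf s(2))
  hence "\<gamma> (q x) = \<gamma> (%i. 0)"
   using 1 \<gamma>.hom_one by simp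
  hence q0: "q x = (%i. 0)"
   using \<gamma> q[OF xc] by (auto simp: iso_def bij_betw_def inj_on_def carrier_Zn)
  hence "f (al (p x)) = \<one>\<^bsub>B\<^esub>"
   using 1 p s.hom_one by (simp add: Ph_def)
  hence "al (p x) = \<one>\<^bsub>A\<^esub>"
   using inj p f.hom_one by (metis A.one_closed al.hom_closed inj_onD)
  hence p0: "p x = (%i. 0)"
   using al p al.hom_one by (auto simp: iso_def bij_betw_def inj_on_def carrier_Zn)
  show "x = (%i. 0)"
  proof
   fix i show "x i = 0"
    using fun_cong[OF p0, of i] fun_cong[OF q0, of "i - a"]
    by (cases "i < a") (auto simp: p_def q_def)
  qed
 qed
 have surjPh: "Ph ` carrier (Zn (a + c)) = carrier B"
 proof
  show "carrier B \<subseteq> Ph ` carrier (Zn (a + c))"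
  proof
   fix y assume y: "y : carrier B"
   then obtain d where d: "d : carrier (Zn c)" "\<gamma> d = g y"
    using \<gamma> by (metis (no_types, lifting) g.hom_closed imageE iso_def bij_betw_def mem_Collect_eq)
   have "y \<otimes>\<^bsub>B\<^esub> inv\<^bsub>B\<^esub> (s d) : kernel B C g"
    using y d s by (simp add: kernel_def)
   then obtain z where z: "z : carrier A" "f z = y \<otimes>\<^bsub>B\<^esub> inv\<^bsub>B\<^esub> (s d)"
    using ex by auto
   obtain w where w: "w : carrier (Zn a)" "al w = z"
    using al z by (metis (no_types, lifting) imageE iso_def bij_betw_def mem_Collect_eq)
   define x where "x i = (if i < a then w i else d (i - a))" for i
   have "x : carrier (Zn (a + c))" "p x = w" "q x = d"
    using w d by (auto simp: x_def p_def q_def carrier_Zn)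
   moreover have "f z \<otimes>\<^bsub>B\<^esub> s d = y"
    using y d by (simp add: z B.m_assoc)
   ultimately show "y : Ph ` carrier (Zn (a + c))"
    using w by (auto simp: Ph_def)
  qed
 qed auto
 show ?thesis
  unfolding free_rank_def iso_def bij_betw_def using B Phh injPh surjPh by blast
qed

section \<open>Kernels in exact ladders\<close>

abbreviation kgroup where
 "kgroup G H f \<equiv> subgroup_generated G (kernel G H f)"

lemma carrier_kgroup:
 assumes "group_hom G H f"
 shows "carrier (kgroup G H f) = kernel G H f"
 using group_hom.subgroup_kernel[OF assms] subgroup.carrier_subgroup_generated_subgroup by blast

lemma comm_group_kgroup: "comm_group G ==> comm_group (kgroup G H f)"
 by (metis comm_group_def group.abelian_subgroup_generated)

text \<open>A diagram chase in a map between the long exact sequences of two pairs. \<open>A\<close>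
  and \<open>B\<close> stand for the homology of the subspaces, \<open>R\<close>, \<open>S\<close>
  and \<open>R1\<close>, \<open>S1\<close> for the relative groups in two consecutive degrees. As
  the relative groups agree and \<open>fA\<close> is onto, the kernel of \<open>fA\<close>, then
  \<open>X\<close>, then \<open>M\<close> form a short exact sequence.\<close>

lemma ladder_even:
 assumes grp: "comm_group A" "comm_group B" "comm_group X" "comm_group M" "comm_group R" "comm_group S"
   "comm_group R1" "comm_group S1"
  and hom: "i : hom A X" "i' : hom B M" "j : hom X R" "j' : hom M S" "d : hom R1 A" "d' : hom S1 B"
   "fA : hom A B" "fX : hom X M" "fR : hom R S" "f1 : hom R1 S1"
  and ex: "i ` carrier A = kernel X R j" "i' ` carrier B = kernel M S j'"
   "d ` carrier R1 = kernel A X i" "d' ` carrier S1 = kernel B M i'"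
  and inj_d': "inj_on d' (carrier S1)" and surj_j: "j ` carrier X = carrier R"
  and com: "!!x. x : carrier A ==> fX (i x) = i' (fA x)"
   "!!x. x : carrier X ==> fR (j x) = j' (fX x)"
   "!!x. x : carrier R1 ==> fA (d x) = d' (f1 x)"
  and fR: "bij_betw fR (carrier R) (carrier S)" and f1: "bij_betw f1 (carrier R1) (carrier S1)"
  and fA: "fA ` carrier A = carrier B"
  and k: "free_rank (kgroup A B fA) k" and m: "free_rank M m"
 shows "free_rank X (k + m)"
proof -
 interpret A: comm_group A by fact
 interpret B: comm_group B by fact
 interpret X: comm_group X by fact
 interpret M: comm_group M by fact
 interpret R: comm_group R by fact
 interpret S: comm_group S by fact
 interpret R1: comm_group R1 by fact
 interpret S1: comm_group S1 by fact
 interpret i: group_hom A X i using hom by unfold_locales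
 interpret i': group_hom B M i' using hom by unfold_locales
 interpret j: group_hom X R j using hom by unfold_locales
 interpret j': group_hom M S j' using hom by unfold_locales
 interpret d: group_hom R1 A d using hom by unfold_locales
 interpret d': group_hom S1 B d' using hom by unfold_locales
 interpret fA: group_hom A B fA using hom by unfold_locales
 interpret fX: group_hom X M fX using hom by unfold_locales
 interpret fR: group_hom R S fR using hom by unfold_locales
 interpret f1: group_hom R1 S1 f1 using hom by unfold_locales
 have K: "carrier (kgroup A B fA) = kernel A B fA"
  by (simp add: carrier_kgroup fA.group_hom_axioms)
 show ?thesis
 proof (rule free_rank_extension[OF _ k m])
  show "i : hom (kgroup A B fA) X"
   using hom(1) by (rule A.hom_from_subgroup_generated)
  show "inj_on i (carrier (kgroup A B fA))"
  proof (rule inj_onI)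
   fix x y assume "x : carrier (kgroup A B fA)" "y : carrier (kgroup A B fA)" and eq: "i x = i y"
   hence x: "x : carrier A" "fA x = \<one>\<^bsub>B\<^esub>" and y: "y : carrier A" "fA y = \<one>\<^bsub>B\<^esub>"
    unfolding K by (auto simp: kernel_def)
   have "x \<otimes>\<^bsub>A\<^esub> inv\<^bsub>A\<^esub> y : kernel A X i"
    using x y eq by (simp add: kernel_def)
   then obtain r where r: "r : carrier R1" "d r = x \<otimes>\<^bsub>A\<^esub> inv\<^bsub>A\<^esub> y"
    using ex(3) by (metis imageE)
   have "d' (f1 r) = d' \<one>\<^bsub>S1\<^esub>"
    using com(3)[OF r(1)] r x y by simp
   hence "f1 r = f1 \<one>\<^bsub>R1\<^esub>"
    using inj_d' r by (metis S1.one_closed f1.hom_closed f1.hom_one inj_onD)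
   hence "r = \<one>\<^bsub>R1\<^esub>"
    using f1 r by (auto simp: bij_betw_def inj_on_def)
   hence "x \<otimes>\<^bsub>A\<^esub> inv\<^bsub>A\<^esub> y = \<one>\<^bsub>A\<^esub>"
    using r by simp
   thus "x = y"
    using x y by (metis A.inv_equality A.inv_inv A.inv_closed)
  qed
  show "fX ` carrier X = carrier M"
  proof
   show "carrier M \<subseteq> fX ` carrier X"
   proof
    fix z assume z: "z : carrier M"
    then obtain x where x: "x : carrier X" "fR (j x) = j' z"
     using fR surj_j by (metis bij_betw_imp_surj_on imageE j'.hom_closed)
    have "z \<otimes>\<^bsub>M\<^esub> inv\<^bsub>M\<^esub> (fX x) : kernel M S j'"
     using x z com(2)[OF x(1)] by (simp add: kernel_def)
    then obtain b where b: "b : carrier B" "i' b = z \<otimes>\<^bsub>M\<^esub> inv\<^bsub>M\<^esub> (fX x)"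
     using ex(2) by (metis imageE)
    then obtain a where a: "a : carrier A" "fA a = b"
     using fA by (metis imageE)
    have "fX (i a \<otimes>\<^bsub>X\<^esub> x) = z"
     using a b x z com(1)[OF a(1)] by (simp add: M.m_assoc)
    thus "z : fX ` carrier X"
     using a x by (intro image_eqI[of _ _ "i a \<otimes>\<^bsub>X\<^esub> x"]) auto
   qed
  qed auto
  show "kernel X M fX = i ` carrier (kgroup A B fA)"
   unfolding K
  proof (intro equalityI subsetI)
   fix z assume "z : kernel X M fX"
   hence z: "z : carrier X" "fX z = \<one>\<^bsub>M\<^esub>"
    by (auto simp: kernel_def)
   hence "fR (j z) = fR \<one>\<^bsub>R\<^esub>"
    using com(2)[OF z(1)] by simp
   hence "j z = \<one>\<^bsub>R\<^esub>"
    using fR z by (metis R.one_closed bij_betw_imp_inj_on inj_onD j.hom_closed)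
   then obtain x where x: "x : carrier A" "i x = z"
    using ex(1) z unfolding kernel_def by (metis (mono_tags, lifting) imageE mem_Collect_eq)
   have "fA x : kernel B M i'"
    using x z com(1)[OF x(1)] by (simp add: kernel_def)
   then obtain w where w: "w : carrier S1" "d' w = fA x"
    using ex(4) by (metis imageE)
   then obtain y where y: "y : carrier R1" "f1 y = w"
    using f1 by (metis bij_betw_def imageE)
   have dy: "i (d y) = \<one>\<^bsub>X\<^esub>"
    using ex(3) y by (auto simp: kernel_def)
   have "x \<otimes>\<^bsub>A\<^esub> inv\<^bsub>A\<^esub> (d y) : kernel A B fA"
    using x y w com(3)[OF y(1)] by (simp add: kernel_def)
   moreover have "i (x \<otimes>\<^bsub>A\<^esub> inv\<^bsub>A\<^esub> (d y)) = z"
    using x y dy z by simp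
   ultimately show "z : i ` kernel A B fA"
    by blast
  next
   fix z assume "z : i ` kernel A B fA"
   then obtain x where "x : carrier A" "fA x = \<one>\<^bsub>B\<^esub>" "z = i x"
    by (auto simp: kernel_def)
   thus "z : kernel X M fX"
    using com(1)[of x] by (simp add: kernel_def)
  qed
 qed (use grp hom in auto)
qed

lemma free_rank_kernel_iso:
 assumes grp: "comm_group A" "comm_group B" "comm_group A'" "comm_group B'"
  and g: "g : hom A B" and g': "g' : hom A' B'" and al: "al : iso A A'"
  and \<beta>: "\<beta> : hom B B'" "inj_on \<beta> (carrier B)"
  and com: "!!x. x : carrier A ==> g' (al x) = \<beta> (g x)"
  and k: "free_rank (kgroup A B g) k"
 shows "free_rank (kgroup A' B' g') k"
proof -
 interpret A: comm_group A by fact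
 interpret B: comm_group B by fact
 interpret A': comm_group A' by fact
 interpret B': comm_group B' by fact
 interpret g: group_hom A B g using g by unfold_locales
 interpret g': group_hom A' B' g' using g' by unfold_locales
 interpret al: group_hom A A' al using al by unfold_locales (simp add: iso_def)
 interpret \<beta>: group_hom B B' \<beta> using \<beta> by unfold_locales
 have K: "carrier (kgroup A B g) = kernel A B g" "carrier (kgroup A' B' g') = kernel A' B' g'"
  by (simp_all add: carrier_kgroup g.group_hom_axioms g'.group_hom_axioms)
 have "al ` kernel A B g = kernel A' B' g'"
 proof (intro equalityI subsetI)
  fix y assume y: "y : kernel A' B' g'"
  then obtain x where x: "x : carrier A" "al x = y"
   using al unfolding kernel_def iso_def bij_betw_def by (metis (mono_tags, lifting) imageE mem_Collect_eq)
  have "\<beta> (g x) = \<beta> \<one>\<^bsub>B\<^esub>"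
   using com[OF x(1)] x y by (simp add: kernel_def)
  hence "g x = \<one>\<^bsub>B\<^esub>"
   using \<beta>(2) x by (metis B.one_closed g.hom_closed inj_onD)
  thus "y : al ` kernel A B g"
   using x by (auto simp: kernel_def)
 next
  fix y assume "y : al ` kernel A B g"
  thus "y : kernel A' B' g'"
   using com by (auto simp: kernel_def)
 qed
 moreover have "inj_on al (kernel A B g)"
  using al by (rule_tac inj_on_subset[of _ "carrier A"]) (auto simp: iso_def bij_betw_def kernel_def)
 ultimately have "bij_betw al (carrier (kgroup A B g)) (carrier (kgroup A' B' g'))"
  unfolding K by (simp add: bij_betw_def)
 moreover have "al : hom (kgroup A B g) (kgroup A' B' g')"
 proof (rule homI)
  fix x assume "x : carrier (kgroup A B g)"
  thus "al x : carrier (kgroup A' B' g')"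
   unfolding K using com by (auto simp: kernel_def)
 next
  fix x y assume "x : carrier (kgroup A B g)" "y : carrier (kgroup A B g)"
  thus "al (x \<otimes>\<^bsub>kgroup A B g\<^esub> y) = al x \<otimes>\<^bsub>kgroup A' B' g'\<^esub> al y"
   unfolding K by (auto simp: kernel_def)
 qed
 ultimately show ?thesis
  using k free_rank_iso comm_group_kgroup[OF grp(3)] by (fastforce simp: iso_def)
qed

text \<open>\<open>i o s\<close> is a section of \<open>r\<close> that passes through
  \<open>U\<close>. Subtracting \<open>i (s (r z))\<close> moves \<open>z\<close> into the kernel of
  \<open>r\<close> without changing its image under \<open>j\<close>, so the kernel of
  \<open>r\<close> still maps onto \<open>R\<close>: attaching cells enlarges the kernel by the
  relative group.\<close>

lemma kernel_attach:
 assumes grp: "comm_group U" "comm_group X" "comm_group R" "comm_group T"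
  and hom: "i : hom U X" "j : hom X R" "r : hom X T" "s : hom T U"
  and inj: "inj_on i (carrier U)" and surj: "j ` carrier X = carrier R"
  and ex: "i ` carrier U = kernel X R j"
  and rs: "!!t. t : carrier T ==> r (i (s t)) = t"
  and a: "free_rank (kgroup U T (r o i)) a" and c: "free_rank R c"
 shows "free_rank (kgroup X T r) (a + c)"
proof -
 interpret U: comm_group U by fact
 interpret X: comm_group X by fact
 interpret R: comm_group R by fact
 interpret T: comm_group T by fact
 interpret i: group_hom U X i using hom by unfold_locales
 interpret j: group_hom X R j using hom by unfold_locales
 interpret r: group_hom X T r using hom by unfold_locales
 interpret s: group_hom T U s using hom by unfold_locales
 have "r o i : hom U T" using hom by (blast intro: hom_compose)
 then interpret ri: group_hom U T "r o i" by unfold_locales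
 have K: "carrier (kgroup U T (r o i)) = kernel U T (r o i)" "carrier (kgroup X T r) = kernel X T r"
  by (simp_all add: carrier_kgroup r.group_hom_axioms ri.group_hom_axioms)
 show ?thesis
 proof (rule free_rank_extension[OF _ a c])
  show "comm_group (kgroup X T r)"
   by (rule comm_group_kgroup) fact
  show "i : hom (kgroup U T (r o i)) (kgroup X T r)"
   by (rule homI; unfold K) (auto simp: kernel_def)
  show "inj_on i (carrier (kgroup U T (r o i)))"
   unfolding K by (rule inj_on_subset[OF inj]) (auto simp: kernel_def)
  show "j : hom (kgroup X T r) R"
   using hom(2) by (rule X.hom_from_subgroup_generated)
  have is1: "j (i u) = \<one>\<^bsub>R\<^esub>" if "u : carrier U" for u
   using ex that by (auto simp: kernel_def)
  show "j ` carrier (kgroup X T r) = carrier R"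
  proof (intro equalityI subsetI)
   fix y assume "y : carrier R"
   then obtain z where z: "z : carrier X" "j z = y"
    using surj by (metis imageE)
   have "z \<otimes>\<^bsub>X\<^esub> inv\<^bsub>X\<^esub> (i (s (r z))) : kernel X T r"
    using z by (simp add: kernel_def rs)
   moreover have "j (z \<otimes>\<^bsub>X\<^esub> inv\<^bsub>X\<^esub> (i (s (r z)))) = y"
    using z by (simp add: is1 flip: z(2))
   ultimately show "y : j ` carrier (kgroup X T r)"
    unfolding K by blast
  qed (unfold K, auto simp: kernel_def)
  have "kernel (kgroup X T r) R j = kernel X T r Int kernel X R j"
   by (auto simp: kernel_def K[unfolded kernel_def])
  also have "... = i ` carrier (kgroup U T (r o i))"
   unfolding K ex[symmetric] by (auto simp: kernel_def)
  finally show "kernel (kgroup X T r) R j = i ` carrier (kgroup U T (r o i))" .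
 qed
qed

section \<open>The homology of a blow-up\<close>

text \<open>Excising \<open>Z\<close> downstairs and its preimage upstairs reduces both pairs to
  complements, where \<open>f\<close> is a homeomorphism. A closed \<open>Z\<close> inside an open
  \<open>N\<close> gives the closure condition of excision.\<close>

lemma relative_homeomorphism_iso:
 assumes f: "continuous_map X M f" and Z: "closedin M Z" and N: "openin M N" and ZN: "Z \<subseteq> N"
  and h: "homeomorphic_map (subtopology X {x : topspace X. f x ~: Z}) (subtopology M (topspace M - Z)) f"
 shows "hom_induced p X {x : topspace X. f x : N} M N f
   : iso (RHG p X {x : topspace X. f x : N}) (RHG p M N)"
proof -
 define N' where "N' = {x : topspace X. f x : N}"
 define E where "E = {x : topspace X. f x : Z}"
 have E: "closedin X E" and N': "openin X N'" and EN: "E \<subseteq> N'"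
  using f Z N ZN by (auto simp: E_def N'_def closedin_continuous_map_preimage openin_continuous_map_preimage)
 have NM: "N \<subseteq> topspace M" using N openin_subset by blast
 have eqE: "{x : topspace X. f x ~: Z} = topspace X - E"
  by (auto simp: E_def)
 let ?X = "subtopology X (topspace X - E)" and ?M = "subtopology M (topspace M - Z)"
 have iX: "hom_induced p ?X (N' - E) X N' id : iso (RHG p ?X (N' - E)) (RHG p X N')"
  using homology_excision_axiom[of X E N' "topspace X" p] E N' EN openin_subset[OF N']
  by (simp add: closure_of_closedin interior_of_openin)
 have iM: "hom_induced p ?M (N - Z) M N id : iso (RHG p ?M (N - Z)) (RHG p M N)"
  using homology_excision_axiom[of M Z N "topspace M" p] Z N ZN openin_subset[OF N]
  by (simp add: closure_of_closedin interior_of_openin)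
 have himg: "f ` (topspace X - E) = topspace M - Z"
  using homeomorphic_imp_surjective_map[OF h] by (auto simp: eqE)
 have fim: "f ` (N' - E) = N - Z"
 proof (intro equalityI subsetI)
  fix y assume y: "y : N - Z"
  hence "y : f ` (topspace X - E)"
   using himg NM by auto
  thus "y : f ` (N' - E)"
   using y by (auto simp: N'_def)
 qed (auto simp: N'_def E_def)
 have h': "homeomorphic_map ?X ?M f"
  using h by (simp add: eqE)
 have "hom_induced p ?X (N' - E) ?M (N - Z) f : iso (RHG p ?X (N' - E)) (RHG p ?M (N - Z))"
 proof (rule homeomorphic_map_relative_homology_iso[OF h'])
  show "N' - E \<subseteq> topspace ?X" using openin_subset[OF N'] by auto
 qed (rule fim)
 hence "hom_induced p ?M (N - Z) M N id o hom_induced p ?X (N' - E) ?M (N - Z) f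
   : iso (RHG p ?X (N' - E)) (RHG p M N)"
  using iM by (rule iso_set_trans)
 also have "hom_induced p ?M (N - Z) M N id o hom_induced p ?X (N' - E) ?M (N - Z) f =
   hom_induced p ?X (N' - E) M N (id o f)"
  using h' fim by (intro hom_induced_compose[symmetric])
   (auto intro: homeomorphic_imp_continuous_map continuous_map_from_subtopology)
 also have "hom_induced p ?X (N' - E) M N (id o f) = hom_induced p ?X (N' - E) M N (f o id)"
  by simp
 also have "... = hom_induced p X N' M N f o hom_induced p ?X (N' - E) X N' id"
  using f by (intro hom_induced_compose) (auto simp: N'_def intro: continuous_map_from_subtopology)
 finally have comp: "hom_induced p X N' M N f o hom_induced p ?X (N' - E) X N' id
   : iso (RHG p ?X (N' - E)) (RHG p M N)" .
 have "hom_induced p X N' M N f : hom (RHG p X N') (RHG p M N)"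
  by (simp add: hom_induced_hom)
 moreover have "bij_betw (hom_induced p X N' M N f) (carrier (RHG p X N')) (carrier (RHG p M N))"
  using comp iX bij_betw_comp_iff[of "hom_induced p ?X (N' - E) X N' id"] by (auto simp: iso_def)
 ultimately show ?thesis
  by (simp add: iso_def N'_def)
qed

lemma exact_seq_trivial_inj:
 assumes "exact_seq ([C, B, A], [g, f])" "trivial_group A"
 shows "inj_on g (carrier B)"
proof -
 have hom: "group_hom A B f" "group_hom B C g" and ex: "kernel B C g = f ` carrier A"
  using assms by (auto simp: group_hom_def group_hom_axioms_def)
 have "f ` carrier A = {\<one>\<^bsub>B\<^esub>}"
  using assms(2) group_hom.hom_one[OF hom(1)] by (simp add: trivial_group_def)
 thus ?thesis
  using ex group_hom.inj_iff_trivial_ker[OF hom(2)] by simp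
qed

lemma exact_seq_trivial_surj:
 assumes "exact_seq ([C, B, A], [g, f])" "trivial_group C"
 shows "f ` carrier A = carrier B"
proof -
 have hom: "group_hom B C g" and ex: "kernel B C g = f ` carrier A"
  using assms by (auto simp: group_hom_def group_hom_axioms_def)
 show ?thesis
  using ex group_hom.kernel_to_trivial_group[OF hom assms(2)] by simp
qed

lemma group_hom_hom_induced:
 "group_hom (RHG p X S) (RHG p Y T) (hom_induced p X S Y T f)"
 by (simp add: group_hom_def group_hom_axioms_def hom_induced_hom)

locale blowup_square =
 fixes X :: "'a topology" and M :: "'b topology" and f :: "'a => 'b" and N :: "'b set"
 assumes cont: "continuous_map X M f"
  and rel: "!!p. hom_induced p X {x : topspace X. f x : N} M N f
    : iso (RHG p X {x : topspace X. f x : N}) (RHG p M N)"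
begin

abbreviation N' where "N' \<equiv> {x : topspace X. f x : N}"

lemma fN: "f : N' \<rightarrow> N" "continuous_map (subtopology X N') (subtopology M N) f"
 using cont by (auto simp: continuous_map_in_subtopology continuous_map_from_subtopology)

text \<open>\<open>HG p X\<close> injects into the relative group of the pair with
  \<open>N'\<close>, which is that of \<open>M\<close> and \<open>N\<close>. By naturality the
  composite passes through the trivial group \<open>HG p M\<close>.\<close>

lemma odd_vanishing:
 assumes M: "trivial_group (HG p M)" and N: "trivial_group (HG p (subtopology X N'))"
 shows "trivial_group (HG p X)"
proof -
 let ?j = "hom_induced p X {} X N' id"
 have j: "inj_on ?j (carrier (HG p X))"
  using homology_exactness_axiom_3 N by (rule exact_seq_trivial_inj)
 have "hom_induced p X N' M N f (?j z) = \<one>\<^bsub>RHG p M N\<^esub>"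
  if z: "z : carrier (HG p X)" for z
 proof -
  have *: "hom_induced p X N' M N f (?j z) = hom_induced p M {} M N id (hom_induced p X {} M {} f z)"
   using cont by (simp add: hom_induced_compose')
  have "hom_induced p X {} M {} f z = \<one>\<^bsub>HG p M\<^esub>"
   using M hom_induced_carrier[of p X "{}" M "{}" f z] by (simp add: trivial_group_def)
  thus ?thesis
   unfolding * using group_hom.hom_one[OF group_hom_hom_induced] by metis
 qed
 moreover have "inj_on (hom_induced p X N' M N f o ?j) (carrier (HG p X))"
  using j rel[of p] group_hom.homh[OF group_hom_hom_induced[of p X "{}" X N' id]]
  by (intro comp_inj_on) (auto simp: iso_def bij_betw_def hom_def intro: inj_on_subset)
 ultimately have "z = \<one>\<^bsub>HG p X\<^esub>" if "z : carrier (HG p X)" for z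
  using that by (auto simp: inj_on_def group.is_monoid)
 thus ?thesis
  by (auto simp: trivial_group_def group.is_monoid)
qed

lemma even_rank:
 assumes M1: "trivial_group (HG (p + 1) M)"
  and N1: "trivial_group (HG (p - 1) (subtopology X N'))"
  and surj: "hom_induced p (subtopology X N') {} (subtopology M N) {} f ` carrier (HG p (subtopology X N'))
    = carrier (HG p (subtopology M N))"
  and k: "free_rank (kgroup (HG p (subtopology X N')) (HG p (subtopology M N))
    (hom_induced p (subtopology X N') {} (subtopology M N) {} f)) k"
  and m: "free_rank (HG p M) m"
 shows "free_rank (HG p X) (k + m)"
proof (rule ladder_even[OF _ _ _ _ _ _ _ _ _ _ _ _ _ _ _ _ _ _ _ _ _ _ _ _ _ _ _ _ _ surj k m])
 show "hom_induced p (subtopology X N') {} X {} id ` carrier (HG p (subtopology X N')) =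
   kernel (HG p X) (RHG p X N') (hom_induced p X {} X N' id)"
  using homology_exactness_axiom_3[of p X N'] by simp
 show "hom_induced p (subtopology M N) {} M {} id ` carrier (HG p (subtopology M N)) =
   kernel (HG p M) (RHG p M N) (hom_induced p M {} M N id)"
  using homology_exactness_axiom_3[of p M N] by simp
 show "hom_boundary (p + 1) X N' ` carrier (RHG (p + 1) X N') =
   kernel (HG p (subtopology X N')) (HG p X) (hom_induced p (subtopology X N') {} X {} id)"
  using homology_exactness_axiom_2[of "p + 1" X N'] by simp
 show "hom_boundary (p + 1) M N ` carrier (RHG (p + 1) M N) =
   kernel (HG p (subtopology M N)) (HG p M) (hom_induced p (subtopology M N) {} M {} id)"
  using homology_exactness_axiom_2[of "p + 1" M N] by simp
 show "inj_on (hom_boundary (p + 1) M N) (carrier (RHG (p + 1) M N))"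
  using homology_exactness_axiom_1 M1 by (rule exact_seq_trivial_inj)
 show "hom_induced p X {} X N' id ` carrier (HG p X) = carrier (RHG p X N')"
  using homology_exactness_axiom_1 N1 by (rule exact_seq_trivial_surj)
 show "hom_induced p X {} M {} f (hom_induced p (subtopology X N') {} X {} id x) =
   hom_induced p (subtopology M N) {} M {} id (hom_induced p (subtopology X N') {} (subtopology M N) {} f x)"
  if "x : carrier (HG p (subtopology X N'))" for x
  using cont fN by (simp add: hom_induced_compose')
 show "hom_induced p X N' M N f (hom_induced p X {} X N' id x) =
   hom_induced p M {} M N id (hom_induced p X {} M {} f x)"
  if "x : carrier (HG p X)" for x
  using cont by (simp add: hom_induced_compose')
 show "hom_induced p (subtopology X N') {} (subtopology M N) {} f (hom_boundary (p + 1) X N' x) =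
   hom_boundary (p + 1) M N (hom_induced (p + 1) X N' M N f x)"
  if "x : carrier (RHG (p + 1) X N')" for x
  using fun_cong[OF naturality_hom_induced[OF cont fN(1), of "p + 1"], of x] by simp
 show "bij_betw (hom_induced p X N' M N f) (carrier (RHG p X N')) (carrier (RHG p M N))"
  "bij_betw (hom_induced (p + 1) X N' M N f) (carrier (RHG (p + 1) X N')) (carrier (RHG (p + 1) M N))"
  using rel[of p] rel[of "p + 1"] by (auto simp: iso_def)
 show "hom_boundary (p + 1) X N' : hom (RHG (p + 1) X N') (HG p (subtopology X N'))"
  "hom_boundary (p + 1) M N : hom (RHG (p + 1) M N) (HG p (subtopology M N))"
  using hom_boundary_hom[of "p + 1" X N'] hom_boundary_hom[of "p + 1" M N] by simp_all
qed (simp_all add: hom_induced_hom)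

end

text \<open>Degrees are integers, because the suspension isomorphisms shift them below zero.\<close>

definition even_hom :: "'a topology => (int => nat) => bool" where
 "even_hom X b \<longleftrightarrow> (ALL p. if even p then free_rank (HG p X) (b p)
   else trivial_group (HG p X))"

text \<open>Records what is needed of a trivial projective bundle over a center: a section, and the
  ranks of the kernel in homology, which by \<open>ladder_even\<close> are what a blow-up
  adds.\<close>

definition even_fibration :: "'a topology => 'b topology => ('a => 'b) => (int => nat) => bool" where
 "even_fibration E Z f k \<longleftrightarrow> retraction_map E Z f & (ALL p. if even p
   then free_rank (kgroup (HG p E) (HG p Z) (hom_induced p E {} Z {} f)) (k p)
   else trivial_group (HG p E))"

text \<open>The neighbourhoods serve the excision argument; \<open>iZ\<close> and \<open>iE\<close>
  then move the kernel to the center itself, where the fibration is explicit. Surjectivity on the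
  neighbourhoods comes from the section over \<open>Z\<close>.\<close>

theorem blowup_homology:
 assumes f: "continuous_map X M f" and Z: "closedin M Z" and N: "openin M N" and ZN: "Z \<subseteq> N"
  and h: "homeomorphic_map (subtopology X {x : topspace X. f x ~: Z}) (subtopology M (topspace M - Z)) f"
  and iZ: "!!p. hom_induced p (subtopology M Z) {} (subtopology M N) {} id
    : iso (HG p (subtopology M Z)) (HG p (subtopology M N))"
  and iE: "!!p. hom_induced p (subtopology X {x : topspace X. f x : Z}) {} (subtopology X {x : topspace X. f x : N}) {} id
    : iso (HG p (subtopology X {x : topspace X. f x : Z})) (HG p (subtopology X {x : topspace X. f x : N}))"
  and M: "even_hom M m"
  and EZ: "even_fibration (subtopology X {x : topspace X. f x : Z}) (subtopology M Z) f k"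
 shows "even_hom X (%p. k p + m p)"
proof -
 let ?E = "subtopology X {x : topspace X. f x : Z}" and ?N = "subtopology X {x : topspace X. f x : N}"
 interpret blowup_square X M f N
  by (rule blowup_square.intro[OF f relative_homeomorphism_iso[OF f Z N ZN h]])
 have fE: "continuous_map ?E (subtopology M Z) f"
  using f by (auto simp: continuous_map_in_subtopology continuous_map_from_subtopology)
 have inclE: "continuous_map ?E ?N id" and inclZ: "continuous_map (subtopology M Z) (subtopology M N) id"
  using ZN by (auto simp: continuous_map_in_subtopology)
 have com: "hom_induced p ?N {} (subtopology M N) {} f (hom_induced p ?E {} ?N {} id x) =
   hom_induced p (subtopology M Z) {} (subtopology M N) {} id (hom_induced p ?E {} (subtopology M Z) {} f x)" for p x
  using fN fE inclE inclZ by (simp add: hom_induced_compose')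
 have triv: "trivial_group (HG p ?N)" if "odd p" for p
  using EZ that isomorphic_group_triviality1[OF is_isoI[OF iE[of p]]]
  by (simp add: even_fibration_def)
 have odd: "trivial_group (HG p X)" if "odd p" for p
  using M triv[OF that] that by (intro odd_vanishing) (auto simp: even_hom_def)
 have even: "free_rank (HG p X) (k p + m p)" if p: "even p" for p
 proof (rule even_rank)
  show "trivial_group (HG (p + 1) M)" "free_rank (HG p M) (m p)"
   using M p by (auto simp: even_hom_def)
  show "trivial_group (HG (p - 1) ?N)"
   using p by (intro triv) simp
  show "free_rank (kgroup (HG p ?N) (HG p (subtopology M N)) (hom_induced p ?N {} (subtopology M N) {} f)) (k p)"
  proof (rule free_rank_kernel_iso[where A = "HG p ?E" and B = "HG p (subtopology M Z)"
     and g = "hom_induced p ?E {} (subtopology M Z) {} f" and al = "hom_induced p ?E {} ?N {} id"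
     and \<beta> = "hom_induced p (subtopology M Z) {} (subtopology M N) {} id"])
   show "inj_on (hom_induced p (subtopology M Z) {} (subtopology M N) {} id) (carrier (HG p (subtopology M Z)))"
    using iZ[of p] by (simp add: iso_def bij_betw_def)
   show "free_rank (kgroup (HG p ?E) (HG p (subtopology M Z)) (hom_induced p ?E {} (subtopology M Z) {} f)) (k p)"
    using EZ p by (simp add: even_fibration_def)
  qed (simp_all add: hom_induced_hom iE com)
  show "hom_induced p ?N {} (subtopology M N) {} f ` carrier (HG p ?N) = carrier (HG p (subtopology M N))"
  proof (intro equalityI subsetI)
   fix y assume "y : carrier (HG p (subtopology M N))"
   then obtain z where z: "z : carrier (HG p (subtopology M Z))"
     "y = hom_induced p (subtopology M Z) {} (subtopology M N) {} id z"
    using iZ[of p] by (auto simp: iso_def bij_betw_def)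
   then obtain x where x: "x : carrier (HG p ?E)" "z = hom_induced p ?E {} (subtopology M Z) {} f x"
    using EZ surj_hom_induced_retraction_map[of ?E "subtopology M Z" f p] by (auto simp: even_fibration_def)
   show "y : hom_induced p ?N {} (subtopology M N) {} f ` carrier (HG p ?N)"
    using z x com[of p x] by (auto simp: image_iff intro!: hom_induced_carrier)
  qed (auto intro: hom_induced_carrier)
 qed
 show ?thesis
  using odd even by (simp add: even_hom_def)
qed

section \<open>Suspension of pairs\<close>

text \<open>Only the real coordinate moves, so the one thing to check is that \<open>B\<close> is
  kept along the segment. The predicate \<open>Q\<close> lets the same homotopy serve for maps of
  pairs.\<close>

lemma homotopic_linear_snd:
 fixes X :: "'a topology" and a b :: "real => real"
 assumes a: "continuous_on UNIV a" and b: "continuous_on UNIV b" and B: "B \<subseteq> topspace X \<times> UNIV"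
  and im: "!!s x t. s : {0..1} ==> (x, t) : B ==> (x, (1 - s) * a t + s * b t) : B"
  and Q: "!!s. s : {0..1} ==> Q (%(x, t). (x, (1 - s) * a t + s * b t))"
 shows "homotopic_with Q (subtopology (prod_topology X euclideanreal) B) (subtopology (prod_topology X euclideanreal) B)
  (%(x, t). (x, a t)) (%(x, t). (x, b t))"
 unfolding homotopic_with_def
proof (intro exI conjI allI ballI)
 let ?P = "subtopology (prod_topology X euclideanreal) B"
 let ?h = "%(s, (x, t)). (x, (1 - s) * a t + s * b t) :: 'a \<times> real"
 let ?D = "prod_topology (top_of_set {0..1::real}) ?P"
 have s: "continuous_map ?D euclideanreal fst"
  by (rule continuous_map_into_fulltopology[OF continuous_map_fst])
 have x: "continuous_map ?D X (%z. fst (snd z))"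
  using continuous_map_compose[OF continuous_map_snd continuous_map_from_subtopology[OF continuous_map_fst[of X euclideanreal]]]
  by (simp add: o_def)
 have t: "continuous_map ?D euclideanreal (%z. snd (snd z))"
  using continuous_map_compose[OF continuous_map_snd continuous_map_from_subtopology[OF continuous_map_snd[of X euclideanreal]]]
  by (simp add: o_def)
 have ca: "continuous_map ?D euclideanreal (%z. a (snd (snd z)))" and cb: "continuous_map ?D euclideanreal (%z. b (snd (snd z)))"
  using continuous_map_compose[OF t, of euclideanreal a] continuous_map_compose[OF t, of euclideanreal b] a b
  by (simp_all add: o_def)
 have "continuous_map ?D (prod_topology X euclideanreal) (%z. (fst (snd z), (1 - fst z) * a (snd (snd z)) + fst z * b (snd (snd z))))"
  by (intro continuous_map_pairedI x continuous_map_add continuous_map_real_mult continuous_map_diff s ca cb) simp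
 moreover have "?h = (%z. (fst (snd z), (1 - fst z) * a (snd (snd z)) + fst z * b (snd (snd z))))"
  by auto
 ultimately show "continuous_map ?D ?P ?h"
  using im by (auto simp: continuous_map_in_subtopology)
qed (use Q in auto)

text \<open>The pair of the whole product and \<open>C\<close> has trivial homology, so the boundary
  map of the triple identifies the left side with the homology of \<open>B\<close> relative to
  \<open>C\<close>, one degree lower. Excising everything but the negative half \<open>L\<close>
  leaves the pair (\<open>X\<close>, \<open>A\<close>) times an open half line.\<close>

lemma relative_homology_suspension:
 assumes A: "openin X A"
 shows "RHG (p + 1) (prod_topology X euclideanreal) (A \<times> UNIV Un topspace X \<times> (- {0}))
  \<cong> RHG p X A"
proof -
 let ?P = "prod_topology X euclideanreal"
 define B where "B = A \<times> UNIV Un topspace X \<times> (- {0::real})"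
 define C where "C = A \<times> UNIV Un topspace X \<times> {0::real<..}"
 define L where "L = topspace X \<times> {..<0::real}"
 have AX: "A \<subseteq> topspace X" using A openin_subset by auto
 have tP: "topspace ?P = topspace X \<times> UNIV" by simp
 have CB: "C \<subseteq> B" by (auto simp: B_def C_def)
 have oC: "openin ?P C" and oL: "openin ?P L" and oB: "openin ?P B"
  using A by (auto simp: C_def L_def B_def openin_prod_Times_iff open_Compl)
 have BP: "B \<subseteq> topspace X \<times> UNIV" and CP: "C \<subseteq> topspace X \<times> UNIV"
  using AX by (auto simp: B_def C_def)
 have subP: "subtopology ?P (topspace X \<times> UNIV) = ?P"
  by (metis subtopology_topspace tP)
 have idf: "(%(x, t). (x, t)) = (id :: 'a \<times> real => _)" by auto
 have trivC: "trivial_group (RHG q ?P C)" for q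
 proof (rule trivial_relative_homology_group_gen)
  \<comment> \<open>Adding 1 to the absolute value makes the coordinate positive, so the whole
    product is mapped into \<open>C\<close>. On \<open>C\<close> the segment to the identity stays
    positive or stays over \<open>A\<close>.\<close>
  let ?f = "%(x, t). (x, \<bar>t\<bar> + 1) :: 'a \<times> real"
  have "homotopic_with (%h. True) (subtopology ?P (topspace X \<times> UNIV)) (subtopology ?P (topspace X \<times> UNIV)) ?f (%(x, t). (x, t))"
   by (rule homotopic_linear_snd) (auto intro!: continuous_intros)
  thus h: "homotopic_with (%h. True) ?P ?P ?f id"
   by (simp add: subP)
  have pos: "0 < (1 - s) * (\<bar>t\<bar> + 1) + s * t" if "0 <= s" "s <= 1" "0 < t" for s t :: real
   using that by (cases "s = 1") (auto intro: add_pos_nonneg)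
  have "homotopic_with (%h. True) (subtopology ?P C) (subtopology ?P C) ?f (%(x, t). (x, t))"
   by (rule homotopic_linear_snd) (use CP pos in \<open>auto simp: C_def intro!: continuous_intros\<close>)
  thus "homotopic_with (%h. True) (subtopology ?P C) (subtopology ?P C) ?f id"
   by (simp)
  show "continuous_map ?P (subtopology ?P C) ?f"
   using homotopic_with_imp_continuous_maps[OF h] by (auto simp: continuous_map_in_subtopology C_def)
 qed
 have iso1: "hom_relboundary (p + 1) ?P B C : iso (RHG (p + 1) ?P B) (RHG p (subtopology ?P B) C)"
 proof -
  have inj: "inj_on (hom_relboundary (p + 1) ?P B C) (carrier (RHG (p + 1) ?P B))"
   using homology_exactness_triple_1[OF CB] trivC by (rule exact_seq_trivial_inj)
  have "hom_relboundary (p + 1) ?P B C ` carrier (RHG (p + 1) ?P B) =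
    carrier (RHG (p + 1 - 1) (subtopology ?P B) C)"
   using homology_exactness_triple_2[OF CB] trivC by (rule exact_seq_trivial_surj)
  thus ?thesis
   using inj group_homomorphism_hom_relboundary[of "p + 1" ?P B C] by (simp add: iso_def bij_betw_def)
 qed
 have "hom_induced p (subtopology (subtopology ?P B) (B - (B - L))) (C - (B - L)) (subtopology (subtopology ?P B) B) C id
  : iso (RHG p (subtopology (subtopology ?P B) (B - (B - L))) (C - (B - L)))
     (RHG p (subtopology (subtopology ?P B) B) C)"
 proof (rule homology_excision_axiom[OF _ CB])
  have "topspace (subtopology ?P B) = B" "B - (B - L) = L" "L Int B = L"
   using BP by (auto simp: L_def B_def)
  hence "closedin (subtopology ?P B) (B - L)"
   using oL unfolding closedin_def by (metis Diff_subset openin_subtopology)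
  moreover have "openin (subtopology ?P B) C"
   using oC CB by (auto simp: openin_subtopology)
  moreover have "B - L \<subseteq> C"
   by (auto simp: B_def L_def C_def)
  ultimately show "subtopology ?P B closure_of (B - L) \<subseteq> subtopology ?P B interior_of C"
   by (simp add: closure_of_closedin interior_of_openin)
 qed
 moreover have LB: "L \<subseteq> B" by (auto simp: L_def B_def)
 moreover have "B - (B - L) = L" "C - (B - L) = A \<times> {..<0}" "B Int L = L"
  using AX by (auto simp: L_def B_def C_def)
 ultimately have iso2: "RHG p (subtopology ?P L) (A \<times> {..<0}) \<cong> RHG p (subtopology ?P B) C"
  by (auto simp: subtopology_subtopology is_iso_def)
 have iso3: "RHG p (subtopology ?P L) (A \<times> {..<0}) \<cong> RHG p X A"
 proof (rule homotopy_equivalent_space_imp_isomorphic_relative_homology_groups)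
  show "continuous_map (subtopology ?P L) X fst"
   by (rule continuous_map_from_subtopology[OF continuous_map_fst])
  show "continuous_map X (subtopology ?P L) (%x. (x, -1))"
   by (auto simp: continuous_map_in_subtopology L_def continuous_map_paired)
  have neg: "(1 - s) * (-1) + s * t < (0::real)" if "0 <= s" "s <= 1" "t < 0" for s t
  proof (cases "s = 0")
   case False
   hence "s * t < 0" using that by (simp add: mult_pos_neg)
   moreover have "(1 - s) * (-1) + s * t = s * t - (1 - s)" by (simp)
   ultimately show ?thesis using that by linarith
  qed auto
  have "homotopic_with (%h. h : A \<times> {..<0} \<rightarrow> A \<times> {..<0}) (subtopology ?P L) (subtopology ?P L) (%(x, t). (x, -1)) (%(x, t). (x, t))"
   by (rule homotopic_linear_snd) (use neg in \<open>auto simp: L_def simp del: mult_minus_right\<close>)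
  moreover have "(%x :: 'a. (x, -1::real)) o fst = (%(x, t::real). (x, -1))"
   by auto
  ultimately show "homotopic_with (%h. h : A \<times> {..<0} \<rightarrow> A \<times> {..<0}) (subtopology ?P L) (subtopology ?P L) ((%x. (x, -1)) o fst) id"
   by (simp only: idf)
  show "homotopic_with (%k. k : A \<rightarrow> A) X X (fst o (%x. (x, -1))) id"
   by (simp add: o_def homotopic_with_equal)
 qed auto
 have "RHG (p + 1) ?P B \<cong> RHG p (subtopology ?P B) C"
  using iso1 by (auto simp: is_iso_def)
 also have "... \<cong> RHG p (subtopology ?P L) (A \<times> {..<0})"
  using iso2 by (meson group.iso_sym group_relative_homology_group)
 also have "... \<cong> RHG p X A"
  by (rule iso3)
 finally show ?thesis
  by (simp add: B_def)
qed

text \<open>A complex number is nonzero iff its real or its imaginary part is, which is how the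
  subspaces of two successive real suspensions combine.\<close>

lemma relative_homology_suspension_complex:
 assumes A: "openin X A"
 shows "RHG (p + 2) (prod_topology X (euclidean :: complex topology)) (A \<times> UNIV Un topspace X \<times> (- {0}))
  \<cong> RHG p X A"
proof -
 define P1 where "P1 = prod_topology X euclideanreal"
 define B1 where "B1 = A \<times> UNIV Un topspace X \<times> (- {0::real})"
 define B2 where "B2 = B1 \<times> UNIV Un topspace P1 \<times> (- {0::real})"
 let ?PC = "prod_topology X (euclidean :: complex topology)"
 let ?BC = "A \<times> UNIV Un topspace X \<times> (- {0 :: complex})"
 have AX: "A \<subseteq> topspace X" using A openin_subset by auto
 have oB1: "openin P1 B1"
  using A by (auto simp: B1_def P1_def openin_prod_Times_iff open_Compl)
 define h where "h = (%z :: ('a \<times> real) \<times> real. (fst (fst z), Complex (snd (fst z)) (snd z)))"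
 define g where "g = (%w :: 'a \<times> complex. ((fst w, Re (snd w)), Im (snd w)))"
 have "homeomorphic_maps (prod_topology P1 euclideanreal) ?PC h g"
  unfolding homeomorphic_maps_def
 proof (intro conjI)
  have fs: "continuous_map (prod_topology P1 euclideanreal) X (%z. fst (fst z))"
   "continuous_map (prod_topology P1 euclideanreal) euclideanreal (%z. snd (fst z))"
   using continuous_map_compose[OF continuous_map_fst[of P1 euclideanreal] continuous_map_fst[of X euclideanreal, folded P1_def]]
    continuous_map_compose[OF continuous_map_fst[of P1 euclideanreal] continuous_map_snd[of X euclideanreal, folded P1_def]]
   by (simp_all add: o_def)
  have c1: "continuous_map (prod_topology P1 euclideanreal) (prod_topology euclideanreal euclideanreal) (%z. (snd (fst z), snd z))"
   by (intro continuous_map_pairedI fs continuous_map_snd)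
  have c2: "continuous_map (prod_topology euclideanreal euclideanreal) euclidean (%z. Complex (fst z) (snd z))"
   by (auto intro!: continuous_intros)
  have "continuous_map (prod_topology P1 euclideanreal) euclidean (%z. Complex (snd (fst z)) (snd z))"
   using continuous_map_compose[OF c1 c2] by (simp add: o_def)
  thus "continuous_map (prod_topology P1 euclideanreal) ?PC h"
   using fs by (simp add: h_def continuous_map_paired)
  have "continuous_map ?PC euclideanreal (%w. Re (snd w))" "continuous_map ?PC euclideanreal (%w. Im (snd w))"
   using continuous_map_compose[OF continuous_map_snd[of X euclidean], of euclideanreal Re]
    continuous_map_compose[OF continuous_map_snd[of X euclidean], of euclideanreal Im]
   by (simp_all add: o_def continuous_on_Re continuous_on_Im)
  thus "continuous_map ?PC (prod_topology P1 euclideanreal) g"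
   by (simp add: g_def P1_def continuous_map_paired continuous_map_fst)
 qed (auto simp: h_def g_def P1_def)
 hence hm: "homeomorphic_map (prod_topology P1 euclideanreal) ?PC h"
  by (rule homeomorphic_maps_map[THEN iffD1, THEN conjunct1])
 have "h ` B2 = ?BC"
 proof (intro equalityI subsetI)
  fix w assume "w : ?BC"
  moreover have "w = h (g w)" by (simp add: h_def g_def)
  moreover have "w : ?BC ==> g w : B2"
   by (cases w) (auto simp: g_def B2_def B1_def P1_def complex_eq_iff)
  ultimately show "w : h ` B2" by blast
 qed (use AX in \<open>auto simp: h_def B2_def B1_def P1_def complex_eq_iff\<close>)
 moreover have "B2 \<subseteq> topspace (prod_topology P1 euclideanreal)"
  using openin_subset[OF oB1] by (auto simp: B2_def)
 ultimately have "hom_induced (p + 2) (prod_topology P1 euclideanreal) B2 ?PC ?BC h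
   : iso (RHG (p + 2) (prod_topology P1 euclideanreal) B2) (RHG (p + 2) ?PC ?BC)"
  by (intro homeomorphic_map_relative_homology_iso[OF hm])
 hence "RHG (p + 2) ?PC ?BC \<cong> RHG (p + 2) (prod_topology P1 euclideanreal) B2"
  by (meson group.iso_sym group_relative_homology_group is_isoI)
 also have "... \<cong> RHG (p + 1) P1 B1"
  using relative_homology_suspension[OF oB1, of "p + 1"] by (simp add: B2_def add.commute[of p 2])
 also have "... \<cong> RHG p X A"
  using relative_homology_suspension[OF A, of p] by (simp add: B1_def P1_def)
 finally show ?thesis .
qed

section \<open>Projective spaces as spaces of projectors\<close>

type_synonym cvec = "nat => complex"
type_synonym cmat = "nat => nat => complex"

lemma continuous_on_matrixI:
 fixes f :: "'a :: topological_space => 'i => 'j => 'b :: topological_space"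
 assumes "!!i j. continuous_on S (%z. f z i j)"
 shows "continuous_on S f"
 by (rule continuous_on_funI, rule continuous_on_funI, rule assms)

lemma cont_matrixD:
 fixes f :: "'a :: topological_space => 'i => 'j => 'b :: topological_space"
 assumes "continuous_on S f"
 shows "continuous_on S (%z. f z i j)"
 by (rule continuous_on_coordD, rule continuous_on_coordD, rule assms)

abbreviation zvec :: cvec where
 "zvec \<equiv> %_. 0"

definition coords :: "nat set => cvec set" where
 "coords K = {x. ALL j. j ~: K --> x j = 0}"

definition vscale :: "complex => cvec => cvec" where
 "vscale c x = (%i. c * x i)"

definition homogeneous :: "(cvec => cvec) => bool" where
 "homogeneous L \<longleftrightarrow> (ALL c x. L (vscale c x) = vscale c (L x))"

definition oncols :: "(cvec => cvec) => cmat => cmat" where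
 "oncols L M = (%i k. L (%j. M j k) i)"

lemma coords_mono: "K \<subseteq> K' ==> coords K \<subseteq> coords K'"
 by (auto simp: coords_def)

lemma vscale_coords: "x : coords K ==> vscale c x : coords K"
 by (simp add: coords_def vscale_def)

lemma vscale_vscale [simp]: "vscale c (vscale d x) = vscale (c * d) x"
 by (simp add: vscale_def mult.assoc)

lemma vscale_1 [simp]: "vscale 1 x = x"
 by (simp add: vscale_def)

lemma vscale_0 [simp]: "vscale 0 x = zvec" "vscale c zvec = zvec"
 by (auto simp: vscale_def)

lemma vscale_eq_0_iff: "vscale c x = zvec \<longleftrightarrow> c = 0 | x = zvec"
 by (auto simp: vscale_def fun_eq_iff)

text \<open>\<open>N\<close> bounds the index range of the finite sums. Vectors live in the full
  sequence type, and \<open>coords K\<close> selects those supported on \<open>K\<close>.\<close>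

locale projective =
 fixes N :: nat
begin

definition sqnorm :: "cvec => real" where
 "sqnorm x = (\<Sum>k<N. (cmod (x k))\<^sup>2)"

definition msqnorm :: "cmat => real" where
 "msqnorm W = (\<Sum>i<N. \<Sum>k<N. (cmod (W i k))\<^sup>2)"

text \<open>The point of projective space spanned by \<open>x\<close>, encoded by the orthogonal projector onto its line.\<close>

definition pr :: "cvec => cmat" where
 "pr x = (%i j. x i * cnj (x j) / of_real (sqnorm x))"

text \<open>\<open>W\<close> times its adjoint, divided by the squared Hilbert-Schmidt norm. For
  \<open>W\<close> of rank one this is the projector onto the column space, so \<open>act\<close>
  lets a linear map act on projectors by a formula that is continuous wherever the image is a
  line.\<close>

definition normalize :: "cmat => cmat" where
 "normalize W = (%i j. (\<Sum>k<N. W i k * cnj (W j k)) / of_real (msqnorm W))"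

definition act :: "(cvec => cvec) => cmat => cmat" where
 "act L M = normalize (oncols L M)"

text \<open>A projector fixes exactly the vectors of its line; written as an equation, incidence
  becomes a closed condition.\<close>

definition in_line :: "cvec => cmat => bool" where
 "in_line u M \<longleftrightarrow> (ALL i. (\<Sum>k<N. M i k * u k) = u i)"

definition points :: "nat set => cmat set" where
 "points K = pr ` (coords K - {zvec})"

lemma mult_cnj_cmod: "z * cnj z = of_real ((cmod z)\<^sup>2)"
 by (rule complex_norm_square[symmetric])

lemma sqnorm_nonneg: "sqnorm x >= 0"
 by (simp add: sqnorm_def sum_nonneg)

lemma sqnorm_pos:
 assumes "x : coords K" "K \<subseteq> {..<N}" "x ~= zvec"
 shows "sqnorm x > 0"
proof -
 obtain k where k: "x k ~= 0" using assms(3) by (auto)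
 hence "k < N" using assms by (auto simp: coords_def)
 hence "(cmod (x k))\<^sup>2 <= sqnorm x"
  unfolding sqnorm_def by (intro member_le_sum) auto
 thus ?thesis using k by (metis less_le_trans norm_eq_zero zero_less_power2)
qed

lemma sqnorm_vscale: "sqnorm (vscale c x) = (cmod c)\<^sup>2 * sqnorm x"
 by (simp add: sqnorm_def vscale_def norm_mult power_mult_distrib sum_distrib_left)

lemma sqnorm_0 [simp]: "sqnorm zvec = 0"
 by (simp add: sqnorm_def)

lemma sum_cnj_sqnorm: "(\<Sum>k<N. x k * cnj (x k)) = of_real (sqnorm x)"
 unfolding sqnorm_def mult_cnj_cmod by simp

lemma pr_vscale: "c ~= 0 ==> pr (vscale c x) = pr x"
proof (intro ext)
 fix i j assume c: "c ~= 0"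
 show "pr (vscale c x) i j = pr x i j"
  using c unfolding pr_def sqnorm_vscale of_real_mult mult_cnj_cmod[symmetric] by (simp add: vscale_def)
qed

lemma pr_eqD:
 assumes "pr x = pr y" "x : coords K" "K \<subseteq> {..<N}" "x ~= zvec" "y : coords K'" "K' \<subseteq> {..<N}" "y ~= zvec"
 shows "EX c. c ~= 0 & y = vscale c x"
proof -
 have nx: "sqnorm x > 0" and ny: "sqnorm y > 0" using assms sqnorm_pos by blast+
 obtain a where a: "y a ~= 0" using assms by (auto simp: fun_eq_iff)
 \<comment> \<open>The factor is found by comparing column \<open>a\<close> of the two projectors,
   where \<open>y a\<close> is nonzero.\<close>
 define c where "c = (cnj (x a) / of_real (sqnorm x)) * of_real (sqnorm y) / cnj (y a)"
 have "y i = c * x i" for i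
  using fun_cong[OF fun_cong[OF assms(1), of i], of a] a nx ny
  by (simp add: pr_def c_def field_simps)
 hence y: "y = vscale c x" by (auto simp: vscale_def)
 hence "c ~= 0" using assms by auto
 with y show ?thesis by blast
qed

lemma in_line_pr:
 assumes "x : coords K" "K \<subseteq> {..<N}" "x ~= zvec"
 shows "in_line u (pr x) \<longleftrightarrow> (EX c. u = vscale c x)"
proof
 assume "in_line u (pr x)"
 hence "u i = (\<Sum>k<N. x i * cnj (x k) / of_real (sqnorm x) * u k)" for i
  unfolding in_line_def pr_def by simp
 also have "... i = (\<Sum>k<N. cnj (x k) * u k / of_real (sqnorm x)) * x i" for i
  unfolding sum_distrib_right by (rule sum.cong) auto
 finally have "u i = (\<Sum>k<N. cnj (x k) * u k / of_real (sqnorm x)) * x i" for i .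
 thus "EX c. u = vscale c x" by (auto simp: vscale_def)
next
 assume "EX c. u = vscale c x"
 then obtain c where u: "u = vscale c x" by auto
 have "(\<Sum>k<N. pr x i k * u k) = c * x i * (\<Sum>k<N. x k * cnj (x k)) / of_real (sqnorm x)" for i
  unfolding u pr_def vscale_def by (simp add: sum_distrib_left sum_divide_distrib algebra_simps)
 thus "in_line u (pr x)"
  using sqnorm_pos[OF assms] by (simp add: in_line_def sum_cnj_sqnorm u vscale_def)
qed

lemma oncols_pr:
 assumes "homogeneous L"
 shows "oncols L (pr x) = (%i k. L x i * cnj (x k) / of_real (sqnorm x))"
proof (intro ext)
 fix i k
 have "(%j. pr x j k) = vscale (cnj (x k) / of_real (sqnorm x)) x"
  by (auto simp: pr_def vscale_def)
 thus "oncols L (pr x) i k = L x i * cnj (x k) / of_real (sqnorm x)"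
  using assms by (simp add: oncols_def homogeneous_def) (simp add: vscale_def)
qed

lemma msqnorm_outer: "msqnorm (%i k. u i * cnj (w k) / c) = sqnorm u * sqnorm w / (cmod c)\<^sup>2"
proof -
 have "msqnorm (%i k. u i * cnj (w k) / c) = (\<Sum>i<N. \<Sum>k<N. (cmod (u i))\<^sup>2 * (cmod (w k))\<^sup>2) / (cmod c)\<^sup>2"
  by (simp add: msqnorm_def norm_mult norm_divide power_mult_distrib power_divide sum_divide_distrib)
 thus ?thesis by (simp add: sqnorm_def sum_product)
qed

lemma msqnorm_oncols:
 assumes "homogeneous L" "sqnorm x > 0"
 shows "msqnorm (oncols L (pr x)) = sqnorm (L x) / sqnorm x"
 using assms by (simp add: oncols_pr msqnorm_outer power2_eq_square)

lemma normalize_outer: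
 assumes "c ~= 0" "sqnorm w > 0"
 shows "normalize (%i k. u i * cnj (w k) / c) = pr u"
proof (intro ext)
 fix i j
 have "(\<Sum>k<N. (u i * cnj (w k) / c) * cnj (u j * cnj (w k) / c))
   = u i * cnj (u j) * (\<Sum>k<N. w k * cnj (w k)) / (c * cnj c)"
  by (simp add: sum_distrib_left sum_divide_distrib algebra_simps)
 also have "... = u i * cnj (u j) * of_real (sqnorm w) / of_real ((cmod c)\<^sup>2)"
  by (simp only: sum_cnj_sqnorm) (simp only: mult_cnj_cmod)
 finally show "normalize (%i k. u i * cnj (w k) / c) i j = pr u i j"
  using assms by (simp add: normalize_def msqnorm_outer pr_def)
qed

lemma act_pr:
 assumes "homogeneous L" "sqnorm x > 0"
 shows "act L (pr x) = pr (L x)"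
 using assms by (simp add: act_def oncols_pr normalize_outer)

lemma continuous_on_normalize:
 assumes f: "!!i j. continuous_on S (%z. f z i j)" and nz: "!!z. z : S ==> msqnorm (f z) ~= 0"
 shows "continuous_on S (%z. normalize (f z))"
proof (rule continuous_on_matrixI)
 fix i j
 have "continuous_on S (%z. msqnorm (f z))"
  unfolding msqnorm_def by (intro continuous_intros f)
 thus "continuous_on S (%z. normalize (f z) i j)"
  unfolding normalize_def using nz by (intro continuous_intros f) auto
qed

lemma continuous_on_pr:
 assumes f: "continuous_on S f" and nz: "!!z. z : S ==> sqnorm (f z) > 0"
 shows "continuous_on S (%z. pr (f z))"
proof (rule continuous_on_matrixI)
 fix i j
 have f': "continuous_on S (%z. f z i)" for i
  using f by (rule continuous_on_coordD)
 have "continuous_on S (%z. sqnorm (f z))"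
  unfolding sqnorm_def by (intro continuous_intros f')
 thus "continuous_on S (%z. pr (f z) i j)"
  unfolding pr_def using nz by (intro continuous_intros f') (force simp: less_le)+
qed

lemma pr_in_points: "x : coords K ==> x ~= zvec ==> pr x : points K"
 by (auto simp: points_def)

end

section \<open>Products with projective spaces\<close>

lemma homotopic_with_id_prod_right:
 fixes S :: "'b :: topological_space set" and H :: "real \<times> 'b => 'b"
 assumes H: "continuous_on ({0..1} \<times> S) H" and im: "!!s y. s : {0..1} ==> y : S ==> H (s, y) : S"
  and 1: "!!y. y : S ==> H (1, y) = y"
 shows "homotopic_with (%h. True) (prod_topology T (top_of_set S)) (prod_topology T (top_of_set S))
  (%(t, y). (t, H (0, y))) id"
proof -
 have "homotopic_with (%h. True) (top_of_set S) (top_of_set S) (%y. H (0, y)) (%y. H (1, y))"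
  unfolding homotopic_with_def by (rule exI[of _ H]) (use H im in auto)
 hence "homotopic_with (%h. True) (top_of_set S) (top_of_set S) (%y. H (0, y)) id"
  by (rule homotopic_with_eq) (use 1 in auto)
 moreover have "homotopic_with (%h. True) T T id id"
  by (simp)
 ultimately have "homotopic_with (%h. True) (prod_topology T (top_of_set S)) (prod_topology T (top_of_set S))
   (%z. (id (fst z), H (0, snd z))) (%z. (id (fst z), id (snd z)))"
  using homotopic_with_prod_topology[of "%_. True" T T id id "%_. True" _ _ _ _ "%_. True"] by blast
 thus ?thesis
  by (rule homotopic_with_eq) auto
qed

context projective begin

definition unit :: "nat => cvec" where
 "unit a = (%i. if i = a then 1 else 0)"

lemma unit_in: "a : K ==> unit a : coords K" and unit_nonzero: "unit a ~= zvec"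
 by (auto simp: unit_def coords_def fun_eq_iff)

lemma points_singleton:
 assumes "a < N"
 shows "points {a} = {pr (unit a)}"
proof -
 have "pr x = pr (unit a)" if "x : coords {a}" "x ~= zvec" for x
 proof -
  have "x = vscale (x a) (unit a)" "x a ~= 0"
   using that by (auto simp: coords_def unit_def vscale_def)
  thus ?thesis by (metis pr_vscale)
 qed
 moreover have "pr (unit a) : points {a}"
  using unit_in[of a "{a}"] unit_nonzero by (simp add: pr_in_points)
 ultimately show ?thesis by (auto simp: points_def)
qed

text \<open>The point \<open>pr (unit a)\<close> is the only one whose last homogeneous coordinates all vanish.\<close>

lemma pr_unit_iff:
 assumes x: "x : coords (insert a K)" "x ~= zvec" and K: "a ~: K" "insert a K \<subseteq> {..<N}"
 shows "pr x = pr (unit a) \<longleftrightarrow> (\<forall>k\<in>K. x k = 0)"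
proof
 assume "pr x = pr (unit a)"
 then obtain c where "x = vscale c (unit a)"
  using pr_eqD[of "unit a" x "insert a K" "insert a K"] x K(2) unit_in[of a "insert a K"] unit_nonzero[of a] by auto
 thus "\<forall>k\<in>K. x k = 0" using K by (auto simp: vscale_def unit_def)
next
 assume "\<forall>k\<in>K. x k = 0"
 hence "x = vscale (x a) (unit a)" "x a ~= 0"
  using x by (auto simp: coords_def unit_def vscale_def fun_eq_iff)
 thus "pr x = pr (unit a)" by (metis pr_vscale)
qed

definition shrink :: "nat => real => cvec => cvec" where
 "shrink a s x = (%i. of_real (if i = a then s else 1) * x i)"

lemma homogeneous_shrink: "homogeneous (shrink a s)"
 by (auto simp: homogeneous_def shrink_def vscale_def)

text \<open>Scaling the coordinate \<open>a\<close> from 1 down to 0 deforms projective space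
  without the point \<open>pr (unit a)\<close> onto a hyperplane. Every remaining point has a
  nonzero coordinate in \<open>K\<close>, which is not scaled, so no vector becomes zero.\<close>

lemma points_shrink:
 assumes K: "a ~: K" "insert a K \<subseteq> {..<N}"
 defines "U \<equiv> points (insert a K) - {pr (unit a)}"
 shows "continuous_on ({0..1} \<times> U) (%(s, M). act (shrink a s) M)"
  and "!!s M. M : U ==> act (shrink a s) M : U"
  and "!!M. M : U ==> act (shrink a 0) M : points K"
  and "!!M. M : U ==> act (shrink a 1) M = M"
  and "!!M s. M : points K ==> act (shrink a s) M = M"
  and "points K \<subseteq> U"
proof -
 have U: "EX x. x : coords (insert a K) & x ~= zvec & M = pr x & sqnorm x > 0 & (\<exists>k\<in>K. x k ~= 0)" if M: "M : U" for M
  using that K sqnorm_pos[of _ "insert a K"] pr_unit_iff[OF _ _ K] unfolding U_def points_def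
  by blast
 have sx: "shrink a s x : coords (insert a K) & shrink a s x ~= zvec & sqnorm (shrink a s x) > 0 & (\<exists>k\<in>K. shrink a s x k ~= 0)"
  if x: "x : coords (insert a K)" "k : K" "x k ~= 0" for s x k
 proof -
  have 1: "shrink a s x : coords (insert a K)" using x by (auto simp: coords_def shrink_def)
  have "shrink a s x k ~= 0" using x K by (auto simp: shrink_def)
  moreover from this have 2: "shrink a s x ~= zvec" by (auto)
  moreover have "sqnorm (shrink a s x) > 0" using sqnorm_pos[OF 1 _ 2] K by auto
  ultimately show ?thesis using 1 x by blast
 qed
 have "continuous_on ({0..1} \<times> U) (%z :: real \<times> cmat. normalize (oncols (shrink a (fst z)) (snd z)))"
 proof (rule continuous_on_normalize)
  fix i j
  show "continuous_on ({0..1} \<times> U) (%z :: real \<times> cmat. oncols (shrink a (fst z)) (snd z) i j)"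
   unfolding oncols_def shrink_def
   by (intro continuous_intros cont_matrixD[OF continuous_on_snd[OF continuous_on_id]])
    (cases "i = a"; simp add: continuous_on_fst)
 next
  fix z :: "real \<times> cmat" assume z: "z : {0..1} \<times> U"
  obtain x k where x: "x : coords (insert a K)" "snd z = pr x" "sqnorm x > 0" "k : K" "x k ~= 0"
   using U[of "snd z"] z by auto
  show "msqnorm (oncols (shrink a (fst z)) (snd z)) ~= 0"
   using sx[OF x(1,4,5), of "fst z"] x(3) by (simp add: x(2) msqnorm_oncols homogeneous_shrink)
 qed
 thus "continuous_on ({0..1} \<times> U) (%(s, M). act (shrink a s) M)"
  by (simp add: act_def case_prod_unfold)
 show "act (shrink a s) M : U" if M: "M : U" for s M
 proof -
  obtain x k where x: "x : coords (insert a K)" "M = pr x" "sqnorm x > 0" "k : K" "x k ~= 0"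
   using U[OF M] by blast
  have "act (shrink a s) M = pr (shrink a s x)"
   using x by (simp add: act_pr homogeneous_shrink)
  thus ?thesis
   using sx[OF x(1,4,5), of s] pr_unit_iff[OF _ _ K, of "shrink a s x"] by (auto simp: U_def points_def)
 qed
 show "act (shrink a 0) M : points K" if M: "M : U" for M
 proof -
  obtain x k where x: "x : coords (insert a K)" "M = pr x" "sqnorm x > 0" "k : K" "x k ~= 0"
   using U[OF M] by blast
  hence "shrink a 0 x : coords K" "shrink a 0 x ~= zvec"
   using sx[OF x(1,4,5), of 0] by (auto simp: coords_def shrink_def)
  thus ?thesis using x act_pr[OF homogeneous_shrink] by (simp add: points_def)
 qed
 show "act (shrink a 1) M = M" if M: "M : U" for M
  using U[OF M] act_pr[OF homogeneous_shrink, of _ a 1] by (auto simp: shrink_def)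
 show "act (shrink a s) M = M" if M: "M : points K" for M s
 proof -
  obtain x where x: "x : coords K" "x ~= zvec" "M = pr x" using M by (auto simp: points_def)
  hence "shrink a s x = x" using K by (auto simp: shrink_def coords_def)
  thus ?thesis using x K sqnorm_pos[OF x(1) _ x(2)] act_pr[OF homogeneous_shrink, of x a s] by auto
 qed
 show "points K \<subseteq> U"
 proof
  fix M assume "M : points K"
  then obtain x where x: "x : coords K" "x ~= zvec" "M = pr x" by (auto simp: points_def)
  moreover obtain k where "x k ~= 0" using x(2) by (auto)
  ultimately have "x : coords (insert a K)" "\<exists>k\<in>K. x k ~= 0"
   by (auto simp: coords_def)
  thus "M : U" using x pr_unit_iff[OF _ x(2) K] by (auto simp: U_def points_def)
 qed
qed

definition chart :: "nat => nat set => cmat => cvec" where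
 "chart a K M = (%i. if i : K then M i a / M a a else 0)"

definition unchart :: "nat => cvec => cmat" where
 "unchart a y = pr (y(a := 1))"

text \<open>The affine chart in which the homogeneous coordinate \<open>a\<close> is nonzero, read
  off column \<open>a\<close> of the projector. The point \<open>pr (unit a)\<close> removed in
  \<open>points_shrink\<close> is its origin.\<close>

lemma chart_homeomorphic:
 assumes K: "a ~: K" "insert a K \<subseteq> {..<N}"
 shows "homeomorphic_maps (top_of_set {M : points (insert a K). M a a ~= 0}) (top_of_set (coords K)) (chart a K) (unchart a)"
  and "chart a K (pr (unit a)) = zvec"
proof -
 show "chart a K (pr (unit a)) = zvec"
  using K by (auto simp: chart_def pr_def unit_def)
 have pos: "sqnorm x > 0" if "x : coords (insert a K)" "x ~= zvec" for x
  using sqnorm_pos[OF that(1) K(2) that(2)] .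
 have ya: "y(a := 1) : coords (insert a K)" "y(a := 1) ~= zvec" if "y : coords K" for y
  using that by (auto simp: coords_def fun_eq_iff)
 show "homeomorphic_maps (top_of_set {M : points (insert a K). M a a ~= 0}) (top_of_set (coords K)) (chart a K) (unchart a)"
  unfolding homeomorphic_maps_def
 proof (intro conjI ballI)
  have "continuous_on {M : points (insert a K). M a a ~= 0} (chart a K)"
   unfolding chart_def
  proof (rule continuous_on_funI)
   fix i show "continuous_on {M : points (insert a K). M a a ~= 0} (%M. if i : K then M i a / M a a else 0)"
    using cont_matrixD[OF continuous_on_id, of _ i a] cont_matrixD[OF continuous_on_id, of _ a a]
    by (cases "i : K") (auto intro!: continuous_on_divide)
  qed
  thus "continuous_map (top_of_set {M : points (insert a K). M a a ~= 0}) (top_of_set (coords K)) (chart a K)"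
   by (auto simp: coords_def chart_def)
  have "continuous_on (coords K) (%y. pr (y(a := 1)))"
  proof (rule continuous_on_pr)
   show "continuous_on (coords K) (%y. y(a := 1))"
   proof (rule continuous_on_funI)
    fix i show "continuous_on (coords K) (%y. (y(a := 1)) i)"
     using continuous_on_coordD[OF continuous_on_id, of _ i] by (cases "i = a") auto
   qed
  qed (use pos ya in auto)
  moreover have "unchart a y : {M : points (insert a K). M a a ~= 0}" if "y : coords K" for y
   using ya[OF that] pos[of "y(a := 1)"] by (auto simp: unchart_def points_def) (auto simp: pr_def)
  ultimately show "continuous_map (top_of_set (coords K)) (top_of_set {M : points (insert a K). M a a ~= 0}) (unchart a)"
   by (auto simp: unchart_def[abs_def])
 next
  fix M assume "M : topspace (top_of_set {M : points (insert a K). M a a ~= 0})"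
  then obtain x where x: "x : coords (insert a K)" "x ~= zvec" "M = pr x" "M a a ~= 0"
   by (auto simp: points_def)
  hence xa: "x a ~= 0" by (auto simp: pr_def)
  have "(chart a K M)(a := 1) = vscale (1 / x a) x"
   using x by (auto simp: chart_def vscale_def pr_def coords_def)
  thus "unchart a (chart a K M) = M"
   using xa x by (simp add: unchart_def pr_vscale)
 next
  fix y assume "y : topspace (top_of_set (coords K))"
  hence y: "y : coords K" by simp
  show "chart a K (unchart a y) = y"
   using y K pos[OF ya[OF y]] by (auto simp: chart_def unchart_def pr_def coords_def)
 qed
qed

end

context projective begin

lemma prod_homeomorphic_maps_right:
 assumes "homeomorphic_maps X Y f g"
 shows "homeomorphic_maps (prod_topology T X) (prod_topology T Y) (%(t, x). (t, f x)) (%(t, y). (t, g y))"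
 using assms
 by (auto simp: homeomorphic_maps_def continuous_map_prod_top)

text \<open>The Thom isomorphism of a trivial bundle, by splitting off one complex coordinate at a
  time with the complex suspension.\<close>

lemma relative_homology_coords:
 assumes "finite K"
 shows "RHG (p + 2 * int (card K)) (prod_topology T (top_of_set (coords K))) (topspace T \<times> (coords K - {zvec}))
  \<cong> HG p T"
 using assms
proof (induct K)
 case empty
 have "coords {} = {zvec}" by (auto simp: coords_def)
 moreover have "homeomorphic_maps (prod_topology T (top_of_set {zvec})) T fst (%t. (t, zvec))"
  by (auto simp: homeomorphic_maps_def continuous_map_paired continuous_map_fst)
 ultimately show ?case
  using homeomorphic_space_imp_isomorphic_homology_groups homeomorphic_space_def by fastforce
next
 case (insert a K)
 let ?X = "prod_topology T (top_of_set (coords K))" and ?A = "topspace T \<times> (coords K - {zvec})"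
 let ?Y = "prod_topology T (top_of_set (coords (insert a K)))" and ?B = "topspace T \<times> (coords (insert a K) - {zvec})"
 define h where "h = (%(t :: 'a, y :: cvec). ((t, y(a := 0)), y a))"
 define g where "g = (%((t :: 'a, x :: cvec), c). (t, x(a := c)))"
 have c_upd: "continuous_on S (%z. (f z)(a := u z))" if "continuous_on S f" "continuous_on S u" for S :: "'c :: topological_space set" and f :: "'c => cvec" and u
 proof (rule continuous_on_funI)
  fix i show "continuous_on S (%z. ((f z)(a := u z)) i)"
   using continuous_on_coordD[OF that(1), of i] that(2) by (cases "i = a") auto
 qed
 have hm: "homeomorphic_maps ?Y (prod_topology ?X euclidean) h g"
  unfolding homeomorphic_maps_def
 proof (intro conjI)
  have "continuous_map ?Y (top_of_set (coords K)) (%z. (snd z)(a := 0))"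
  proof -
   have "continuous_map (top_of_set (coords (insert a K))) (top_of_set (coords K)) (%y. y(a := 0))"
    using c_upd[OF continuous_on_id continuous_on_const] by (auto simp: coords_def)
   from continuous_map_compose[OF continuous_map_snd this] show ?thesis by (simp add: o_def)
  qed
  moreover have "continuous_map ?Y euclidean (%z. snd z a)"
  proof -
   have "continuous_map (top_of_set (coords (insert a K))) euclidean (%y. y a)"
    using continuous_on_coordD[OF continuous_on_id] by auto
   from continuous_map_compose[OF continuous_map_snd this] show ?thesis by (simp add: o_def)
  qed
  ultimately show "continuous_map ?Y (prod_topology ?X euclidean) h"
   by (simp add: h_def case_prod_unfold continuous_map_paired continuous_map_fst)
  have "continuous_map (prod_topology ?X euclidean) T (%z. fst (fst z))"
   using continuous_map_compose[OF continuous_map_fst[of ?X euclidean] continuous_map_fst[of T]] by (simp add: o_def)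
  moreover have "continuous_map (prod_topology ?X euclidean) (top_of_set (coords (insert a K))) (%z. (snd (fst z))(a := snd z))"
  proof -
   have 1: "continuous_map (prod_topology ?X euclidean) (prod_topology (top_of_set (coords K)) euclidean) (%z. (snd (fst z), snd z))"
    using continuous_map_compose[OF continuous_map_fst[of ?X euclidean] continuous_map_snd[of T]]
    by (intro continuous_map_pairedI continuous_map_snd) (simp add: o_def)
   have "continuous_on (coords K \<times> UNIV) (%z. (fst z)(a := snd z))"
    by (intro c_upd continuous_on_fst continuous_on_snd continuous_on_id)
   hence 2: "continuous_map (top_of_set (coords K \<times> UNIV)) (top_of_set (coords (insert a K))) (%z. (fst z)(a := snd z))"
    by (auto simp: coords_def)
   have "top_of_set (coords K \<times> (UNIV :: complex set)) = prod_topology (top_of_set (coords K)) euclidean"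
    using prod_topology_subtopology_eu[of "coords K" "UNIV :: complex set"] by simp
   with 2 continuous_map_compose[OF 1, of _ "%z. (fst z)(a := snd z)"] show ?thesis by (simp add: o_def)
  qed
  ultimately show "continuous_map (prod_topology ?X euclidean) ?Y g"
   by (simp add: g_def case_prod_unfold continuous_map_paired)
 qed (use insert in \<open>auto simp: h_def g_def coords_def fun_eq_iff\<close>)
 have img: "h ` ?B = ?A \<times> UNIV Un topspace ?X \<times> (- {0})"
 proof (intro equalityI subsetI)
  fix z assume "z : ?A \<times> UNIV Un topspace ?X \<times> (- {0 :: complex})"
  then obtain t x c where z: "z = ((t, x), c)" "t : topspace T" "x : coords K" "c ~= 0 | x ~= zvec"
   by auto
  hence xa: "x a = 0" using insert by (auto simp: coords_def)
  hence "x(a := 0) = x" by (metis fun_upd_triv)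
  hence zh: "z = h (t, x(a := c))" by (simp add: h_def z(1))
  have "x(a := c) ~= zvec"
   using z(4) xa by (metis fun_upd_same fun_upd_triv)
  moreover have "x(a := c) : coords (insert a K)"
   using z(3) by (simp add: coords_def)
  ultimately show "z : h ` ?B"
   unfolding zh using z(2) by (intro imageI) simp
 next
  fix z assume "z : h ` ?B"
  then obtain w where w: "w : ?B" "z = h w" ..
  moreover obtain t y where "w = (t, y)" by (cases w)
  ultimately have "(t, y) : ?B" "z = h (t, y)" by simp_all
  hence ty: "t : topspace T" "y : coords (insert a K)" "y ~= zvec" "z = ((t, y(a := 0)), y a)"
   by (simp_all add: h_def)
  have y0: "y(a := 0) : coords K" using ty by (auto simp: coords_def)
  show "z : ?A \<times> UNIV Un topspace ?X \<times> (- {0})"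
  proof (cases "y a = 0")
   case True
   hence "y(a := 0) = y" by auto
   thus ?thesis using ty y0 by simp
  qed (use ty y0 in simp)
 qed
 have oA: "openin ?X ?A"
  by (simp add: openin_prod_Times_iff openin_delete)
 have "hom_induced q ?Y ?B (prod_topology ?X euclidean) (?A \<times> UNIV Un topspace ?X \<times> (- {0})) h
   : iso (RHG q ?Y ?B) (RHG q (prod_topology ?X euclidean) (?A \<times> UNIV Un topspace ?X \<times> (- {0})))" for q
  using hm img by (intro homeomorphic_map_relative_homology_iso) (auto simp: homeomorphic_maps_map)
 hence "RHG (p + 2 * int (card (insert a K))) ?Y ?B
   \<cong> RHG (p + 2 * int (card (insert a K))) (prod_topology ?X (euclidean :: complex topology)) (?A \<times> UNIV Un topspace ?X \<times> (- {0}))"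
  by (rule is_isoI)
 also have "... \<cong> RHG (p + 2 * int (card K)) ?X ?A"
  using relative_homology_suspension_complex[OF oA, of "p + 2 * int (card K)"] insert by (simp add: algebra_simps)
 also have "... \<cong> HG p T" by (rule insert)
 finally show ?case .
qed

text \<open>The usual cell structure, in families over \<open>T\<close>: adding a coordinate
  \<open>a\<close> attaches a cell of real dimension \<open>2 * card K\<close> centred at
  \<open>pr (unit a)\<close>. The kernel of the projection is trivial when the fibre is a point and
  gains \<open>b (p - 2 * int (card K))\<close> at each step.\<close>

lemma even_fibration_points:
 assumes K: "finite K" "K ~= {}" "K \<subseteq> {..<N}" and T: "even_hom T b"
 shows "even_fibration (prod_topology T (top_of_set (points K))) T fst (%p. \<Sum>j = 1..<card K. b (p - 2 * int j))"
 using K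
proof (induct K rule: finite_ne_induct)
 case (singleton a)
 let ?E = "prod_topology T (top_of_set (points {a}))"
 have pt: "points {a} = {pr (unit a)}" using singleton by (simp add: points_singleton)
 have hm: "homeomorphic_maps ?E T fst (%t. (t, pr (unit a)))"
  by (auto simp: homeomorphic_maps_def continuous_map_paired continuous_map_fst pt)
 hence retr: "retraction_map ?E T fst"
  by (auto simp: retraction_map_def retraction_maps_def homeomorphic_maps_def)
 have "hom_induced p ?E {} T {} fst : iso (HG p ?E) (HG p T)" for p
  using hm by (intro homeomorphic_map_homology_iso) (auto simp: homeomorphic_maps_map)
 hence iso: "kernel (HG p ?E) (HG p T) (hom_induced p ?E {} T {} fst) = {\<one>\<^bsub>HG p ?E\<^esub>}"
   "HG p ?E \<cong> HG p T" for p
  using group_hom.inj_iff_trivial_ker[OF group_hom_hom_induced[of p ?E "{}" T "{}" fst]]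
  by (auto simp: is_iso_def iso_def bij_betw_def)
 have "trivial_group (kgroup (HG p ?E) (HG p T) (hom_induced p ?E {} T {} fst))" for p
  unfolding iso(1) by (simp add: group.trivial_group_subgroup_generated)
 hence "free_rank (kgroup (HG p ?E) (HG p T) (hom_induced p ?E {} T {} fst)) 0" for p
  by (intro free_rank_trivial comm_group_kgroup) simp_all
 moreover have "trivial_group (HG p ?E)" if "odd p" for p
  using T that isomorphic_group_triviality[OF iso(2)] by (simp add: even_hom_def)
 ultimately show ?case
  using retr by (simp add: even_fibration_def)
next
 case (insert a K)
 let ?P = "points (insert a K)" and ?pt = "pr (unit a)"
 let ?U = "points (insert a K) - {pr (unit a)}" and ?V = "{M : points (insert a K). M a a ~= 0}"
 let ?X = "prod_topology T (top_of_set ?P)" and ?TU = "prod_topology T (top_of_set ?U)"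
 let ?TK = "prod_topology T (top_of_set (points K))" and ?TV = "prod_topology T (top_of_set ?V)"
 let ?S = "topspace T \<times> ?U"
 have aK: "a ~: K" "insert a K \<subseteq> {..<N}" using insert by auto
 note sh = points_shrink[OF aK]
 have pt_in: "?pt : ?P" using unit_in[of a "insert a K"] unit_nonzero by (simp add: pr_in_points)
 have pt_aa: "?pt a a ~= 0"
  using sqnorm_pos[of "unit a" "{a}"] unit_in[of a "{a}"] unit_nonzero aK by (auto simp: pr_def unit_def)
 have TU: "subtopology ?X ?S = ?TU"
  by (simp add: subtopology_Times subtopology_subtopology Int_absorb1)
 \<comment> \<open>\<open>T \<times> U\<close> retracts onto the smaller product.\<close>
 have retr: "retraction_maps ?TU ?TK (%(t, M). (t, act (shrink a 0) M)) id"
 proof -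
  have "continuous_on ?U (%M. (0 :: real, M))"
   by (rule continuous_on_Pair[OF continuous_on_const continuous_on_id])
  hence "continuous_on ?U (act (shrink a 0))"
   using continuous_on_compose2[OF sh(1), of ?U "%M. (0, M)"] by fastforce
  hence c: "continuous_map (top_of_set ?U) (top_of_set (points K)) (act (shrink a 0))"
   using sh(3) by auto
  have i: "continuous_map (top_of_set (points K)) (top_of_set ?U) (%M. M)"
   using sh(6) by auto
  have idT: "continuous_map T T (%t. t)"
   by (simp)
  have "continuous_map ?TU ?TK (%(t, M). (t, act (shrink a 0) M))" "continuous_map ?TK ?TU (%(t, M). (t, M))"
   using idT c i by (simp_all only: continuous_map_prod_top simp_thms)
  moreover have "(%(t :: 'a, M :: cmat). (t, M)) = id" by auto
  ultimately show ?thesis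
   using sh(5) by (auto simp: retraction_maps_def)
 qed
 have inclK: "continuous_map ?TK ?TU id"
  using retr by (simp add: retraction_maps_def)
 have homot: "homotopic_with (%h. True) ?TU ?TU (%(t, M). (t, act (shrink a 0) M)) id"
  using homotopic_with_id_prod_right[OF sh(1), of T] sh(2,4) by simp
 have isoK: "hom_induced p ?TK {} ?TU {} id : iso (HG p ?TK) (HG p ?TU)" for p
  by (rule deformation_retract_relative_homology_group_isomorphism_id[OF retr]) (use homot in auto)
 have IH: "even_fibration ?TK T fst (%p. \<Sum>j = 1..<card K. b (p - 2 * int j))"
  using insert by auto
 have oddU: "trivial_group (HG p ?TU)" if "odd p" for p
  using IH that isomorphic_group_triviality1[OF is_isoI[OF isoK]] by (simp add: even_fibration_def)
 have fstU: "continuous_map ?TU T fst" and fstX: "continuous_map ?X T fst" and fstK: "continuous_map ?TK T fst"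
  by (auto intro: continuous_map_fst)
 have kerU: "free_rank (kgroup (HG p ?TU) (HG p T) (hom_induced p ?TU {} T {} fst)) (\<Sum>j = 1..<card K. b (p - 2 * int j))"
  if "even p" for p
 proof (rule free_rank_kernel_iso[where A = "HG p ?TK" and B = "HG p T"
    and g = "hom_induced p ?TK {} T {} fst" and al = "hom_induced p ?TK {} ?TU {} id" and \<beta> = id])
  show "free_rank (kgroup (HG p ?TK) (HG p T) (hom_induced p ?TK {} T {} fst)) (\<Sum>j = 1..<card K. b (p - 2 * int j))"
   using IH that by (simp add: even_fibration_def)
  show "hom_induced p ?TU {} T {} fst (hom_induced p ?TK {} ?TU {} id x) = id (hom_induced p ?TK {} T {} fst x)" for x
   using hom_induced_compose'[OF inclK _ fstU, of "{}" "{}" "{}" p x] by simp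
  show "id : hom (HG p T) (HG p T)" by (simp add: hom_def)
 qed (simp_all add: hom_induced_hom isoK)
 \<comment> \<open>Excision to the chart around the missing point.\<close>
 have rel: "RHG p ?X ?S \<cong> HG (p - 2 * int (card K)) T" for p
 proof -
  let ?W = "topspace T \<times> {M : ?P. M a a = 0}"
  have cl: "closedin ?X ?W"
  proof -
   have "closedin (top_of_set ?P) {M : ?P. M a a = 0}"
    using continuous_closedin_preimage_constant[OF cont_matrixD[OF continuous_on_id], of ?P a a 0] by simp
   thus ?thesis by (simp add: closedin_prod_Times_iff)
  qed
  have op: "openin ?X ?S"
  proof -
   have "openin (top_of_set ?P) ?U" by (simp add: openin_delete)
   thus ?thesis by (simp add: openin_prod_Times_iff)
  qed
  have "?W \<subseteq> ?S" using pt_aa by auto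
  hence exc: "hom_induced p (subtopology ?X (topspace ?X - ?W)) (?S - ?W) (subtopology ?X (topspace ?X)) ?S id
    : iso (RHG p (subtopology ?X (topspace ?X - ?W)) (?S - ?W)) (RHG p (subtopology ?X (topspace ?X)) ?S)"
   using cl op by (intro homology_excision_axiom) (auto simp: closure_of_closedin interior_of_openin)
  have e: "topspace ?X - ?W = topspace T \<times> ?V" "?S - ?W = topspace T \<times> (?V - {?pt})"
   by auto
  have e': "subtopology ?X (topspace T \<times> ?V) = ?TV"
   by (simp add: subtopology_Times subtopology_subtopology Int_absorb1)
  have 1: "RHG p ?TV (topspace T \<times> (?V - {?pt})) \<cong> RHG p ?X ?S"
   using exc unfolding e e' subtopology_topspace by (rule is_isoI)
  let ?C = "prod_topology T (top_of_set (coords K))" and ?D = "topspace T \<times> (coords K - {zvec})"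
  let ?h = "%(t :: 'a, M). (t, chart a K M)"
  have hm: "homeomorphic_maps ?TV ?C ?h (%(t, y). (t, unchart a y))"
   by (rule prod_homeomorphic_maps_right[OF chart_homeomorphic(1)[OF aK]])
  have bij: "bij_betw (chart a K) ?V (coords K)"
   using chart_homeomorphic(1)[OF aK] unfolding homeomorphic_maps_def
   by (intro bij_betwI[where g = "unchart a"]) (auto simp: Pi_iff)
  have "chart a K ` (?V - {?pt}) = chart a K ` ?V - chart a K ` {?pt}"
   using bij pt_in pt_aa by (intro inj_on_image_set_diff[where C = ?V]) (auto simp: bij_betw_def)
  hence "chart a K ` (?V - {?pt}) = coords K - {zvec}"
   using bij chart_homeomorphic(2)[OF aK] by (simp add: bij_betw_def)
  moreover have "?h ` (A \<times> B) = A \<times> chart a K ` B" for A B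
   by force
  ultimately have "?h ` (topspace T \<times> (?V - {?pt})) = ?D"
   by simp
  hence "hom_induced p ?TV (topspace T \<times> (?V - {?pt})) ?C ?D ?h
    : iso (RHG p ?TV (topspace T \<times> (?V - {?pt}))) (RHG p ?C ?D)"
   using hm by (intro homeomorphic_map_relative_homology_iso) (auto simp: homeomorphic_maps_map)
  hence 2: "RHG p ?TV (topspace T \<times> (?V - {?pt})) \<cong> RHG p ?C ?D"
   by (rule is_isoI)
  have 3: "RHG p ?C ?D \<cong> HG (p - 2 * int (card K)) T"
   using relative_homology_coords[OF insert(1), of "p - 2 * int (card K)" T] by simp
  show ?thesis
   using 1 2 3 by (meson group.iso_sym group_relative_homology_group iso_trans)
 qed
 have oddR: "trivial_group (RHG p ?X ?S)" if "odd p" for p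
  using T that isomorphic_group_triviality[OF rel] by (auto simp: even_hom_def)
 have oddX: "trivial_group (HG p ?X)" if "odd p" for p
 proof -
  have "trivial_group (HG p (subtopology ?X ?S))"
   using oddU[OF that] by (simp only: TU)
  hence inj: "inj_on (hom_induced p ?X {} ?X ?S id) (carrier (HG p ?X))"
   using homology_exactness_axiom_3 exact_seq_trivial_inj by blast
  have "hom_induced p ?X {} ?X ?S id x = \<one>\<^bsub>RHG p ?X ?S\<^esub>" for x
   using oddR[OF that] hom_induced_carrier[of p ?X "{}" ?X ?S id x] by (simp add: trivial_group_def)
  hence "x = \<one>\<^bsub>HG p ?X\<^esub>" if "x : carrier (HG p ?X)" for x
   using inj that by (auto simp: inj_on_def group.is_monoid)
  thus ?thesis by (auto simp: trivial_group_def group.is_monoid)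
 qed
 obtain k where k: "k : K" using insert by auto
 have "pr (unit k) : points K" using k unit_in unit_nonzero by (simp add: pr_in_points)
 hence kU: "pr (unit k) : ?U" "pr (unit k) : ?P" using sh(6) by auto
 \<comment> \<open>A constant section that avoids the removed point, so it passes through
   \<open>?TU\<close>, as \<open>kernel_attach\<close> requires.\<close>
 define sec where "sec = (%t :: 'a. (t, pr (unit k)))"
 have sec: "continuous_map T ?TU sec" "continuous_map T ?X sec"
  using kU by (auto simp: continuous_map_paired sec_def)
 have inclU: "continuous_map ?TU ?X id"
  using TU continuous_map_from_subtopology[OF continuous_map_id, of ?X ?S] by simp
 have evenX: "free_rank (kgroup (HG p ?X) (HG p T) (hom_induced p ?X {} T {} fst))
   ((\<Sum>j = 1..<card K. b (p - 2 * int j)) + b (p - 2 * int (card K)))" if p: "even p" for p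
 proof (rule kernel_attach[where U = "HG p ?TU" and R = "RHG p ?X ?S" and i = "hom_induced p ?TU {} ?X {} id"
    and j = "hom_induced p ?X {} ?X ?S id" and s = "hom_induced p T {} ?TU {} sec"])
  show "inj_on (hom_induced p ?TU {} ?X {} id) (carrier (HG p ?TU))"
   using exact_seq_trivial_inj[OF homology_exactness_axiom_2[of "p + 1" ?X ?S] oddR] p by (simp add: TU)
  show "hom_induced p ?X {} ?X ?S id ` carrier (HG p ?X) = carrier (RHG p ?X ?S)"
   using exact_seq_trivial_surj[OF homology_exactness_axiom_1[of p ?X ?S]] oddU[of "p - 1"] p by (simp add: TU)
  show "hom_induced p ?TU {} ?X {} id ` carrier (HG p ?TU) = kernel (HG p ?X) (RHG p ?X ?S) (hom_induced p ?X {} ?X ?S id)"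
   using homology_exactness_axiom_3[of p ?X ?S] by (simp add: TU)
  have comp: "fst o (id o sec) = id" by (auto simp: sec_def)
  show "hom_induced p ?X {} T {} fst (hom_induced p ?TU {} ?X {} id (hom_induced p T {} ?TU {} sec t)) = t"
   if "t : carrier (HG p T)" for t
  proof -
   have "hom_induced p ?TU {} ?X {} id (hom_induced p T {} ?TU {} sec t) = hom_induced p T {} ?X {} sec t"
    using hom_induced_compose'[OF sec(1) _ inclU, of "{}" "{}" "{}" p t] by simp
   moreover have "fst o sec = id" by (auto simp: sec_def)
   hence "hom_induced p ?X {} T {} fst (hom_induced p T {} ?X {} sec t) = t"
    using hom_induced_compose'[OF sec(2) _ fstX, of "{}" "{}" "{}" p t] that by (simp add: hom_induced_id)
   ultimately show ?thesis by simp
  qed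
  have "hom_induced p ?X {} T {} fst o hom_induced p ?TU {} ?X {} id = hom_induced p ?TU {} T {} fst"
   using hom_induced_compose[OF inclU _ fstX, of "{}" "{}" "{}" p] by simp
  thus "free_rank (kgroup (HG p ?TU) (HG p T) (hom_induced p ?X {} T {} fst o hom_induced p ?TU {} ?X {} id))
    (\<Sum>j = 1..<card K. b (p - 2 * int j))"
   using kerU[OF p] by simp
  show "free_rank (RHG p ?X ?S) (b (p - 2 * int (card K)))"
  proof (rule free_rank_is_iso)
   show "free_rank (HG (p - 2 * int (card K)) T) (b (p - 2 * int (card K)))"
    using T p by (simp add: even_hom_def)
   show "HG (p - 2 * int (card K)) T \<cong> RHG p ?X ?S"
    using rel[of p] by (simp add: group.iso_sym)
  qed simp
 qed (simp_all add: hom_induced_hom)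
 have cK: "card K > 0" using insert by (simp add: card_gt_0_iff)
 have "retraction_map ?X T fst"
  using sec(2) fstX by (auto simp: retraction_map_def retraction_maps_def sec_def)
 thus ?case
  using evenX oddX insert by (auto simp: even_fibration_def)
qed

end

section \<open>Flats of the braid arrangement\<close>

text \<open>A partition of \<open>I\<close> is encoded by the map sending each element to the minimum of its block;
 \<open>p o s = p\<close> says that \<open>s\<close> is finer than \<open>p\<close>.\<close>

definition flats :: "nat set => (nat => nat) set" where
 "flats I = {r. (ALL i. r (r i) = r i) & (ALL i. r i <= i) & (\<forall>i\<in>I. r i : I) & (ALL i. i ~: I --> r i = i)}"

definition pflats :: "nat set => (nat => nat) set" where
 "pflats I = flats I - {id}"

text \<open>The elements that are not the minimum of their block. Their number is the rank of the
  flat, and they index the coordinates of the corresponding quotient space.\<close>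

definition moved :: "(nat => nat) => nat set" where
 "moved r = {j. r j ~= j}"

definition min_rep :: "nat rel => nat => nat" where
 "min_rep R i = (LEAST j. (i, j) : (R Un R\<inverse>)\<^sup>*)"

lemma flatsD:
 assumes "r : flats I"
 shows "r (r i) = r i" "r i <= i" "i : I ==> r i : I" "i ~: I ==> r i = i" "r o r = r"
 using assms by (auto simp: flats_def)

lemma id_in_flats: "id : flats I"
 by (simp add: flats_def)

lemma moved_subset: "r : flats I ==> moved r \<subseteq> I"
 by (auto simp: moved_def flats_def)

lemma moved_empty_iff: "moved r = {} \<longleftrightarrow> r = id"
 by (auto simp: moved_def)

lemma finite_flats:
 assumes "finite I"
 shows "finite (flats I)"
proof -
 have "inj_on (%r. restrict r I) (flats I)"
  by (rule inj_onI) (auto simp: flats_def fun_eq_iff restrict_def split: if_splits, metis)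
 moreover have "(%r. restrict r I) ` flats I \<subseteq> I \<rightarrow>\<^sub>E I"
  by (auto simp: flats_def)
 ultimately show ?thesis
  using finite_PiE[OF assms, of "%_. I"] assms by (metis finite_imageD finite_subset)
qed

lemma card_moved:
 assumes "r : flats I" "finite I"
 shows "card (moved r) + card (r ` I) = card I"
proof -
 have "r ` I = {i : I. r i = i}"
  using flatsD[OF assms(1)] by (auto simp: image_iff) metis
 moreover have "moved r = {i : I. r i ~= i}"
  using moved_subset[OF assms(1)] by (auto simp: moved_def)
 ultimately have "moved r Un r ` I = I" "moved r Int r ` I = {}" by auto
 thus ?thesis
  using assms(2) card_Un_disjoint[of "moved r" "r ` I"] by (metis finite_Un)
qed

lemma min_rep_in: "(i, min_rep R i) : (R Un R\<inverse>)\<^sup>*"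
 unfolding min_rep_def by (rule LeastI[of _ i]) simp

lemma min_rep_le: "(i, j) : (R Un R\<inverse>)\<^sup>* ==> min_rep R i <= j"
 unfolding min_rep_def by (rule Least_le)

lemma sym_rtrancl_closure: "(i, j) : (R Un R\<inverse>)\<^sup>* ==> (j, i) : (R Un R\<inverse>)\<^sup>*"
 by (metis converse_Un converse_converse rtrancl_converseI sup_commute)

lemma min_rep_eq:
 assumes "(i, j) : (R Un R\<inverse>)\<^sup>*"
 shows "min_rep R i = min_rep R j"
 by (meson assms min_rep_in min_rep_le le_antisym rtrancl_trans sym_rtrancl_closure)

lemma min_rep_eq_iff: "min_rep R i = min_rep R j \<longleftrightarrow> (i, j) : (R Un R\<inverse>)\<^sup>*"
 by (metis min_rep_eq min_rep_in rtrancl_trans sym_rtrancl_closure)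

lemma min_rep_flat:
 assumes "R \<subseteq> I \<times> I Un Id"
 shows "min_rep R : flats I"
proof -
 have *: "i : I \<longleftrightarrow> j : I" "i ~: I ==> j = i" if "(i, j) : (R Un R\<inverse>)\<^sup>*" for i j
  using that assms by (induct rule: rtrancl_induct) auto
 show ?thesis
  unfolding flats_def
  using min_rep_in[of _ R] min_rep_le[of _ _ R] min_rep_eq[of _ _ R] *
  by (auto, metis, blast+)
qed

lemma invariant_min_rep:
 assumes "!!i j. (i, j) : R ==> x i = x j"
 shows "x (min_rep R i) = x i"
proof -
 have "x i = x j" if "(i, j) : (R Un R\<inverse>)\<^sup>*" for j
  using that by (induct rule: rtrancl_induct) (use assms in auto)
 thus ?thesis using min_rep_in by metis
qed

text \<open>The finest common coarsening of two flats. The least upper bound property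
  \<open>join_least\<close> is stated for arbitrary functions, so it also says that a vector
  constant on the blocks of \<open>p\<close> and of \<open>b\<close> is constant on those of the
  join.\<close>

definition join :: "(nat => nat) => (nat => nat) => nat => nat" where
 "join p b = min_rep ({(i, p i) | i. True} Un {(i, b i) | i. True})"

lemma join_flat:
 assumes "p : flats I" "b : flats I"
 shows "join p b : flats I"
 unfolding join_def using assms by (intro min_rep_flat) (auto simp: flats_def)

lemma join_coarser: "join p b o p = join p b" "join p b o b = join p b"
proof -
 have "join p b (p i) = join p b i" "join p b (b i) = join p b i" for i
  unfolding join_def by (rule min_rep_eq[symmetric], rule r_into_rtrancl, blast)+
 thus "join p b o p = join p b" "join p b o b = join p b" by auto
qed

lemma join_least:
 assumes "x o p = x" "x o b = x"
 shows "x o join p b = x"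
proof
 fix i
 have "x (p i) = x i" "x (b i) = x i" for i
  using assms by (simp_all add: fun_eq_iff)
 thus "(x o join p b) i = x i"
  unfolding join_def o_def by (intro invariant_min_rep) auto
qed

lemma finer_antisym:
 assumes "p : flats I" "s : flats I" "p o s = p" "s o p = s"
 shows "p = s"
proof
 fix i
 have "p (s i) = p i" "s (p i) = s i" using assms by (simp_all add: fun_eq_iff)
 thus "p i = s i" using assms(1,2) by (metis flatsD(2) le_antisym)
qed

text \<open>If \<open>j\<close> is the minimum of its block in the coarser flat, then
  \<open>b j\<close>, which lies in that block and is at most \<open>j\<close>, must be
  \<open>j\<close>.\<close>

lemma coarser_fixed:
 assumes "p : flats I" "b : flats I" "p o b = p" "p j = j"
 shows "b j = j"
proof -
 have "p (b j) = j" using assms by (simp add: fun_eq_iff)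
 thus ?thesis using assms(1,2) by (metis flatsD(2) le_antisym)
qed

lemma coarser_comp:
 assumes "p : flats I" "b : flats I" "p o b = p"
 shows "b o p = p"
 using coarser_fixed[OF assms] flatsD(1)[OF assms(1)] by auto

lemma join_absorb:
 assumes "p : flats I" "b : flats I" "p o b = p"
 shows "join p b = p"
 by (rule finer_antisym[OF join_flat[OF assms(1,2)] assms(1) join_coarser(1) join_least[OF flatsD(5)[OF assms(1)] assms(3)]])

lemma finer_trans: "t o p = t ==> p o s = p ==> t o s = t"
 by (metis comp_assoc)

definition top_flat :: "nat set => nat => nat" where
 "top_flat I = (%i. if i : I then Min I else i)"

lemma top_flat_in: "finite I ==> top_flat I : flats I"
 by (auto simp: top_flat_def flats_def intro: Min_in)

lemma top_flat_coarser: "r : flats I ==> top_flat I o r = top_flat I"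
 by (auto simp: top_flat_def flats_def)

lemma moved_top_flat: "finite I ==> moved (top_flat I) = I - {Min I}"
 by (auto simp: moved_def top_flat_def)

section \<open>Differences along a flat\<close>

text \<open>The quotient by the vectors constant on the blocks of \<open>r\<close>, realised as a
  projection onto the coordinates in \<open>moved r\<close>; the coordinates at block minima become
  zero.\<close>

definition along :: "(nat => nat) => cvec => cvec" where
 "along r x = (%i. x i - x (r i))"

lemma homogeneous_along: "homogeneous (along r)"
 by (auto simp: homogeneous_def along_def vscale_def algebra_simps)

lemma along_vscale: "along r (vscale c x) = vscale c (along r x)"
 using homogeneous_along by (simp add: homogeneous_def)

lemma along_in: "along r x : coords (moved r)"
 by (auto simp: along_def coords_def moved_def)

lemma along_zero_iff: "along r x = zvec \<longleftrightarrow> x o r = x"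
 by (auto simp: along_def fun_eq_iff)

lemma along_along: "p o s = p ==> along s (along p x) = along s x"
 by (auto simp: along_def fun_eq_iff)

lemma along_self:
 assumes "r : flats I" "x : coords (moved r)"
 shows "along r x = x"
 using assms by (auto simp: along_def coords_def moved_def flats_def)

lemma nonzero_not_invariant:
 assumes "r : flats I" "x : coords (moved r)" "x ~= zvec"
 shows "x o r ~= x"
 using assms along_self along_zero_iff by metis

section \<open>Wonderful models by incidence conditions\<close>

type_synonym model_point = "cvec \<times> ((nat => nat) => cmat)"

context projective begin

text \<open>Homogeneous coordinates of a point of the model of the family \<open>S\<close> of flats of \<open>I\<close>: a vector \<open>v\<close> of the
 ambient space and, for each flat, a representative of a line in the corresponding quotient.\<close>

definition config :: "nat set => (nat => nat) set => cvec => ((nat => nat) => cvec) => bool" where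
 "config I S v X \<longleftrightarrow> v : coords (moved (top_flat I)) \<and>
  (\<forall>p\<in>S. X p : coords (moved p) & X p ~= zvec & (EX c. along p v = vscale c (X p))) \<and>
  (\<forall>p\<in>S. \<forall>s\<in>S. p o s = p --> (EX c. along s (X p) = vscale c (X s)))"

text \<open>The zero matrix outside \<open>S\<close> makes a point of the model determined by its
  vector and its lines.\<close>

definition lines_of :: "(nat => nat) set => ((nat => nat) => cvec) => (nat => nat) => cmat" where
 "lines_of S X = (%p. if p : S then pr (X p) else (%_. zvec))"

definition model :: "nat set => (nat => nat) set => model_point set" where
 "model I S = {(v, lines_of S X) | v X. config I S v X}"

lemma configD:
 assumes "config I S v X"
 shows "v : coords (moved (top_flat I))"
  and "p : S ==> X p : coords (moved p)" "p : S ==> X p ~= zvec"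
  and "p : S ==> EX c. along p v = vscale c (X p)"
  and "p : S ==> s : S ==> p o s = p ==> EX c. along s (X p) = vscale c (X s)"
 using assms by (auto simp: config_def)

definition coarser_cl :: "nat set => (nat => nat) set => bool" where
 "coarser_cl I S \<longleftrightarrow> S \<subseteq> pflats I & (\<forall>p\<in>S. \<forall>t\<in>flats I. t o p = t --> t : S)"

end

text \<open>The setting of one blow-up. \<open>S\<close> is closed under coarsening and already
  contains all flats strictly coarser than \<open>b\<close>, hence none finer than \<open>b\<close>;
  so the line at \<open>b\<close> is constrained only by \<open>v\<close> and by the lines of
  coarser flats.\<close>

locale adjoin_flat = projective +
 fixes I :: "nat set" and S :: "(nat => nat) set" and b :: "nat => nat"
 assumes I: "I \<subseteq> {..<N}" "I ~= {}"
  and S: "coarser_cl I S"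
  and b: "b : pflats I" "b ~: S"
  and Sb: "!!t. t : flats I ==> t o b = t ==> t ~= b ==> t : S"
begin

lemma finI: "finite I" using I finite_subset by auto

lemma bF: "b : flats I" using b by (simp add: pflats_def)

lemma SF: "p : S ==> p : flats I" "p : S ==> p ~= id"
 using S by (auto simp: coarser_cl_def pflats_def)

lemma finS: "finite S"
 using finite_subset[OF _ finite_flats[OF finI]] SF by auto

lemma up: "p : S ==> t : flats I ==> t o p = t ==> t : S"
 using S by (auto simp: coarser_cl_def)

lemma not_finer: "s : S ==> b o s ~= b"
 using up[of s b] bF b(2) by blast

lemma movedN: "p : flats I ==> moved p \<subseteq> {..<N}"
 using moved_subset I by blast

abbreviation J where "J \<equiv> %p. join p b"

lemma J_S: "p : S ==> J p : S"
 using up[of p "J p"] join_flat[OF SF(1) bF] join_coarser by blast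

lemma J_F: "p : S ==> J p : flats I"
 using J_S SF by blast

lemma J_b: "J p o b = J p" and J_p: "J p o p = J p"
 by (rule join_coarser)+

lemma J_mono: "p o s = p ==> J p o J s = J p"
 by (rule join_least) (use finer_trans[OF J_p, of p s] J_b in auto)

lemma J_absorb: "p : S ==> p o b = p ==> J p = p"
 using join_absorb[OF SF(1) bF] by blast

definition contract :: "real => cvec => cvec" where
 "contract s x = (%i. x (b i) + of_real s * (x i - x (b i)))"

lemma contract_vscale: "contract s (vscale c x) = vscale c (contract s x)"
 by (auto simp: contract_def vscale_def algebra_simps)

lemma contract_1 [simp]: "contract 1 x = x"
 by (simp add: contract_def)

lemma bb: "b (b i) = b i" using flatsD(1)[OF bF] .

lemma diff_b_contract: "along b (contract s x) = vscale (of_real s) (along b x)"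
 by (auto simp: contract_def along_def vscale_def bb)

lemma contract_fixed: "along b x = zvec ==> contract s x = x"
 by (auto simp: along_def contract_def fun_eq_iff)

text \<open>For flats that are not coarser than \<open>b\<close>, \<open>along t\<close> and the
  contraction need not commute, which is why \<open>moved_config\<close> passes through
  \<open>J p\<close>.\<close>

lemma contract_commute:
 assumes "t : flats I" "t o b = t"
 shows "along t (contract s x) = contract s (along t x)"
proof -
 have "b (t i) = t i" "t (b i) = t i" for i
  using coarser_comp[OF assms(1) bF assms(2)] assms(2) by (simp_all add: fun_eq_iff)
 thus ?thesis
  by (auto simp: along_def contract_def)
qed

text \<open>\<open>J p\<close> is coarser than \<open>b\<close>, so the vector there can be
  contracted; the line at \<open>p\<close> is taken to be the image of the result. The line at
  \<open>b\<close> is kept, because the contraction acts on the image along \<open>b\<close> by a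
  scalar.\<close>

definition moved_config :: "real => ((nat => nat) => cvec) => (nat => nat) => cvec" where
 "moved_config s X p = (if p : S then along p (contract s (X (J p))) else X p)"

text \<open>By \<open>contract_sum\<close>, the new vector at \<open>p\<close> is a fixed part plus
  \<open>s\<close> times a normal part. The strict inequality of norms keeps this sum nonzero for
  all \<open>s\<close> up to 1, and it is an open condition.\<close>

definition near :: "((nat => nat) => cvec) => bool" where
 "near X \<longleftrightarrow> (\<forall>p\<in>S. sqnorm (along p (along b (X (J p)))) < sqnorm (along p (X (J p) o b)))"

lemma contract_sum:
 "along p (contract s x) = (%i. along p (x o b) i + of_real s * along p (along b x) i)"
 by (auto simp: along_def contract_def algebra_simps)

lemma near_nonzero:
 assumes "near X" "p : S" "s : {0..1}"
 shows "along p (contract s (X (J p))) ~= zvec"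
proof
 let ?x = "X (J p)"
 assume 0: "along p (contract s ?x) = zvec"
 have "along p (?x o b) = vscale (- of_real s) (along p (along b ?x))"
 proof
  fix i
  show "along p (?x o b) i = vscale (- of_real s) (along p (along b ?x)) i"
   using fun_cong[OF 0, of i] unfolding contract_sum by (simp add: vscale_def eq_neg_iff_add_eq_0)
 qed
 hence "sqnorm (along p (?x o b)) = s\<^sup>2 * sqnorm (along p (along b ?x))"
  by (simp add: sqnorm_vscale)
 also have "... <= 1 * sqnorm (along p (along b ?x))"
  using assms(3) by (intro mult_right_mono sqnorm_nonneg) (auto simp: power_le_one)
 finally show False
  using assms(1,2) by (auto simp: near_def)
qed

text \<open>Contraction leaves the fixed part unchanged and multiplies the normal part by
  \<open>s\<close>.\<close>

lemma near_moved:
 assumes "near X" "s : {0..1}"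
 shows "near (moved_config s X)"
 unfolding near_def
proof
 fix p assume p: "p : S"
 let ?x = "X (J p)"
 have X': "moved_config s X (J p) = along (J p) (contract s ?x)"
  using J_S[OF p] J_absorb[OF J_S[OF p] J_b] by (simp add: moved_config_def)
 have a: "along p (moved_config s X (J p) o b) = along p (?x o b)"
 proof -
  have "b (J p i) = J p i" "J p (b i) = J p i" "J p (p i) = J p i" for i
   using coarser_comp[OF J_F[OF p] bF J_b] J_b[of p] J_p[of p] by (simp_all add: fun_eq_iff)
  thus ?thesis
   unfolding X' by (auto simp: along_def contract_def bb)
 qed
 have "along p (along b (moved_config s X (J p))) = vscale (of_real s) (along p (along b ?x))"
  unfolding X' by (simp add: along_along[OF J_b] diff_b_contract along_vscale)
 hence "sqnorm (along p (along b (moved_config s X (J p)))) = s\<^sup>2 * sqnorm (along p (along b ?x))"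
  by (simp add: sqnorm_vscale)
 also have "... <= 1 * sqnorm (along p (along b ?x))"
  using assms(2) by (intro mult_right_mono sqnorm_nonneg) (auto simp: power_le_one)
 finally show "sqnorm (along p (along b (moved_config s X (J p)))) < sqnorm (along p (moved_config s X (J p) o b))"
  using assms(1) p unfolding near_def a by force
qed

text \<open>The two cases of \<open>S'\<close> are the model before and after the blow-up. Treating
  them together yields one flow for the center and for its preimage.\<close>

lemma config_moved:
 assumes X: "config I S' v X" and S': "S' = S | S' = insert b S" and n: "near X" and s: "s : {0..1}"
 shows "config I S' (contract s v) (moved_config s X)"
proof -
 have SS: "S \<subseteq> S'" using S' by auto
 have topb: "top_flat I o b = top_flat I" by (rule top_flat_coarser[OF bF])
 have vtop: "along (top_flat I) (contract s v) = contract s v"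
  using contract_commute[OF top_flat_in[OF finI] topb] along_self[OF top_flat_in[OF finI] configD(1)[OF X]] by simp
 hence v: "contract s v : coords (moved (top_flat I))"
  using along_in by metis
 have mb: "moved_config s X b = X b" using b(2) by (simp add: moved_config_def)
 \<comment> \<open>The common form of the incidences with target \<open>\<sigma>\<close> in
   \<open>S\<close>: a vector whose image lies in the line at \<open>J \<sigma>\<close> has, after
   contraction, its image in the new line at \<open>\<sigma>\<close>. It is applied to
   \<open>v\<close> and to the vectors at \<open>J p\<close>.\<close>
 have key: "EX c. along \<sigma> (contract s y) = vscale c (moved_config s X \<sigma>)"
  if \<sigma>: "\<sigma> : S" and y: "EX c. along (J \<sigma>) y = vscale c (X (J \<sigma>))" for \<sigma> y
 proof -
  from y obtain c where c: "along (J \<sigma>) y = vscale c (X (J \<sigma>))" by auto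
  have "along \<sigma> (contract s y) = along \<sigma> (along (J \<sigma>) (contract s y))"
   by (rule along_along[OF J_p, symmetric])
  also have "... = vscale c (along \<sigma> (contract s (X (J \<sigma>))))"
   by (simp add: contract_commute[OF J_F[OF \<sigma>] J_b] c contract_vscale along_vscale)
  finally show ?thesis using \<sigma> by (auto simp: moved_config_def)
 qed
 have keyb: "EX c. along b (contract s y) = vscale c (X b)" if "EX c. along b y = vscale c (X b)" for y
  using that by (auto simp: diff_b_contract)
 have 1: "moved_config s X p : coords (moved p) & moved_config s X p ~= zvec \<and>
   (EX c. along p (contract s v) = vscale c (moved_config s X p))" if p: "p : S'" for p
 proof (cases "p : S")
  case True
  thus ?thesis
   using near_nonzero[OF n True s] along_in[of p] key[OF True configD(4)[OF X]] J_S[OF True] SS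
   by (auto simp: moved_config_def)
 next
  case False
  hence "p = b" using p S' by auto
  thus ?thesis using configD[OF X] p keyb mb by metis
 qed
 have 2: "EX c. along \<sigma> (moved_config s X p) = vscale c (moved_config s X \<sigma>)"
  if p: "p : S'" and \<sigma>: "\<sigma> : S'" and le: "p o \<sigma> = p" for p \<sigma>
 proof (cases "p : S")
  case True
  have eq: "along \<sigma> (moved_config s X p) = along \<sigma> (contract s (X (J p)))"
   using True le by (simp add: moved_config_def along_along)
  show ?thesis
  proof (cases "\<sigma> : S")
   case \<sigma>S: True
   show ?thesis unfolding eq
    using configD(5)[OF X _ _ J_mono[OF le]] J_S[OF True] J_S[OF \<sigma>S] SS by (intro key \<sigma>S) auto
  next
   case False
   hence \<sigma>b: "\<sigma> = b" using \<sigma> S' by auto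
   thus ?thesis unfolding eq
    using configD(5)[OF X _ _ J_b] J_S[OF True] SS \<sigma> mb by (auto intro!: keyb)
  qed
 next
  case False
  hence pb: "p = b" using p S' by auto
  hence "\<sigma> = b" using not_finer le \<sigma> S' by auto
  thus ?thesis
   using mb along_self[OF bF] configD(2)[OF X] p pb by (intro exI[of _ 1]) simp
 qed
 show ?thesis unfolding config_def using v 1 2 by blast
qed

end

context projective begin

lemma oncols_pr_zero_iff:
 assumes "homogeneous L" "sqnorm x > 0"
 shows "oncols L (pr x) = (%_. zvec) \<longleftrightarrow> L x = zvec"
proof
 assume 0: "oncols L (pr x) = (%_. zvec)"
 have "x ~= zvec" using assms(2) by auto
 then obtain k where k: "x k ~= 0" by auto
 have "L x i * cnj (x k) / of_real (sqnorm x) = 0" for i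
  using fun_cong[OF fun_cong[OF 0, of i], of k] assms by (simp add: oncols_pr)
 thus "L x = zvec" using k assms by auto
qed (use assms in \<open>auto simp: oncols_pr\<close>)

lemma homogeneous_reindex: "homogeneous (%x. x o r)"
 by (auto simp: homogeneous_def vscale_def)

lemma cont_snd_matrix:
 fixes p :: "nat => nat"
 assumes "continuous_on A (f :: 'b :: topological_space => model_point)"
 shows "continuous_on A (%z. snd (f z) p i k)"
 by (rule cont_matrixD[OF continuous_on_coordD[OF continuous_on_snd[OF assms]]])

lemma cont_fst_coord:
 assumes "continuous_on A (f :: 'b :: topological_space => model_point)"
 shows "continuous_on A (%z. fst (f z) i)"
 by (rule continuous_on_coordD[OF continuous_on_fst[OF assms]])

end

section \<open>Center, neighbourhood and flow\<close>

context adjoin_flat begin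

definition forget :: "model_point => model_point" where
 "forget z = (fst z, (snd z)(b := (%_. zvec)))"

text \<open>The locus where nothing determines the line at \<open>b\<close>: \<open>v\<close> and
  the lines of all coarser flats have zero image along \<open>b\<close>.\<close>

definition center :: "model_point set" where
 "center = {z : model I S. along b (fst z) = zvec \<and>
   (\<forall>p\<in>S. p o b = p --> oncols (along b) (snd z p) = (%_. zvec))}"

text \<open>The condition \<open>near\<close> in terms of projectors, and so independent of the
  chosen representatives; \<open>nbhd_config\<close> makes the link.\<close>

definition nbhd :: "model_point set" where
 "nbhd = {z : model I S. \<forall>p\<in>S. msqnorm (oncols (%x. along p (along b x)) (snd z (J p)))
   < msqnorm (oncols (%x. along p (x o b)) (snd z (J p)))}"

definition flow :: "real => model_point => model_point" where
 "flow s z = (contract s (fst z),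
   %p. if p : S then act (%x. along p (contract s x)) (snd z (J p)) else snd z p)"

lemma forget_lines: "S' = S | S' = insert b S ==> forget (v, lines_of S' X) = (v, lines_of S X)"
 using b(2) by (auto simp: forget_def lines_of_def)

lemma config_mono: "config I S' v X ==> S \<subseteq> S' ==> config I S v X"
 unfolding config_def by blast

lemma config_pos:
 assumes "config I S' v X" "p : S'" "S' = S | S' = insert b S"
 shows "sqnorm (X p) > 0"
proof -
 have "p : flats I" using assms(2,3) SF bF by auto
 thus ?thesis
  using sqnorm_pos[OF configD(2)[OF assms(1,2)] movedN configD(3)[OF assms(1,2)]] by simp
qed

lemma center_config:
 assumes "config I S v X"
 shows "(v, lines_of S X) : center \<longleftrightarrow> along b v = zvec & (\<forall>p\<in>S. p o b = p --> along b (X p) = zvec)"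
 using assms config_pos[OF assms]
 by (auto simp: center_def model_def lines_of_def oncols_pr_zero_iff homogeneous_along)

lemma homogeneous_maps:
 "homogeneous (%x. along p (along b x))" "homogeneous (%x. along p (x o b))"
 "homogeneous (%x. along p (contract s x))"
 using homogeneous_along[of p] homogeneous_along[of b] homogeneous_reindex[of b] contract_vscale
 by (simp_all add: homogeneous_def)

lemma nbhd_config:
 assumes "config I S v X"
 shows "(v, lines_of S X) : nbhd \<longleftrightarrow> near X"
proof -
 have "msqnorm (oncols (%x. along p (along b x)) (lines_of S X (J p)))
   < msqnorm (oncols (%x. along p (x o b)) (lines_of S X (J p))) \<longleftrightarrow>
   sqnorm (along p (along b (X (J p)))) < sqnorm (along p (X (J p) o b))" if p: "p : S" for p
 proof -
  have pos: "sqnorm (X (J p)) > 0"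
   using config_pos[OF assms J_S[OF p]] by simp
  thus ?thesis
   using J_S[OF p] by (simp add: lines_of_def msqnorm_oncols homogeneous_maps divide_less_cancel)
 qed
 thus ?thesis
  using assms by (auto simp: nbhd_def model_def near_def)
qed

lemma flow_config:
 assumes X: "config I S' v X" and S': "S' = S | S' = insert b S"
 shows "flow s (v, lines_of S' X) = (contract s v, lines_of S' (moved_config s X))"
proof -
 have "sqnorm (X (J p)) > 0" if "p : S" for p
  using config_pos[OF X _ S'] J_S[OF that] S' by auto
 thus ?thesis
  using S' J_S by (auto simp: flow_def lines_of_def moved_config_def act_pr homogeneous_maps)
qed

text \<open>For \<open>S' = S\<close> this is the center, for \<open>S' = insert b S\<close> its
  preimage under the blow-down map \<open>forget\<close>.\<close>

definition center_over :: "(nat => nat) set => model_point set" where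
 "center_over S' = {z : model I S'. forget z : center}"

definition nbhd_over :: "(nat => nat) set => model_point set" where
 "nbhd_over S' = {z : model I S'. forget z : nbhd}"

lemma nbhd_overE:
 assumes "z : nbhd_over S'" "S' = S | S' = insert b S"
 obtains v X where "z = (v, lines_of S' X)" "config I S' v X" "near X"
proof -
 obtain v X where "z = (v, lines_of S' X)" "config I S' v X"
  using assms(1) by (auto simp: nbhd_over_def model_def)
 moreover have "config I S v X" using calculation(2) assms(2) config_mono by blast
 ultimately show ?thesis
  using that assms forget_lines[OF assms(2)] nbhd_config by (auto simp: nbhd_over_def)
qed

lemma nbhd_overI:
 assumes "config I S' v X" "near X" "S' = S | S' = insert b S"
 shows "(v, lines_of S' X) : nbhd_over S'"
 using assms config_mono[OF assms(1)] nbhd_config[of v X]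
 by (auto simp: nbhd_over_def forget_lines model_def)

lemma center_overE:
 assumes "z : center_over S'" "S' = S | S' = insert b S"
 obtains v X where "z = (v, lines_of S' X)" "config I S' v X" "along b v = zvec"
  "!!p. p : S ==> p o b = p ==> along b (X p) = zvec"
proof -
 obtain v X where z: "z = (v, lines_of S' X)" "config I S' v X"
  using assms(1) by (auto simp: center_over_def model_def)
 moreover have "config I S v X" using z(2) assms(2) config_mono by blast
 ultimately show ?thesis
  using that assms forget_lines[OF assms(2)] center_config by (auto simp: center_over_def)
qed

lemma center_overI:
 assumes "config I S' v X" "along b v = zvec" "!!p. p : S ==> p o b = p ==> along b (X p) = zvec"
  "S' = S | S' = insert b S"
 shows "(v, lines_of S' X) : center_over S'"
 using assms config_mono[OF assms(1)] center_config[of v X]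
 by (auto simp: center_over_def forget_lines model_def)

text \<open>On the center the normal part is zero, so the fixed part has to be nonzero. Otherwise
  the vector at \<open>J p\<close> would be constant on the blocks of \<open>p\<close> and of
  \<open>b\<close>, hence on those of their join, which a nonzero representative excludes.\<close>

lemma center_near:
 assumes X: "config I S v X" and 0: "!!p. p : S ==> p o b = p ==> along b (X p) = zvec"
 shows "near X"
 unfolding near_def
proof
 fix p assume p: "p : S"
 let ?x = "X (J p)"
 have x: "along b ?x = zvec" by (rule 0[OF J_S[OF p] J_b])
 hence xb: "?x o b = ?x" by (simp add: along_zero_iff)
 have "along p ?x ~= zvec"
 proof
  assume "along p ?x = zvec"
  hence "?x o J p = ?x" by (intro join_least xb) (simp add: along_zero_iff)
  thus False
   using nonzero_not_invariant[OF J_F[OF p]] configD(2,3)[OF X J_S[OF p]] by blast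
 qed
 hence "sqnorm (along p ?x) > 0"
  using sqnorm_pos[OF along_in movedN[OF SF(1)[OF p]]] by blast
 thus "sqnorm (along p (along b ?x)) < sqnorm (along p (?x o b))"
  unfolding x xb by (simp add: along_def)
qed

lemma center_over_subset: "S' = S | S' = insert b S ==> center_over S' \<subseteq> nbhd_over S'"
 by (metis center_near center_overE config_mono nbhd_overI subsetI subset_insertI)

lemma flow_nbhd:
 assumes "z : nbhd_over S'" "S' = S | S' = insert b S" "s : {0..1}"
 shows "flow s z : nbhd_over S'"
 using assms by (metis config_moved flow_config nbhd_overE nbhd_overI near_moved)

lemma flow_0:
 assumes "z : nbhd_over S'" and S': "S' = S | S' = insert b S"
 shows "flow 0 z : center_over S'"
proof -
 obtain v X where z: "z = (v, lines_of S' X)" "config I S' v X" "near X"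
  using assms by (rule nbhd_overE)
 have "along b (moved_config 0 X p) = zvec" if "p : S" "p o b = p" for p
  using that diff_b_contract[of 0] by (simp add: moved_config_def along_along)
 moreover have "along b (contract 0 v) = zvec"
  using diff_b_contract[of 0] by simp
 ultimately show ?thesis
  unfolding z(1) flow_config[OF z(2) S'] using config_moved[OF z(2) S' z(3), of 0] by (intro center_overI S') auto
qed

text \<open>Incidence determines the line at \<open>p\<close> from the line at \<open>J p\<close>,
  because \<open>near\<close> makes the image vector nonzero.\<close>

lemma flow_fixed:
 assumes X: "config I S' v X" and S': "S' = S | S' = insert b S" and n: "near X"
  and v: "contract s v = v" and XJ: "!!p. p : S ==> contract s (X (J p)) = X (J p)"
 shows "flow s (v, lines_of S' X) = (v, lines_of S' X)"
proof -
 have "pr (moved_config s X p) = pr (X p)" if p: "p : S'" for p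
 proof (cases "p : S")
  case True
  hence m: "moved_config s X p = along p (X (J p))"
   by (simp add: moved_config_def XJ)
  have "J p : S'" using J_S[OF True] S' by auto
  then obtain c where c: "along p (X (J p)) = vscale c (X p)"
   using configD(5)[OF X _ p J_p] by blast
  moreover have "along p (X (J p)) ~= zvec"
   using near_nonzero[OF n True, of 1] by simp
  ultimately show ?thesis unfolding m c by (intro pr_vscale) (auto simp: vscale_def)
 qed (simp add: moved_config_def)
 thus ?thesis
  unfolding flow_config[OF X S'] v by (auto simp: lines_of_def)
qed

lemma flow_1:
 assumes "z : nbhd_over S'" and S': "S' = S | S' = insert b S"
 shows "flow 1 z = z"
 using assms by (metis contract_1 flow_fixed nbhd_overE)

lemma flow_center:
 assumes "z : center_over S'" and S': "S' = S | S' = insert b S"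
 shows "flow s z = z"
proof -
 obtain v X where z: "z = (v, lines_of S' X)" "config I S' v X" "along b v = zvec"
  "!!p. p : S ==> p o b = p ==> along b (X p) = zvec"
  using center_overE[OF assms] by metis
 have "near X" using center_near[OF config_mono[OF z(2)]] z(4) S' by auto
 thus ?thesis
  unfolding z(1) using z S' J_S J_b by (intro flow_fixed) (auto intro: contract_fixed)
qed

lemma continuous_on_flow:
 assumes S': "S' = S | S' = insert b S"
 shows "continuous_on ({0..1} \<times> nbhd_over S') (%(s, z). flow s z)"
proof -
 let ?D = "{0..1::real} \<times> nbhd_over S'"
 have snd: "continuous_on ?D (%w. snd w)" by (rule continuous_on_snd[OF continuous_on_id])
 have s: "continuous_on ?D (%w. complex_of_real (fst w))"
  by (rule continuous_on_of_real[OF continuous_on_fst[OF continuous_on_id]])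
 note m = cont_snd_matrix[OF snd] and v = cont_fst_coord[OF snd]
 have 1: "continuous_on ?D (%w. contract (fst w) (fst (snd w)))"
  unfolding contract_def
  by (rule continuous_on_funI) (intro continuous_on_add continuous_on_mult continuous_on_diff s v)
 have 2: "continuous_on ?D (%w. act (%x. along p (contract (fst w) x)) (snd (snd w) (J p)))" if p: "p : S" for p
  unfolding act_def
 proof (rule continuous_on_normalize)
  fix i j
  show "continuous_on ?D (%w. oncols (%x. along p (contract (fst w) x)) (snd (snd w) (J p)) i j)"
   unfolding oncols_def along_def contract_def
   by (intro continuous_on_add continuous_on_mult continuous_on_diff s m)
 next
  fix w assume w: "w : ?D"
  hence "snd w : nbhd_over S'" by auto
  then obtain v X where z: "snd w = (v, lines_of S' X)" "config I S' v X" "near X"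
   using S' by (rule nbhd_overE)
  have Jp: "J p : S'" using J_S[OF p] S' by auto
  have pos: "sqnorm (X (J p)) > 0" by (rule config_pos[OF z(2) Jp S'])
  have "along p (contract (fst w) (X (J p))) ~= zvec"
   using w by (intro near_nonzero[OF z(3) p]) auto
  hence "sqnorm (along p (contract (fst w) (X (J p)))) > 0"
   using sqnorm_pos[OF along_in movedN[OF SF(1)[OF p]]] by blast
  thus "msqnorm (oncols (%x. along p (contract (fst w) x)) (snd (snd w) (J p))) ~= 0"
   using pos Jp by (simp add: z(1) lines_of_def msqnorm_oncols homogeneous_maps)
 qed
 have 3: "continuous_on ?D (%w. if p : S then act (%x. along p (contract (fst w) x)) (snd (snd w) (J p)) else snd (snd w) p)" for p
  using 2[of p] continuous_on_coordD[OF continuous_on_snd[OF snd], of p] by (cases "p : S") auto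
 have "continuous_on ?D (%w. flow (fst w) (snd w))"
  unfolding flow_def by (rule continuous_on_Pair[OF 1]) (rule continuous_on_funI[OF 3])
 thus ?thesis by (simp add: case_prod_unfold)
qed

text \<open>Within the neighbourhood the flow joins the retraction \<open>flow 0\<close> onto the
  center to the identity \<open>flow 1\<close>, and it fixes the center throughout.\<close>

lemma center_inclusion_iso:
 assumes S': "S' = S | S' = insert b S"
 shows "hom_induced p (top_of_set (center_over S')) {} (top_of_set (nbhd_over S')) {} id
  : iso (HG p (top_of_set (center_over S'))) (HG p (top_of_set (nbhd_over S')))"
proof (rule deformation_retract_relative_homology_group_isomorphism_id)
 let ?N = "top_of_set (nbhd_over S')"
 have "homotopic_with (%h. True) ?N ?N (%z. (%(s, z). flow s z) (0, z)) (%z. (%(s, z). flow s z) (1, z))"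
  unfolding homotopic_with_def
  using continuous_on_flow[OF S'] flow_nbhd[OF _ S'] by (intro exI[of _ "%(s, z). flow s z"]) auto
 hence h: "homotopic_with (%h. True) ?N ?N (flow 0) id"
  by (rule homotopic_with_eq) (use flow_1[OF _ S'] in auto)
 thus "homotopic_with (%h. h ` {} \<subseteq> {}) ?N ?N (flow 0) id" by simp
 have "continuous_map ?N (top_of_set (center_over S')) (flow 0)"
  using homotopic_with_imp_continuous_maps[OF h] flow_0[OF _ S'] by auto
 thus "retraction_maps ?N (top_of_set (center_over S')) (flow 0) id"
  using center_over_subset[OF S'] flow_center[OF _ S'] by (auto simp: retraction_maps_def)
qed auto

end

lemma even_fibration_homeomorphic:
 assumes E: "even_fibration E Z f k" and h: "homeomorphic_maps E' E h g" and f': "!!x. x : topspace E' ==> f (h x) = f' x"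
 shows "even_fibration E' Z f' k"
proof -
 have ch: "continuous_map E' E h" and cg: "continuous_map E E' g"
  using h by (auto simp: homeomorphic_maps_def)
 obtain s where s: "retraction_maps E Z f s"
  using E by (auto simp: even_fibration_def retraction_map_def)
 have cf: "continuous_map E Z f" using s by (simp add: retraction_maps_def)
 have cf': "continuous_map E' Z f'"
  by (rule continuous_map_eq[OF continuous_map_compose[OF ch cf]]) (simp add: f')
 have iso: "hom_induced p E {} E' {} g : iso (HG p E) (HG p E')" for p
  using h by (intro homeomorphic_map_homology_iso) (auto simp: homeomorphic_maps_map homeomorphic_maps_sym)
 have com: "hom_induced p E' {} Z {} f' (hom_induced p E {} E' {} g x) = id (hom_induced p E {} Z {} f x)" for p x
 proof -
  have "hom_induced p E {} Z {} (f' o g) = hom_induced p E {} Z {} f"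
  proof (rule hom_induced_eq)
   fix y assume "y : topspace E"
   hence "g y : topspace E'" "h (g y) = y"
    using h by (auto simp: homeomorphic_maps_def continuous_map_def)
   thus "(f' o g) y = f y" using f'[of "g y"] by simp
  qed
  thus ?thesis using hom_induced_compose'[OF cg _ cf', of "{}" "{}" "{}" p x] by simp
 qed
 have "retraction_maps E' Z f' (g o s)"
  unfolding retraction_maps_def
 proof (intro conjI ballI)
  show "continuous_map Z E' (g o s)"
   using s cg by (auto simp: retraction_maps_def intro: continuous_map_compose)
  fix z assume z: "z : topspace Z"
  hence "s z : topspace E" "f (s z) = z"
   using s by (auto simp: retraction_maps_def continuous_map_def)
  moreover from this have "g (s z) : topspace E'" "h (g (s z)) = s z"
   using h by (auto simp: homeomorphic_maps_def continuous_map_def)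
  ultimately show "f' ((g o s) z) = z"
   using f'[of "g (s z)"] by simp
 qed (rule cf')
 hence "retraction_map E' Z f'" by (auto simp: retraction_map_def)
 moreover have "free_rank (kgroup (HG p E') (HG p Z) (hom_induced p E' {} Z {} f')) (k p)" if "even p" for p
 proof (rule free_rank_kernel_iso[where A = "HG p E" and B = "HG p Z"
    and g = "hom_induced p E {} Z {} f" and al = "hom_induced p E {} E' {} g" and \<beta> = id])
  show "free_rank (kgroup (HG p E) (HG p Z) (hom_induced p E {} Z {} f)) (k p)"
   using E that by (simp add: even_fibration_def)
  show "id : hom (HG p Z) (HG p Z)" by (simp add: hom_def)
 qed (simp_all add: hom_induced_hom iso com)
 moreover have "trivial_group (HG p E')" if "odd p" for p
  using E that isomorphic_group_triviality1[OF is_isoI[OF iso]] by (simp add: even_fibration_def)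
 ultimately show ?thesis by (simp add: even_fibration_def)
qed

lemma even_hom_homeomorphic:
 assumes "even_hom X b" "X homeomorphic_space Y"
 shows "even_hom Y b"
proof -
 have "HG p X \<cong> HG p Y" for p
  by (rule homeomorphic_space_imp_isomorphic_homology_groups[OF assms(2)])
 hence "free_rank (HG p X) r ==> free_rank (HG p Y) r"
  "trivial_group (HG p X) ==> trivial_group (HG p Y)" for p r
  using free_rank_is_iso isomorphic_group_triviality1 by (metis abelian_homology_group, metis group_relative_homology_group)
 thus ?thesis
  using assms(1) by (simp add: even_hom_def)
qed

section \<open>The blow-down map off and over the center\<close>

context adjoin_flat begin

lemma openin_nbhd: "openin (top_of_set (model I S)) nbhd"
proof -
 have id: "continuous_on (model I S) (%z. z)" by (rule continuous_on_id)
 note m = cont_snd_matrix[OF id]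
 let ?U = "%p. {z : model I S. msqnorm (oncols (%x. along p (along b x)) (snd z (J p)))
   < msqnorm (oncols (%x. along p (x o b)) (snd z (J p)))}"
 have o: "openin (top_of_set (model I S)) (?U p)" for p
 proof -
  let ?h = "%z. msqnorm (oncols (%x. along p (x o b)) (snd z (J p)))
   - msqnorm (oncols (%x. along p (along b x)) (snd z (J p)))"
  have "continuous_on (model I S) ?h"
   unfolding msqnorm_def oncols_def along_def o_def
   by (intro continuous_on_diff continuous_on_sum continuous_on_power continuous_on_norm m)
  hence "openin (top_of_set (model I S)) (model I S Int ?h -` {0<..})"
   by (rule continuous_openin_preimage_gen) auto
  moreover have "model I S Int ?h -` {0<..} = ?U p" by auto
  ultimately show ?thesis by simp
 qed
 have "openin (top_of_set (model I S)) ((\<Inter>p\<in>S. ?U p) Int topspace (top_of_set (model I S)))"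
  by (rule openin_INT[OF finS o])
 moreover have "(\<Inter>p\<in>S. ?U p) Int topspace (top_of_set (model I S)) = nbhd"
  by (auto simp: nbhd_def)
 ultimately show ?thesis by simp
qed

definition gram :: "model_point => cmat" where
 "gram z i j = along b (fst z) i * cnj (along b (fst z) j) +
   (\<Sum>p | p : S & p o b = p. \<Sum>k<N. oncols (along b) (snd z p) i k * cnj (oncols (along b) (snd z p) j k))"

definition gram_trace :: "model_point => real" where
 "gram_trace z = sqnorm (along b (fst z)) + (\<Sum>p | p : S & p o b = p. msqnorm (oncols (along b) (snd z p)))"

text \<open>Off the center, the line of the flat \<open>b\<close> is spanned by the images of \<open>v\<close> and of the lines of the coarser flats;
 these are collinear, so a normalised sum of projectors recovers it continuously.\<close>

definition recover :: "model_point => model_point" where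
 "recover z = (fst z, (snd z)(b := (%i j. gram z i j / of_real (gram_trace z))))"

lemma continuous_on_gram: "continuous_on A (%z. gram z i j)" and continuous_on_gram_trace: "continuous_on A gram_trace"
proof -
 have id: "continuous_on A (%z :: model_point. z)" by (rule continuous_on_id)
 note m = cont_snd_matrix[OF id] and v = cont_fst_coord[OF id]
 show "continuous_on A (%z. gram z i j)"
  unfolding gram_def oncols_def along_def
  by (intro continuous_on_add continuous_on_mult continuous_on_sum continuous_on_cnj continuous_on_diff m v)
 show "continuous_on A gram_trace"
  unfolding gram_trace_def[abs_def] sqnorm_def msqnorm_def oncols_def along_def
  by (intro continuous_on_add continuous_on_sum continuous_on_power continuous_on_norm continuous_on_diff m v)
qed

lemma center_iff_gram_trace:
 assumes "z : model I S"
 shows "z : center \<longleftrightarrow> gram_trace z = 0"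
proof -
 obtain v X where z: "z = (v, lines_of S X)" "config I S v X" using assms by (auto simp: model_def)
 let ?C = "{p. p : S & p o b = p}"
 have sq0: "sqnorm (along b x) = 0 \<longleftrightarrow> along b x = zvec" for x
  using sqnorm_pos[OF along_in[of b x] movedN[OF bF]] by (metis sqnorm_0 less_irrefl)
 have ms: "msqnorm (oncols (along b) (snd z p)) = sqnorm (along b (X p)) / sqnorm (X p)" "sqnorm (X p) > 0" if "p : ?C" for p
  using that config_pos[OF z(2), of p] by (auto simp: z(1) lines_of_def msqnorm_oncols homogeneous_along)
 have "gram_trace z = 0 \<longleftrightarrow> sqnorm (along b v) = 0 & (\<Sum>p\<in>?C. msqnorm (oncols (along b) (snd z p))) = 0"
  unfolding gram_trace_def by (subst add_nonneg_eq_0_iff) (auto simp: z(1) sqnorm_nonneg msqnorm_def intro!: sum_nonneg)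
 also have "(\<Sum>p\<in>?C. msqnorm (oncols (along b) (snd z p))) = 0 \<longleftrightarrow> (\<forall>p\<in>?C. msqnorm (oncols (along b) (snd z p)) = 0)"
  using finS by (intro sum_nonneg_eq_0_iff) (auto simp: msqnorm_def intro!: sum_nonneg)
 also have "... \<longleftrightarrow> (\<forall>p\<in>?C. along b (X p) = zvec)"
  using ms by (intro ball_cong refl) (force simp: sq0)
 finally show ?thesis using center_config[OF z(2)] by (auto simp: sq0 z(1))
qed

lemma closedin_center: "closedin (top_of_set (model I S)) center"
proof -
 have "closedin (top_of_set (model I S)) {z : model I S. gram_trace z = 0}"
  by (rule continuous_closedin_preimage_constant[OF continuous_on_gram_trace])
 moreover have "{z : model I S. gram_trace z = 0} = center"
  using center_iff_gram_trace by (auto simp: center_def)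
 ultimately show ?thesis by simp
qed

lemma recover_config:
 assumes X: "config I (insert b S) v X" and nc: "(v, lines_of S X) ~: center"
 shows "gram_trace (v, lines_of S X) > 0" "recover (v, lines_of S X) = (v, lines_of (insert b S) X)"
proof -
 let ?C = "{p. p : S & p o b = p}" and ?y = "X b"
 have XS: "config I S v X" using config_mono[OF X] by auto
 have y: "sqnorm ?y > 0" using config_pos[OF X, of b] by simp
 obtain c0 where c0: "along b v = vscale c0 ?y" using configD(4)[OF X, of b] by auto
 have "\<forall>p\<in>?C. EX c. along b (X p) = vscale c ?y"
  using configD(5)[OF X, of _ b] by auto
 from bchoice[OF this] obtain c where c: "!!p. p : ?C ==> along b (X p) = vscale (c p) ?y" by blast
 have pos: "sqnorm (X p) > 0" if "p : ?C" for p using config_pos[OF XS, of p] that by auto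
 \<comment> \<open>All image vectors entering \<open>gram\<close> are multiples of
   \<open>X b\<close>, so \<open>gram\<close> is \<open>\<gamma>\<close> times the outer product of
   \<open>X b\<close> with itself. The divisors \<open>sqnorm (X p)\<close> come from using
   projectors instead of representatives.\<close>
 define \<gamma> where "\<gamma> = (cmod c0)\<^sup>2 + (\<Sum>p\<in>?C. (cmod (c p))\<^sup>2 / sqnorm (X p))"
 have finC: "finite ?C" using finS by auto
 have nonneg: "(cmod (c p))\<^sup>2 / sqnorm (X p) >= 0" if "p : ?C" for p
  using pos[OF that] by simp
 have \<gamma>: "\<gamma> > 0"
 proof (cases "along b v = zvec")
  case False
  hence "c0 ~= 0" using c0 by auto
  thus ?thesis unfolding \<gamma>_def using nonneg by (intro add_pos_nonneg sum_nonneg) auto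
 next
  case True
  then obtain p where p: "p : ?C" "along b (X p) ~= zvec"
   using nc center_config[OF XS] by auto
  hence "c p ~= 0" using c[OF p(1)] by auto
  thus ?thesis unfolding \<gamma>_def using nonneg p pos[OF p(1)] finC
   by (intro add_nonneg_pos sum_pos2[of _ p]) auto
 qed
 have W: "oncols (along b) (lines_of S X p) = (%i k. (vscale (c p) ?y) i * cnj (X p k) / of_real (sqnorm (X p)))" if "p : ?C" for p
  using that c[OF that] by (simp add: lines_of_def oncols_pr homogeneous_along)
 have msq: "msqnorm (oncols (along b) (lines_of S X p)) = (cmod (c p))\<^sup>2 / sqnorm (X p) * sqnorm ?y" if "p : ?C" for p
  unfolding W[OF that] msqnorm_outer by (simp add: sqnorm_vscale power2_eq_square)
 have tr: "gram_trace (v, lines_of S X) = \<gamma> * sqnorm ?y"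
  using sum.cong[OF refl msq, of ?C "%p. p"]
  by (simp add: gram_trace_def c0 sqnorm_vscale \<gamma>_def distrib_right sum_distrib_right)
 thus "gram_trace (v, lines_of S X) > 0" using \<gamma> y by simp
 have sq: "(\<Sum>k<N. oncols (along b) (lines_of S X p) i k * cnj (oncols (along b) (lines_of S X p) j k))
   = of_real ((cmod (c p))\<^sup>2 / sqnorm (X p)) * (?y i * cnj (?y j))" if p: "p : ?C" for p i j
 proof -
  have "(\<Sum>k<N. oncols (along b) (lines_of S X p) i k * cnj (oncols (along b) (lines_of S X p) j k))
    = (c p * cnj (c p)) * (?y i * cnj (?y j)) / (of_real (sqnorm (X p)))\<^sup>2 * (\<Sum>k<N. X p k * cnj (X p k))"
   unfolding W[OF p] by (simp add: vscale_def sum_distrib_left sum_divide_distrib power2_eq_square mult_ac)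
  thus ?thesis
   by (simp only: sum_cnj_sqnorm) (simp add: mult_cnj_cmod power2_eq_square)
 qed
 have "gram (v, lines_of S X) i j = of_real \<gamma> * (?y i * cnj (?y j))" for i j
 proof -
  have "gram (v, lines_of S X) i j = (c0 * cnj c0) * (?y i * cnj (?y j)) +
    (\<Sum>p\<in>?C. of_real ((cmod (c p))\<^sup>2 / sqnorm (X p)) * (?y i * cnj (?y j)))"
   using sum.cong[OF refl sq[of _ i j], of ?C "%p. p"] by (simp add: gram_def c0) (simp add: vscale_def)
  thus ?thesis
   unfolding \<gamma>_def mult_cnj_cmod by (simp add: distrib_right sum_distrib_right)
 qed
 hence "(%i j. gram (v, lines_of S X) i j / of_real (gram_trace (v, lines_of S X))) = pr ?y"
  using \<gamma> by (intro ext) (simp add: tr pr_def)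
 thus "recover (v, lines_of S X) = (v, lines_of (insert b S) X)"
  by (simp add: recover_def lines_of_def) (auto intro!: ext)
qed

text \<open>The line at the join \<open>?t\<close> is incident to the lines at \<open>p\<close> and
  at \<open>q\<close>, so its image along \<open>b\<close> is a multiple of both images. If the
  factor for \<open>p\<close> is zero, so is the one for \<open>q\<close>, and the vector at
  \<open>?t\<close> would be constant on the blocks of \<open>p\<close> and \<open>q\<close>, hence
  on those of \<open>?t\<close>.\<close>

lemma collinear_images:
 assumes X: "config I S v X" and p: "p : S" "p o b = p" and q: "q : S" "q o b = q" and nz: "along b (X q) ~= zvec"
 shows "EX c. along b (X p) = vscale c (along b (X q))"
proof -
 let ?t = "join p q"
 have tF: "?t : flats I" using join_flat SF p q by blast
 have tp: "?t o p = ?t" and tq: "?t o q = ?t" by (rule join_coarser)+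
 have t: "?t : S" by (rule up[OF p(1) tF tp])
 obtain c where c: "along p (X ?t) = vscale c (X p)" using configD(5)[OF X t p(1) tp] by auto
 obtain d where d: "along q (X ?t) = vscale d (X q)" using configD(5)[OF X t q(1) tq] by auto
 have 1: "along b (X ?t) = vscale c (along b (X p))"
  using along_along[OF p(2), of "X ?t"] by (simp add: c along_vscale)
 have 2: "along b (X ?t) = vscale d (along b (X q))"
  using along_along[OF q(2), of "X ?t"] by (simp add: d along_vscale)
 show ?thesis
 proof (cases "c = 0")
  case False
  have "along b (X p) = vscale (1 / c) (vscale c (along b (X p)))"
   using False by simp
  thus ?thesis unfolding 1[symmetric] 2 by auto
 next
  case True
  hence "vscale d (along b (X q)) = zvec" using 1 2 by simp
  hence "d = 0" using nz by (simp add: vscale_eq_0_iff)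
  hence "X ?t o p = X ?t" "X ?t o q = X ?t" using c d True by (simp_all add: along_zero_iff[symmetric])
  hence "X ?t o ?t = X ?t" by (rule join_least)
  thus ?thesis using nonzero_not_invariant[OF tF] configD(2,3)[OF X t] by blast
 qed
qed

lemma config_insert:
 assumes X: "config I S v X" and y: "y : coords (moved b)" "y ~= zvec"
  and v: "EX c. along b v = vscale c y" and p: "!!p. p : S ==> p o b = p ==> EX c. along b (X p) = vscale c y"
 shows "config I (insert b S) v (X(b := y))"
proof -
 let ?X = "X(b := y)"
 have Xp: "?X p = X p" if "p : S" for p using that b(2) by auto
 have yy: "along b y = vscale 1 y" using along_self[OF bF y(1)] by simp
 have "EX c. along s (?X q) = vscale c (?X s)" if q: "q : insert b S" and s: "s : insert b S" and le: "q o s = q" for q s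
 proof (cases "q : S")
  case True
  thus ?thesis using configD(5)[OF X True _ le] p[OF True] le s Xp[OF True] by auto
 next
  case False
  hence "q = b" "s = b" using q s le not_finer[of s] by auto
  thus ?thesis using yy by (metis fun_upd_same)
 qed
 thus ?thesis
  using configD[OF X] Xp v y unfolding config_def by (metis fun_upd_same insert_iff)
qed

text \<open>If the image of \<open>v\<close> is nonzero, it spans the new line, and by incidence
  with the lines at \<open>p\<close> their images are multiples of it. Otherwise some coarser line
  has a nonzero image, and \<open>collinear_images\<close> applies to it.\<close>

lemma config_extends:
 assumes X: "config I S v X" and nc: "(v, lines_of S X) ~: center"
 shows "EX y. config I (insert b S) v (X(b := y))"
proof (cases "along b v = zvec")
 case False
 have "config I (insert b S) v (X(b := along b v))"
 proof (rule config_insert[OF X along_in False])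
  show "EX c. along b v = vscale c (along b v)" by (intro exI[of _ 1]) simp
  fix p assume p: "p : S" "p o b = p"
  obtain c where c: "along p v = vscale c (X p)" using configD(4)[OF X p(1)] by auto
  hence "along b v = vscale c (along b (X p))"
   using along_along[OF p(2), of v] by (simp add: along_vscale)
  moreover have "c ~= 0" using calculation False by auto
  ultimately have "along b (X p) = vscale (1 / c) (along b v)" by simp
  thus "EX c. along b (X p) = vscale c (along b v)" by blast
 qed
 thus ?thesis by blast
next
 case True
 then obtain q where q: "q : S" "q o b = q" "along b (X q) ~= zvec"
  using nc center_config[OF X] by auto
 have "config I (insert b S) v (X(b := along b (X q)))"
 proof (rule config_insert[OF X along_in q(3)])
  show "EX c. along b v = vscale c (along b (X q))" using True by (intro exI[of _ 0]) simp
 qed (rule collinear_images[OF X _ _ q])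
 thus ?thesis by blast
qed

lemma lines_of_upd: "lines_of S (X(b := y)) = lines_of S X"
 using b(2) by (auto simp: lines_of_def)

lemma continuous_on_forget: "continuous_on A forget"
proof -
 have id: "continuous_on A (%z :: model_point. z)" by (rule continuous_on_id)
 have "continuous_on A (%z. ((snd z)(b := (%_. zvec))) p)" for p
  using continuous_on_coordD[OF continuous_on_snd[OF id], of p] by (cases "p = b") auto
 thus ?thesis
  unfolding forget_def
  by (intro continuous_on_Pair continuous_on_fst[OF id]) (rule continuous_on_funI)
qed

lemma forget_model: "z : model I (insert b S) ==> forget z : model I S"
 using config_mono forget_lines unfolding model_def by blast

lemma homeomorphic_off_center:
 "homeomorphic_maps (top_of_set {z : model I (insert b S). forget z ~: center}) (top_of_set (model I S - center)) forget recover"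
 unfolding homeomorphic_maps_def
proof (intro conjI ballI)
 let ?B = "{z : model I (insert b S). forget z ~: center}" and ?M = "model I S - center"
 have M: "EX v X. z = (v, lines_of S X) & config I (insert b S) v X" if z: "z : ?M" for z
 proof -
  obtain v X where "z = (v, lines_of S X)" "config I S v X" using z by (auto simp: model_def)
  thus ?thesis using config_extends[of v X] z lines_of_upd by (metis DiffD2)
 qed
 show "continuous_map (top_of_set ?B) (top_of_set ?M) forget"
  using continuous_on_forget forget_model by auto
 have id: "continuous_on ?M (%z. z)" by (rule continuous_on_id)
 have tr: "gram_trace z ~= 0" if "z : ?M" for z
  using that center_iff_gram_trace[of z] by blast
 have "continuous_on ?M (%z i j. gram z i j / of_real (gram_trace z))"
  by (rule continuous_on_matrixI) (intro continuous_on_divide continuous_on_gram continuous_on_of_real continuous_on_gram_trace, use tr in simp)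
 hence "continuous_on ?M (%z. ((snd z)(b := (%i j. gram z i j / of_real (gram_trace z)))) p)" for p
  using continuous_on_coordD[OF continuous_on_snd[OF id], of p] by (cases "p = b") auto
 hence "continuous_on ?M recover"
  unfolding recover_def
  by (intro continuous_on_Pair continuous_on_fst[OF id]) (rule continuous_on_funI)
 moreover have rec: "recover z : ?B & forget (recover z) = z" if z: "z : ?M" for z
 proof -
  obtain v X where zX: "z = (v, lines_of S X)" "config I (insert b S) v X" using M[OF z] by auto
  hence "recover z = (v, lines_of (insert b S) X)" using recover_config(2) z by auto
  thus ?thesis using zX z forget_lines[of "insert b S" v X] by (auto simp: model_def)
 qed
 ultimately show "continuous_map (top_of_set ?M) (top_of_set ?B) recover" by auto
 show "forget (recover z) = z" if "z : topspace (top_of_set ?M)" for z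
  using rec that by simp
 show "recover (forget z) = z" if "z : topspace (top_of_set ?B)" for z
 proof -
  obtain v X where "z = (v, lines_of (insert b S) X)" "config I (insert b S) v X" "forget z ~: center"
   using `z : topspace (top_of_set ?B)` by (auto simp: model_def)
  thus ?thesis using recover_config(2)[of v X] forget_lines[of "insert b S" v X] by simp
 qed
qed

text \<open>Over the center all incidences with the line at \<open>b\<close> hold with factor zero.
  Any point of \<open>points (moved b)\<close> is therefore admissible, and the preimage is a
  product.\<close>

lemma even_fibration_center:
 assumes "even_hom (top_of_set center) h"
 shows "even_fibration (top_of_set (center_over (insert b S))) (top_of_set center) forget (%p. \<Sum>j = 1..<card (moved b). h (p - 2 * int j))"
proof -
 have mb: "finite (moved b)" "moved b ~= {}" "moved b \<subseteq> {..<N}"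
  using movedN[OF bF] finite_subset[of "moved b"] b(1) moved_empty_iff by (auto simp: pflats_def)
 have "homeomorphic_maps (top_of_set (center_over (insert b S))) (prod_topology (top_of_set center) (top_of_set (points (moved b))))
   (%z. (forget z, snd z b)) (%(z, M). (fst z, (snd z)(b := M)))"
  unfolding homeomorphic_maps_def prod_topology_subtopology_eu
 proof (intro conjI ballI)
  let ?E = "center_over (insert b S)"
  have bin: "snd z b : points (moved b)" if z: "z : ?E" for z
  proof -
   obtain v X where "z = (v, lines_of (insert b S) X)" "config I (insert b S) v X" using z by (auto simp: center_over_def model_def)
   thus ?thesis using configD(2,3)[of I "insert b S" v X b] by (auto simp: lines_of_def pr_in_points)
  qed
  have "continuous_on ?E (%z. (forget z, snd z b))"
   by (intro continuous_on_Pair continuous_on_forget continuous_on_coordD[OF continuous_on_snd[OF continuous_on_id]])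
  thus "continuous_map (top_of_set ?E) (top_of_set (center \<times> points (moved b))) (%z. (forget z, snd z b))"
   using bin by (auto simp: center_over_def)
  have inv: "(fst z, (snd z)(b := M)) : ?E & forget (fst z, (snd z)(b := M)) = z" if z: "z : center" and M: "M : points (moved b)" for z M
  proof -
   have "forget z = z" using z forget_lines[of S] by (auto simp: center_def model_def)
   hence "z : center_over S" using z by (simp add: center_over_def center_def)
   then obtain v X where zX: "z = (v, lines_of S X)" "config I S v X" "along b v = zvec"
     "!!p. p : S ==> p o b = p ==> along b (X p) = zvec"
    using center_overE[of z S] by metis
   obtain y where y: "y : coords (moved b)" "y ~= zvec" "M = pr y" using M by (auto simp: points_def)
   have X': "config I (insert b S) v (X(b := y))"
    using y zX(3,4) by (intro config_insert[OF zX(2)]) (auto intro!: exI[of _ 0])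
   have eq: "(fst z, (snd z)(b := M)) = (v, lines_of (insert b S) (X(b := y)))"
    by (auto simp: zX(1) lines_of_def y(3))
   show ?thesis
    unfolding eq using X' zX(3,4) b(2) forget_lines[of "insert b S" v "X(b := y)"]
    by (auto simp: lines_of_upd zX(1) intro!: center_overI)
  qed
  have id: "continuous_on (center \<times> points (moved b)) (%w. w)" by (rule continuous_on_id)
  have "continuous_on (center \<times> points (moved b)) (%w. ((snd (fst w))(b := snd w)) p)" for p
   using continuous_on_coordD[OF continuous_on_snd[OF continuous_on_fst[OF id]], of p] continuous_on_snd[OF id]
   by (cases "p = b") auto
  hence "continuous_on (center \<times> points (moved b)) (%w. (fst (fst w), (snd (fst w))(b := snd w)))"
   by (intro continuous_on_Pair continuous_on_fst[OF continuous_on_fst[OF id]]) (rule continuous_on_funI)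
  thus "continuous_map (top_of_set (center \<times> points (moved b))) (top_of_set ?E) (%(z, M). (fst z, (snd z)(b := M)))"
   using inv by (auto simp: case_prod_unfold)
  show "(case (forget z, snd z b) of (z, M) => (fst z, (snd z)(b := M))) = z" for z
   by (simp add: forget_def)
  show "(%z. (forget z, snd z b)) (case w of (z, M) => (fst z, (snd z)(b := M))) = w"
   if "w : topspace (top_of_set (center \<times> points (moved b)))" for w
   using that inv by auto
 qed
 thus ?thesis
  by (rule even_fibration_homeomorphic[OF even_fibration_points[OF mb assms]]) simp
qed

end

section \<open>The center as a model on the blocks of the new flat\<close>

context adjoin_flat begin

abbreviation K where "K \<equiv> b ` I"

lemma K_iff: "i : K \<longleftrightarrow> i : I & b i = i"
 using flatsD[OF bF] by (auto simp: image_iff) metis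

lemma K_props: "K \<subseteq> I" "finite K" "K ~= {}" "Min K = Min I"
proof -
 show "K \<subseteq> I" "finite K" "K ~= {}" using K_iff finI I by auto
 have "b (Min I) = Min I"
  using flatsD(2,3)[OF bF] finI I Min_le Min_in by (metis le_antisym)
 hence "Min I : K" using K_iff finI I by auto
 thus "Min K = Min I"
  using `K \<subseteq> I` finI finite_subset[OF `K \<subseteq> I` finI] by (intro Min_eqI Min_le) (blast+)
qed

definition cut :: "cvec => cvec" where
 "cut x = (%i. if i : K then x i else 0)"

definition descend :: "(nat => nat) => nat => nat" where
 "descend p = (%i. if i : K then p i else i)"

lemma cut_vscale: "cut (vscale c x) = vscale c (cut x)"
 by (auto simp: cut_def vscale_def)

lemma cut_0: "cut zvec = zvec"
 by (auto simp: cut_def)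

lemma comp_b_vscale: "vscale c x o b = vscale c (x o b)"
 by (auto simp: vscale_def)

text \<open>A flat of \<open>K\<close> is a partition of the set of blocks of \<open>b\<close>, each
  block being represented by its minimum; composing with \<open>b\<close> turns it into a flat of
  \<open>I\<close> that is coarser than \<open>b\<close>.\<close>

lemma lift_flat:
 assumes t: "t : flats K"
 shows "t o b : flats I" "(t o b) o b = t o b" "b (t (b i)) = t (b i)" "i : K ==> (t o b) i = t i"
proof -
 note t' = flatsD[OF t] and b' = flatsD[OF bF]
 show bt: "b (t (b i)) = t (b i)" for i
  using t' b' K_iff by (cases "b i : K") auto
 show "i : K ==> (t o b) i = t i" using K_iff by auto
 show "(t o b) o b = t o b" using bb by auto
 have "t (b (t (b i))) = t (b i)" for i using bt t' by simp
 moreover have "t (b i) <= i" for i using t'(2) b'(2) le_trans by blast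
 moreover have "i : I ==> t (b i) : I" for i using t'(3)[of "b i"] K_iff by blast
 moreover have "i ~: I ==> t (b i) = i" for i using b'(4)[of i] t'(4)[of i] K_iff by auto
 ultimately show "t o b : flats I" by (simp add: flats_def)
qed

lemma lift_S:
 assumes "t : pflats K"
 shows "t o b : S"
proof (rule Sb)
 have t: "t : flats K" "t ~= id" using assms by (auto simp: pflats_def)
 show "t o b : flats I" "t o b o b = t o b" using lift_flat[OF t(1)] by auto
 obtain j where "t j ~= j" using t(2) by (auto simp: fun_eq_iff)
 hence "j : K" using flatsD(4)[OF t(1)] by auto
 thus "t o b ~= b" using `t j ~= j` K_iff by (metis comp_apply)
qed

lemma descend_flat:
 assumes p: "p : flats I" "p o b = p"
 shows "descend p : flats K" "descend p o b = p"
proof -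
 note p' = flatsD[OF p(1)] and b' = flatsD[OF bF]
 have pb: "p (b i) = p i" and bp: "b (p i) = p i" for i
  using p(2) coarser_comp[OF p(1) bF p(2)] by (simp_all add: fun_eq_iff)
 have pK: "i : K ==> p i : K" for i using p'(3) bp K_iff by auto
 show "descend p : flats K"
  using pK p' by (auto simp: flats_def descend_def)
 show "descend p o b = p"
 proof
  fix i show "(descend p o b) i = p i"
   using pb[of i] K_iff[of "b i"] bb[of i] b'(3)[of i] b'(4)[of i] p'(4)[of i]
   by (cases "i : I") (auto simp: descend_def)
 qed
qed

lemma descend_lift: "t : flats K ==> descend (t o b) = t"
 using flatsD(4)[of t K] K_iff by (auto simp: descend_def fun_eq_iff)

lemma descend_J:
 assumes "p : S"
 shows "descend (J p) : pflats K" "descend (J p) o b = J p"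
proof -
 show d: "descend (J p) o b = J p" using descend_flat[OF J_F[OF assms] J_b] by simp
 have "J p ~= b" using J_S[OF assms] b(2) by auto
 hence "descend (J p) ~= id" using d by auto
 thus "descend (J p) : pflats K"
  using descend_flat[OF J_F[OF assms] J_b] by (simp add: pflats_def)
qed

lemma descend_mono:
 assumes "p : S" "s : S" "p o s = p"
 shows "descend (J p) o descend (J s) = descend (J p)"
proof
 fix i
 have "J p (J s i) = J p i" using J_mono[OF assms(3)] by (simp add: fun_eq_iff)
 moreover have "i : K ==> J s i : K"
  using flatsD(3)[OF J_F[OF assms(2)], of i] coarser_comp[OF J_F[OF assms(2)] bF J_b] K_iff by (auto simp: fun_eq_iff)
 ultimately show "(descend (J p) o descend (J s)) i = descend (J p) i"
  by (auto simp: descend_def)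
qed

lemma diff_lift:
 assumes "t : flats K"
 shows "along (t o b) (x o b) = along t x o b" "along t (cut x) = cut (along (t o b) x)"
 using lift_flat(3)[OF assms] flatsD(3,4)[OF assms] K_iff
 by (auto simp: along_def cut_def fun_eq_iff)

lemma lift_vec:
 assumes t: "t : flats K" and y: "y : coords (moved t)"
 shows "y o b : coords (moved (t o b))" "cut (y o b) = y"
proof -
 have "y (b i) = 0" if "t (b i) = i" for i
 proof -
  have "b i = i" using that flatsD(2)[OF t, of "b i"] flatsD(2)[OF bF, of i] by simp
  thus ?thesis using that y by (auto simp: coords_def moved_def)
 qed
 thus "y o b : coords (moved (t o b))" by (auto simp: coords_def moved_def)
 have "i ~: K ==> y i = 0" for i
  using y flatsD(4)[OF t, of i] by (auto simp: coords_def moved_def)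
 thus "cut (y o b) = y" using K_iff by (auto simp: cut_def fun_eq_iff)
qed

lemma cut_lift:
 assumes x: "along b x = zvec" and x0: "!!i. i ~: I ==> x i = 0"
 shows "cut x o b = x"
proof
 fix i
 have "x (b i) = x i" using x unfolding along_zero_iff by (metis comp_apply)
 thus "(cut x o b) i = x i"
  using x0[of i] flatsD(3,4)[OF bF, of i] bb[of i] K_iff[of "b i"] by (cases "i : I") (auto simp: cut_def)
qed

lemma coord_top: "v : coords (moved (top_flat I)) \<longleftrightarrow> (ALL i. i ~: I | i = Min I --> v i = 0)"
 "v : coords (moved (top_flat K)) \<longleftrightarrow> (ALL i. i ~: K | i = Min I --> v i = 0)"
 using moved_top_flat[OF finI] moved_top_flat[OF K_props(2)] K_props(4) by (auto simp: coords_def)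

definition restr_config :: "((nat => nat) => cvec) => (nat => nat) => cvec" where
 "restr_config X t = cut (X (t o b))"

text \<open>On the center the lines of the coarser flats come from the smaller model, and for every
  other flat \<open>p\<close> the line at \<open>J p\<close> determines the line at
  \<open>p\<close>. One formula covers both, as \<open>J p = p\<close> for coarser
  \<open>p\<close>.\<close>

definition ext_config :: "((nat => nat) => cvec) => (nat => nat) => cvec" where
 "ext_config Y p = along p (Y (descend (J p)) o b)"

lemma zero_outside: "p : S ==> x : coords (moved p) ==> i ~: I ==> x i = 0"
 using moved_subset[OF SF(1)] by (auto simp: coords_def)

lemma config_restrict:
 assumes X: "config I S v X" and v: "along b v = zvec" and Xb: "!!p. p : S ==> p o b = p ==> along b (X p) = zvec"
 shows "config K (pflats K) (cut v) (restr_config X)"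
 unfolding config_def
proof (intro conjI ballI impI)
 show "cut v : coords (moved (top_flat K))"
  using configD(1)[OF X] unfolding coord_top by (auto simp: cut_def)
 fix t assume t: "t : pflats K"
 have tF: "t : flats K" using t by (simp add: pflats_def)
 note tS = lift_S[OF t]
 note x = configD(2,3)[OF X tS]
 show "restr_config X t : coords (moved t)"
  using x(1) flatsD(4)[OF tF] lift_flat(4)[OF tF] by (auto simp: restr_config_def cut_def coords_def moved_def)
 show "restr_config X t ~= zvec"
 proof
  assume "restr_config X t = zvec"
  moreover have "restr_config X t o b = X (t o b)"
   unfolding restr_config_def using Xb[OF tS lift_flat(2)[OF tF]] zero_outside[OF tS x(1)] by (rule cut_lift)
  ultimately show False using x(2) by (auto simp: fun_eq_iff)
 qed
 show "EX c. along t (cut v) = vscale c (restr_config X t)"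
  using configD(4)[OF X tS] by (auto simp: diff_lift[OF tF] cut_vscale restr_config_def)
 fix s assume s: "s : pflats K" and le: "t o s = t"
 have sF: "s : flats K" using s by (simp add: pflats_def)
 have "(t o b) o (s o b) = t o b"
  using lift_flat(3)[OF sF] le by (auto simp: fun_eq_iff)
 thus "EX c. along s (restr_config X t) = vscale c (restr_config X s)"
  using configD(5)[OF X tS lift_S[OF s]] by (auto simp: restr_config_def diff_lift[OF sF] cut_vscale)
qed

lemma extend_nonzero:
 assumes Y: "config K (pflats K) w Y" and p: "p : S"
 shows "ext_config Y p ~= zvec"
proof
 let ?t = "descend (J p)"
 let ?x = "Y ?t o b"
 note t = descend_J[OF p]
 have tF: "?t : flats K" using t by (simp add: pflats_def)
 assume "ext_config Y p = zvec"
 hence "?x o p = ?x" by (simp add: ext_config_def along_zero_iff)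
 moreover have "?x o b = ?x" by (auto simp: bb)
 ultimately have "?x o J p = ?x" by (rule join_least)
 moreover have "?x : coords (moved (J p))"
  using lift_vec(1)[OF tF configD(2)[OF Y t(1)]] t(2) by simp
 moreover have "?x ~= zvec"
  using lift_vec(2)[OF tF configD(2)[OF Y t(1)]] configD(3)[OF Y t(1)] cut_0 by metis
 ultimately show False using nonzero_not_invariant[OF J_F[OF p]] by blast
qed

lemma extend_coarse:
 assumes Y: "config K (pflats K) w Y" and p: "p : S" "p o b = p"
 shows "ext_config Y p = Y (descend p) o b"
proof -
 note t = descend_J[OF p(1), unfolded J_absorb[OF p]]
 have tF: "descend p : flats K" using t by (simp add: pflats_def)
 have "Y (descend p) o b : coords (moved p)"
  using lift_vec(1)[OF tF configD(2)[OF Y t(1)]] t(2) by simp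
 thus ?thesis
  by (simp add: ext_config_def J_absorb[OF p] along_self[OF SF(1)[OF p(1)]])
qed

lemma config_extend:
 assumes Y: "config K (pflats K) w Y"
 shows "config I S (w o b) (ext_config Y)"
proof -
 have key: "EX c. along p (x o b) = vscale c (ext_config Y p)"
  if p: "p : S" and x: "EX c. along (descend (J p)) x = vscale c (Y (descend (J p)))" for p x
 proof -
  obtain c where c: "along (descend (J p)) x = vscale c (Y (descend (J p)))" using x by auto
  have tF: "descend (J p) : flats K" using descend_J[OF p] by (simp add: pflats_def)
  have "along p (x o b) = along p (along (J p) (x o b))"
   by (rule along_along[OF J_p, symmetric])
  also have "along (J p) (x o b) = vscale c (Y (descend (J p)) o b)"
   using diff_lift(1)[OF tF, of x] descend_J(2)[OF p] c by (simp add: comp_b_vscale)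
  finally show ?thesis unfolding ext_config_def along_vscale by blast
 qed
 show ?thesis
  unfolding config_def
 proof (intro conjI ballI impI)
  show "w o b : coords (moved (top_flat I))"
   using configD(1)[OF Y] flatsD(4)[OF bF] K_iff K_props(3,4) Min_in[OF K_props(2)] unfolding coord_top by auto
  fix p assume p: "p : S"
  show "ext_config Y p : coords (moved p)" by (simp add: ext_config_def along_in)
  show "ext_config Y p ~= zvec" by (rule extend_nonzero[OF Y p])
  show "EX c. along p (w o b) = vscale c (ext_config Y p)"
   by (rule key[OF p configD(4)[OF Y descend_J(1)[OF p]]])
  fix s assume s: "s : S" and le: "p o s = p"
  have "along s (ext_config Y p) = along s (Y (descend (J p)) o b)"
   unfolding ext_config_def by (rule along_along[OF le])
  thus "EX c. along s (ext_config Y p) = vscale c (ext_config Y s)"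
   using key[OF s configD(5)[OF Y descend_J(1)[OF p] descend_J(1)[OF s] descend_mono[OF p s le]]] by simp
 qed
qed

definition to_small :: "model_point => model_point" where
 "to_small z = (cut (fst z), %t. if t : pflats K then act cut (snd z (t o b)) else (%_. zvec))"

definition from_small :: "model_point => model_point" where
 "from_small z = (fst z o b, %p. if p : S then act (%x. along p (x o b)) (snd z (descend (J p))) else (%_. zvec))"

lemma homogeneous_cut: "homogeneous cut"
 using cut_vscale by (simp add: homogeneous_def)

lemma to_small_config: "config I S v X ==> to_small (v, lines_of S X) = (cut v, lines_of (pflats K) (restr_config X))"
 using config_pos[of S v X] lift_S
 by (auto simp: to_small_def lines_of_def restr_config_def act_pr homogeneous_cut intro!: ext)

lemma small_pos:
 assumes "config K (pflats K) w Y" "t : pflats K"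
 shows "sqnorm (Y t) > 0"
proof -
 have "moved t \<subseteq> {..<N}"
  using moved_subset[of t K] assms(2) K_props(1) I by (auto simp: pflats_def)
 thus ?thesis using sqnorm_pos configD(2,3)[OF assms] by blast
qed

lemma from_small_config: "config K (pflats K) w Y ==> from_small (w, lines_of (pflats K) Y) = (w o b, lines_of S (ext_config Y))"
 using small_pos[of w Y] descend_J(1)
 by (auto simp: from_small_def lines_of_def ext_config_def act_pr homogeneous_maps intro!: ext)

lemma center_eq: "center_over S = center"
proof -
 have "forget z = z" if "z : model I S" for z
  using that forget_lines[of S] by (auto simp: model_def)
 thus ?thesis by (auto simp: center_over_def center_def)
qed

lemma centerE:
 assumes "z : center"
 obtains v X where "z = (v, lines_of S X)" "config I S v X" "along b v = zvec"
  "!!p. p : S ==> p o b = p ==> along b (X p) = zvec"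
 using assms center_overE[of z S] unfolding center_eq by metis

lemma from_small_center:
 assumes "z : model K (pflats K)"
 shows "from_small z : center"
proof -
 obtain w Y where z: "z = (w, lines_of (pflats K) Y)" "config K (pflats K) w Y"
  using assms by (auto simp: model_def)
 have "along b (ext_config Y p) = zvec" if "p : S" "p o b = p" for p
  using extend_coarse[OF z(2) that] by (auto simp: along_def bb)
 moreover have "along b (w o b) = zvec" by (auto simp: along_def bb)
 ultimately show ?thesis
  using center_config[OF config_extend[OF z(2)]] unfolding z(1) from_small_config[OF z(2)] by blast
qed

lemma from_to_small:
 assumes "z : center"
 shows "from_small (to_small z) = z"
proof -
 obtain v X where z: "z = (v, lines_of S X)" "config I S v X" "along b v = zvec"
  "!!p. p : S ==> p o b = p ==> along b (X p) = zvec"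
  using assms by (rule centerE) blast
 note Y = config_restrict[OF z(2-4)]
 have v: "cut v o b = v"
  using configD(1)[OF z(2)] by (intro cut_lift z(3)) (simp add: coord_top)
 have "pr (ext_config (restr_config X) p) = pr (X p)" if p: "p : S" for p
 proof -
  have "restr_config X (descend (J p)) o b = X (J p)"
   unfolding restr_config_def descend_J(2)[OF p]
   using zero_outside[OF J_S[OF p] configD(2)[OF z(2) J_S[OF p]]] by (intro cut_lift z(4) J_S p J_b)
  hence e: "ext_config (restr_config X) p = along p (X (J p))"
   by (simp add: ext_config_def)
  then obtain c where c: "along p (X (J p)) = vscale c (X p)"
   using configD(5)[OF z(2) J_S[OF p] p J_p] by auto
  hence "c ~= 0" using extend_nonzero[OF Y p] e by auto
  thus ?thesis using e c pr_vscale by simp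
 qed
 hence "lines_of S (ext_config (restr_config X)) = lines_of S X"
  by (auto simp: lines_of_def intro!: ext)
 moreover have "from_small (to_small z) = (cut v o b, lines_of S (ext_config (restr_config X)))"
  by (simp only: z(1) to_small_config[OF z(2)] from_small_config[OF Y])
 ultimately show ?thesis
  by (simp only: z(1) v)
qed

lemma to_from_small:
 assumes "z : model K (pflats K)"
 shows "to_small (from_small z) = z"
proof -
 obtain w Y where z: "z = (w, lines_of (pflats K) Y)" "config K (pflats K) w Y"
  using assms by (auto simp: model_def)
 have w: "cut (w o b) = w"
  using configD(1)[OF z(2)] K_iff unfolding coord_top by (auto simp: cut_def fun_eq_iff)
 have "restr_config (ext_config Y) t = Y t" if t: "t : pflats K" for t
 proof -
  have tF: "t : flats K" using t by (simp add: pflats_def)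
  show ?thesis
   using extend_coarse[OF z(2) lift_S[OF t] lift_flat(2)[OF tF]] lift_vec(2)[OF tF configD(2)[OF z(2) t]]
   by (simp add: restr_config_def descend_lift[OF tF])
 qed
 thus ?thesis
  unfolding z(1) from_small_config[OF z(2)] to_small_config[OF config_extend[OF z(2)]] w
  by (auto simp: lines_of_def intro!: ext)
qed

lemma center_homeomorphic: "top_of_set (model K (pflats K)) homeomorphic_space top_of_set center"
proof -
 have to: "to_small z : model K (pflats K)" if "z : center" for z
  using that by (rule centerE) (use to_small_config config_restrict in \<open>auto simp: model_def\<close>)
 let ?K = "pflats K"
 have idc: "continuous_on center (%z. z)" by (rule continuous_on_id)
 have ids: "continuous_on (model K ?K) (%z. z)" by (rule continuous_on_id)
 have c11: "continuous_on center (%z. cut (fst z))"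
 proof (rule continuous_on_funI)
  fix i show "continuous_on center (%z. cut (fst z) i)"
   using cont_fst_coord[OF idc, of i] by (cases "i : K") (simp_all add: cut_def)
 qed
 have c12: "continuous_on center (%z. if t : ?K then act cut (snd z (t o b)) else (%_. zvec))" for t
 proof (cases "t : ?K")
  case True
  have "continuous_on center (%z. act cut (snd z (t o b)))"
   unfolding act_def
  proof (rule continuous_on_normalize)
   fix i j show "continuous_on center (%z. oncols cut (snd z (t o b)) i j)"
    using cont_snd_matrix[OF idc, of "t o b" i j] by (cases "i : K") (simp_all add: cut_def oncols_def)
  next
   fix z assume "z : center"
   then obtain v X where z: "z = (v, lines_of S X)" "config I S v X" "along b v = zvec"
    "!!p. p : S ==> p o b = p ==> along b (X p) = zvec" by (rule centerE) blast
   have "sqnorm (restr_config X t) > 0" by (rule small_pos[OF config_restrict[OF z(2-4)] True])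
   thus "msqnorm (oncols cut (snd z (t o b))) ~= 0"
    using config_pos[OF z(2) lift_S[OF True]] lift_S[OF True]
    by (simp add: z(1) lines_of_def msqnorm_oncols homogeneous_cut restr_config_def)
  qed
  thus ?thesis using True by simp
 qed simp
 have c1: "continuous_on center to_small"
  unfolding to_small_def by (rule continuous_on_Pair[OF c11 continuous_on_funI[OF c12]])
 have c21: "continuous_on (model K ?K) (%z. fst z o b)"
  unfolding o_def by (rule continuous_on_funI) (rule cont_fst_coord[OF ids])
 have c22: "continuous_on (model K ?K) (%z. if p : S then act (%x. along p (x o b)) (snd z (descend (J p))) else (%_. zvec))" for p
 proof (cases "p : S")
  case True
  have "continuous_on (model K ?K) (%z. act (%x. along p (x o b)) (snd z (descend (J p))))"
   unfolding act_def
  proof (rule continuous_on_normalize)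
   fix i j show "continuous_on (model K ?K) (%z. oncols (%x. along p (x o b)) (snd z (descend (J p))) i j)"
    unfolding oncols_def along_def o_def by (intro continuous_on_diff cont_snd_matrix[OF ids])
  next
   fix z assume "z : model K ?K"
   then obtain w Y where z: "z = (w, lines_of ?K Y)" "config K ?K w Y" by (auto simp: model_def)
   have "sqnorm (ext_config Y p) > 0" by (rule config_pos[OF config_extend[OF z(2)] True]) simp
   thus "msqnorm (oncols (%x. along p (x o b)) (snd z (descend (J p)))) ~= 0"
    using small_pos[OF z(2) descend_J(1)[OF True]] descend_J(1)[OF True]
    by (simp add: z(1) lines_of_def msqnorm_oncols homogeneous_maps ext_config_def)
  qed
  thus ?thesis using True by simp
 qed simp
 have c2: "continuous_on (model K ?K) from_small"
  unfolding from_small_def by (rule continuous_on_Pair[OF c21 continuous_on_funI[OF c22]])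
 have "homeomorphic_maps (top_of_set (model K ?K)) (top_of_set center) from_small to_small"
  using c1 c2 to from_small_center from_to_small to_from_small by (auto simp: homeomorphic_maps_def)
 thus ?thesis by (auto simp: homeomorphic_space_def)
qed

theorem adjoin_even_hom:
 assumes M: "even_hom (top_of_set (model I S)) m" and Z: "even_hom (top_of_set (model K (pflats K))) h"
 shows "even_hom (top_of_set (model I (insert b S))) (%p. (\<Sum>j = 1..<card (moved b). h (p - 2 * int j)) + m p)"
proof -
 let ?X = "top_of_set (model I (insert b S))" and ?M = "top_of_set (model I S)"
 have eq: "nbhd_over S = nbhd"
 proof -
  have "forget z = z" if "z : model I S" for z
   using that forget_lines[of S] by (auto simp: model_def)
  thus ?thesis by (auto simp: nbhd_over_def nbhd_def)
 qed
 have sub: "center \<subseteq> model I S" "nbhd \<subseteq> model I S" by (auto simp: center_def nbhd_def)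
 have s1: "subtopology ?M center = top_of_set center" "subtopology ?M nbhd = top_of_set nbhd"
  "subtopology ?M (topspace ?M - center) = top_of_set (model I S - center)"
  using sub by (simp_all add: subtopology_subtopology Int_absorb1 Int_Diff)
 have s2: "subtopology ?X {x : topspace ?X. forget x : center} = top_of_set (center_over (insert b S))"
  "subtopology ?X {x : topspace ?X. forget x : nbhd} = top_of_set (nbhd_over (insert b S))"
  "subtopology ?X {x : topspace ?X. forget x ~: center} = top_of_set {z : model I (insert b S). forget z ~: center}"
  by (simp_all add: subtopology_subtopology center_over_def nbhd_over_def Collect_conj_eq Int_absorb1 Int_assoc[symmetric])
 have Z': "even_hom (top_of_set center) h"
  by (rule even_hom_homeomorphic[OF Z center_homeomorphic])
 show ?thesis
 proof (rule blowup_homology[of ?X ?M forget center nbhd])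
  show "continuous_map ?X ?M forget" using continuous_on_forget forget_model by auto
  show "closedin ?M center" by (rule closedin_center)
  show "openin ?M nbhd" by (rule openin_nbhd)
  show "center \<subseteq> nbhd" using center_over_subset[of S] by (simp add: center_eq eq)
  show "homeomorphic_map (subtopology ?X {x : topspace ?X. forget x ~: center}) (subtopology ?M (topspace ?M - center)) forget"
   unfolding s1 s2 using homeomorphic_off_center by (auto simp: homeomorphic_maps_map)
  show "hom_induced p (subtopology ?M center) {} (subtopology ?M nbhd) {} id
    : iso (HG p (subtopology ?M center)) (HG p (subtopology ?M nbhd))" for p
   unfolding s1 using center_inclusion_iso[of S p] by (simp add: center_eq eq)
  show "hom_induced p (subtopology ?X {x : topspace ?X. forget x : center}) {} (subtopology ?X {x : topspace ?X. forget x : nbhd}) {} id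
    : iso (HG p (subtopology ?X {x : topspace ?X. forget x : center}))
      (HG p (subtopology ?X {x : topspace ?X. forget x : nbhd}))" for p
   unfolding s2 using center_inclusion_iso[of "insert b S" p] by simp
  show "even_hom ?M m" by (rule M)
  show "even_fibration (subtopology ?X {x : topspace ?X. forget x : center}) (subtopology ?M center) forget
    (%p. \<Sum>j = 1..<card (moved b). h (p - 2 * int j))"
   unfolding s1 s2 by (rule even_fibration_center[OF Z'])
 qed
qed

end

section \<open>Induction over the adjoined flats\<close>

lemma free_rank_integer_group: "free_rank integer_group 1"
proof -
 have "(%c. c 0) : iso (Zn 1) integer_group"
 proof (rule isoI)
  show "(%c. c 0) : hom (Zn 1) integer_group" by (auto simp: hom_def)
  show "bij_betw (%c. c 0) (carrier (Zn 1)) (carrier integer_group)"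
   by (rule bij_betwI[where g = "%k i. if i = 0 then k else 0"]) (auto simp: carrier_Zn fun_eq_iff)
 qed
 thus ?thesis by (auto simp: free_rank_def abelian_integer_group)
qed

lemma even_hom_singleton:
 assumes "topspace X = {a}"
 shows "even_hom X (%p. if p = 0 then 1 else 0)"
proof -
 have "integer_group \<cong> HG 0 X"
  by (rule group.iso_sym[OF group_relative_homology_group homology_coefficients[OF assms]])
 hence "free_rank (HG 0 X) 1"
  by (rule free_rank_is_iso[OF free_rank_integer_group _ abelian_homology_group])
 moreover have "trivial_group (HG p X)" if "p ~= 0" for p
  using homology_dimension_axiom[OF assms that] .
 ultimately show ?thesis
  by (auto simp: even_hom_def intro: free_rank_trivial)
qed

lemma flat_image_card:
 assumes "b : pflats I" "finite I"
 shows "card (b ` I) < card I"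
proof -
 have "moved b ~= {}" "finite (moved b)"
  using assms moved_empty_iff finite_subset[OF moved_subset[of b I]] by (auto simp: pflats_def)
 hence "card (moved b) > 0" by (simp add: card_gt_0_iff)
 thus ?thesis using card_moved[of b I] assms by (simp add: pflats_def)
qed

text \<open>The quotient (q^c - q) / (q - 1), by \<open>q_factor_eq\<close>. It is zero for
  \<open>c = 1\<close>, in accordance with the fact that blowing up a divisor changes
  nothing.\<close>

definition qsum :: "nat => nat poly" where
 "qsum c = (\<Sum>j = 1..<c. Polynomial.monom 1 j)"

text \<open>One summand for each blow-up; its center is the full model on the block minima of
  \<open>b\<close>, and \<open>card (moved b)\<close> is the number of homogeneous coordinates of
  the fibre.\<close>

function flat_poly :: "nat set => nat poly" where
 "flat_poly I = (if finite I then 1 + (\<Sum>b\<in>pflats I. qsum (card (moved b)) * flat_poly (b ` I)) else 0)"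
 by auto
termination by (relation "measure card") (auto simp: flat_image_card)

declare flat_poly.simps [simp del]

definition even_coeff :: "nat poly => int => nat" where
 "even_coeff P p = (if p < 0 then 0 else poly.coeff P (nat (p div 2)))"

lemma even_coeff_add: "even_coeff (P + Q) p = even_coeff P p + even_coeff Q p"
 by (simp add: even_coeff_def)

lemma even_coeff_qsum_mult:
 assumes "even p"
 shows "even_coeff (qsum c * P) p = (\<Sum>j = 1..<c. even_coeff P (p - 2 * int j))"
proof (cases "p < 0")
 case True
 thus ?thesis by (simp add: even_coeff_def)
next
 case False
 have "even_coeff (qsum c * P) p = (\<Sum>j = 1..<c. poly.coeff (Polynomial.monom 1 j * P) (nat (p div 2)))"
  using False by (simp add: even_coeff_def qsum_def sum_distrib_right coeff_sum)
 also have "... = (\<Sum>j = 1..<c. even_coeff P (p - 2 * int j))"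
 proof (rule sum.cong[OF refl])
  fix j
  obtain m where "p = 2 * m" using assms by (rule evenE)
  hence "p = 2 * int (nat m)" using False by simp
  then obtain n where k: "p = 2 * int n" ..
  show "poly.coeff (Polynomial.monom 1 j * P) (nat (p div 2)) = even_coeff P (p - 2 * int j)"
  proof (cases "j <= n")
   case True
   hence "p - 2 * int j = 2 * int (n - j)" by (simp add: k of_nat_diff)
   thus ?thesis using True by (simp add: k even_coeff_def coeff_monom_mult nat_diff_distrib')
  next
   case False
   hence "p - 2 * int j < 0" by (simp add: k)
   thus ?thesis using False by (simp add: k even_coeff_def coeff_monom_mult)
  qed
 qed
 finally show ?thesis .
qed

context projective begin

text \<open>Without flats the model is the vector space itself, which scaling contracts to the
  origin.\<close>

lemma even_hom_model_empty:
 assumes "finite I" "I ~= {}"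
 shows "even_hom (top_of_set (model I {})) (even_coeff 1)"
proof -
 let ?M = "model I {}" and ?o = "(zvec, lines_of {} (%_. zvec)) :: model_point"
 have M: "?M = coords (moved (top_flat I)) \<times> {%_ _. zvec}"
  by (auto simp: model_def config_def lines_of_def)
 have o: "?o = (zvec, %_ _. zvec)" by (simp add: lines_of_def)
 have sv: "vscale c v : coords A" if "v : coords A" for c v A by (rule vscale_coords[OF that])
 let ?H = "%w :: real \<times> model_point. (vscale (of_real (fst w)) (fst (snd w)), snd (snd w))"
 let ?D = "{0..1::real} \<times> ?M"
 have id: "continuous_on ?D (%w. snd w)" by (rule continuous_on_snd[OF continuous_on_id])
 have "continuous_on ?D (%w. vscale (of_real (fst w)) (fst (snd w)))"
  unfolding vscale_def
  by (rule continuous_on_funI)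
   (intro continuous_on_mult cont_fst_coord[OF id] continuous_on_of_real continuous_on_fst[OF continuous_on_id])
 hence "continuous_on ?D ?H"
  by (intro continuous_on_Pair continuous_on_snd[OF id])
 hence "homotopic_with (%h. True) (top_of_set ?M) (top_of_set ?M) (%z. ?H (0, z)) (%z. ?H (1, z))"
  unfolding homotopic_with_def by (intro exI[of _ ?H]) (auto simp: M sv)
 hence h: "homotopic_with (%h. True) (top_of_set ?M) (top_of_set ?M) (%z. ?o) id"
  by (rule homotopic_with_eq) (auto simp: M o)
 have oM: "?o : ?M" by (auto simp: M o coords_def)
 have "retraction_maps (top_of_set ?M) (top_of_set {?o}) (%z. ?o) id"
  using oM by (auto simp: retraction_maps_def)
 hence "HG p (top_of_set ?M) \<cong> HG p (top_of_set {?o})" for p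
  by (rule deformation_retract_imp_isomorphic_homology_groups[OF _ h])
 hence iso: "HG p (top_of_set {?o}) \<cong> HG p (top_of_set ?M)" for p
  by (simp add: group.iso_sym)
 have pt: "even_hom (top_of_set {?o}) (%p. if p = 0 then 1 else 0)"
  by (rule even_hom_singleton) simp
 have "even_coeff 1 p = (if p = 0 then 1 else 0)" if "even p" for p
  using that by (auto simp: even_coeff_def)
 hence "even_hom (top_of_set {?o}) (even_coeff 1)"
  using pt by (simp add: even_hom_def)
 moreover have "free_rank (HG p (top_of_set {?o})) r ==> free_rank (HG p (top_of_set ?M)) r"
  "trivial_group (HG p (top_of_set {?o})) ==> trivial_group (HG p (top_of_set ?M))" for p r
  using free_rank_is_iso[OF _ iso abelian_homology_group] isomorphic_group_triviality1[OF iso group_relative_homology_group] by blast+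
 ultimately show ?thesis by (simp add: even_hom_def)
qed

text \<open>The last flat to be adjoined is one with the fewest moved elements. If it were coarser
  than another member, the two moved sets would coincide, which forces comparable flats to be
  equal.\<close>

lemma coarser_cl_remove:
 assumes S: "coarser_cl I S" "S ~= {}" and I: "finite I"
 obtains b where "b : S" "coarser_cl I (S - {b})"
proof -
 have SF: "S \<subseteq> pflats I" using S(1) by (simp add: coarser_cl_def)
 have fin: "finite S"
  using finite_subset[OF SF] finite_flats[OF I] by (simp add: pflats_def)
 obtain b where b: "b : S" "!!p. p : S ==> card (moved b) <= card (moved p)"
  using ex_has_least_nat[of "%p. p : S" _ "%p. card (moved p)"] S(2) by blast
 have "coarser_cl I (S - {b})"
  unfolding coarser_cl_def
 proof (intro conjI ballI impI)
  show "S - {b} \<subseteq> pflats I" using SF by auto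
  fix p t assume p: "p : S - {b}" and t: "t : flats I" "t o p = t"
  have pF: "p : flats I" using p SF by (auto simp: pflats_def)
  have "t ~= b"
  proof
   assume "t = b"
   hence "moved p \<subseteq> moved b" using coarser_fixed[OF t(1) pF t(2)] by (auto simp: moved_def)
   moreover have "finite (moved b)" using finite_subset[OF moved_subset[of b I] I] b(1) SF by (auto simp: pflats_def)
   ultimately have eq: "moved p = moved b" using b(2)[of p] p by (metis DiffD1 card_seteq)
   have "p o b = p"
   proof
    fix i
    have "b (b i) = b i" using `t = b` flatsD(1)[OF t(1)] by simp
    hence 1: "p (b i) = b i" using eq by (auto simp: moved_def)
    have "p (p i) = p i" using flatsD(1)[OF pF] by simp
    hence "b (p i) = p i" using eq by (auto simp: moved_def)
    moreover have "b (p i) = b i" using t(2) `t = b` by (auto simp: fun_eq_iff)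
    ultimately show "(p o b) i = p i" using 1 by simp
   qed
   thus False using finer_antisym[OF pF t(1)] t(2) `t = b` p by auto
  qed
  thus "t : S - {b}" using S(1) p t by (auto simp: coarser_cl_def)
 qed
 thus ?thesis using that b(1) by blast
qed

text \<open>The inner induction, on the number of adjoined flats. The centers are full models on
  smaller index sets, supplied by the outer induction on \<open>card I\<close>.\<close>

lemma even_hom_model_aux:
 assumes I: "I \<subseteq> {..<N}" "I ~= {}"
  and IH: "!!b. b : pflats I ==> even_hom (top_of_set (model (b ` I) (pflats (b ` I)))) (even_coeff (flat_poly (b ` I)))"
 shows "coarser_cl I S ==> even_hom (top_of_set (model I S)) (even_coeff (1 + (\<Sum>b\<in>S. qsum (card (moved b)) * flat_poly (b ` I))))"
proof (induct "card S" arbitrary: S rule: less_induct)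
 case less
 have finI: "finite I" using I finite_subset by auto
 have S_sub: "S \<subseteq> pflats I" using less(2) by (simp add: coarser_cl_def)
 have fin_S: "finite S"
  using finite_subset[OF S_sub] finite_flats[OF finI] by (simp add: pflats_def)
 show ?case
 proof (cases "S = {}")
  case True
  thus ?thesis using even_hom_model_empty[OF finI I(2)] by simp
 next
  case False
  then obtain b where bS: "b : S" "coarser_cl I (S - {b})"
   using coarser_cl_remove[OF less(2) _ finI] by blast
  interpret adjoin_flat N I "S - {b}" b
  proof
   show "b : pflats I" using bS S_sub by auto
   fix t assume "t : flats I" "t o b = t" "t ~= b"
   thus "t : S - {b}" using less(2) bS(1) by (auto simp: coarser_cl_def)
  qed (use I bS in auto)
  have "card (S - {b}) < card S" using bS(1) fin_S by (metis card_Diff1_less)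
  hence "even_hom (top_of_set (model I (S - {b}))) (even_coeff (1 + (\<Sum>b\<in>S - {b}. qsum (card (moved b)) * flat_poly (b ` I))))"
   using less(1) bS(2) by blast
  moreover have "even_hom (top_of_set (model (b ` I) (pflats (b ` I)))) (even_coeff (flat_poly (b ` I)))"
   using IH S_sub bS(1) by blast
  ultimately have *: "even_hom (top_of_set (model I (insert b (S - {b}))))
    (%p. (\<Sum>j = 1..<card (moved b). even_coeff (flat_poly (b ` I)) (p - 2 * int j))
     + even_coeff (1 + (\<Sum>b\<in>S - {b}. qsum (card (moved b)) * flat_poly (b ` I))) p)"
   by (rule adjoin_even_hom)
  have sum: "1 + (\<Sum>b\<in>S. qsum (card (moved b)) * flat_poly (b ` I)) =
    qsum (card (moved b)) * flat_poly (b ` I) + (1 + (\<Sum>b\<in>S - {b}. qsum (card (moved b)) * flat_poly (b ` I)))"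
   using sum.remove[OF fin_S bS(1), of "%b. qsum (card (moved b)) * flat_poly (b ` I)"] by (simp add: algebra_simps)
  show ?thesis
   using * bS(1) unfolding sum even_hom_def
   by (simp add: even_coeff_add even_coeff_qsum_mult insert_absorb cong: if_cong)
 qed
qed

theorem even_hom_model:
 assumes "I \<subseteq> {..<N}" "I ~= {}"
 shows "even_hom (top_of_set (model I (pflats I))) (even_coeff (flat_poly I))"
 using assms
proof (induct "card I" arbitrary: I rule: less_induct)
 case less
 have finI: "finite I" using less(2) finite_subset by auto
 have "coarser_cl I (pflats I)"
  unfolding coarser_cl_def
 proof (intro conjI ballI impI)
  fix p t assume p: "p : pflats I" and t: "t : flats I" "t o p = t"
  hence "t ~= id" by (auto simp: pflats_def)
  thus "t : pflats I" using t by (simp add: pflats_def)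
 qed simp
 moreover have "even_hom (top_of_set (model (b ` I) (pflats (b ` I)))) (even_coeff (flat_poly (b ` I)))" if b: "b : pflats I" for b
 proof (rule less(1))
  show "card (b ` I) < card I" by (rule flat_image_card[OF b finI])
  show "b ` I \<subseteq> {..<N}" using b less(2) by (auto simp: pflats_def dest!: flatsD(3))
 qed (use less(3) in simp)
 ultimately have "even_hom (top_of_set (model I (pflats I))) (even_coeff (1 + (\<Sum>b\<in>pflats I. qsum (card (moved b)) * flat_poly (b ` I))))"
  by (intro even_hom_model_aux less(2,3))
 thus ?case using finI by (simp add: flat_poly.simps[of I])
qed

end

section \<open>Cohomology of spaces with free homology\<close>

text \<open>Subgroups of free abelian groups are projective; what is needed is that a homomorphism from the kernel of a
 map into a free abelian group extends to the whole domain. A partial extension together with its set `T` of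
 admissible basis elements is coded as one set, so that Zorn's lemma for inclusion applies.\<close>

lemma extend_hom_from_kernel:
 fixes f :: "('c \<Rightarrow>\<^sub>0 int) => ('s \<Rightarrow>\<^sub>0 int)" and ps :: "('c \<Rightarrow>\<^sub>0 int) => int"
 assumes C: "0 : C" "!!a b. a : C ==> b : C ==> a - b : C" "!!k a. a : C ==> frag_cmul k a : C"
  and f: "!!a b. f (a - b) = f a - f b" "!!k a. f (frag_cmul k a) = frag_cmul k (f a)"
  and ps: "!!a b. a : C ==> b : C ==> f a = 0 ==> f b = 0 ==> ps (a - b) = ps a - ps b"
 shows "EX ph. (\<forall>a\<in>C. \<forall>b\<in>C. ph (a - b) = ph a - ph b) & (\<forall>a\<in>C. f a = 0 --> ph a = (ps a :: int))"
proof -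
 define dom where "dom T = {c : C. Poly_Mapping.keys (f c) \<subseteq> T}" for T
 define code where "code T ph = Inl ` T Un Inr ` {(c, ph c) | c. c : dom T}" for T and ph :: "('c \<Rightarrow>\<^sub>0 int) => int"
 define good where "good T ph \<longleftrightarrow> (\<forall>a\<in>dom T. \<forall>b\<in>dom T. ph (a - b) = ph a - ph b) & (\<forall>a\<in>C. f a = 0 --> ph a = ps a)"
  for T and ph :: "('c \<Rightarrow>\<^sub>0 int) => int"
 define \<A> where "\<A> = {code T ph | T ph. good T ph}"
 have domD: "a - b : dom T" if "a : dom T" "b : dom T" for a b T
  using that C(2) keys_diff[of "f a" "f b"] by (auto simp: dom_def f)
 have dom_ker: "a : dom T" if "a : C" "f a = 0" for a T
  using that by (simp add: dom_def)
 have codeI: "Inl t : code T ph \<longleftrightarrow> t : T" "Inr (c, x) : code T ph \<longleftrightarrow> c : dom T & x = ph c" for t T ph c x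
  by (auto simp: code_def)
 have "\<exists>M\<in>\<A>. \<forall>X\<in>\<A>. M \<subseteq> X --> X = M"
 proof (rule subset_Zorn_nonempty)
  have "dom {} = {c : C. f c = 0}" by (auto simp: dom_def)
  hence "good {} ps" using ps by (auto simp: good_def)
  thus "\<A> ~= {}" by (auto simp: \<A>_def)
  fix \<C> assume ne: "\<C> ~= {}" and ch: "subset.chain \<A> \<C>"
  define T where "T = {t. Inl t : \<Union>\<C>}"
  have mem: "EX T' ph. U = code T' ph & good T' ph & T' \<subseteq> T" if "U : \<C>" for U
  proof -
   have "U : \<A>" using ch that by (auto simp: subset.chain_def)
   then obtain T' ph where "U = code T' ph" "good T' ph" by (auto simp: \<A>_def)
   moreover have "T' \<subseteq> T" using that calculation(1) codeI(1) by (auto simp: T_def)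
   ultimately show ?thesis by blast
  qed
  have common: "EX T' ph. code T' ph : \<C> & good T' ph & F \<subseteq> dom T'" if F: "finite F" "F \<subseteq> dom T" for F
  proof -
   let ?K = "\<Union>c\<in>F. Inl ` Poly_Mapping.keys (f c)"
   have "finite ?K" using F(1) by auto
   moreover have "?K \<subseteq> \<Union>\<C>" using F(2) by (auto simp: dom_def T_def)
   ultimately obtain U where U: "U : \<C>" "?K \<subseteq> U"
    using finite_subset_Union_chain[OF _ _ ne ch] by metis
   then obtain T' ph where "U = code T' ph" "good T' ph" using mem by blast
   moreover have "F \<subseteq> dom T'"
   proof
    fix c assume c: "c : F"
    have "t : T'" if "t : Poly_Mapping.keys (f c)" for t
    proof -
     have "Inl t : U" using that c U(2) by blast
     thus ?thesis using calculation(1) by (simp add: codeI)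
    qed
    thus "c : dom T'" using c F(2) by (auto simp: dom_def)
   qed
   ultimately show ?thesis using U(1) by blast
  qed
  define Ph where "Ph c = (THE x. Inr (c, x) : \<Union>\<C>)" for c
  have Ph: "Ph c = ph c" if "code T' ph : \<C>" "c : dom T'" for c T' ph
   unfolding Ph_def
  proof (rule the_equality)
   show "Inr (c, ph c) : \<Union>\<C>" using that by (intro UnionI[OF that(1)]) (simp add: codeI)
   fix x assume "Inr (c, x) : \<Union>\<C>"
   then obtain U where U: "U : \<C>" "Inr (c, x) : U" by blast
   have "U \<subseteq> code T' ph | code T' ph \<subseteq> U" using subset.chain_total[OF ch U(1) that(1)] by auto
   thus "x = ph c"
   proof
    assume "U \<subseteq> code T' ph"
    hence "Inr (c, x) : code T' ph" using U(2) by blast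
    thus ?thesis by (simp add: codeI)
   next
    assume "code T' ph \<subseteq> U"
    moreover have "Inr (c, ph c) : code T' ph" using that(2) by (simp add: codeI)
    ultimately have 1: "Inr (c, ph c) : U" by blast
    obtain T'' ph' where "U = code T'' ph'" using mem[OF U(1)] by blast
    hence "x = ph' c" "ph c = ph' c" using 1 U(2) by (simp_all add: codeI)
    thus ?thesis by simp
   qed
  qed
  have "good T Ph"
   unfolding good_def
  proof (intro conjI ballI impI)
   fix a b assume "a : dom T" "b : dom T"
   then obtain T' ph where T': "code T' ph : \<C>" "good T' ph" "{a, b} \<subseteq> dom T'" using common[of "{a, b}"] by auto
   thus "Ph (a - b) = Ph a - Ph b"
    using Ph[OF T'(1)] domD by (auto simp: good_def)
  next
   fix a assume a: "a : C" "f a = 0"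
   obtain T' ph where T': "code T' ph : \<C>" "good T' ph" using common[of "{}"] by auto
   thus "Ph a = ps a" using Ph[OF T'(1) dom_ker] a by (simp add: good_def)
  qed
  moreover have "code T Ph = \<Union>\<C>"
  proof (intro equalityI subsetI)
   fix z assume z: "z : code T Ph"
   show "z : \<Union>\<C>"
   proof (cases z)
    case (Inl t)
    thus ?thesis using z by (auto simp: T_def codeI)
   next
    case (Inr w)
    then obtain c where c: "z = Inr (c, Ph c)" "c : dom T" using z by (auto simp: code_def)
    then obtain T' ph where T': "code T' ph : \<C>" "{c} \<subseteq> dom T'" using common[of "{c}"] by auto
    thus ?thesis using c Ph[OF T'(1), of c] by (intro UnionI[OF T'(1)]) (simp add: codeI)
   qed
  next
   fix z assume "z : \<Union>\<C>"
   then obtain U where U: "U : \<C>" "z : U" by blast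
   then obtain T' ph where T': "U = code T' ph" "T' \<subseteq> T" using mem by blast
   have "dom T' \<subseteq> dom T" using T'(2) by (auto simp: dom_def)
   hence "code T' ph \<subseteq> code T Ph" using U(1) T' Ph[of T' ph] unfolding code_def by force
   thus "z : code T Ph" using U(2) T'(1) by blast
  qed
  ultimately show "\<Union>\<C>\<in>\<A>" unfolding \<A>_def by blast
 qed
 then obtain M where M: "M : \<A>" "!!X. X : \<A> ==> M \<subseteq> X ==> X = M" by blast
 then obtain T ph where g: "good T ph" and MT: "M = code T ph" by (auto simp: \<A>_def)
 have max: "code T' ph' = code T ph" if h: "good T' ph'" "code T ph \<subseteq> code T' ph'" for T' ph'
 proof -
  have "code T' ph' : \<A>" unfolding \<A>_def using h(1) by blast
  thus ?thesis using M(2) h(2) unfolding MT by blast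
 qed
 have "T = UNIV"
 proof (rule ccontr)
  assume "T ~= UNIV"
  then obtain t where t: "t ~: T" by auto
  let ?T = "insert t T"
  define A where "A = (%c. Poly_Mapping.lookup (f c) t) ` dom ?T"
  have lk: "Poly_Mapping.lookup (f (a - b)) t = Poly_Mapping.lookup (f a) t - Poly_Mapping.lookup (f b) t" for a b
   by (simp add: f lookup_minus)
  have lkc: "Poly_Mapping.lookup (f (frag_cmul k a)) t = k * Poly_Mapping.lookup (f a) t" for k a
   by (simp add: f)
  have cm: "frag_cmul k a : dom ?T" if "a : dom ?T" for k a
   using that C(3) keys_cmul[of k "f a"] by (auto simp: dom_def f)
  have sub: "c : dom T" if "c : dom ?T" "Poly_Mapping.lookup (f c) t = 0" for c
   using that by (auto simp: dom_def in_keys_iff)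
  have domT: "c : dom ?T" "Poly_Mapping.lookup (f c) t = 0" if "c : dom T" for c
   using that t by (auto simp: dom_def in_keys_iff)
  have "EX ph'. good ?T ph' & (\<forall>c\<in>dom T. ph' c = ph c)"
  proof (cases "A \<subseteq> {0}")
   case True
   hence "dom ?T = dom T" using sub domT by (auto simp: A_def)
   thus ?thesis using g by (intro exI[of _ ph]) (simp add: good_def)
  next
   case False
   then obtain c1 where c1: "c1 : dom ?T" "Poly_Mapping.lookup (f c1) t ~= 0" by (auto simp: A_def)
   \<comment> \<open>The coordinates at \<open>t\<close> of the elements of the enlarged domain form
     the nonzero subgroup of the integers generated by \<open>n\<close>. Subtracting multiples of an
     element \<open>c0\<close> that realises \<open>n\<close> leads back to the old domain; the
     extension sends \<open>c0\<close> to 0.\<close>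
   define n where "n = (LEAST n::nat. n > 0 & int n : A)"
   have "\<exists>n::nat. n > 0 & int n : A"
   proof (cases "Poly_Mapping.lookup (f c1) t > 0")
    case True
    moreover have "Poly_Mapping.lookup (f c1) t : A" using c1(1) by (simp add: A_def)
    ultimately show ?thesis by (intro exI[of _ "nat (Poly_Mapping.lookup (f c1) t)"]) simp
   next
    case False
    have "- Poly_Mapping.lookup (f c1) t : A"
     unfolding A_def by (rule image_eqI[OF _ cm[OF c1(1), of "-1"]]) (subst lkc, simp)
    thus ?thesis using c1 False by (intro exI[of _ "nat (- Poly_Mapping.lookup (f c1) t)"]) auto
   qed
   hence n: "n > 0" "int n : A" and least: "!!m::nat. m > 0 ==> int m : A ==> n <= m"
    using LeastI_ex[of "%n::nat. n > 0 & int n : A"] Least_le[of "%n::nat. n > 0 & int n : A"]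
    unfolding n_def by blast+
   then obtain c0 where c0: "c0 : dom ?T" "Poly_Mapping.lookup (f c0) t = int n" by (auto simp: A_def)
   define k where "k c = Poly_Mapping.lookup (f c) t div int n" for c
   have k: "Poly_Mapping.lookup (f c) t = k c * int n" if c: "c : dom ?T" for c
   proof -
    let ?r = "Poly_Mapping.lookup (f c) t mod int n"
    have "?r = Poly_Mapping.lookup (f (c - frag_cmul (k c) c0)) t"
     by (simp add: lk lkc c0 k_def minus_div_mult_eq_mod)
    moreover have "c - frag_cmul (k c) c0 : dom ?T" by (intro domD c cm c0)
    ultimately have "?r : A" unfolding A_def by blast
    moreover have "0 <= ?r" "?r < int n" using n(1) by simp_all
    ultimately have "?r = 0" using least[of "nat ?r"] by (cases "?r = 0") auto
    thus ?thesis by (simp add: k_def) (metis div_mult_mod_eq add.right_neutral)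
   qed
   have red: "c - frag_cmul (k c) c0 : dom T" if c: "c : dom ?T" for c
    using k[OF c] by (intro sub domD c cm c0) (simp add: lk lkc c0)
   define ph' where "ph' c = ph (c - frag_cmul (k c) c0)" for c
   have ext: "ph' c = ph c" if "c : dom T" for c
    using domT(2)[OF that] by (simp add: ph'_def k_def)
   have "good ?T ph'"
    unfolding good_def
   proof (intro conjI ballI impI)
    fix a b assume a: "a : dom ?T" and b: "b : dom ?T"
    have "k (a - b) * int n = (k a - k b) * int n"
     using k[OF a] k[OF b] k[OF domD[OF a b]] by (simp add: lk left_diff_distrib)
    hence "k (a - b) = k a - k b" using n(1) by simp
    hence "a - b - frag_cmul (k (a - b)) c0 = (a - frag_cmul (k a) c0) - (b - frag_cmul (k b) c0)"
     by (intro poly_mapping_eqI) (simp add: lookup_minus left_diff_distrib)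
    thus "ph' (a - b) = ph' a - ph' b"
     using g red[OF a] red[OF b] unfolding ph'_def good_def by presburger
   next
    fix a assume "a : C" "f a = 0"
    thus "ph' a = ps a" using g ext dom_ker by (simp add: good_def)
   qed
   thus ?thesis using ext by blast
  qed
  then obtain ph' where ph': "good ?T ph'" "!!c. c : dom T ==> ph' c = ph c" by blast
  have "code T ph \<subseteq> code ?T ph'"
   using ph'(2) domT(1) by (auto simp: code_def)
  hence "code ?T ph' = code T ph" using max ph'(1) by blast
  hence "Inl t : code T ph" by (metis codeI(1) insertI1)
  thus False using t by (simp add: codeI)
 qed
 hence "dom T = C" by (auto simp: dom_def)
 thus ?thesis using g unfolding good_def by blast
qed

section \<open>Cochains, cocycles and ranks\<close>

lemma carrier_cochain:
 "carrier (cochain_group p X) =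
  {ph. (ALL a b. singular_chain p X a --> singular_chain p X b --> ph (a + b) = ph a + ph b) \<and>
   ph : extensional (Collect (singular_chain p X))}"
 by (auto simp: cochain_group_def hom_def)

lemma mult_cochain_group [simp]:
  "ph \<otimes>\<^bsub>cochain_group p X\<^esub> ps = (\<lambda>c\<in>Collect (singular_chain p X). ph c + ps c)"
 and one_cochain_group [simp]: "\<one>\<^bsub>cochain_group p X\<^esub> = (\<lambda>c\<in>Collect (singular_chain p X). 0)"
 by (simp_all add: cochain_group_def)

lemma cochain_minus:
 assumes "ph : carrier (cochain_group p X)" "singular_chain p X a" "singular_chain p X b"
 shows "ph (a - b) = ph a - ph b"
proof -
 have "ph ((a - b) + b) = ph (a - b) + ph b"
  using assms singular_chain_diff[OF assms(2,3)] unfolding carrier_cochain by blast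
 thus ?thesis by simp
qed

lemma comm_group_cochain_group: "comm_group (cochain_group p X)"
proof (rule comm_groupI)
 fix x assume x: "x : carrier (cochain_group p X)"
 show "\<exists>y\<in>carrier (cochain_group p X). y \<otimes>\<^bsub>cochain_group p X\<^esub> x = \<one>\<^bsub>cochain_group p X\<^esub>"
 proof
  let ?y = "\<lambda>c\<in>Collect (singular_chain p X). - x c"
  show "?y : carrier (cochain_group p X)"
   using x by (auto simp: carrier_cochain singular_chain_add)
  show "?y \<otimes>\<^bsub>cochain_group p X\<^esub> x = \<one>\<^bsub>cochain_group p X\<^esub>"
   by (auto simp: fun_eq_iff)
 qed
next
 fix x assume "x : carrier (cochain_group p X)"
 thus "\<one>\<^bsub>cochain_group p X\<^esub> \<otimes>\<^bsub>cochain_group p X\<^esub> x = x"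
  by (auto simp: carrier_cochain fun_eq_iff extensional_def)
qed (auto simp: carrier_cochain singular_chain_add fun_eq_iff)

lemma mem_cocycle_set:
 "ph : cocycle_set p X \<longleftrightarrow> ph : carrier (cochain_group p X) \<and>
  (ALL c. singular_chain (Suc p) X c --> ph (chain_boundary (Suc p) c) = 0)"
 by (auto simp: cocycle_set_def kernel_def coboundary_def cochain_group_def fun_eq_iff)

lemma singular_chain_boundary': "singular_chain (Suc p) X c ==> singular_chain p X (chain_boundary (Suc p) c)"
 using singular_chain_boundary[of "Suc p" X c] by simp

lemma subgroup_cocycle_set: "subgroup (cocycle_set p X) (cochain_group p X)"
proof -
 interpret G: comm_group "cochain_group p X" by (rule comm_group_cochain_group)
 show ?thesis
 proof (rule G.subgroupI)
  have "\<one>\<^bsub>cochain_group p X\<^esub> : cocycle_set p X"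
   unfolding mem_cocycle_set using G.one_closed
   by (intro conjI allI impI) (assumption, simp add: singular_chain_boundary')
  thus "cocycle_set p X ~= {}" by blast
  fix a assume a: "a : cocycle_set p X"
  hence ac: "a : carrier (cochain_group p X)" by (simp add: mem_cocycle_set)
  have inv: "(inv\<^bsub>cochain_group p X\<^esub> a) c = - a c" if c: "singular_chain p X c" for c
  proof -
   have "(inv\<^bsub>cochain_group p X\<^esub> a \<otimes>\<^bsub>cochain_group p X\<^esub> a) c = \<one>\<^bsub>cochain_group p X\<^esub> c"
    using ac by (simp only: G.l_inv)
   thus ?thesis using c by simp
  qed
  thus "inv\<^bsub>cochain_group p X\<^esub> a : cocycle_set p X"
   using a by (auto simp: mem_cocycle_set singular_chain_boundary' inv)
  fix b assume b: "b : cocycle_set p X"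
  thus "a \<otimes>\<^bsub>cochain_group p X\<^esub> b : cocycle_set p X"
   using a G.m_closed[of a b] unfolding mem_cocycle_set
   by (intro conjI allI impI) (blast, simp add: singular_chain_boundary')
 qed (auto simp: mem_cocycle_set)
qed

text \<open>Cycles are the kernel of a homomorphism into a free abelian group, so they are a direct
  summand of the chains.\<close>

lemma cochain_extension:
 assumes "!!a b. singular_relcycle p X {} a ==> singular_relcycle p X {} b ==> ps (a - b) = ps a - (ps b :: int)"
 shows "\<exists>ph\<in>carrier (cochain_group p X). ALL a. singular_relcycle p X {} a --> ph a = ps a"
proof -
 have "EX ph. (\<forall>a\<in>Collect (singular_chain p X). \<forall>b\<in>Collect (singular_chain p X). ph (a - b) = ph a - ph b) \<and>
   (\<forall>a\<in>Collect (singular_chain p X). chain_boundary p a = 0 --> ph a = ps a)"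
 proof (rule extend_hom_from_kernel)
  show "!!a b. a : Collect (singular_chain p X) ==> b : Collect (singular_chain p X) ==>
   chain_boundary p a = 0 ==> chain_boundary p b = 0 ==> ps (a - b) = ps a - ps b"
   using assms by (simp add: singular_cycle)
 qed (simp_all add: singular_chain_diff singular_chain_cmul chain_boundary_diff chain_boundary_cmul)
 then obtain ph where ph: "!!a b. singular_chain p X a ==> singular_chain p X b ==> ph (a - b) = ph a - ph b"
   and ex: "!!a. singular_chain p X a ==> chain_boundary p a = 0 ==> ph a = ps a"
  by auto
 have 0: "singular_chain p X 0" "ph 0 = 0" using ph[of 0 0] by auto
 have "ph (a + b) = ph a + ph b" if "singular_chain p X a" "singular_chain p X b" for a b
  using that ph[of a "0 - b"] ph[of 0 b] 0 singular_chain_diff[of p X 0 b] by simp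
 thus ?thesis using ex
  by (intro bexI[of _ "restrict ph (Collect (singular_chain p X))"])
   (auto simp: carrier_cochain singular_cycle singular_chain_add)
qed

text \<open>The universal coefficient theorem when the preceding homology group vanishes. Evaluation
  at cycles \<open>z j\<close> representing a basis of homology maps the cocycles onto
  \<open>Zn r\<close>; its kernel consists of the cocycles that vanish on all cycles, and
  \<open>H'\<close> shows that these are coboundaries.\<close>

lemma free_rank_cohomology_group:
 assumes H: "free_rank (HG (int p) X) r"
  and H': "p > 0 ==> trivial_group (HG (int p - 1) X)"
 shows "free_rank (cohomology_group p X) r"
proof -
 let ?cyc = "singular_relcycle p X {}" and ?bd = "singular_relboundary p X {}"
 let ?cls = "homologous_rel_set p X {}" and ?H = "HG (int p) X"
 let ?G = "cochain_group p X"
 interpret G: comm_group ?G by (rule comm_group_cochain_group)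
 interpret Z: subgroup "cocycle_set p X" ?G by (rule subgroup_cocycle_set)
 define Z where "Z = subgroup_generated ?G (cocycle_set p X)"
 have carZ: "carrier Z = cocycle_set p X"
  by (simp add: Z_def subgroup.carrier_subgroup_generated_subgroup[OF subgroup_cocycle_set])
 have grZ: "group Z" by (simp add: Z_def)
 have multZ: "x \<otimes>\<^bsub>Z\<^esub> y = x \<otimes>\<^bsub>?G\<^esub> y" for x y by (simp add: Z_def)
 obtain h where "h : iso (Zn r) ?H" using H by (auto simp: free_rank_def)
 hence "inv_into (carrier (Zn r)) h : iso ?H (Zn r)"
  by (intro group.iso_set_sym comm_Zn[THEN comm_group.axioms(2)])
 then obtain \<theta> where \<theta>: "\<theta> : iso ?H (Zn r)" by blast
 define ka where "ka c = \<theta> (?cls c)" for c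
 have clsH: "?cls c : carrier ?H" if "?cyc c" for c
  using that by (auto simp: carrier_relative_homology_group)
 have cls_add: "?cls (a + b) = ?cls a \<otimes>\<^bsub>?H\<^esub> ?cls b" if "?cyc a" "?cyc b" for a b
 proof -
  have "r_coset (relcycle_group p X {}) (singular_relboundary_set p X {}) (a \<otimes>\<^bsub>relcycle_group p X {}\<^esub> b) =
   set_mult (relcycle_group p X {}) (r_coset (relcycle_group p X {}) (singular_relboundary_set p X {}) a) (r_coset (relcycle_group p X {}) (singular_relboundary_set p X {}) b)"
   by (rule normal.rcos_sum[OF normal_subgroup_singular_relboundary_relcycle, symmetric]) (use that in auto)
  thus ?thesis
   by (simp add: right_coset_singular_relboundary nontrivial_relative_homology_group FactGroup_def)
 qed
 have ka_in: "ka c : carrier (Zn r)" if "?cyc c" for c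
  using clsH[OF that] \<theta> by (auto simp: ka_def iso_def bij_betw_def)
 have ka_add: "ka (a + b) j = ka a j + ka b j" if "?cyc a" "?cyc b" for a b j
  using \<theta> clsH that by (simp add: ka_def cls_add iso_def hom_def)
 have ka_diff: "ka (a - b) j = ka a j - ka b j" if "?cyc a" "?cyc b" for a b j
  using ka_add[of "a - b" b j] that singular_relcycle_diff by (metis add_diff_cancel diff_add_cancel)
 have ka_bd: "ka c = (%_. 0) \<longleftrightarrow> ?bd c" if "?cyc c" for c
 proof -
  have 1: "\<theta> \<one>\<^bsub>?H\<^esub> = \<one>\<^bsub>Zn r\<^esub>"
   using \<theta> comm_Zn by (intro hom_one) (auto simp: iso_def comm_group_def)
  have inj: "inj_on \<theta> (carrier ?H)" using \<theta> by (simp add: iso_def bij_betw_def)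
  have 2: "\<one>\<^bsub>?H\<^esub> : carrier ?H" by (rule group.is_monoid[OF group_relative_homology_group, THEN monoid.one_closed])
  have "ka c = (%_. 0) \<longleftrightarrow> \<theta> (?cls c) = \<theta> \<one>\<^bsub>?H\<^esub>"
   unfolding 1 ka_def by simp
  also have "... \<longleftrightarrow> ?cls c = \<one>\<^bsub>?H\<^esub>"
   by (rule inj_on_eq_iff[OF inj clsH[OF that] 2])
  finally have "ka c = (%_. 0) \<longleftrightarrow> ?cls c = \<one>\<^bsub>?H\<^esub>" .
  thus ?thesis by (simp add: homologous_rel_set_eq_relboundary)
 qed
 have ka_surj: "EX c. ?cyc c & ka c = m" if "m : carrier (Zn r)" for m
 proof -
  have "\<theta> ` carrier ?H = carrier (Zn r)" using \<theta> by (auto simp: iso_def bij_betw_def)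
  hence "m : \<theta> ` carrier ?H" using that by simp
  thus ?thesis unfolding carrier_relative_homology_group ka_def by blast
 qed
 define z where "z j = (SOME c. ?cyc c & ka c = Zn_unit j)" for j
 have z: "?cyc (z j)" "ka (z j) = Zn_unit j" if "j < r" for j
  using someI_ex[OF ka_surj[of "Zn_unit j"]] that by (auto simp: z_def carrier_Zn Zn_unit_def)
 have cm1: "?cyc (frag_cmul k c)" if "?cyc c" for k c
  using that by (simp add: singular_cycle singular_chain_cmul chain_boundary_cmul)
 have cm2: "ka (frag_cmul k c) i = k * ka c i" if "?cyc c" for k c i
 proof -
  note cc = cm1[OF that]
  have 0: "?cyc 0" by (simp add: singular_cycle)
  have nn: "ka (frag_cmul (int n) c) i = int n * ka c i" for n
  proof (induct n)
   case 0
   have "?cyc 0" by (simp add: singular_cycle)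
   thus ?case using ka_add[of 0 0 i] by simp
  next
   case (Suc n)
   have "frag_cmul (int (Suc n)) c = frag_cmul (int n) c + c" by (simp add: frag_cmul_distrib)
   thus ?case using Suc ka_add[OF cc that, of "int n" i] by (simp only:) (simp add: algebra_simps)
  qed
  show "ka (frag_cmul k c) i = k * ka c i"
  proof (cases "k >= 0")
   case True
   thus ?thesis using nn[of "nat k"] by simp
  next
   case False
   have "frag_cmul k c = 0 - frag_cmul (int (nat (- k))) c" using False by simp
   thus ?thesis using ka_diff[OF 0 cc, of "int (nat (- k))" i] nn[of 0] nn[of "nat (-k)"] False by simp
  qed
 qed
 define comb where "comb m s = (\<Sum>j<s. frag_cmul (m j) (z j))" for m :: "nat => int" and s :: nat
 have comb: "?cyc (comb m s) & (ALL i. ka (comb m s) i = (if i < s then m i else 0))" if "s <= r" for m s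
  using that
 proof (induct s)
  case 0
  have 0: "?cyc 0" by (simp add: singular_cycle)
  thus ?case using cm2[OF 0, of 0] by (simp add: comb_def)
 next
  case (Suc s)
  hence s: "s < r" by simp
  hence "?cyc (frag_cmul (m s) (z s))" using cm1 z by blast
  thus ?case using Suc s cm2[OF z(1)[OF s], of "m s"] z(2)[OF s] ka_add[of "comb m s" "frag_cmul (m s) (z s)"] singular_relcycle_add
   by (auto simp: comb_def Zn_unit_def less_Suc_eq)
 qed
 define \<Psi> where "\<Psi> ph = (%j. if j < r then ph (z j) else (0::int))" for ph
 have chz: "singular_chain p X c" if "?cyc c" for c using that by (simp add: singular_cycle)
 \<comment> \<open>A cycle differs from the combination of the \<open>z j\<close> with the same
   coordinates by a boundary, and a cocycle vanishes on boundaries.\<close>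
 have vanish: "ph c = 0" if ph: "ph : cocycle_set p X" and 0: "!!j. j < r ==> ph (z j) = 0" and c: "?cyc c" for ph c
 proof -
  have phc: "ph : carrier ?G" using ph by (simp add: mem_cocycle_set)
  have phcm: "ph (frag_cmul k a) = k * ph a" if a: "singular_chain p X a" for k a
  proof -
   have nn: "ph (frag_cmul (int n) a) = int n * ph a" for n
   proof (induct n)
    case 0
    show ?case using cochain_minus[OF phc, of 0 0] by simp
   next
    case (Suc n)
    have "frag_cmul (int (Suc n)) a = frag_cmul (int n) a + a" by (simp add: frag_cmul_distrib)
    thus ?case using Suc phc a singular_chain_cmul[OF a, of "int n"]
     unfolding carrier_cochain by (simp only: mem_Collect_eq) (simp add: algebra_simps)
   qed
   show ?thesis
   proof (cases "k >= 0")
    case True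
    thus ?thesis using nn[of "nat k"] by simp
   next
    case False
    have "frag_cmul k a = 0 - frag_cmul (int (nat (- k))) a" using False by simp
    thus ?thesis
     using cochain_minus[OF phc, of 0 "frag_cmul (int (nat (- k))) a"] nn[of 0] nn[of "nat (-k)"] False a
     by (simp add: singular_chain_cmul)
   qed
  qed
  have cc: "?cyc (comb (ka c) r)" "ka (comb (ka c) r) = ka c"
   using comb[of r "ka c"] ka_in[OF c] by (auto simp: carrier_Zn fun_eq_iff)
  have "ph (comb m s) = 0" if "s <= r" for m s
   using that
  proof (induct s)
   case 0
   thus ?case using cochain_minus[OF phc, of 0 0] by (simp add: comb_def)
  next
   case (Suc s)
   hence s: "s < r" by simp
   have "ph (comb m s + frag_cmul (m s) (z s)) = ph (comb m s) + ph (frag_cmul (m s) (z s))"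
    using phc chz comb[of s m] s chz[OF cm1[OF z(1)[OF s]]] unfolding carrier_cochain by auto
   thus ?case using Suc s phcm[OF chz[OF z(1)[OF s]]] 0[OF s] by (simp add: comb_def)
  qed
  hence "ph (comb (ka c) r) = 0" by simp
  moreover have "?bd (c - comb (ka c) r)"
  proof (subst ka_bd[symmetric])
   show "?cyc (c - comb (ka c) r)" using c cc by (intro singular_relcycle_diff)
   show "ka (c - comb (ka c) r) = (%_. 0)"
    using ka_diff[OF c cc(1)] cc(2) by auto
  qed
  hence "ph (c - comb (ka c) r) = 0" using ph by (auto simp: singular_boundary mem_cocycle_set)
  moreover have "ph (c - comb (ka c) r) = ph c - ph (comb (ka c) r)"
   using cochain_minus[OF phc] chz c cc(1) by blast
  ultimately show ?thesis by simp
 qed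
 have hom: "\<Psi> : hom Z (Zn r)"
  unfolding hom_def multZ carZ
  using z(1) chz by (auto simp: \<Psi>_def carrier_Zn cochain_group_def)
 have surj: "\<Psi> ` carrier Z = carrier (Zn r)"
 proof
  show "\<Psi> ` carrier Z \<subseteq> carrier (Zn r)" by (auto simp: \<Psi>_def carrier_Zn)
  show "carrier (Zn r) \<subseteq> \<Psi> ` carrier Z"
  proof
   fix m assume m: "m : carrier (Zn r)"
   \<comment> \<open>The values are prescribed on cycles through their homology classes and then
     extended to all chains. Since boundaries have zero class, the extension is a cocycle.\<close>
   have "\<exists>ph\<in>carrier ?G. ALL a. ?cyc a --> ph a = (\<Sum>j<r. ka a j * m j)"
    by (rule cochain_extension) (simp add: ka_diff left_diff_distrib sum_subtractf)
   then obtain ph where ph: "ph : carrier ?G" "!!a. ?cyc a ==> ph a = (\<Sum>j<r. ka a j * m j)" by blast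
   have "ph (chain_boundary (Suc p) c) = 0" if "singular_chain (Suc p) X c" for c
   proof -
    have b: "?bd (chain_boundary (Suc p) c)" using that by (auto simp: singular_boundary)
    hence "?cyc (chain_boundary (Suc p) c)" by (rule singular_relboundary_imp_relcycle)
    thus ?thesis using ph(2) ka_bd[THEN iffD2, OF _ b] by simp
   qed
   hence "ph : carrier Z" using ph(1) by (simp add: carZ mem_cocycle_set)
   moreover have "ph (z j) = m j" if "j < r" for j
   proof -
    have "ph (z j) = (\<Sum>i<r. if i = j then m i else 0)"
     unfolding ph(2)[OF z(1)[OF that]] z(2)[OF that] by (intro sum.cong) (auto simp: Zn_unit_def)
    also have "... = m j" using that by simp
    finally show ?thesis .
   qed
   hence "\<Psi> ph = m" using m by (auto simp: \<Psi>_def carrier_Zn fun_eq_iff)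
   ultimately show "m : \<Psi> ` carrier Z" by blast
  qed
 qed
 have "kernel Z (Zn r) \<Psi> = {ph : cocycle_set p X. ALL c. ?cyc c --> ph c = 0}"
  using vanish z(1) by (auto simp: kernel_def carZ \<Psi>_def fun_eq_iff)
 also have "... = coboundary_set p X"
 proof (cases p)
  case 0
  have "?cyc c \<longleftrightarrow> singular_chain p X c" for c
   by (simp add: 0 singular_cycle chain_boundary_def)
  thus ?thesis using singular_chain_boundary'[of p X]
   by (auto simp: 0 coboundary_set_def mem_cocycle_set carrier_cochain singular_chain_add extensional_def)
 next
  case (Suc k)
  show ?thesis
  proof
   show "coboundary_set p X \<subseteq> {ph : cocycle_set p X. ALL c. ?cyc c --> ph c = 0}"
   proof
    fix ph assume "ph : coboundary_set p X"
    then obtain \<eta> where \<eta>: "\<eta> : carrier (cochain_group k X)" "ph = coboundary k X \<eta>" by (auto simp: coboundary_set_def Suc)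
    have 0: "\<eta> 0 = 0" using cochain_minus[OF \<eta>(1), of 0 0] by simp
    have *: "ph c = (if singular_chain p X c then \<eta> (chain_boundary p c) else undefined)" for c
     by (simp add: \<eta>(2) coboundary_def Suc)
    have add: "ph : carrier ?G"
     using \<eta>(1) singular_chain_boundary'[of k X] by (auto simp: * carrier_cochain singular_chain_add chain_boundary_add extensional_def Suc)
    moreover have van: "ph c = 0" if "?cyc c" for c using that by (simp add: * 0 singular_cycle)
    moreover have "?cyc (chain_boundary (Suc p) c)" if "singular_chain (Suc p) X c" for c
     using that by (intro singular_relboundary_imp_relcycle) (auto simp: singular_boundary)
    ultimately show "ph : {ph : cocycle_set p X. ALL c. ?cyc c --> ph c = 0}" by (simp add: mem_cocycle_set)
   qed
   show "{ph : cocycle_set p X. ALL c. ?cyc c --> ph c = 0} \<subseteq> coboundary_set p X"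
   proof clarify
    fix ph assume ph: "ph : cocycle_set p X" and van: "ALL c. ?cyc c --> ph c = 0"
    hence phc: "ph : carrier ?G" by (simp add: mem_cocycle_set)
    have "trivial_group (HG (int k) X)" using H' by (simp add: Suc)
    hence sg: "homologous_rel_set k X {} a = \<one>\<^bsub>HG (int k) X\<^esub>" if "singular_relcycle k X {} a" for a
    proof -
     have "homologous_rel_set k X {} a : carrier (HG (int k) X)"
      unfolding carrier_relative_homology_group using that by (intro imageI CollectI)
     moreover have "carrier (HG (int k) X) = {\<one>\<^bsub>HG (int k) X\<^esub>}"
      using `trivial_group (HG (int k) X)` by (simp only: trivial_group_def)
     ultimately show ?thesis by (simp only: singleton_iff)
    qed
    have bd: "EX c. singular_chain p X c & chain_boundary p c = a" if "singular_relcycle k X {} a" for a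
     using sg[OF that] by (simp add: homologous_rel_set_eq_relboundary singular_boundary Suc)
    \<comment> \<open>By \<open>H'\<close> every cycle of degree \<open>k\<close> bounds. The value
      of \<open>ph\<close> on a chain that it bounds does not depend on that chain, as two of them
      differ by a cycle; this defines the primitive of \<open>ph\<close> on cycles.\<close>
    define lift where "lift a = (SOME c. singular_chain p X c & chain_boundary p c = a)" for a
    have lift: "singular_chain p X (lift a)" "chain_boundary p (lift a) = a" if "singular_relcycle k X {} a" for a
     using someI_ex[OF bd[OF that]] by (simp_all add: lift_def)
    have eq: "ph c = ph d" if "singular_chain p X c" "singular_chain p X d" "chain_boundary p c = chain_boundary p d" for c d
    proof -
     have "?cyc (c - d)" using that by (simp add: singular_cycle singular_chain_diff chain_boundary_diff)
     thus ?thesis using van cochain_minus[OF phc that(1,2)] by simp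
    qed
    have "\<exists>\<eta>\<in>carrier (cochain_group k X). ALL a. singular_relcycle k X {} a --> \<eta> a = ph (lift a)"
    proof (rule cochain_extension)
     fix a b assume ab: "singular_relcycle k X {} a" "singular_relcycle k X {} b"
     have "ph (lift (a - b)) = ph (lift a - lift b)"
      using lift ab singular_relcycle_diff[OF ab] by (intro eq) (auto simp: singular_chain_diff chain_boundary_diff)
     thus "ph (lift (a - b)) = ph (lift a) - ph (lift b)"
      using cochain_minus[OF phc] lift ab by simp
    qed
    then obtain \<eta> where \<eta>: "\<eta> : carrier (cochain_group k X)"
      "!!a. singular_relcycle k X {} a ==> \<eta> a = ph (lift a)" by blast
    have "ph = coboundary k X \<eta>"
    proof
     fix c
     show "ph c = coboundary k X \<eta> c"
     proof (cases "singular_chain p X c")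
      case True
      hence "singular_relcycle k X {} (chain_boundary p c)"
       by (intro singular_relboundary_imp_relcycle) (auto simp: singular_boundary Suc)
      hence "coboundary k X \<eta> c = ph (lift (chain_boundary p c))" "ph (lift (chain_boundary p c)) = ph c"
       using True \<eta>(2) eq[OF lift(1) True lift(2)] by (simp_all add: coboundary_def Suc)
      thus ?thesis by simp
     next
      case False
      thus ?thesis using phc unfolding carrier_cochain extensional_def by (simp add: coboundary_def Suc)
     qed
    qed
    thus "ph : coboundary_set p X" using \<eta>(1) by (simp add: coboundary_set_def Suc)
   qed
  qed
 qed
 finally have ker: "kernel Z (Zn r) \<Psi> = coboundary_set p X" .
 have gh: "group_hom Z (Zn r) \<Psi>"
  using grZ hom comm_Zn by (simp add: group_hom_def group_hom_axioms_def comm_group_def)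
 have iso: "(%U. the_elem (\<Psi> ` U)) : iso (cohomology_group p X) (Zn r)"
  using group_hom.FactGroup_iso_set[OF gh surj, unfolded ker] unfolding cohomology_group_def Z_def[symmetric] .
 have gQ: "group (cohomology_group p X)"
  using normal.factorgroup_is_group[OF group_hom.normal_kernel[OF gh], unfolded ker] unfolding cohomology_group_def Z_def[symmetric] .
 have inv: "inv_into (carrier (cohomology_group p X)) (%U. the_elem (\<Psi> ` U)) : iso (Zn r) (cohomology_group p X)"
  using group.iso_set_sym[OF gQ iso] .
 have "comm_group (cohomology_group p X)"
  by (rule comm_group.iso_imp_comm_group[OF comm_Zn is_isoI[OF inv] group.is_monoid[OF gQ]])
 thus ?thesis using inv unfolding free_rank_def by blast
qed

text \<open>Gaussian elimination without division. With a pivot \<open>y\<close> in equation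
  \<open>r\<close>, the coefficients \<open>B\<close> satisfy that equation identically, so one
  equation and one unknown disappear together.\<close>

lemma integer_relation:
 fixes A :: "nat => 'x => int"
 assumes "finite S" "card S > r"
 shows "EX c. (\<exists>x\<in>S. c x ~= 0) & (\<forall>i<r. (\<Sum>x\<in>S. c x * A i x) = 0)"
 using assms
proof (induct r arbitrary: S A)
 case 0
 hence "S ~= {}" by auto
 thus ?case by (intro exI[of _ "%_. 1"]) auto
next
 case (Suc r)
 show ?case
 proof (cases "\<forall>x\<in>S. A r x = 0")
  case True
  obtain c where "\<exists>x\<in>S. c x ~= 0" "\<forall>i<r. (\<Sum>x\<in>S. c x * A i x) = 0"
   using Suc(1)[of S A, OF Suc(2)] Suc(3) by auto
  thus ?thesis using True by (intro exI[of _ c]) (auto simp: less_Suc_eq)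
 next
  case False
  then obtain y where y: "y : S" "A r y ~= 0" by blast
  define B where "B i x = A r y * A i x - A r x * A i y" for i x
  have "card (S - {y}) > r" using y Suc(2,3) by (simp add: card_Diff_singleton)
  then obtain c where c: "\<exists>x\<in>S - {y}. c x ~= 0" "\<forall>i<r. (\<Sum>x\<in>S - {y}. c x * B i x) = 0"
   using Suc(1)[of "S - {y}" B] Suc(2) by auto
  define d where "d x = (if x = y then - (\<Sum>x\<in>S - {y}. c x * A r x) else A r y * c x)" for x
  have eq: "(\<Sum>x\<in>S. d x * A i x) = (\<Sum>x\<in>S - {y}. c x * B i x)" for i
  proof -
   have "(\<Sum>x\<in>S. d x * A i x) = d y * A i y + (\<Sum>x\<in>S - {y}. d x * A i x)"
    by (rule sum.remove[OF Suc(2) y(1)])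
   also have "(\<Sum>x\<in>S - {y}. d x * A i x) = (\<Sum>x\<in>S - {y}. A r y * c x * A i x)"
    by (intro sum.cong) (auto simp: d_def)
   finally show ?thesis
    by (simp add: d_def B_def sum_subtractf sum_distrib_right sum_distrib_left algebra_simps)
  qed
  have "B r x = 0" for x by (simp add: B_def)
  hence "\<forall>i<Suc r. (\<Sum>x\<in>S. d x * A i x) = 0"
   unfolding eq using c(2) by (auto simp: less_Suc_eq)
  moreover obtain x where "x : S" "x ~= y" "c x ~= 0" using c(1) by blast
  hence "\<exists>x\<in>S. d x ~= 0" using y(2) by (intro bexI[of _ x]) (auto simp: d_def)
  ultimately show ?thesis by blast
 qed
qed

lemma Zn_int_pow: "x : carrier (Zn r) ==> x [^]\<^bsub>Zn r\<^esub> (k::int) = (%i. k * x i)"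
proof -
 assume x: "x : carrier (Zn r)"
 interpret Z: comm_group "Zn r" by (rule comm_Zn)
 have n: "x [^]\<^bsub>Zn r\<^esub> (n::nat) = (%i. int n * x i)" for n
  by (induct n) (auto simp: fun_eq_iff algebra_simps)
 show ?thesis
 proof (cases "k >= 0")
  case True
  thus ?thesis using n[of "nat k"] by (metis int_pow_int nat_0_le)
 next
  case False
  have "inv\<^bsub>Zn r\<^esub> (%i. int (nat (- k)) * x i) = (%i. k * x i)"
   using False x by (intro Z.inv_equality) (auto simp: carrier_Zn)
  thus ?thesis using False n[of "nat (- k)"] by (metis int_pow_def2 not_le)
 qed
qed

lemma Zn_finprod:
 assumes "finite S" "!!x. x : S ==> f x : carrier (Zn r)"
 shows "finprod (Zn r) f S = (%i. \<Sum>x\<in>S. f x i)"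
proof -
 interpret Z: comm_group "Zn r" by (rule comm_Zn)
 show ?thesis using assms
 proof (induct S)
  case (insert x S)
  have "finprod (Zn r) f (insert x S) = f x \<otimes>\<^bsub>Zn r\<^esub> finprod (Zn r) f S"
   using insert by (intro Z.finprod_insert) auto
  thus ?case using insert by (simp add: fun_eq_iff)
 qed simp
qed

lemma integrally_independent_iso:
 assumes G: "comm_group G" and H: "comm_group H" and ph: "ph : iso G H" and S: "integrally_independent G S"
 shows "integrally_independent H (ph ` S)" "card (ph ` S) = card S"
proof -
 interpret G: comm_group G by fact
 interpret H: comm_group H by fact
 interpret ph: group_hom G H ph using ph by unfold_locales (auto simp: iso_def)
 have inj: "inj_on ph (carrier G)" using ph by (auto simp: iso_def bij_betw_def)
 have SG: "S \<subseteq> carrier G" and fin: "finite S" using S by (auto simp: integrally_independent_def)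
 have injS: "inj_on ph S" using inj SG inj_on_subset by blast
 thus "card (ph ` S) = card S" by (rule card_image)
 have fp: "finprod H (%x. x [^]\<^bsub>H\<^esub> c x) (ph ` S) = ph (finprod G (%x. x [^]\<^bsub>G\<^esub> c (ph x)) S)" for c :: "_ => int"
 proof -
  have "finprod H (%x. x [^]\<^bsub>H\<^esub> c x) (ph ` S) = finprod H (%x. ph x [^]\<^bsub>H\<^esub> c (ph x)) S"
   using injS SG by (intro H.finprod_reindex) auto
  also have "... = finprod H (%x. ph (x [^]\<^bsub>G\<^esub> c (ph x))) S"
   using SG by (intro H.finprod_cong refl) (auto simp: ph.hom_int_pow simp_implies_def)
  also have "... = ph (finprod G (%x. x [^]\<^bsub>G\<^esub> c (ph x)) S)"
   using fin SG
  proof (induct S)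
   case (insert x F)
   have *: "x : carrier G" "(%x. x [^]\<^bsub>G\<^esub> c (ph x)) : F \<rightarrow> carrier G" using insert(4) by auto
   hence "ph (finprod G (%x. x [^]\<^bsub>G\<^esub> c (ph x)) (insert x F)) =
     ph (x [^]\<^bsub>G\<^esub> c (ph x)) \<otimes>\<^bsub>H\<^esub> ph (finprod G (%x. x [^]\<^bsub>G\<^esub> c (ph x)) F)"
    using insert(1,2) by (subst G.finprod_insert) (auto intro!: ph.hom_mult G.finprod_closed)
   moreover have "finprod H (%x. ph (x [^]\<^bsub>G\<^esub> c (ph x))) (insert x F) =
     ph (x [^]\<^bsub>G\<^esub> c (ph x)) \<otimes>\<^bsub>H\<^esub> finprod H (%x. ph (x [^]\<^bsub>G\<^esub> c (ph x))) F"
    using insert(1,2,4) by (intro H.finprod_insert) auto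
   ultimately show ?case using insert(3,4) by simp
  qed simp
  finally show ?thesis .
 qed
 show "integrally_independent H (ph ` S)"
  unfolding integrally_independent_def
 proof (intro conjI allI impI ballI)
  show "finite (ph ` S)" "ph ` S \<subseteq> carrier H" using fin SG by auto
  fix c :: "_ => int" and y
  assume "finprod H (%x. x [^]\<^bsub>H\<^esub> c x) (ph ` S) = \<one>\<^bsub>H\<^esub>" and y: "y : ph ` S"
  hence "ph (finprod G (%x. x [^]\<^bsub>G\<^esub> c (ph x)) S) = ph \<one>\<^bsub>G\<^esub>" by (simp add: fp)
  moreover have "finprod G (%x. x [^]\<^bsub>G\<^esub> c (ph x)) S : carrier G" using SG by (intro G.finprod_closed) auto
  ultimately have "finprod G (%x. x [^]\<^bsub>G\<^esub> c (ph x)) S = \<one>\<^bsub>G\<^esub>"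
   using inj_onD[OF inj] by blast
  hence "\<forall>x\<in>S. c (ph x) = 0"
   using S[unfolded integrally_independent_def, THEN conjunct2, THEN conjunct2, THEN spec, of "%x. c (ph x)"] by blast
  thus "c y = 0" using y by auto
 qed
qed

text \<open>The unit vectors attain \<open>r\<close>, and \<open>integer_relation\<close> excludes
  larger independent sets.\<close>

lemma abelian_rank_free:
 assumes "free_rank G r"
 shows "abelian_rank G = r"
proof -
 have G: "comm_group G" using assms by (simp add: free_rank_def)
 obtain ph where ph: "ph : iso (Zn r) G" using assms by (auto simp: free_rank_def)
 hence ph': "inv_into (carrier (Zn r)) ph : iso G (Zn r)"
  using group.iso_set_sym comm_Zn comm_group.axioms(2) by blast
 have u: "Zn_unit j : carrier (Zn r)" if "j < r" for j using that by (auto simp: carrier_Zn Zn_unit_def)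
 have uinj: "inj Zn_unit" unfolding inj_def Zn_unit_def fun_eq_iff by (metis zero_neq_one)
 have "integrally_independent (Zn r) (Zn_unit ` {..<r})"
  unfolding integrally_independent_def
 proof (intro conjI allI impI ballI)
  fix c :: "_ => int" and x
  assume eq: "finprod (Zn r) (%x. x [^]\<^bsub>Zn r\<^esub> c x) (Zn_unit ` {..<r}) = \<one>\<^bsub>Zn r\<^esub>" and "x : Zn_unit ` {..<r}"
  then obtain j where j: "x = Zn_unit j" "j < r" by blast
  have pw: "y [^]\<^bsub>Zn r\<^esub> c y = (%i. c y * y i)" "y [^]\<^bsub>Zn r\<^esub> c y : carrier (Zn r)" if "y : Zn_unit ` {..<r}" for y
   using u that by (auto simp: Zn_int_pow) (auto simp: carrier_Zn Zn_unit_def)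
  have "finprod (Zn r) (%x. x [^]\<^bsub>Zn r\<^esub> c x) (Zn_unit ` {..<r}) = (%i. \<Sum>y\<in>Zn_unit ` {..<r}. (y [^]\<^bsub>Zn r\<^esub> c y) i)"
   by (rule Zn_finprod) (use pw in auto)
  also have "... = (%i. \<Sum>y\<in>Zn_unit ` {..<r}. c y * y i)"
   using pw by (intro ext sum.cong) auto
  also have "... = (%i. \<Sum>k<r. c (Zn_unit k) * Zn_unit k i)"
   by (subst sum.reindex) (auto intro: inj_on_subset[OF uinj])
  finally have "(\<Sum>k<r. c (Zn_unit k) * Zn_unit k j) = 0"
   unfolding eq by (simp add: fun_eq_iff)
  moreover have "(\<Sum>k<r. c (Zn_unit k) * Zn_unit k j) = (\<Sum>k<r. if k = j then c (Zn_unit k) else 0)"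
   by (intro sum.cong) (auto simp: Zn_unit_def)
  ultimately show "c x = 0" using j by simp
 qed (use u in auto)
 from integrally_independent_iso[OF comm_Zn G ph this]
 have 1: "r : card ` Collect (integrally_independent G)"
  using card_image[OF inj_on_subset[OF uinj], of "{..<r}"] by (force simp: image_iff)
 have 2: "card S <= r" if S: "integrally_independent G S" for S
 proof (rule ccontr)
  let ?S = "inv_into (carrier (Zn r)) ph ` S"
  assume "~ card S <= r"
  note S' = integrally_independent_iso[OF G comm_Zn ph' S]
  hence *: "finite ?S" "card ?S > r" "?S \<subseteq> carrier (Zn r)"
   using `~ card S <= r` by (auto simp: integrally_independent_def)
  obtain c where c: "\<exists>x\<in>?S. c x ~= 0" "\<forall>i<r. (\<Sum>x\<in>?S. c x * x i) = 0"
   using integer_relation[OF *(1,2), of "%i x. x i"] by blast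
  have "finprod (Zn r) (%x. x [^]\<^bsub>Zn r\<^esub> c x) ?S = (%i. \<Sum>x\<in>?S. (x [^]\<^bsub>Zn r\<^esub> c x) i)"
   using * comm_Zn[THEN comm_group.axioms(2)] by (intro Zn_finprod group.int_pow_closed) auto
  also have "... = (%i. \<Sum>x\<in>?S. c x * x i)"
   using *(3) by (intro ext sum.cong refl) (subst Zn_int_pow, auto)
  also have "... = \<one>\<^bsub>Zn r\<^esub>"
  proof
   fix i
   show "(\<Sum>x\<in>?S. c x * x i) = \<one>\<^bsub>Zn r\<^esub> i"
   proof (cases "i < r")
    case True
    thus ?thesis using c(2) by simp
   next
    case False
    hence "(\<Sum>x\<in>?S. c x * x i) = 0" using *(3) by (intro sum.neutral) (auto simp: carrier_Zn)
    thus ?thesis by simp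
   qed
  qed
  finally show False using S'(1) c(1) unfolding integrally_independent_def by blast
 qed
 show ?thesis
  unfolding abelian_rank_def by (rule cSup_eq_maximum) (use 1 2 in auto)
qed

lemma abelian_rank_cohomology_group:
 assumes "even_hom X b"
 shows "abelian_rank (cohomology_group (2 * i) X) = b (2 * int i)"
proof (rule abelian_rank_free[OF free_rank_cohomology_group])
 show "free_rank (HG (int (2 * i)) X) (b (2 * int i))"
  using assms by (auto simp: even_hom_def)
 have "odd (int (2 * i) - 1)" by simp
 thus "trivial_group (HG (int (2 * i) - 1) X)"
  using assms unfolding even_hom_def by presburger
qed

lemma poincare_polynomial_even_hom:
 assumes "even_hom X (%p. if p < 0 then 0 else Polynomial.coeff P (nat (p div 2)))"
 shows "poincare_polynomial X = map_poly of_nat P"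
proof -
 have r: "abelian_rank (cohomology_group (2 * i) X) = Polynomial.coeff P i" for i
  by (simp add: abelian_rank_cohomology_group[OF assms])
 have "(\<Sum>i | Polynomial.coeff P i ~= 0. Polynomial.monom (of_nat (Polynomial.coeff P i)) i) =
   (\<Sum>i\<le>degree P. Polynomial.monom (of_nat (Polynomial.coeff P i) :: rat) i)"
  by (rule sum.mono_neutral_left) (auto intro: le_degree)
 also have "... = map_poly of_nat P"
  by (rule poly_eqI) (simp add: coeff_map_poly coeff_sum coeff_eq_0)
 finally show ?thesis by (simp add: poincare_polynomial_def r)
qed

section \<open>Chains of flats\<close>

text \<open>Strict chains of \<open>k\<close> flats above \<open>s\<close>, coarsest first. The
  value \<open>id\<close> at 0 and \<open>s\<close> beyond \<open>k\<close> are padding that makes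
  each chain exactly one function.\<close>

definition lchains :: "nat set => nat => (nat => nat) => (nat => nat => nat) set" where
 "lchains I k s = {F. F 0 = id & (\<forall>d>k. F d = s) \<and>
   (\<forall>d\<in>{1..k}. F d : flats I & F d o F (Suc d) = F d & F d ~= F (Suc d))}"

definition cweight :: "(nat => nat poly) => nat => (nat => nat => nat) => nat poly" where
 "cweight q k F = (\<Prod>d = 1..k. q (card (moved (F d)) - card (moved (F (Suc d)))))"

lemma lchains_0: "lchains I 0 s = {%d. if d = 0 then id else s}"
 by (auto simp: lchains_def fun_eq_iff)

text \<open>The finest member \<open>r\<close> of the chain is split off; the others form a chain
  above \<open>r\<close>.\<close>

lemma lchains_Suc:
 "bij_betw (%(r, F) d. if d <= Suc k then F d else s)
   (SIGMA r : {r : flats I. r o s = r & r ~= s}. lchains I k r) (lchains I (Suc k) s)"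
proof (rule bij_betwI[where g = "%G. (G (Suc k), %d. if d <= Suc k then G d else G (Suc k))"])
 let ?A = "SIGMA r : {r : flats I. r o s = r & r ~= s}. lchains I k r"
 let ?f = "%(r, F) d. if d <= Suc k then F d else s" and ?g = "%G. (G (Suc k), %d. if d <= Suc k then G d else G (Suc k))"
 show "?f : ?A \<rightarrow> lchains I (Suc k) s"
 proof clarify
  fix r F assume r: "r : flats I" "r o s = r" "r ~= s" and F: "F : lchains I k r"
  have "F (Suc k) = r" "F 0 = id" using F by (simp_all add: lchains_def)
  moreover have "F d : flats I" "F d o F (Suc d) = F d" "F d ~= F (Suc d)" if "d : {1..k}" for d
   using F that unfolding lchains_def by blast+
  ultimately show "(%d. if d <= Suc k then F d else s) : lchains I (Suc k) s"
   using r unfolding lchains_def by (auto simp: le_Suc_eq)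
 qed
 show "?g : lchains I (Suc k) s \<rightarrow> ?A"
 proof
  fix G assume G: "G : lchains I (Suc k) s"
  have *: "G d : flats I" "G d o G (Suc d) = G d" "G d ~= G (Suc d)" if "d : {1..Suc k}" for d
   using G that unfolding lchains_def by blast+
  have "G (Suc (Suc k)) = s" "G 0 = id" using G by (simp_all add: lchains_def)
  thus "?g G : ?A"
   using *[of "Suc k"] * by (auto simp: lchains_def dest: le_antisym[OF _ Suc_leI])
 qed
 show "?g (?f z) = z" if "z : ?A" for z
  using that by (auto simp: lchains_def fun_eq_iff)
 show "?f (?g G) = G" if "G : lchains I (Suc k) s" for G
  using that by (auto simp: lchains_def fun_eq_iff)
qed

lemma finite_lchains:
 assumes "finite I"
 shows "finite (lchains I k s)"
proof (induct k arbitrary: s)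
 case (Suc k)
 have "finite (SIGMA r : {r : flats I. r o s = r & r ~= s}. lchains I k r)"
  using Suc finite_flats[OF assms] by (intro finite_SigmaI) auto
 thus ?case using bij_betw_finite[OF lchains_Suc] by blast
qed (simp add: lchains_0)

lemma comp_flat:
 assumes "s : flats I" "b : flats (s ` I)"
 shows "b o s : flats I"
proof -
 have sI: "s ` I \<subseteq> I" using flatsD(3)[OF assms(1)] by auto
 have sb: "s (b (s i)) = b (s i)" for i
 proof (cases "s i : s ` I")
  case True
  hence "b (s i) : s ` I" using flatsD(3)[OF assms(2)] by blast
  thus ?thesis using flatsD(1)[OF assms(1)] by auto
 next
  case False
  thus ?thesis using flatsD(4)[OF assms(2)] flatsD(1)[OF assms(1)] by simp
 qed
 show ?thesis
  unfolding flats_def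
 proof (intro CollectI conjI allI ballI impI)
  fix i
  show "(b o s) ((b o s) i) = (b o s) i" using sb flatsD(1)[OF assms(2)] by simp
  show "(b o s) i <= i" using flatsD(2)[OF assms(2), of "s i"] flatsD(2)[OF assms(1), of i] by simp
  show "(b o s) i : I" if "i : I" using that flatsD(3)[OF assms(2), of "s i"] sI by auto
  assume "i ~: I"
  thus "(b o s) i = i" using flatsD(4)[OF assms(1)] flatsD(4)[OF assms(2), of i] sI by auto
 qed
qed

lemma card_moved_comp_flat:
 assumes "s : flats I" "finite I" "b : flats (s ` I)"
 shows "card (moved (b o s)) = card (moved s) + card (moved b)"
proof -
 have "(b o s) ` I = b ` (s ` I)" by auto
 thus ?thesis
  using card_moved[OF comp_flat[OF assms(1,3)] assms(2)] card_moved[OF assms(1,2)] card_moved[OF assms(3)] assms(2) by simp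
qed

text \<open>The correspondence of \<open>lift_flat\<close> and \<open>descend_flat\<close> for an
  arbitrary flat \<open>s\<close>: a strictly coarser flat is a nontrivial partition of the blocks
  of \<open>s\<close>, read on their minima.\<close>

lemma coarser_flats_bij:
 assumes s: "s : flats I"
 shows "bij_betw (%b. b o s) (pflats (s ` I)) {r : flats I. r o s = r & r ~= s}"
proof (rule bij_betwI[where g = "%r i. if i : s ` I then r i else i"])
 have sI: "s ` I \<subseteq> I" using flatsD(3)[OF s] by auto
 have b_eq: "(%i. if i : s ` I then (b o s) i else i) = b" if "b : flats (s ` I)" for b
 proof
  fix i
  have "b (s i) = b i" if i: "i : s ` I"
  proof -
   obtain j where "i = s j" using i by blast
   thus ?thesis using flatsD(1)[OF s] by simp
  qed
  thus "(if i : s ` I then (b o s) i else i) = b i" using flatsD(4)[OF that] by simp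
 qed
 show "(%b. b o s) : pflats (s ` I) \<rightarrow> {r : flats I. r o s = r & r ~= s}"
 proof
  fix b assume b: "b : pflats (s ` I)"
  hence bf: "b : flats (s ` I)" "b ~= id" by (auto simp: pflats_def)
  have "b o s : flats I" by (rule comp_flat[OF s bf(1)])
  moreover have "b o s o s = b o s" using flatsD(5)[OF s] by (simp add: comp_assoc)
  moreover have "b o s ~= s"
  proof
   assume bs: "b o s = s"
   have "b i = i" for i
   proof (cases "i : s ` I")
    case True
    then obtain j where "i = s j" by blast
    thus ?thesis using fun_cong[OF bs, of j] by simp
   next
    case False
    thus ?thesis by (rule flatsD(4)[OF bf(1)])
   qed
   thus False using bf(2) by auto
  qed
  ultimately show "b o s : {r : flats I. r o s = r & r ~= s}" by blast
 qed
 show "(%i. if i : s ` I then (b o s) i else i) = b" if "b : pflats (s ` I)" for b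
  using b_eq that by (auto simp: pflats_def)
 have r_eq: "(%i. if i : s ` I then r i else i) o s = r" if r: "r : {r : flats I. r o s = r & r ~= s}" for r
 proof
  fix i
  have "r (s i) = r i" using r by (simp add: fun_eq_iff)
  moreover have "r (s i) = s i" if "s i ~: s ` I"
  proof -
   have "i ~: I" using that by auto
   thus ?thesis using r flatsD(4)[OF s] flatsD(4)[of r I i] by simp
  qed
  ultimately show "((%i. if i : s ` I then r i else i) o s) i = r i" by auto
 qed
 thus "(%i. if i : s ` I then r i else i) o s = r" if "r : {r : flats I. r o s = r & r ~= s}" for r
  using that by blast
 show "(%r i. if i : s ` I then r i else i) : {r : flats I. r o s = r & r ~= s} \<rightarrow> pflats (s ` I)"
 proof
  fix r assume r: "r : {r : flats I. r o s = r & r ~= s}"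
  let ?b = "%i. if i : s ` I then r i else i"
  have rf: "r : flats I" and sr: "s o r = r" using r coarser_comp[OF _ s] by auto
  have in_im: "r i : s ` I" if "i : I" for i
   using fun_cong[OF sr, of i] flatsD(3)[OF rf that] by (metis comp_apply imageI)
  have "?b : flats (s ` I)"
   using in_im sI flatsD[OF rf] unfolding flats_def by auto
  moreover have "?b ~= id" using r_eq[OF r] r by auto
  ultimately show "?b : pflats (s ` I)" by (simp add: pflats_def)
 qed
qed

text \<open>Unfolding the recursion of \<open>flat_poly\<close> once chooses the finest member of a
  chain. \<open>K\<close> bounds the number of blocks and hence the length of the chains, which
  makes the sum finite and drives the induction.\<close>

lemma flat_poly_chains:
 assumes I: "finite I" and s: "s : flats I" and K: "card (s ` I) <= K" "0 < K"
 shows "flat_poly (s ` I) = (\<Sum>k<K. \<Sum>F\<in>lchains I k s. cweight qsum k F)"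
 using s K
proof (induct K arbitrary: s)
 case 0
 thus ?case by (meson less_irrefl)
next
 case (Suc K)
 note s = Suc(2)
 let ?A = "{r : flats I. r o s = r & r ~= s}"
 have finA: "finite ?A" using finite_flats[OF I] by simp
 have step: "(\<Sum>F\<in>lchains I (Suc k) s. cweight qsum (Suc k) F) =
   (\<Sum>r\<in>?A. qsum (card (moved r) - card (moved s)) * (\<Sum>F\<in>lchains I k r. cweight qsum k F))" for k
 proof -
  have "(\<Sum>F\<in>lchains I (Suc k) s. cweight qsum (Suc k) F) =
    (\<Sum>z\<in>Sigma ?A (lchains I k). cweight qsum (Suc k) ((%(r, F) d. if d <= Suc k then F d else s) z))"
   by (rule sum.reindex_bij_betw[OF lchains_Suc, where g = "cweight qsum (Suc k)", symmetric])
  also have "... = (\<Sum>(r, F)\<in>Sigma ?A (lchains I k). qsum (card (moved r) - card (moved s)) * cweight qsum k F)"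
  proof (rule sum.cong[OF refl])
   fix z assume "z : Sigma ?A (lchains I k)"
   then obtain r F where z: "z = (r, F)" "F : lchains I k r" by blast
   have "F (Suc k) = r" using z(2) by (simp add: lchains_def)
   thus "cweight qsum (Suc k) ((%(r, F) d. if d <= Suc k then F d else s) z) =
     (case z of (r, F) => qsum (card (moved r) - card (moved s)) * cweight qsum k F)"
    unfolding z(1) cweight_def by (simp add: mult.commute)
  qed
  also have "... = (\<Sum>r\<in>?A. \<Sum>F\<in>lchains I k r. qsum (card (moved r) - card (moved s)) * cweight qsum k F)"
   using finA finite_lchains[OF I] by (intro sum.Sigma[symmetric]) auto
  finally show ?thesis by (simp add: sum_distrib_left)
 qed
 \<comment> \<open>A strictly coarser flat has fewer blocks, so the smaller bound is enough for
   it.\<close>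
 have IH: "flat_poly (r ` I) = (\<Sum>k<K. \<Sum>F\<in>lchains I k r. cweight qsum k F)" if r: "r : ?A" for r
 proof -
  obtain b where b: "b : pflats (s ` I)" "r = b o s"
   using r coarser_flats_bij[OF s] unfolding bij_betw_def by blast
  have "card (b ` (s ` I)) < card (s ` I)" using b(1) I by (intro flat_image_card) auto
  hence lt: "card (r ` I) < card (s ` I)" by (simp add: b(2) image_comp)
  have "I ~= {}" using lt by auto
  hence "0 < card (r ` I)" using I by (simp add: card_gt_0_iff)
  thus ?thesis using lt Suc(3) r by (intro Suc(1)) auto
 qed
 have "flat_poly (s ` I) = 1 + (\<Sum>b\<in>pflats (s ` I). qsum (card (moved b)) * flat_poly (b ` (s ` I)))"
  using I by (subst flat_poly.simps) simp
 also have "(\<Sum>b\<in>pflats (s ` I). qsum (card (moved b)) * flat_poly (b ` (s ` I))) =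
   (\<Sum>b\<in>pflats (s ` I). qsum (card (moved (b o s)) - card (moved s)) * flat_poly ((b o s) ` I))"
  using card_moved_comp_flat[OF s I] by (intro sum.cong) (auto simp: pflats_def image_comp)
 also have "... = (\<Sum>r\<in>?A. qsum (card (moved r) - card (moved s)) * flat_poly (r ` I))"
  by (rule sum.reindex_bij_betw[OF coarser_flats_bij[OF s]])
 also have "... = (\<Sum>r\<in>?A. \<Sum>k<K. qsum (card (moved r) - card (moved s)) * (\<Sum>F\<in>lchains I k r. cweight qsum k F))"
  using IH by (simp add: sum_distrib_left)
 also have "... = (\<Sum>k<K. \<Sum>F\<in>lchains I (Suc k) s. cweight qsum (Suc k) F)"
  unfolding step by (rule sum.swap)
 finally show ?case
  by (subst sum.lessThan_Suc_shift) (simp add: lchains_0 cweight_def)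
qed

section \<open>Levels and leaves of forests\<close>

definition below :: "digraph => nat => nat set" where
 "below Gr v = {w : leaves Gr. (v, w) : (snd Gr)\<^sup>*}"

locale forest_graph =
 fixes Gr :: digraph
 assumes forest: "forest Gr"
begin

abbreviation "V \<equiv> fst Gr"
abbreviation "E \<equiv> snd Gr"

lemma finite_V: "finite V" and E_subset: "E \<subseteq> V \<times> V" and acyclic_E: "acyclic E"
 and parent_unique: "(u, w) : E ==> (v, w) : E ==> u = v"
 using forest by (auto simp: forest_def case_prod_unfold)

lemma finite_E: "finite E"
 using finite_subset[OF E_subset] finite_V by blast

lemma wf_E: "wf E" and wf_converse_E: "wf (E\<inverse>)"
 using finite_acyclic_wf[OF finite_E acyclic_E] finite_acyclic_wf_converse[OF finite_E acyclic_E] by auto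

lemma edge_in_V: "(u, v) : E ==> u : V" "(u, v) : E ==> v : V"
 using E_subset by auto

lemma path_in_V: "(u, v) : E\<^sup>* ==> u : V ==> v : V"
 by (induct rule: rtrancl_induct) (auto dest: edge_in_V)

lemma root_or_parent: "v : V ==> v : roots Gr | (EX u. (u, v) : E)"
 by (auto simp: roots_def)

lemma root_no_parent: "v : roots Gr ==> (u, v) ~: E"
 by (auto simp: roots_def)

lemma root_path: "v : V ==> \<exists>r\<in>roots Gr. EX d. (r, v) : E ^^ d"
proof (induct v rule: wf_induct_rule[OF wf_E])
 case (1 v)
 show ?case
 proof (cases "v : roots Gr")
  case True
  thus ?thesis by (intro bexI[of _ v] exI[of _ 0]) auto
 next
  case False
  then obtain u where u: "(u, v) : E" using root_or_parent 1(2) by blast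
  then obtain r d where "r : roots Gr" "(r, u) : E ^^ d" using 1(1)[OF u edge_in_V(1)[OF u]] by blast
  thus ?thesis using u by (intro bexI[of _ r] exI[of _ "Suc d"]) auto
 qed
qed

lemma root_path_unique:
 "r : roots Gr ==> r' : roots Gr ==> (r, v) : E ^^ d ==> (r', v) : E ^^ d' ==> d = d'"
proof (induct d arbitrary: v d')
 case 0
 thus ?case by (cases d') (auto dest: root_no_parent)
next
 case (Suc d)
 then obtain u where u: "(r, u) : E ^^ d" "(u, v) : E" by auto
 show ?case
 proof (cases d')
  case 0
  thus ?thesis using Suc(3,5) u(2) root_no_parent by auto
 next
  case (Suc e)
  then obtain u' where u': "(r', u') : E ^^ e" "(u', v) : E" using `(r', v) : E ^^ d'` by auto
  hence "u' = u" using u(2) parent_unique by blast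
  thus ?thesis using Suc.hyps[OF Suc.prems(1,2) u(1)] u'(1) `d' = Suc e` by simp
 qed
qed

lemma level_eq: "r : roots Gr ==> (r, v) : E ^^ d ==> level Gr v = Suc d"
proof -
 assume r: "r : roots Gr" "(r, v) : E ^^ d"
 have "(LEAST d. \<exists>r\<in>roots Gr. (r, v) : E ^^ d) = d"
 proof (rule Least_equality)
  fix e assume "\<exists>r\<in>roots Gr. (r, v) : E ^^ e"
  then obtain r' where "r' : roots Gr" "(r', v) : E ^^ e" by blast
  hence "d = e" by (rule root_path_unique[OF r(1) _ r(2)])
  thus "d <= e" by simp
 qed (use r in blast)
 thus ?thesis by (simp add: level_def)
qed

lemma level_root: "v : roots Gr ==> level Gr v = 1"
 using level_eq[of v v 0] by simp

lemma level_edge: "(u, v) : E ==> level Gr v = Suc (level Gr u)"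
proof -
 assume e: "(u, v) : E"
 obtain r d where "r : roots Gr" "(r, u) : E ^^ d" using root_path edge_in_V[OF e] by blast
 moreover hence "(r, v) : E ^^ Suc d" using e by auto
 ultimately show ?thesis using level_eq by metis
qed

lemma level_pos: "level Gr v >= 1"
 by (simp add: level_def)

lemma parent_exists: "v : V ==> level Gr v ~= 1 ==> EX u. (u, v) : E"
 using root_or_parent level_root by blast

lemma root_iff_level: "v : V ==> v : roots Gr \<longleftrightarrow> level Gr v = 1"
proof
 assume v: "v : V" "level Gr v = 1"
 have "(u, v) ~: E" for u using level_edge[of u v] level_pos[of u] v(2) by auto
 thus "v : roots Gr" using root_or_parent v(1) by blast
qed (rule level_root)

lemma level_mono: "(u, v) : E\<^sup>* ==> level Gr u <= level Gr v & (level Gr u = level Gr v --> u = v)"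
proof (induct rule: rtrancl_induct)
 case (step y z)
 thus ?case using level_edge[OF step(2)] by simp
qed simp

text \<open>Parents are unique, so the ancestors of a vertex form a path, along which the level is
  strictly increasing.\<close>

lemma level_separates: "(u, w) : E\<^sup>* ==> (v, w) : E\<^sup>* ==> level Gr u = level Gr v ==> u = v"
proof (induct rule: rtrancl_induct)
 case base
 thus ?case using level_mono[OF base(1)] by simp
next
 case (step y z)
 show ?case using step(4)
 proof (cases rule: rtranclE)
  case base
  thus ?thesis using level_mono[OF step(1)] level_edge[OF step(2)] step(5) by simp
 next
  case (step y')
  hence "y' = y" using parent_unique[OF step(2) `(y, z) : E`] by simp
  thus ?thesis using `(v, y) : E\<^sup>* ==> level Gr u = level Gr v ==> u = v` step(1) `level Gr u = level Gr v` by simp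
 qed
qed

lemma leaves_in_V: "leaves Gr \<subseteq> V" and nonleaves_in_V: "nonleaves Gr \<subseteq> V"
 by (auto simp: leaves_def nonleaves_def)

lemma V_split: "leaves Gr Un nonleaves Gr = V" "leaves Gr Int nonleaves Gr = {}"
 by (auto simp: leaves_def nonleaves_def)

lemma leaf_iff: "v : leaves Gr \<longleftrightarrow> v : V & (ALL w. (v, w) ~: E)"
 by (auto simp: leaves_def out_edges_def)

lemma nonleaf_iff: "v : nonleaves Gr \<longleftrightarrow> (EX w. (v, w) : E)"
 by (auto simp: nonleaves_def out_edges_def dest: edge_in_V)

lemma finite_leaves: "finite (leaves Gr)" and finite_nonleaves: "finite (nonleaves Gr)"
 using finite_V V_split(1) by (metis finite_Un)+

lemma below_subset: "below Gr v \<subseteq> leaves Gr"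
 by (auto simp: below_def)

lemma finite_below: "finite (below Gr v)"
 using below_subset finite_leaves finite_subset by blast

lemma below_leaf:
 assumes "v : leaves Gr"
 shows "below Gr v = {v}"
proof -
 have "w = v" if "(v, w) : E\<^sup>*" for w
  using that assms leaf_iff by (auto elim: converse_rtranclE)
 thus ?thesis using assms by (auto simp: below_def)
qed

lemma below_mono: "(u, v) : E\<^sup>* ==> below Gr v \<subseteq> below Gr u"
 by (auto simp: below_def)

lemma below_disjoint:
 assumes "w : below Gr u" "w : below Gr v" "level Gr u = level Gr v"
 shows "u = v"
 using assms level_separates by (auto simp: below_def)

lemma below_nonempty: "v : V ==> below Gr v ~= {}"
proof (induct v rule: wf_induct_rule[OF wf_converse_E])
 case (1 v)
 show ?case
 proof (cases "v : leaves Gr")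
  case True
  thus ?thesis by (simp add: below_leaf)
 next
  case False
  then obtain w where w: "(v, w) : E" using 1(2) leaf_iff by blast
  hence "below Gr w ~= {}" using 1 edge_in_V by simp
  thus ?thesis using below_mono[of v w] w by blast
 qed
qed

definition children :: "nat => nat set" where
 "children v = {w. (v, w) : E}"

lemma card_out_edges: "card (out_edges Gr v) = card (children v)"
proof -
 have "out_edges Gr v = Pair v ` children v"
  by (auto simp: out_edges_def children_def)
 thus ?thesis by (simp add: card_image inj_on_def)
qed

lemma finite_children: "finite (children v)"
 using finite_subset[of "children v" V] finite_V edge_in_V by (auto simp: children_def)

lemma card_below_nonleaf:
 assumes "v : nonleaves Gr"
 shows "card (below Gr v) = (\<Sum>w\<in>children v. card (below Gr w))"
proof -
 have "below Gr v = (\<Union>w\<in>children v. below Gr w)"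
 proof
  show "(\<Union>w\<in>children v. below Gr w) \<subseteq> below Gr v"
   using below_mono[of v] by (auto simp: children_def)
  show "below Gr v \<subseteq> (\<Union>w\<in>children v. below Gr w)"
  proof
   fix x assume x: "x : below Gr v"
   hence "(v, x) : E\<^sup>*" "x ~= v" using assms V_split(2) by (auto simp: below_def)
   then obtain w where "(v, w) : E" "(w, x) : E\<^sup>*" by (auto elim: converse_rtranclE)
   thus "x : (\<Union>w\<in>children v. below Gr w)" using x by (auto simp: below_def children_def)
  qed
 qed
 moreover have "disjoint_family_on (below Gr) (children v)"
  using below_disjoint level_edge by (fastforce simp: disjoint_family_on_def children_def)
 ultimately show ?thesis
  using finite_children finite_below by (simp add: card_UN_disjoint' disjoint_family_on_def card_UN_disjoint)
qed

lemma card_below_pos: "v : V ==> card (below Gr v) >= 1"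
 using below_nonempty finite_below by (simp add: Suc_le_eq card_gt_0_iff)

lemma card_children_le:
 assumes "v : nonleaves Gr"
 shows "card (children v) <= card (below Gr v)" "card (children v) >= 1"
proof -
 have "(\<Sum>w\<in>children v. 1) <= (\<Sum>w\<in>children v. card (below Gr w))"
  using card_below_pos edge_in_V by (intro sum_mono) (auto simp: children_def)
 thus "card (children v) <= card (below Gr v)" using card_below_nonleaf[OF assms] by simp
 have "children v ~= {}" using assms by (auto simp: nonleaf_iff children_def)
 thus "card (children v) >= 1" using finite_children[of v] by (simp add: Suc_le_eq card_gt_0_iff)
qed

lemma has_trivial_tail_iff: "has_trivial_tail Gr \<longleftrightarrow> (\<exists>v\<in>nonleaves Gr. card (below Gr v) = 1)"
proof -
 have "card (out_edges Gr v) = 1" if "v : nonleaves Gr" "card (below Gr v) = 1" for v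
  using card_children_le[OF that(1)] that(2) by (simp add: card_out_edges)
 thus ?thesis unfolding has_trivial_tail_def below_def by blast
qed

text \<open>The rank of the partition of the leaves at level \<open>d\<close>: a vertex with m
  leaves below it is a block of size m and contributes m - 1.\<close>

definition rank_at :: "nat => nat" where
 "rank_at d = (\<Sum>v | v : nonleaves Gr & level Gr v = d. card (below Gr v) - 1)"

text \<open>Splitting a block over c children lowers the rank by c - 1, and children that are leaves
  have no rank left. This identifies the exponent at level \<open>d\<close> with a rank jump between
  consecutive partitions.\<close>

lemma rank_at_step:
 assumes "d >= 1"
 shows "rank_at d = (\<Sum>v | v : nonleaves Gr & level Gr v = d. card (out_edges Gr v) - 1) + rank_at (Suc d)"
proof -
 let ?L = "{v : nonleaves Gr. level Gr v = d}"
 have ch: "card (below Gr v) - 1 = (card (out_edges Gr v) - 1) + (\<Sum>w\<in>children v Int nonleaves Gr. card (below Gr w) - 1)"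
  if v: "v : nonleaves Gr" for v
 proof -
  have "card (below Gr v) = (\<Sum>w\<in>children v. 1 + (card (below Gr w) - 1))"
   unfolding card_below_nonleaf[OF v] using card_below_pos edge_in_V
   by (intro sum.cong refl) (fastforce simp: children_def)
  also have "... = card (children v) + (\<Sum>w\<in>children v. card (below Gr w) - 1)"
   by (simp only: sum.distrib) simp
  also have "(\<Sum>w\<in>children v. card (below Gr w) - 1) = (\<Sum>w\<in>children v Int nonleaves Gr. card (below Gr w) - 1)"
  proof (rule sum.mono_neutral_right[OF finite_children])
   show "\<forall>i\<in>children v - children v Int nonleaves Gr. card (below Gr i) - 1 = 0"
   proof
    fix w assume "w : children v - children v Int nonleaves Gr"
    hence "w : leaves Gr" using V_split(1) edge_in_V(2) by (auto simp: children_def)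
    thus "card (below Gr w) - 1 = 0" by (simp add: below_leaf)
   qed
  qed auto
  finally show ?thesis using card_children_le(2)[OF v] by (simp add: card_out_edges)
 qed
 have "{v : nonleaves Gr. level Gr v = Suc d} = (\<Union>v\<in>?L. children v Int nonleaves Gr)"
 proof
  show "{v : nonleaves Gr. level Gr v = Suc d} \<subseteq> (\<Union>v\<in>?L. children v Int nonleaves Gr)"
  proof clarify
   fix v assume v: "v : nonleaves Gr" "level Gr v = Suc d"
   then obtain u where u: "(u, v) : E" using parent_exists[of v] nonleaves_in_V assms by auto
   hence "u : ?L" using level_edge[OF u] v(2) nonleaf_iff by auto
   thus "v : (\<Union>v\<in>?L. children v Int nonleaves Gr)" using u v(1) unfolding children_def by blast
  qed
  show "(\<Union>v\<in>?L. children v Int nonleaves Gr) \<subseteq> {v : nonleaves Gr. level Gr v = Suc d}"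
   using level_edge by (auto simp: children_def)
 qed
 hence "rank_at (Suc d) = (\<Sum>w\<in>(\<Union>v\<in>?L. children v Int nonleaves Gr). card (below Gr w) - 1)"
  by (simp add: rank_at_def)
 also have "... = (\<Sum>v\<in>?L. \<Sum>w\<in>children v Int nonleaves Gr. card (below Gr w) - 1)"
  by (rule sum.UNION_disjoint) (use finite_nonleaves finite_children parent_unique in \<open>auto simp: children_def\<close>)
 finally have "rank_at (Suc d) = (\<Sum>v\<in>?L. \<Sum>w\<in>children v Int nonleaves Gr. card (below Gr w) - 1)" .
 thus ?thesis
  using ch by (simp only: rank_at_def[of d] sum.distrib[symmetric]) (intro sum.cong refl, blast)
qed

lemma card_leaves: "card (leaves Gr) = num_trees Gr + rank_at 1"
proof -
 have fr: "finite (roots Gr)" using finite_V by (simp add: roots_def)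
 have "leaves Gr = (\<Union>r\<in>roots Gr. below Gr r)"
 proof
  show "(\<Union>r\<in>roots Gr. below Gr r) \<subseteq> leaves Gr" using below_subset by blast
  show "leaves Gr \<subseteq> (\<Union>r\<in>roots Gr. below Gr r)"
  proof
   fix x assume x: "x : leaves Gr"
   then obtain r d where "r : roots Gr" "(r, x) : E ^^ d" using root_path leaves_in_V by blast
   thus "x : (\<Union>r\<in>roots Gr. below Gr r)" using x relpow_imp_rtrancl by (fastforce simp: below_def)
  qed
 qed
 moreover have "\<forall>i\<in>roots Gr. \<forall>j\<in>roots Gr. i ~= j --> below Gr i Int below Gr j = {}"
  using below_disjoint level_root by (metis disjoint_iff)
 ultimately have "card (leaves Gr) = (\<Sum>r\<in>roots Gr. card (below Gr r))"
  using fr finite_below by (simp add: card_UN_disjoint)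
 also have "... = (\<Sum>r\<in>roots Gr. 1 + (card (below Gr r) - 1))"
  using card_below_pos by (intro sum.cong refl) (fastforce simp: roots_def)
 also have "... = num_trees Gr + (\<Sum>r\<in>roots Gr. card (below Gr r) - 1)"
  by (simp only: sum.distrib) (simp add: num_trees_def)
 also have "(\<Sum>r\<in>roots Gr. card (below Gr r) - 1) = rank_at 1"
  unfolding rank_at_def
 proof (rule sum.mono_neutral_right[OF fr])
  show "{v : nonleaves Gr. level Gr v = 1} \<subseteq> roots Gr"
   using root_iff_level nonleaves_in_V by auto
  show "\<forall>i\<in>roots Gr - {v : nonleaves Gr. level Gr v = 1}. card (below Gr i) - 1 = 0"
  proof
   fix v assume "v : roots Gr - {v : nonleaves Gr. level Gr v = 1}"
   hence "v : leaves Gr" using V_split(1) level_root by (auto simp: roots_def)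
   thus "card (below Gr v) - 1 = 0" by (simp add: below_leaf)
  qed
 qed
 finally show ?thesis .
qed

lemma lookup_forest_monomial:
 "Poly_Mapping.lookup (forest_monomial Gr) 0 = num_trees Gr"
 "d >= 1 ==> Poly_Mapping.lookup (forest_monomial Gr) d = rank_at d - rank_at (Suc d)"
proof -
 have l: "Poly_Mapping.lookup (forest_monomial Gr) d = (if d = 0 then num_trees Gr else 0) +
   (\<Sum>v | v : nonleaves Gr & level Gr v = d. card (out_edges Gr v) - 1)" for d
 proof -
  have "(\<Sum>v\<in>nonleaves Gr. Poly_Mapping.lookup (Poly_Mapping.single (level Gr v) (card (out_edges Gr v) - 1)) d)
    = (\<Sum>v\<in>nonleaves Gr. if level Gr v = d then card (out_edges Gr v) - 1 else 0)"
   by (intro sum.cong) (auto simp: lookup_single)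
  also have "... = (\<Sum>v | v : nonleaves Gr & level Gr v = d. card (out_edges Gr v) - 1)"
   using finite_nonleaves by (simp add: sum.If_cases Int_def)
  finally show ?thesis by (simp add: forest_monomial_def lookup_add lookup_sum lookup_single when_def)
 qed
 have "{v : nonleaves Gr. level Gr v = 0} = {}" using level_pos by (metis (mono_tags, lifting) Collect_empty_eq not_one_le_zero)
 thus "Poly_Mapping.lookup (forest_monomial Gr) 0 = num_trees Gr"
  by (simp only: l sum.empty add_0_right refl if_True)
 show "Poly_Mapping.lookup (forest_monomial Gr) d = rank_at d - rank_at (Suc d)" if "d >= 1"
  using that rank_at_step[OF that] by (simp add: l)
qed

end

section \<open>Labelled forests\<close>

text \<open>Together with a labelling of the leaves, a forest is determined up to isomorphism by the label sets of
 its non-leaf vertices. In a vertex code, level \<open>0\<close> marks the leaves.\<close>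

definition lblocks :: "digraph => (nat => nat) => (nat \<times> nat set) set" where
 "lblocks Gr l = {(level Gr v, l ` below Gr v) | v. v : nonleaves Gr}"

definition vcode :: "digraph => (nat => nat) => nat => nat \<times> nat set" where
 "vcode Gr l v = (if v : leaves Gr then (0, {l v}) else (level Gr v, l ` below Gr v))"

text \<open>Recovers the edges from the codes. The parent of a non-leaf vertex is the vertex one
  level up whose block contains its own; the parent of a leaf is the deepest vertex whose block
  contains its label, expressed by the absence of such a block at the next level.\<close>

definition code_edge :: "(nat \<times> nat set) set => nat \<times> nat set => nat \<times> nat set => bool" where
 "code_edge T x y \<longleftrightarrow> 1 <= fst x & snd y \<subseteq> snd x \<and>
   (if fst y = 0 then ~ (EX C. (Suc (fst x), C) : T & snd y \<subseteq> C) else fst y = Suc (fst x))"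

definition diso :: "(nat => nat) => digraph => digraph => bool" where
 "diso f Gr De \<longleftrightarrow> bij_betw f (fst Gr) (fst De) & map_prod f f ` snd Gr = snd De"

context forest_graph begin

lemma nonleaf_in_V: "v : nonleaves Gr ==> v : V" and nonleaf_not_leaf: "v : nonleaves Gr ==> v ~: leaves Gr"
 and nonleafI: "v : V ==> v ~: leaves Gr ==> v : nonleaves Gr"
 using V_split by auto

lemma label_in_image:
 assumes "inj_on l (leaves Gr)" "x : leaves Gr" "l x : l ` below Gr v"
 shows "x : below Gr v"
 using inj_on_image_mem_iff[OF assms(1,2) below_subset] assms(3) by blast

lemma label_subset:
 assumes "inj_on l (leaves Gr)" "l ` below Gr u \<subseteq> l ` below Gr v"
 shows "below Gr u \<subseteq> below Gr v"
 using assms label_in_image below_subset by blast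

lemma inj_vcode:
 assumes l: "inj_on l (leaves Gr)"
 shows "inj_on (vcode Gr l) V"
proof (rule inj_onI)
 fix u v assume uv: "u : V" "v : V" and eq: "vcode Gr l u = vcode Gr l v"
 have lp: "level Gr x ~= 0" for x using level_pos[of x] by simp
 show "u = v"
 proof (cases "u : leaves Gr")
  case True
  hence "v : leaves Gr" using eq lp[of v] by (auto simp: vcode_def split: if_splits)
  thus ?thesis using eq True l by (simp add: vcode_def inj_on_eq_iff)
 next
  case False
  hence v: "v ~: leaves Gr" using eq lp[of u] by (auto simp: vcode_def split: if_splits)
  hence e: "level Gr u = level Gr v" "l ` below Gr u = l ` below Gr v" using eq False by (auto simp: vcode_def)
  obtain x where x: "x : below Gr u" using below_nonempty[OF uv(1)] by blast
  moreover have "x : below Gr v" using label_subset[OF l] e(2) x by blast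
  ultimately show ?thesis using below_disjoint e(1) by blast
 qed
qed

lemma vcode_image:
 assumes "l ` leaves Gr = I"
 shows "vcode Gr l ` V = (%i. (0, {i})) ` I Un lblocks Gr l"
proof -
 have "vcode Gr l ` leaves Gr = (%i. (0, {i})) ` I"
  using assms by (auto simp: vcode_def)
 moreover have "vcode Gr l ` nonleaves Gr = lblocks Gr l"
  using nonleaf_not_leaf unfolding lblocks_def by (auto simp: vcode_def image_iff)
 ultimately show ?thesis using V_split(1) by (metis image_Un)
qed

lemma edge_iff_code:
 assumes l: "inj_on l (leaves Gr)" and u: "u : V" and v: "v : V"
 shows "(u, v) : E \<longleftrightarrow> code_edge (lblocks Gr l) (vcode Gr l u) (vcode Gr l v)"
proof
 assume e: "(u, v) : E"
 hence nu: "u : nonleaves Gr" using nonleaf_iff by blast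
 have cu: "vcode Gr l u = (level Gr u, l ` below Gr u)" using nonleaf_not_leaf[OF nu] by (simp add: vcode_def)
 have bm: "below Gr v \<subseteq> below Gr u" using below_mono e by blast
 show "code_edge (lblocks Gr l) (vcode Gr l u) (vcode Gr l v)"
 proof (cases "v : leaves Gr")
  case True
  have "~ (EX C. (Suc (level Gr u), C) : lblocks Gr l & {l v} \<subseteq> C)"
  proof
   assume "EX C. (Suc (level Gr u), C) : lblocks Gr l & {l v} \<subseteq> C"
   then obtain w where w: "w : nonleaves Gr" "level Gr w = Suc (level Gr u)" "l v : l ` below Gr w"
    by (auto simp: lblocks_def)
   hence "v : below Gr w" using label_in_image[OF l True] by blast
   moreover have "v : below Gr v" using True by (simp add: below_leaf)
   ultimately have "w = v" using below_disjoint level_edge[OF e] w(2) by metis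
   thus False using w(1) True nonleaf_not_leaf by blast
  qed
  thus ?thesis using True bm cu level_pos[of u] by (auto simp: code_edge_def vcode_def below_leaf)
 next
  case False
  thus ?thesis using bm cu level_pos[of u] level_edge[OF e] by (auto simp: code_edge_def vcode_def)
 qed
next
 assume c: "code_edge (lblocks Gr l) (vcode Gr l u) (vcode Gr l v)"
 hence "u ~: leaves Gr" by (auto simp: code_edge_def vcode_def)
 hence cu: "vcode Gr l u = (level Gr u, l ` below Gr u)" by (simp add: vcode_def)
 show "(u, v) : E"
 proof (cases "v : leaves Gr")
  case True
  hence c': "l v : l ` below Gr u" "~ (EX C. (Suc (level Gr u), C) : lblocks Gr l & l v : C)"
   using c cu by (auto simp: code_edge_def vcode_def)
  have "v : below Gr u" by (rule label_in_image[OF l True c'(1)])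
  hence "(u, v) : E\<^sup>*" "u ~= v" using True `u ~: leaves Gr` by (auto simp: below_def)
  then obtain w where w: "(u, w) : E" "(w, v) : E\<^sup>*" by (auto elim: converse_rtranclE)
  show ?thesis
  proof (cases "w : leaves Gr")
   case True
   hence "w = v" using w(2) leaf_iff by (auto elim: converse_rtranclE)
   thus ?thesis using w(1) by simp
  next
   case False
   hence "w : nonleaves Gr" using w(1) edge_in_V nonleafI by blast
   moreover have "v : below Gr w" using w(2) True by (simp add: below_def)
   ultimately have "(Suc (level Gr u), l ` below Gr w) : lblocks Gr l" "l v : l ` below Gr w"
    using level_edge[OF w(1)] unfolding lblocks_def by force+
   thus ?thesis using c'(2) by blast
  qed
 next
  case False
  hence e: "level Gr v = Suc (level Gr u)" "l ` below Gr v \<subseteq> l ` below Gr u"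
   using c cu level_pos[of v] by (auto simp: code_edge_def vcode_def)
  then obtain p where p: "(p, v) : E" using parent_exists[OF v] level_pos[of u] by auto
  obtain x where x: "x : below Gr v" using below_nonempty[OF v] by blast
  hence "x : below Gr u" "x : below Gr p" using label_subset[OF l e(2)] below_mono[of p v] p by blast+
  moreover have "level Gr p = level Gr u" using level_edge[OF p] e(1) by simp
  ultimately have "p = u" using below_disjoint by blast
  thus ?thesis using p by simp
 qed
qed

lemma lblocks_cong:
 assumes "!!x. x : leaves Gr ==> l x = m x"
 shows "lblocks Gr l = lblocks Gr m" "v : V ==> vcode Gr l v = vcode Gr m v"
proof -
 have "l ` below Gr v = m ` below Gr v" for v
  using assms below_subset by (intro image_cong) auto
 thus "lblocks Gr l = lblocks Gr m" "v : V ==> vcode Gr l v = vcode Gr m v"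
  using assms by (auto simp: lblocks_def vcode_def)
qed

end

text \<open>Both vertex sets are in bijection with the same set of codes, and by
  \<open>edge_iff_code\<close> the codes determine the edges.\<close>

lemma label_isomorphism:
 assumes G: "forest Gr" and D: "forest De" and l: "bij_betw l (leaves Gr) I" and m: "bij_betw m (leaves De) I"
  and T: "lblocks Gr l = lblocks De m"
 shows "EX f. diso f Gr De & (\<forall>x\<in>leaves Gr. f x : leaves De & m (f x) = l x)"
proof -
 interpret G: forest_graph Gr by unfold_locales fact
 interpret D: forest_graph De by unfold_locales fact
 let ?c = "vcode Gr l" and ?d = "vcode De m"
 have li: "inj_on l (leaves Gr)" "l ` leaves Gr = I" and mi: "inj_on m (leaves De)" "m ` leaves De = I"
  using l m by (auto simp: bij_betw_def)
 have im: "?c ` fst Gr = ?d ` fst De"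
  by (simp add: G.vcode_image[OF li(2)] D.vcode_image[OF mi(2)] T)
 have bc: "bij_betw ?c (fst Gr) (?d ` fst De)" "bij_betw ?d (fst De) (?d ` fst De)"
  using G.inj_vcode[OF li(1)] D.inj_vcode[OF mi(1)] im by (auto simp: bij_betw_def)
 define f where "f = inv_into (fst De) ?d o ?c"
 have bf: "bij_betw f (fst Gr) (fst De)"
  unfolding f_def by (rule bij_betw_trans[OF bc(1) bij_betw_inv_into[OF bc(2)]])
 have df: "?d (f v) = ?c v" if "v : fst Gr" for v
  using that im by (simp add: f_def f_inv_into_f[of "?c v" ?d "fst De"] flip: im)
 have fV: "f v : fst De" if "v : fst Gr" for v using bf that by (auto simp: bij_betw_def)
 have edge: "(u, v) : snd Gr \<longleftrightarrow> (f u, f v) : snd De" if "u : fst Gr" "v : fst Gr" for u v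
  using that by (simp add: G.edge_iff_code[OF li(1)] D.edge_iff_code[OF mi(1)] fV df T)
 have "map_prod f f ` snd Gr = snd De"
 proof
  show "map_prod f f ` snd Gr \<subseteq> snd De"
  proof
   fix p assume "p : map_prod f f ` snd Gr"
   then obtain u v where p: "p = (f u, f v)" "(u, v) : snd Gr" by auto
   thus "p : snd De" using edge[OF G.edge_in_V[OF p(2)]] by simp
  qed
  show "snd De \<subseteq> map_prod f f ` snd Gr"
  proof (rule subrelI)
   fix a b assume ab: "(a, b) : snd De"
   have "a : fst De" "b : fst De" using D.edge_in_V[OF ab] .
   then obtain u v where uv: "a = f u" "u : fst Gr" "b = f v" "v : fst Gr"
    using bij_betw_imp_surj_on[OF bf] by blast
   hence "(u, v) : snd Gr" using ab edge by simp
   thus "(a, b) : map_prod f f ` snd Gr" using uv by force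
  qed
 qed
 moreover have "f x : leaves De & m (f x) = l x" if x: "x : leaves Gr" for x
 proof -
  have "?c x = (0, {l x})" using x by (simp add: vcode_def)
  hence "?d (f x) = (0, {l x})" using df[of x] x G.leaves_in_V by auto
  thus ?thesis using D.level_pos[of "f x"] unfolding vcode_def by (simp split: if_splits)
 qed
 ultimately show ?thesis using bf unfolding diso_def by blast
qed

locale ftransport = forest_graph +
 fixes De :: digraph and f :: "nat => nat"
 assumes iso: "diso f Gr De"
begin

lemma f_bij: "bij_betw f V (fst De)" and f_edges: "snd De = map_prod f f ` E"
 using iso by (auto simp: diso_def)

lemma f_inj: "u : V ==> v : V ==> f u = f v \<longleftrightarrow> u = v"
 using f_bij by (auto simp: bij_betw_def inj_on_eq_iff)

lemma f_in: "v : V ==> f v : fst De"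
 using f_bij by (auto simp: bij_betw_def)

lemma f_edge: "(u, v) : E ==> (f u, f v) : snd De"
 unfolding f_edges by force

lemma f_edgeD: "(x, y) : snd De ==> EX u v. x = f u & y = f v & (u, v) : E"
 unfolding f_edges by auto

lemma f_edge_out: "u : V ==> (f u, y) : snd De ==> EX v. y = f v & (u, v) : E"
 using f_edgeD f_inj edge_in_V by metis

lemma f_edge_in: "v : V ==> (x, f v) : snd De ==> EX u. x = f u & (u, v) : E"
 using f_edgeD f_inj edge_in_V by metis

lemma f_trancl:
 assumes u: "u : V" and path: "(f u, y) : (snd De)\<^sup>+"
 shows "EX w. y = f w & (u, w) : E\<^sup>+"
 using path
proof (induct rule: trancl_induct)
 case (base y)
 thus ?case using f_edge_out[OF u base] by blast
next
 case (step y z)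
 then obtain w where w: "y = f w" "(u, w) : E\<^sup>+" by blast
 hence "w : V" using edge_in_V by (auto elim: tranclE)
 moreover have "(f w, z) : snd De" using step(2) w(1) by simp
 ultimately obtain v where "z = f v" "(w, v) : E" using f_edge_out[of w z] by blast
 thus ?case using trancl_into_trancl[OF w(2)] by blast
qed

lemma forest_target: "forest De"
proof -
 have "finite (fst De)" using f_bij finite_V by (metis bij_betw_finite)
 moreover have "snd De \<subseteq> fst De \<times> fst De" using f_edgeD f_in edge_in_V by fast
 moreover have "acyclic (snd De)"
 proof (rule acyclicI, intro allI notI)
  fix x assume x: "(x, x) : (snd De)\<^sup>+"
  then obtain y where "(x, y) : snd De" by (auto elim: converse_tranclE)
  then obtain u where u: "x = f u" "u : V" using f_edgeD edge_in_V by metis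
  have "(f u, f u) : (snd De)\<^sup>+" using x u(1) by simp
  from f_trancl[OF u(2) this] obtain w where w: "f u = f w" "(u, w) : E\<^sup>+" by blast
  hence "w : V" using edge_in_V by (auto elim: tranclE)
  hence "u = w" using w(1) u(2) f_inj by blast
  thus False using w(2) acyclic_E by (auto simp: acyclic_def)
 qed
 moreover have "u = v" if h: "(u, w) : snd De" "(v, w) : snd De" for u v w
 proof -
  obtain a b where ab: "u = f a" "w = f b" "(a, b) : E" using f_edgeD[OF h(1)] by blast
  hence "(v, f b) : snd De" using h(2) by simp
  then obtain c where "v = f c" "(c, b) : E" using f_edge_in[OF edge_in_V(2)[OF ab(3)]] by blast
  thus ?thesis using parent_unique[OF ab(3)] ab(1) by blast
 qed
 ultimately show ?thesis by (auto simp: forest_def case_prod_unfold)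
qed

sublocale D: forest_graph De
 by unfold_locales (rule forest_target)

lemma f_leaf: "v : V ==> f v : leaves De \<longleftrightarrow> v : leaves Gr"
proof
 assume "v : V" "f v : leaves De"
 thus "v : leaves Gr" using f_edge[of v] by (auto simp: D.leaf_iff leaf_iff)
next
 assume v: "v : V" "v : leaves Gr"
 have "(f v, y) ~: snd De" for y using f_edge_out[OF v(1), of y] v(2) by (auto simp: leaf_iff)
 thus "f v : leaves De" using f_in[OF v(1)] by (simp add: D.leaf_iff)
qed

lemma f_leaves: "leaves De = f ` leaves Gr"
proof (intro equalityI subsetI)
 fix x assume x: "x : leaves De"
 hence "x : f ` V" using f_bij D.leaves_in_V by (auto simp: bij_betw_def)
 thus "x : f ` leaves Gr" using x f_leaf by auto
next
 fix x assume "x : f ` leaves Gr"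
 thus "x : leaves De" using f_leaf leaves_in_V by auto
qed

lemma f_nonleaves: "nonleaves De = f ` nonleaves Gr"
proof -
 have "inj_on f V" "f ` V = fst De" using f_bij by (auto simp: bij_betw_def)
 hence "f ` (V - leaves Gr) = fst De - leaves De"
  using inj_on_image_set_diff[of f V V "leaves Gr"] leaves_in_V by (simp add: f_leaves)
 moreover have "nonleaves De = fst De - leaves De" "nonleaves Gr = V - leaves Gr"
  using D.V_split V_split by blast+
 ultimately show ?thesis by simp
qed

lemma f_level: "v : V ==> level De (f v) = level Gr v"
proof (induct v rule: wf_induct_rule[OF wf_E])
 case (1 v)
 show ?case
 proof (cases "v : roots Gr")
  case True
  hence "f v : roots De" using 1(2) f_in f_edge_in by (fastforce simp: roots_def)
  thus ?thesis using True D.level_root level_root by simp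
 next
  case False
  then obtain u where u: "(u, v) : E" using 1(2) root_or_parent by blast
  hence "level De (f u) = level Gr u" using 1(1) edge_in_V by blast
  thus ?thesis using D.level_edge[OF f_edge[OF u]] level_edge[OF u] by simp
 qed
qed

lemma f_path: "(u, w) : E\<^sup>* ==> (f u, f w) : (snd De)\<^sup>*"
 by (induct rule: rtrancl_induct) (auto dest: f_edge intro: rtrancl_into_rtrancl)

lemma f_pathD:
 assumes "u : V" "(f u, y) : (snd De)\<^sup>*"
 shows "EX w. y = f w & (u, w) : E\<^sup>*"
proof (cases "y = f u")
 case False
 hence "(f u, y) : (snd De)\<^sup>+" using rtranclD[OF assms(2)] by auto
 from f_trancl[OF assms(1) this] obtain w where "y = f w" "(u, w) : E\<^sup>+" by blast
 thus ?thesis by (intro exI[of _ w] conjI trancl_into_rtrancl)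
qed (intro exI[of _ u], simp)

lemma f_below: "v : V ==> below De (f v) = f ` below Gr v"
proof -
 assume v: "v : V"
 have "x : f ` below Gr v" if h: "x : leaves De" "(f v, x) : (snd De)\<^sup>*" for x
 proof -
  obtain w where w: "x = f w" "(v, w) : E\<^sup>*" using f_pathD[OF v h(2)] by blast
  hence "w : leaves Gr" using h(1) f_leaf[OF path_in_V[OF w(2) v]] by simp
  thus ?thesis using w by (simp add: below_def)
 qed
 moreover have "f x : below De (f v)" if "x : below Gr v" for x
  using that f_path f_leaves by (auto simp: below_def)
 ultimately show ?thesis by (auto simp: below_def)
qed

lemma lblocks_transport: "lblocks De m = lblocks Gr (m o f)"
proof -
 have "lblocks De m = (%v. (level De v, m ` below De v)) ` nonleaves De" by (auto simp: lblocks_def)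
 also have "... = (%v. (level De (f v), m ` below De (f v))) ` nonleaves Gr" by (simp add: f_nonleaves image_image)
 also have "... = (%v. (level Gr v, (m o f) ` below Gr v)) ` nonleaves Gr"
  using nonleaf_in_V by (intro image_cong) (auto simp: f_level f_below image_image)
 finally show ?thesis by (auto simp: lblocks_def)
qed

lemma vcode_transport: "v : V ==> vcode De m (f v) = vcode Gr (m o f) v"
 by (auto simp: vcode_def f_leaf f_level f_below)

lemma card_leaves_transport: "card (leaves De) = card (leaves Gr)"
 unfolding f_leaves by (intro card_image inj_onI) (use f_inj leaves_in_V in auto)

lemma has_trivial_tail_transport: "has_trivial_tail De \<longleftrightarrow> has_trivial_tail Gr"
proof -
 have "card (f ` below Gr v) = card (below Gr v)" for v
  by (intro card_image inj_onI) (use f_inj leaves_in_V below_subset in blast)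
 hence "card (below De (f v)) = card (below Gr v)" if "v : nonleaves Gr" for v
  using that f_below nonleaf_in_V by simp
 thus ?thesis by (simp add: D.has_trivial_tail_iff has_trivial_tail_iff f_nonleaves)
qed

end

text \<open>The automorphisms act simply transitively on the labellings with given blocks:
  transitively by \<open>label_isomorphism\<close>, and freely because a vertex is determined by its
  code.\<close>

lemma card_labellings:
 assumes G: "forest Gr" and l0: "bij_betw l0 (leaves Gr) I"
 shows "card {l : extensional (leaves Gr). bij_betw l (leaves Gr) I & lblocks Gr l = lblocks Gr l0} =
  card (automorphisms Gr)"
proof -
 interpret forest_graph Gr by unfold_locales fact
 let ?L = "{l : extensional (leaves Gr). bij_betw l (leaves Gr) I & lblocks Gr l = lblocks Gr l0}"
 have tr: "ftransport Gr Gr al" if "al : automorphisms Gr" for al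
  using that permutes_imp_bij by unfold_locales (auto simp: diso_def automorphisms_def)
 have "bij_betw (%al. restrict (l0 o al) (leaves Gr)) (automorphisms Gr) ?L"
 proof (rule bij_betw_imageI)
  show "inj_on (%al. restrict (l0 o al) (leaves Gr)) (automorphisms Gr)"
  proof (rule inj_onI)
   fix al \<beta> assume a: "al : automorphisms Gr" and b: "\<beta> : automorphisms Gr"
    and eq: "restrict (l0 o al) (leaves Gr) = restrict (l0 o \<beta>) (leaves Gr)"
   have "al v = \<beta> v" for v
   proof (cases "v : V")
    case True
    have "(l0 o al) x = (l0 o \<beta>) x" if "x : leaves Gr" for x
     using fun_cong[OF eq, of x] that by simp
    hence "vcode Gr (l0 o al) v = vcode Gr (l0 o \<beta>) v"
     by (rule lblocks_cong(2)[OF _ True])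
    hence "vcode Gr l0 (al v) = vcode Gr l0 (\<beta> v)"
     using ftransport.vcode_transport[OF tr[OF a] True] ftransport.vcode_transport[OF tr[OF b] True]
     by simp
    moreover have "inj_on (vcode Gr l0) V" using l0 inj_vcode by (simp add: bij_betw_def)
    moreover have "al v : V" "\<beta> v : V" using ftransport.f_in[OF tr[OF a] True] ftransport.f_in[OF tr[OF b] True] .
    ultimately show ?thesis by (simp add: inj_on_eq_iff)
   next
    case False
    thus ?thesis using a b by (auto simp: automorphisms_def permutes_def)
   qed
   thus "al = \<beta>" by auto
  qed
  show "(%al. restrict (l0 o al) (leaves Gr)) ` automorphisms Gr = ?L"
  proof (intro equalityI subsetI)
   fix l assume "l : (%al. restrict (l0 o al) (leaves Gr)) ` automorphisms Gr"
   then obtain al where al: "al : automorphisms Gr" "l = restrict (l0 o al) (leaves Gr)" by blast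
   interpret A: ftransport Gr Gr al by (rule tr[OF al(1)])
   have "bij_betw al (leaves Gr) (leaves Gr)"
    unfolding bij_betw_def using A.f_leaves A.f_inj leaves_in_V by (auto intro!: inj_onI)
   hence "bij_betw (l0 o al) (leaves Gr) I" using l0 by (rule bij_betw_trans)
   hence "bij_betw l (leaves Gr) I" unfolding al(2) by (simp cong: bij_betw_cong)
   moreover have "lblocks Gr l = lblocks Gr l0"
    unfolding A.lblocks_transport[of l0] by (rule lblocks_cong) (simp add: al(2))
   ultimately show "l : ?L" using al(2) by simp
  next
   fix l assume l: "l : ?L"
   then obtain f where f: "diso f Gr Gr" "!!x. x : leaves Gr ==> l0 (f x) = l x"
    using label_isomorphism[OF G G _ l0, of l] by blast
   define al where "al v = (if v : V then f v else v)" for v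
   have "bij_betw al V V" using f(1) by (simp add: al_def diso_def cong: bij_betw_cong)
   hence "al permutes V" by (rule bij_imp_permutes) (simp add: al_def)
   moreover have "map_prod al al ` E = map_prod f f ` E"
    using edge_in_V by (intro image_cong) (auto simp: al_def)
   ultimately have "al : automorphisms Gr" using f(1) by (simp add: automorphisms_def diso_def)
   moreover have "l = restrict (l0 o al) (leaves Gr)"
    using l f(2) leaves_in_V by (auto simp: al_def extensional_def fun_eq_iff)
   ultimately show "l : (%al. restrict (l0 o al) (leaves Gr)) ` automorphisms Gr" by blast
  qed
 qed
 thus ?thesis by (simp add: bij_betw_same_card)
qed

section \<open>Levelled families of blocks\<close>

text \<open>The families of label sets that come from forests. Singleton blocks are left out, which
  is the counterpart of the absence of trivial tails.\<close>

definition lfamily :: "nat set => (nat \<times> nat set) set => bool" where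
 "lfamily I T \<longleftrightarrow> finite T \<and>
   (\<forall>(d, B)\<in>T. 1 <= d & B \<subseteq> I & 2 <= card B) \<and>
   (ALL d B C. (d, B) : T --> (d, C) : T --> B Int C ~= {} --> B = C) \<and>
   (ALL d B. 1 <= d --> (Suc d, B) : T --> (EX C. (d, C) : T & B \<subseteq> C))"

lemma lfamilyD:
 assumes "lfamily I T"
 shows "finite T" "(d, B) : T ==> 1 <= d" "(d, B) : T ==> B \<subseteq> I" "(d, B) : T ==> 2 <= card B"
  "(d, B) : T ==> (d, C) : T ==> x : B ==> x : C ==> B = C"
  "1 <= d ==> (Suc d, B) : T ==> EX C. (d, C) : T & B \<subseteq> C"
proof -
 show "finite T" using assms by (simp add: lfamily_def)
 have 1: "\<forall>(d, B)\<in>T. 1 <= d & B \<subseteq> I & 2 <= card B"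
  using assms unfolding lfamily_def by (elim conjE)
 have 2: "ALL d B C. (d, B) : T --> (d, C) : T --> B Int C ~= {} --> B = C"
  using assms unfolding lfamily_def by (elim conjE)
 have 3: "ALL d B. 1 <= d --> (Suc d, B) : T --> (EX C. (d, C) : T & B \<subseteq> C)"
  using assms unfolding lfamily_def by (elim conjE)
 show "(d, B) : T ==> 1 <= d" "(d, B) : T ==> B \<subseteq> I" "(d, B) : T ==> 2 <= card B"
  using bspec[OF 1, of "(d, B)"] by simp_all
 show "(d, B) : T ==> (d, C) : T ==> x : B ==> x : C ==> B = C"
  using 2[rule_format, of d B C] by blast
 show "1 <= d ==> (Suc d, B) : T ==> EX C. (d, C) : T & B \<subseteq> C"
  using 3 by simp
qed

lemma (in forest_graph) lfamily_blocks:
 assumes "~ has_trivial_tail Gr" and l: "bij_betw l (leaves Gr) I"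
 shows "lfamily I (lblocks Gr l)"
proof -
 have li: "inj_on l (leaves Gr)" and lI: "l ` leaves Gr = I" using l by (auto simp: bij_betw_def)
 have cb: "card (l ` below Gr v) = card (below Gr v)" for v
  by (rule card_image[OF inj_on_subset[OF li below_subset]])
 have c2: "2 <= card (below Gr v)" if v: "v : nonleaves Gr" for v
  using assms(1) card_below_pos[OF nonleaf_in_V[OF v]] v unfolding has_trivial_tail_iff by fastforce
 have "lblocks Gr l = (%v. (level Gr v, l ` below Gr v)) ` nonleaves Gr"
  by (auto simp: lblocks_def)
 hence "finite (lblocks Gr l)" using finite_nonleaves by simp
 moreover have "1 <= d & B \<subseteq> I & 2 <= card B" if h: "(d, B) : lblocks Gr l" for d B
 proof -
  obtain v where v: "d = level Gr v" "B = l ` below Gr v" "v : nonleaves Gr" using h unfolding lblocks_def by blast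
  hence "B \<subseteq> I" using below_subset lI by blast
  thus ?thesis using v c2 cb level_pos by simp
 qed
 moreover have "B = C" if h: "(d, B) : lblocks Gr l" "(d, C) : lblocks Gr l" "B Int C ~= {}" for d B C
 proof -
  obtain u where u: "B = l ` below Gr u" "d = level Gr u" using h(1) unfolding lblocks_def by blast
  obtain v where v: "C = l ` below Gr v" "d = level Gr v" using h(2) unfolding lblocks_def by blast
  obtain x where x: "x : below Gr u" "l x : C" using h(3) u(1) by auto
  hence "x : below Gr v" using label_in_image[OF li] below_subset v(1) by blast
  hence "u = v" using below_disjoint[OF x(1)] u(2) v(2) by simp
  thus ?thesis using u v by simp
 qed
 moreover have "EX C. (d, C) : lblocks Gr l & B \<subseteq> C" if h: "1 <= d" "(Suc d, B) : lblocks Gr l" for d B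
 proof -
  obtain v where v: "B = l ` below Gr v" "level Gr v = Suc d" "v : nonleaves Gr" using h(2) unfolding lblocks_def by force
  then obtain u where u: "(u, v) : E" using parent_exists[OF nonleaf_in_V[OF v(3)]] h(1) by auto
  hence "u : nonleaves Gr" "level Gr u = d" "below Gr v \<subseteq> below Gr u"
   using nonleaf_iff level_edge[OF u] v(2) below_mono[of u v] by auto
  thus ?thesis using v(1) unfolding lblocks_def by (intro exI[of _ "l ` below Gr u"]) blast
 qed
 ultimately show ?thesis unfolding lfamily_def by auto
qed

text \<open>The codes themselves serve as vertices, turned into natural numbers by an injection
  \<open>h\<close>, with \<open>code_edge\<close> as the edge relation.\<close>

lemma lfamily_realized:
 assumes I: "finite I" and T: "lfamily I T"
 shows "EX Gr l. forest Gr & ~ has_trivial_tail Gr & bij_betw l (leaves Gr) I & lblocks Gr l = T"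
proof -
 note TD = lfamilyD[OF T]
 define X where "X = (%i. (0::nat, {i})) ` I Un T"
 have "finite X" using I TD(1) by (simp add: X_def)
 then obtain h :: "nat \<times> nat set => nat" where h: "inj_on h X"
  using finite_imp_inj_to_nat_seg by metis
 define c where "c = inv_into X h"
 have ch: "c (h x) = x" if "x : X" for x using h that by (simp add: c_def)
 define Gr where "Gr = (h ` X, {(h x, h y) | x y. x : X & y : X & code_edge T x y})"
 have V: "fst Gr = h ` X" and E: "!!u v. (u, v) : snd Gr \<longleftrightarrow> (EX x y. u = h x & v = h y & x : X & y : X & code_edge T x y)"
  by (auto simp: Gr_def)
 have X0: "x = (0, {i}) & i : I | x : T & fst x >= 1" if "x : X" "i : snd x" "fst x = 0 --> snd x = {i}" for x i
  using that TD(2) by (cases x) (auto simp: X_def)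
 have X1: "x : T" if "x : X" "fst x >= 1" for x using that by (auto simp: X_def)
 have X2: "\<exists>i\<in>I. x = (0, {i})" if "x : X" "fst x = 0" for x
  using that TD(2) by (cases x) (auto simp: X_def)
 have ne: "snd x ~= {}" if "x : X" for x
  using that TD(4)[of "fst x" "{}"] by (cases x) (auto simp: X_def)
 define N where "N = Suc (Max (insert 0 (fst ` T)))"
 have N: "fst x < N" if "x : X" for x
  using that TD(1) by (auto simp: N_def X_def less_Suc_eq_le intro: Max_ge)
 \<comment> \<open>A height that drops along every edge, with leaves at the bottom; it yields
   acyclicity and an induction from the leaves upwards.\<close>
 define ht where "ht x = (if fst x = 0 then 0 else N - fst x)" for x :: "nat \<times> nat set"
 have ht: "ht y < ht x" if "code_edge T x y" "x : X" "y : X" for x y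
  using that N[OF that(2)] N[OF that(3)] by (auto simp: ht_def code_edge_def split: if_splits)
 have par: "x = x'" if h': "code_edge T x y" "code_edge T x' y" "x : X" "x' : X" "y : X" for x x' y
 proof -
  obtain i where i: "i : snd y" using ne[OF h'(5)] by blast
  have xT: "x : T" "x' : T" "i : snd x" "i : snd x'"
   using h' X1 i by (auto simp: code_edge_def)
  have same: "x = x'" if "fst x = fst x'" using TD(5)[of "fst x" "snd x" "snd x'" i] xT that by (cases x; cases x') auto
  \<comment> \<open>Nesting over several levels. It excludes parents of one leaf at different
    levels, since the deeper block would be contained in a block just below the shallower parent,
    which then contains the label.\<close>
  have up: "EX C. (d, C) : T & B \<subseteq> C" if "(d + e, B) : T" "d >= 1" for d e B
   using that
  proof (induct e arbitrary: B)
   case (Suc e)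
   obtain C where C: "(d + e, C) : T" "B \<subseteq> C" using TD(6)[of "d + e" B] Suc(2,3) by auto
   obtain D where "(d, D) : T" "C \<subseteq> D" using Suc(1)[OF C(1) Suc(3)] by blast
   thus ?case using C(2) by blast
  qed auto
  show ?thesis
  proof (cases "fst y = 0")
   case False
   hence "fst x = fst x'" using that by (simp add: code_edge_def)
   thus ?thesis by (rule same)
  next
   case True
   hence y: "snd y = {i}" using X2[OF that(5)] i by auto
   have no: "~ (EX C. (Suc (fst x), C) : T & i : C)" "~ (EX C. (Suc (fst x'), C) : T & i : C)"
    using that True y by (auto simp: code_edge_def)
   have False if lt: "fst a < fst b" "a : T" "b : T" "i : snd b" "~ (EX C. (Suc (fst a), C) : T & i : C)" for a b
    using up[of "Suc (fst a)" "fst b - Suc (fst a)" "snd b"] lt by auto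
   hence "~ fst x < fst x'" "~ fst x' < fst x" using xT no by blast+
   thus ?thesis using same by simp
  qed
 qed
 have forest: "forest Gr"
 proof -
  have "(snd Gr)\<inverse> \<subseteq> measure (ht o c)"
   using ht ch by (auto simp: E)
  hence "wf ((snd Gr)\<inverse>)" by (rule wf_subset[OF wf_measure])
  hence "acyclic (snd Gr)" using wf_acyclic acyclic_converse by blast
  moreover have "u = v" if h1: "(u, w) : snd Gr" and h2: "(v, w) : snd Gr" for u v w
  proof -
   obtain x y where x: "u = h x" "w = h y" "x : X" "y : X" "code_edge T x y" using h1 E by blast
   obtain x' y' where x': "v = h x'" "w = h y'" "x' : X" "y' : X" "code_edge T x' y'" using h2 E by blast
   have "y = y'" using inj_onD[OF h] x(2,4) x'(2,4) by metis
   thus ?thesis using par[of x y x'] x x' by simp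
  qed
  moreover have "finite (fst Gr)" using `finite X` by (simp add: V)
  moreover have "snd Gr \<subseteq> fst Gr \<times> fst Gr" by (auto simp: Gr_def)
  ultimately show ?thesis unfolding forest_def case_prod_unfold by blast
 qed
 interpret G: forest_graph Gr by unfold_locales (rule forest)
 have edge: "(h x, h y) : snd Gr \<longleftrightarrow> code_edge T x y" if "x : X" "y : X" for x y
  using that inj_onD[OF h] unfolding E by metis
 have lev: "level Gr (h (d, B)) = d" if "(d, B) : T" for d B
  using that
 proof (induct d arbitrary: B)
  case 0
  thus ?case using TD(2) by fastforce
 next
  case (Suc d)
  have xX: "(Suc d, B) : X" using Suc(2) by (simp add: X_def)
  show ?case
  proof (cases "d = 0")
   case True
   have "(u, h (Suc d, B)) ~: snd Gr" for u
   proof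
    assume "(u, h (Suc d, B)) : snd Gr"
    then obtain x y where x: "h (Suc d, B) = h y" "y : X" "code_edge T x y" unfolding E by blast
    hence "y = (Suc d, B)" using inj_onD[OF h] xX by metis
    thus False using x(3) True by (auto simp: code_edge_def)
   qed
   hence "h (Suc d, B) : roots Gr" using xX by (auto simp: roots_def V)
   thus ?thesis using G.level_root True by simp
  next
   case False
   then obtain C where C: "(d, C) : T" "B \<subseteq> C" using TD(6)[OF _ Suc(2)] by auto
   hence "code_edge T (d, C) (Suc d, B)" using False by (simp add: code_edge_def)
   moreover have "(d, C) : X" using C(1) by (simp add: X_def)
   ultimately have "(h (d, C), h (Suc d, B)) : snd Gr" using edge xX by simp
   thus ?thesis using G.level_edge Suc(1)[OF C(1)] by simp
  qed
 qed
 \<comment> \<open>Each label of a block is passed on to a child: to a block of the next level if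
   one contains it, and to its own leaf otherwise.\<close>
 have down: "\<exists>y\<in>X. code_edge T (d, B) y & i : snd y" if h1: "(d, B) : T" and i: "i : B" for d B i
 proof (cases "EX C. (Suc d, C) : T & i : C")
  case True
  then obtain C where C: "(Suc d, C) : T" "i : C" by blast
  obtain C' where C': "(d, C') : T" "C \<subseteq> C'" using TD(6)[OF TD(2)[OF h1] C(1)] by blast
  hence "C' = B" using TD(5)[OF C'(1) h1] C(2) i by blast
  hence "code_edge T (d, B) (Suc d, C)" using C' TD(2)[OF h1] by (simp add: code_edge_def)
  thus ?thesis using C by (intro bexI[of _ "(Suc d, C)"]) (auto simp: X_def)
 next
  case False
  hence "code_edge T (d, B) (0, {i})" using i TD(2)[OF h1] by (simp add: code_edge_def)
  moreover have "(0, {i}) : X" using i TD(3)[OF h1] by (auto simp: X_def)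
  ultimately show ?thesis by (intro bexI[of _ "(0, {i})"]) auto
 qed
 have leaf: "h x : leaves Gr \<longleftrightarrow> fst x = 0" if x: "x : X" for x
 proof
  assume 0: "fst x = 0"
  have "(h x, w) ~: snd Gr" for w
  proof
   assume "(h x, w) : snd Gr"
   then obtain x' y where "h x = h x'" "x' : X" "code_edge T x' y" unfolding E by blast
   hence "code_edge T x y" using inj_onD[OF h _ x] by metis
   thus False using 0 by (simp add: code_edge_def)
  qed
  thus "h x : leaves Gr" using x by (simp add: G.leaf_iff V)
 next
  assume lf: "h x : leaves Gr"
  show "fst x = 0"
  proof (rule ccontr)
   assume "fst x ~= 0"
   hence xT: "(fst x, snd x) : T" using X1 x by simp
   obtain i where i: "i : snd x" using ne[OF x] by blast
   have "\<exists>y\<in>X. code_edge T x y & i : snd y" using down[OF xT i] by simp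
   then obtain y where "y : X" "code_edge T x y" by blast
   hence "(h x, h y) : snd Gr" using edge x by simp
   thus False using lf G.leaf_iff by blast
  qed
 qed
 have lvs: "leaves Gr = (%i. h (0, {i})) ` I"
 proof (intro equalityI subsetI)
  fix v assume v: "v : leaves Gr"
  then obtain x where x: "v = h x" "x : X" using G.leaves_in_V V by auto
  hence "fst x = 0" using leaf v by simp
  thus "v : (%i. h (0, {i})) ` I" using X2[OF x(2)] x(1) by auto
 next
  fix v assume "v : (%i. h (0, {i})) ` I"
  then obtain i where "v = h (0, {i})" "(0, {i}) : X" by (auto simp: X_def)
  thus "v : leaves Gr" using leaf by simp
 qed
 have nlvs: "nonleaves Gr = h ` T"
 proof (intro equalityI subsetI)
  fix v assume v: "v : nonleaves Gr"
  have "v : h ` X" using G.nonleaf_in_V[OF v] V by simp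
  then obtain x where x: "v = h x" "x : X" by blast
  have "fst x ~= 0" using leaf[OF x(2)] G.nonleaf_not_leaf[OF v] x(1) by simp
  hence "x : T" using X1[OF x(2)] v x(1) by simp
  thus "v : h ` T" using x(1) by simp
 next
  fix v assume "v : h ` T"
  then obtain d B where x: "v = h (d, B)" "(d, B) : T" by (auto simp: image_iff)
  hence "(d, B) : X" "d ~= 0" using TD(2)[of d B] by (auto simp: X_def)
  thus "v : nonleaves Gr" using leaf G.nonleafI x(1) V by auto
 qed
 define l where "l v = the_elem (snd (c v))" for v
 have lh: "l (h (0, {i})) = i" if "i : I" for i
  using ch[of "(0, {i})"] that by (simp add: l_def X_def)
 have bij: "bij_betw l (leaves Gr) I"
  unfolding lvs by (rule bij_betwI[where g = "%i. h (0, {i})"]) (auto simp: lh)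
 have path_sub: "\<exists>y\<in>X. w = h y & snd y \<subseteq> snd x" if p: "(h x, w) : (snd Gr)\<^sup>*" and x: "x : X" for x w
  using p
 proof (induct rule: rtrancl_induct)
  case base
  show ?case using x by blast
 next
  case (step y z)
  then obtain a where a: "a : X" "y = h a" "snd a \<subseteq> snd x" by blast
  obtain a' b where b: "y = h a'" "z = h b" "a' : X" "b : X" "code_edge T a' b" using step(2) E by blast
  have "a' = a" using inj_onD[OF h] a(1,2) b(1,3) by metis
  hence "snd b \<subseteq> snd x" using b(5) a(3) by (auto simp: code_edge_def)
  thus ?case using b by blast
 qed
 have path_ex: "(h x, h (0, {i})) : (snd Gr)\<^sup>*" if "x : X" "i : snd x" for x i
  using that
 proof (induct x rule: measure_induct_rule[of ht])
  case (less x)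
  show ?case
  proof (cases "fst x = 0")
   case True
   hence "x = (0, {i})" using X2[OF less(2)] less(3) by auto
   thus ?thesis by simp
  next
   case False
   hence xT: "(fst x, snd x) : T" using X1 less(2) by simp
   have "\<exists>y\<in>X. code_edge T x y & i : snd y" using down[OF xT less(3)] by simp
   then obtain y where y: "y : X" "code_edge T x y" "i : snd y" by blast
   hence "(h y, h (0, {i})) : (snd Gr)\<^sup>*" using less(1)[OF ht[OF y(2) less(2) y(1)]] by blast
   moreover have "(h x, h y) : snd Gr" using edge less(2) y by simp
   ultimately show ?thesis by (rule converse_rtrancl_into_rtrancl[rotated])
  qed
 qed
 have bel: "l ` below Gr (h (d, B)) = B" if x: "(d, B) : T" for d B
 proof (intro equalityI subsetI)
  have xX: "(d, B) : X" using x by (simp add: X_def)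
  fix i
  show "i : B" if h': "i : l ` below Gr (h (d, B))"
  proof -
   obtain w where w: "i = l w" "w : leaves Gr" "(h (d, B), w) : (snd Gr)\<^sup>*" using h' by (auto simp: below_def)
   then obtain j where j: "w = h (0, {j})" "j : I" using lvs by blast
   obtain y where y: "y : X" "w = h y" "snd y \<subseteq> B" using path_sub[OF w(3) xX] by auto
   have "(0, {j}) : X" using j(2) by (simp add: X_def)
   hence "y = (0, {j})" using inj_onD[OF h] y(1,2) j(1) by metis
   thus ?thesis using y(3) w(1) lh j by simp
  qed
  show "i : l ` below Gr (h (d, B))" if i: "i : B"
  proof -
   have iI: "i : I" using TD(3)[OF x] i by blast
   hence "h (0, {i}) : below Gr (h (d, B))" using path_ex[OF xX] i lvs by (simp add: below_def)
   thus ?thesis using lh[OF iI] by (metis image_eqI)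
  qed
 qed
 have "lblocks Gr l = T"
 proof (intro equalityI subsetI)
  fix z assume "z : lblocks Gr l"
  then obtain v where v: "z = (level Gr v, l ` below Gr v)" "v : nonleaves Gr" by (auto simp: lblocks_def)
  then obtain d B where "v = h (d, B)" "(d, B) : T" using nlvs by auto
  thus "z : T" using v(1) lev bel by simp
 next
  fix z assume z: "z : T"
  obtain d B where zz: "z = (d, B)" by (rule prod.exhaust)
  hence "z = (level Gr (h z), l ` below Gr (h z))" "h z : nonleaves Gr" using lev bel nlvs z by auto
  thus "z : lblocks Gr l" unfolding lblocks_def by blast
 qed
 moreover have "~ has_trivial_tail Gr"
 proof
  assume "has_trivial_tail Gr"
  then obtain v where v: "v : nonleaves Gr" "card (below Gr v) = 1" using G.has_trivial_tail_iff by blast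
  then obtain d B where dB: "v = h (d, B)" "(d, B) : T" using nlvs by auto
  have "card B <= 1" using card_image_le[OF G.finite_below[of v], of l] bel[OF dB(2)] dB(1) v(2) by simp
  thus False using TD(4)[OF dB(2)] by simp
 qed
 ultimately show ?thesis using forest bij by blast
qed

text \<open>Weakly refining sequences that end in \<open>id\<close>. They describe all minimal
  forests, those with bad monomials included, whereas \<open>lchains\<close> with end
  \<open>id\<close> are the strict ones.\<close>

definition cchains :: "nat set => (nat => nat => nat) set" where
 "cchains I = {F. F 0 = id & (\<forall>d\<ge>1. F d : flats I & F d o F (Suc d) = F d) & (EX k. \<forall>d>k. F d = id)}"

definition cblocks :: "nat set => (nat => nat => nat) => (nat \<times> nat set) set" where
 "cblocks I F = {(d, B). 1 <= d & (\<exists>x\<in>I. B = {i : I. F d i = F d x}) & 2 <= card B}"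

text \<open>The inverse of \<open>cblocks\<close>; a label in no block forms a singleton and is its
  own minimum.\<close>

definition fchain :: "(nat \<times> nat set) set => nat => nat => nat" where
 "fchain T d i = (if EX B. (d, B) : T & i : B then Min (THE B. (d, B) : T & i : B) else i)"

lemma cchainsD:
 assumes "F : cchains I"
 shows "F 0 = id" "1 <= d ==> F d : flats I" "1 <= d ==> F d (F (Suc d) i) = F d i" "EX k. \<forall>d>k. F d = id"
proof -
 show "F 0 = id" "1 <= d ==> F d : flats I" "EX k. \<forall>d>k. F d = id"
  using assms by (simp_all add: cchains_def)
 show "1 <= d ==> F d (F (Suc d) i) = F d i"
  using assms by (simp add: cchains_def fun_eq_iff)
qed

lemma block_fibre:
 assumes "finite I" "r : flats I" "x : I"
 shows "r x : {i : I. r i = r x}" "Min {i : I. r i = r x} = r x"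
proof -
 show 1: "r x : {i : I. r i = r x}" using assms flatsD[OF assms(2)] by simp
 show "Min {i : I. r i = r x} = r x"
 proof (rule Min_eqI)
  show "r x <= i" if "i : {i : I. r i = r x}" for i using that flatsD(2)[OF assms(2), of i] by simp
 qed (use 1 assms(1) in auto)
qed

lemma fchain_cblocks:
 assumes I: "finite I" and F: "F : cchains I"
 shows "fchain (cblocks I F) = F"
proof (intro ext)
 fix d i
 note FD = cchainsD[OF F]
 show "fchain (cblocks I F) d i = F d i"
 proof (cases "1 <= d & i : I")
  case False
  hence no: "~ (EX B. (d, B) : cblocks I F & i : B)" by (auto simp: cblocks_def)
  have "F d i = i"
  proof (cases "d = 0")
   case True
   thus ?thesis using FD(1) by simp
  next
   case d: False
   thus ?thesis using False flatsD(4)[OF FD(2)[of d], of i] by simp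
  qed
  thus ?thesis by (simp only: fchain_def no if_False)
 next
  case True
  hence fl: "F d : flats I" using FD(2) by simp
  let ?B = "{j : I. F d j = F d i}"
  have eqB: "C = ?B" if "(d, C) : cblocks I F" "i : C" for C
   using that by (auto simp: cblocks_def)
  show ?thesis
  proof (cases "2 <= card ?B")
   case 2: True
   hence B: "(d, ?B) : cblocks I F" using True unfolding cblocks_def by blast
   have iB: "i : ?B" using True by simp
   have "(THE B. (d, B) : cblocks I F & i : B) = ?B"
   proof (rule the_equality)
    show "(d, ?B) : cblocks I F & i : ?B" using B iB by (rule conjI)
    show "C = ?B" if "(d, C) : cblocks I F & i : C" for C
     using eqB[of C] that by (elim conjE)
   qed
   moreover have "EX B. (d, B) : cblocks I F & i : B" using B iB by (intro exI conjI)
   ultimately have "fchain (cblocks I F) d i = Min ?B" by (simp only: fchain_def if_True)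
   also have "... = F d i" using True by (intro block_fibre(2)[OF I fl]) simp
   finally show ?thesis .
  next
   case False
   have "~ (EX B. (d, B) : cblocks I F & i : B)"
   proof
    assume "EX B. (d, B) : cblocks I F & i : B"
    then obtain C where C: "(d, C) : cblocks I F" "i : C" by blast
    hence "2 <= card C" by (simp add: cblocks_def)
    thus False using eqB[OF C] False by simp
   qed
   moreover have "F d i = i"
   proof (rule ccontr)
    assume ne: "F d i ~= i"
    have "{i, F d i} \<subseteq> ?B" using True block_fibre(1)[OF I fl, of i] by simp
    hence "card {i, F d i} <= card ?B" using I by (intro card_mono) auto
    thus False using ne False by simp
   qed
   ultimately show ?thesis by (simp only: fchain_def if_False)
  qed
 qed
qed

lemma lfamily_cblocks:
 assumes I: "finite I" and F: "F : cchains I"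
 shows "lfamily I (cblocks I F)"
proof -
 note FD = cchainsD[OF F]
 obtain k where k: "!!d. d > k ==> F d = id" using FD(4) by blast
 have "d <= k" if h: "(d, B) : cblocks I F" for d B
 proof (rule ccontr)
  assume "~ d <= k"
  hence "F d = id" using k by simp
  then obtain x where "B = {i : I. i = x}" "2 <= card B" using h by (auto simp: cblocks_def)
  moreover have "card {i : I. i = x} <= card {x}" by (intro card_mono) auto
  ultimately show False by simp
 qed
 hence "cblocks I F \<subseteq> {..k} \<times> Pow I" by (auto simp: cblocks_def)
 hence f1: "finite (cblocks I F)" by (rule finite_subset) (use I in simp)
 have f2: "EX C. (d, C) : cblocks I F & B \<subseteq> C" if d: "1 <= d" and B: "(Suc d, B) : cblocks I F" for d B
 proof -
  obtain x where x: "x : I" "B = {i : I. F (Suc d) i = F (Suc d) x}" "2 <= card B"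
   using B by (auto simp: cblocks_def)
  let ?C = "{i : I. F d i = F d x}"
  have sub: "B \<subseteq> ?C"
  proof
   fix i assume "i : B"
   hence i: "i : I" "F (Suc d) i = F (Suc d) x" using x(2) by blast+
   hence "F d i = F d x" using FD(3)[OF d, of i] FD(3)[OF d, of x] by metis
   thus "i : ?C" using i(1) by blast
  qed
  have "finite ?C" using I by simp
  hence "card B <= card ?C" using sub by (rule card_mono)
  hence "2 <= card ?C" using x(3) by linarith
  hence "(d, ?C) : cblocks I F" using x(1) d unfolding cblocks_def by blast
  thus ?thesis using sub by blast
 qed
 have f3: "B = C" if "(d, B) : cblocks I F" "(d, C) : cblocks I F" "B Int C ~= {}" for d B C
  using that by (auto simp: cblocks_def)
 have f4: "1 <= d & B \<subseteq> I & 2 <= card B" if "(d, B) : cblocks I F" for d B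
  using that by (auto simp: cblocks_def)
 show ?thesis
  unfolding lfamily_def
 proof (intro conjI allI impI)
  show "\<forall>(d, B)\<in>cblocks I F. 1 <= d & B \<subseteq> I & 2 <= card B" using f4 by auto
  show "finite (cblocks I F)" by (rule f1)
 next
  fix d B C assume "(d, B) : cblocks I F" "(d, C) : cblocks I F" "B Int C ~= {}"
  thus "B = C" by (rule f3)
 next
  fix d B assume "1 <= d" "(Suc d, B) : cblocks I F"
  thus "EX C. (d, C) : cblocks I F & B \<subseteq> C" by (rule f2)
 qed
qed

lemma fchain_in:
 assumes I: "finite I" and T: "lfamily I T"
 shows "fchain T : cchains I" "cblocks I (fchain T) = T"
proof -
 note TD = lfamilyD[OF T]
 let ?F = "fchain T"
 have cov: "?F d i = Min B" if "(d, B) : T" "i : B" for d B i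
 proof -
  have "(THE B. (d, B) : T & i : B) = B"
   using that TD(5)[of d _ B i] by (intro the_equality) blast+
  moreover have "EX B. (d, B) : T & i : B" using that by blast
  ultimately show ?thesis by (simp only: fchain_def if_True)
 qed
 have unc: "?F d i = i" if "~ (EX B. (d, B) : T & i : B)" for d i
  using that by (simp only: fchain_def if_False)
 have MinB: "Min B : B" "finite B" if "(d, B) : T" for d B
 proof -
  show "finite B" using TD(3)[OF that] I finite_subset by blast
  thus "Min B : B" using TD(4)[OF that] by (intro Min_in) auto
 qed
 have fl: "?F d : flats I" for d
  unfolding flats_def
 proof (intro CollectI conjI allI ballI impI)
  fix i
  have *: "?F d (?F d i) = ?F d i & ?F d i <= i & (i : I --> ?F d i : I) & (i ~: I --> ?F d i = i)"
  proof (cases "EX B. (d, B) : T & i : B")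
   case True
   then obtain B where B: "(d, B) : T" "i : B" by blast
   hence "Min B <= i" "Min B : I" "i : I" using MinB[OF B(1)] TD(3)[OF B(1)] by (auto intro: Min_le)
   thus ?thesis using cov[OF B] cov[OF B(1) MinB(1)[OF B(1)]] by simp
  next
   case False
   thus ?thesis using unc by simp
  qed
  show "?F d (?F d i) = ?F d i" "?F d i <= i" using * by auto
  show "i : I ==> ?F d i : I" "i ~: I ==> ?F d i = i" using * by auto
 qed
 have co: "?F d o ?F (Suc d) = ?F d" if d: "1 <= d" for d
 proof
  fix i
  show "(?F d o ?F (Suc d)) i = ?F d i"
  proof (cases "EX B. (Suc d, B) : T & i : B")
   case True
   then obtain B where B: "(Suc d, B) : T" "i : B" by blast
   then obtain C where C: "(d, C) : T" "B \<subseteq> C" using TD(6)[OF d] by blast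
   hence "?F d (Min B) = Min C" "?F d i = Min C" using cov[OF C(1)] B MinB[OF B(1)] by blast+
   thus ?thesis using cov[OF B] by simp
  next
   case False
   thus ?thesis using unc by simp
  qed
 qed
 have "EX k. \<forall>d>k. ?F d = id"
 proof (intro exI allI impI ext)
  fix d i assume d: "d > Max (insert 0 (fst ` T))"
  have "~ (EX B. (d, B) : T & i : B)"
  proof
   assume "EX B. (d, B) : T & i : B"
   hence "d : insert 0 (fst ` T)" by force
   hence "d <= Max (insert 0 (fst ` T))" using TD(1) by (intro Max_ge) auto
   thus False using d by linarith
  qed
  thus "?F d i = id i" using unc by simp
 qed
 moreover have "?F 0 = id"
 proof
  fix i
  have "~ (EX B. (0, B) : T & i : B)" using TD(2)[of 0] by auto
  thus "?F 0 i = id i" using unc by simp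
 qed
 ultimately show "?F : cchains I"
  using fl co unfolding cchains_def by blast
 have fib: "{i : I. ?F d i = ?F d x} = B" if B: "(d, B) : T" "x : B" for d B x
 proof -
  have "i : B" if "?F d i = Min B" for i
  proof (cases "EX C. (d, C) : T & i : C")
   case True
   then obtain C where C: "(d, C) : T" "i : C" by blast
   hence "Min C = Min B" using cov that by metis
   hence "C = B" using TD(5)[OF C(1) B(1), of "Min B"] MinB(1)[OF C(1)] MinB(1)[OF B(1)] by simp
   thus ?thesis using C(2) by simp
  next
   case False
   thus ?thesis using unc that MinB(1)[OF B(1)] by simp
  qed
  thus ?thesis using cov[OF B(1)] B(2) TD(3)[OF B(1)] by auto
 qed
 show "cblocks I ?F = T"
 proof (intro equalityI subrelI)
  fix d B assume B: "(d, B) : T"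
  then obtain x where x: "x : B" using MinB(1) by blast
  hence "x : I" using TD(3)[OF B] by blast
  thus "(d, B) : cblocks I ?F"
   using fib[OF B x] TD(2)[OF B] TD(4)[OF B] unfolding cblocks_def by blast
 next
  fix d B assume "(d, B) : cblocks I ?F"
  then obtain x where x: "x : I" "B = {i : I. ?F d i = ?F d x}" "2 <= card B" by (auto simp: cblocks_def)
  show "(d, B) : T"
  proof (cases "EX C. (d, C) : T & x : C")
   case True
   then obtain C where C: "(d, C) : T" "x : C" by blast
   have "B = C" unfolding x(2) by (rule fib[OF C])
   thus ?thesis using C(1) by simp
  next
   case False
   have "i = x" if "?F d i = x" for i
   proof (cases "EX C. (d, C) : T & i : C")
    case True
    then obtain C where C: "(d, C) : T" "i : C" by blast
    hence "Min C = x" using cov[OF C] that by simp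
    thus ?thesis using MinB(1)[OF C(1)] False C(1) by blast
   next
    case False
    thus ?thesis using unc that by simp
   qed
   hence "B \<subseteq> {x}" using x(2) unc[OF False] by auto
   hence "card B <= 1" using card_mono[of "{x}" B] by simp
   thus ?thesis using x(3) by simp
  qed
 qed
qed

text \<open>Each block contributes all its elements except the minimum, and a singleton contributes
  nothing.\<close>

lemma card_moved_blocks:
 assumes I: "finite I" and r: "r : flats I" and Bs: "\<B> = {B. (\<exists>x\<in>I. B = {i : I. r i = r x}) & 2 <= card B}"
 shows "card (moved r) = (\<Sum>B\<in>\<B>. card B - 1)"
proof -
 have "\<B> \<subseteq> Pow I" using Bs by auto
 hence fin: "finite \<B>" using I finite_subset by blast
 have finB: "finite B" if "B : \<B>" for B using that I Bs by auto
 have fib: "x : B ==> B = {i : I. r i = r x} & Min B = r x & r x : B" if "B : \<B>" for B x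
  using that block_fibre[OF I r, of x] Bs by auto
 have "moved r = (\<Union>B\<in>\<B>. B - {Min B})"
 proof (intro equalityI subsetI)
  fix i assume "i : moved r"
  hence i: "r i ~= i" "i : I" using moved_subset[OF r] by (auto simp: moved_def)
  let ?B = "{j : I. r j = r i}"
  have "{i, r i} \<subseteq> ?B" using i block_fibre(1)[OF I r i(2)] by simp
  hence "card {i, r i} <= card ?B" using I by (intro card_mono) auto
  hence B: "?B : \<B>" using i Bs by auto
  moreover have "i : ?B - {Min ?B}" using i block_fibre(2)[OF I r i(2)] by simp
  ultimately show "i : (\<Union>B\<in>\<B>. B - {Min B})" by (rule UN_I)
 next
  fix i assume "i : (\<Union>B\<in>\<B>. B - {Min B})"
  then obtain B where "B : \<B>" "i : B" "i ~= Min B" by blast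
  thus "i : moved r" using fib[of B i] by (simp add: moved_def)
 qed
 hence "card (moved r) = card (\<Union>B\<in>\<B>. B - {Min B})" by simp
 also have "... = (\<Sum>B\<in>\<B>. card (B - {Min B}))"
 proof (rule card_UN_disjoint[OF fin])
  show "\<forall>B\<in>\<B>. finite (B - {Min B})" using finB by blast
  have "B = C" if h: "B : \<B>" "C : \<B>" "x : B" "x : C" for B C x
   using fib[OF h(1,3)] fib[OF h(2,4)] by simp
  thus "\<forall>B\<in>\<B>. \<forall>C\<in>\<B>. B ~= C --> (B - {Min B}) Int (C - {Min C}) = {}" by blast
 qed
 also have "... = (\<Sum>B\<in>\<B>. card B - 1)"
 proof (rule sum.cong[OF refl])
  fix B assume B: "B : \<B>"
  hence "B ~= {}" using Bs by auto
  hence "Min B : B" using Min_in[OF finB[OF B]] by blast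
  thus "card (B - {Min B}) = card B - 1" by (rule card_Diff_singleton)
 qed
 finally show ?thesis .
qed

definition rank_drop :: "(nat => nat => nat) => nat => nat" where
 "rank_drop F d = card (moved (F d)) - card (moved (F (Suc d)))"

lemma (in forest_graph) lookup_forest_monomial_chain:
 assumes mn: "~ has_trivial_tail Gr" and l: "bij_betw l (leaves Gr) I"
  and F: "F : cchains I" "cblocks I F = lblocks Gr l"
 shows "Poly_Mapping.lookup (forest_monomial Gr) 0 = card I - card (moved (F 1))"
  "d >= 1 ==> Poly_Mapping.lookup (forest_monomial Gr) d = rank_drop F d"
proof -
 have I: "finite I" using l finite_leaves bij_betw_finite by blast
 have li: "inj_on l (leaves Gr)" using l by (simp add: bij_betw_def)
 have rk: "rank_at d = card (moved (F d))" if d: "d >= 1" for d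
 proof -
  let ?N = "{v : nonleaves Gr. level Gr v = d}"
  have bl: "{B. (\<exists>x\<in>I. B = {i : I. F d i = F d x}) & 2 <= card B} = (%v. l ` below Gr v) ` ?N"
  proof -
   have "{B. (\<exists>x\<in>I. B = {i : I. F d i = F d x}) & 2 <= card B} = {B. (d, B) : cblocks I F}"
    using d by (auto simp: cblocks_def)
   also have "... = (%v. l ` below Gr v) ` ?N" unfolding F(2) by (auto simp: lblocks_def)
   finally show ?thesis .
  qed
  have "inj_on (%v. l ` below Gr v) ?N"
  proof (rule inj_onI)
   fix u v assume u: "u : ?N" and v: "v : ?N" and eq: "l ` below Gr u = l ` below Gr v"
   obtain x where x: "x : below Gr u" using below_nonempty nonleaf_in_V u by blast
   hence "x : below Gr v" using label_subset[OF li, of u v] eq by blast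
   thus "u = v" using below_disjoint[OF x] u v by simp
  qed
  hence "(\<Sum>B\<in>(%v. l ` below Gr v) ` ?N. card B - 1) = (\<Sum>v\<in>?N. card (l ` below Gr v) - 1)"
   by (subst sum.reindex) auto
  also have "... = (\<Sum>v\<in>?N. card (below Gr v) - 1)"
   using card_image[OF inj_on_subset[OF li below_subset]] by simp
  also have "... = rank_at d" by (simp add: rank_at_def)
  finally show ?thesis
   using card_moved_blocks[OF I cchainsD(2)[OF F(1) d] bl[symmetric]] by simp
 qed
 have "card (leaves Gr) = card I" using l by (rule bij_betw_same_card)
 thus "Poly_Mapping.lookup (forest_monomial Gr) 0 = card I - card (moved (F 1))"
  using lookup_forest_monomial(1) card_leaves rk[of 1] by simp
 show "Poly_Mapping.lookup (forest_monomial Gr) d = rank_drop F d" if "d >= 1"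
  using lookup_forest_monomial(2)[OF that] rk[of d] rk[of "Suc d"] that by (simp add: rank_drop_def)
qed

text \<open>Minima of the coarser flat are minima of the finer one. If the moved sets agree, then
  \<open>p\<close> fixes every \<open>s i\<close>, so \<open>p i = p (s i) = s i\<close>.\<close>

lemma moved_coarser:
 assumes "p : flats I" "s : flats I" "p o s = p" "finite I"
 shows "card (moved s) <= card (moved p)" "card (moved s) = card (moved p) ==> p = s"
proof -
 have fin: "finite (moved p)" using finite_subset[OF moved_subset[OF assms(1)] assms(4)] .
 have sub: "moved s \<subseteq> moved p" using coarser_fixed[OF assms(1-3)] by (auto simp: moved_def)
 thus "card (moved s) <= card (moved p)" using fin by (rule card_mono[rotated])
 assume "card (moved s) = card (moved p)"
 hence eq: "moved s = moved p" using sub fin by (intro card_subset_eq) auto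
 show "p = s"
 proof
  fix i
  have "s i ~: moved p" using flatsD(1)[OF assms(2)] eq by (auto simp: moved_def)
  hence "p (s i) = s i" by (simp add: moved_def)
  thus "p i = s i" using fun_cong[OF assms(3), of i] by simp
 qed
qed

lemma lchains_coarsening: "F : lchains I k id ==> F : cchains I"
 unfolding cchains_def
proof (intro CollectI conjI allI impI)
 assume F: "F : lchains I k id"
 thus "F 0 = id" "EX k. \<forall>d>k. F d = id" by (auto simp: lchains_def)
 fix d :: nat assume d: "1 <= d"
 show "F d : flats I" "F d o F (Suc d) = F d"
  using F d id_in_flats by (cases "d <= k"; auto simp: lchains_def)+
qed

lemma rank_drop_pos_iff:
 assumes "F : cchains I" "finite I" "d >= 1"
 shows "rank_drop F d > 0 \<longleftrightarrow> F d ~= F (Suc d)"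
proof -
 have 1: "F d : flats I" "F (Suc d) : flats I" using cchainsD(2)[OF assms(1)] assms(3) by simp_all
 have 2: "F d o F (Suc d) = F d" using cchainsD(3)[OF assms(1,3)] by (simp add: comp_def)
 note le = moved_coarser(1)[OF 1 2 assms(2)]
 show ?thesis
 proof (cases "F d = F (Suc d)")
  case False
  hence "card (moved (F (Suc d))) ~= card (moved (F d))" using moved_coarser(2)[OF 1 2 assms(2)] by blast
  thus ?thesis using False le by (simp add: rank_drop_def)
 qed (simp add: rank_drop_def)
qed

lemma lchains_drop:
 assumes "F : lchains I k id" "finite I" "d >= 1"
 shows "rank_drop F d > 0 \<longleftrightarrow> d <= k"
 unfolding rank_drop_pos_iff[OF lchains_coarsening[OF assms(1)] assms(2,3)]
 using assms(1,3) by (auto simp: lchains_def)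

lemma sum_rank_drop:
 assumes "F : lchains I k id" "finite I"
 shows "(\<Sum>d = 1..k. rank_drop F d) = card (moved (F 1))"
proof -
 have le: "card (moved (F (Suc d))) <= card (moved (F d))" if "d >= 1" for d
  using lchains_coarsening[OF assms(1)] that assms(2)
  by (intro moved_coarser(1)[of _ I]) (auto simp: cchains_def)
 have "(\<Sum>d = 1..j. rank_drop F d) + card (moved (F (Suc j))) = card (moved (F 1))" for j
 proof (induct j)
  case (Suc j)
  have "(\<Sum>d = 1..Suc j. rank_drop F d) = (\<Sum>d = 1..j. rank_drop F d) + rank_drop F (Suc j)" by simp
  thus ?case using Suc le[of "Suc j"] by (simp add: rank_drop_def)
 qed simp
 moreover have "F (Suc k) = id" using assms(1) by (simp add: lchains_def)
 moreover have "moved id = {}" by (simp add: moved_def)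
 ultimately show ?thesis by (metis add.right_neutral card.empty)
qed

lemma lchains_bound:
 assumes "F : lchains I k id" "finite I" "I ~= {}"
 shows "k < card I" "card (moved (F 1)) < card I"
proof -
 have fl: "F 1 : flats I" using cchainsD(2)[OF lchains_coarsening[OF assms(1)]] by simp
 have "card (F 1 ` I) > 0" using assms(2,3) by (simp add: card_gt_0_iff)
 thus lt: "card (moved (F 1)) < card I" using card_moved[OF fl assms(2)] by simp
 have "(\<Sum>d = 1..k. 1) <= (\<Sum>d = 1..k. rank_drop F d)"
  using lchains_drop[OF assms(1,2)] by (intro sum_mono) (simp add: Suc_le_eq)
 thus "k < card I" using lt sum_rank_drop[OF assms(1,2)] by simp
qed

text \<open>A level is missing from the monomial exactly when the chain repeats there. Absence of
  gaps therefore means that repetitions start only after the last jump, where the chain is already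
  \<open>id\<close>.\<close>

lemma not_bad_iff_level_chain:
 assumes F: "F : cchains I" and I: "finite I" and m: "!!d. d >= 1 ==> Poly_Mapping.lookup m d = rank_drop F d"
 shows "~ bad_monomial m \<longleftrightarrow> (EX k. F : lchains I k id)"
proof
 assume "EX k. F : lchains I k id"
 then obtain k where k: "F : lchains I k id" by blast
 have "d : Poly_Mapping.keys m \<longleftrightarrow> d <= k" if "d >= 1" for d
  using lchains_drop[OF k I that] m[OF that] by (simp add: in_keys_iff)
 thus "~ bad_monomial m" unfolding bad_monomial_def by (meson less_imp_le_nat less_le_trans not_le order_trans)
next
 assume nb: "~ bad_monomial m"
 \<comment> \<open>Minimality makes the step at \<open>k\<close> strict, so \<open>k\<close> occurs
   in the monomial, and without gaps all smaller positive levels occur too.\<close>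
 define k where "k = (LEAST k. \<forall>d>k. F d = id)"
 have k: "\<forall>d>k. F d = id" unfolding k_def by (rule LeastI_ex[OF cchainsD(4)[OF F]])
 have key: "d : Poly_Mapping.keys m \<longleftrightarrow> F d ~= F (Suc d)" if "d >= 1" for d
  using rank_drop_pos_iff[OF F I that] m[OF that] by (simp add: in_keys_iff)
 have kk: "k : Poly_Mapping.keys m" if "k >= 1"
 proof -
  have "F k ~= id"
  proof
   assume idk: "F k = id"
   have "\<forall>d>k - 1. F d = id"
   proof (intro allI impI)
    fix d assume "k - 1 < d"
    hence "d = k | k < d" by linarith
    thus "F d = id" using idk k by blast
   qed
   hence "k <= k - 1" unfolding k_def by (rule Least_le)
   thus False using that by simp
  qed
  thus ?thesis using key[OF that] k by simp
 qed
 have "F d ~= F (Suc d)" if d: "d : {1..k}" for d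
 proof (cases "d = k")
  case True
  thus ?thesis using kk key[of k] d by simp
 next
  case False
  hence "1 <= d" "d < k" using d by auto
  hence "d : Poly_Mapping.keys m" using nb kk d unfolding bad_monomial_def by (metis order_trans less_imp_le_nat)
  thus ?thesis using key[of d] d by simp
 qed
 hence "F : lchains I k id"
  using F k unfolding lchains_def cchains_def by auto
 thus "EX k. F : lchains I k id" by blast
qed

section \<open>The substituted series\<close>

lemma q_factor_eq:
 assumes "r >= 1"
 shows "q_factor r = map_poly of_nat (qsum r)"
proof -
 have 1: "(q_var - 1) * (\<Sum>j = 1..<Suc s. q_var ^ j) = q_var ^ Suc s - q_var" for s
 proof (induct s)
  case (Suc s)
  have "(q_var - 1) * (\<Sum>j = 1..<Suc (Suc s). q_var ^ j) =
    (q_var - 1) * (\<Sum>j = 1..<Suc s. q_var ^ j) + (q_var - 1) * q_var ^ Suc s"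
   by (simp add: distrib_left)
  also have "... = q_var ^ Suc (Suc s) - q_var"
   unfolding Suc by (simp add: left_diff_distrib)
  finally show ?case .
 qed simp
 obtain s where r: "r = Suc s" using assms by (cases r) auto
 have "q_var - 1 ~= 0" by (simp add: one_pCons)
 hence "q_factor r = (\<Sum>j = 1..<r. q_var ^ j)"
  unfolding q_factor_def r 1[symmetric] by (rule nonzero_mult_div_cancel_left)
 also have "... = (\<Sum>j = 1..<r. Polynomial.monom 1 j)"
  by (simp add: monom_altdef)
 also have "... = map_poly of_nat (qsum r)"
  by (rule poly_eqI) (simp add: coeff_map_poly qsum_def coeff_sum of_nat_sum if_distrib[of of_nat] cong: if_cong)
 finally show ?thesis .
qed

lemma of_nat_poly_mult: "map_poly of_nat (P * Q) = map_poly of_nat P * (map_poly of_nat Q :: rat poly)"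
 by (rule poly_eqI) (simp add: coeff_map_poly coeff_mult)

lemma of_nat_poly_prod: "map_poly of_nat (\<Prod>i\<in>A. P i) = (\<Prod>i\<in>A. map_poly of_nat (P i) :: rat poly)"
 by (induct A rule: infinite_finite_induct) (simp_all add: of_nat_poly_mult)

lemma of_nat_poly_sum: "map_poly of_nat (\<Sum>i\<in>A. P i) = (\<Sum>i\<in>A. map_poly of_nat (P i) :: rat poly)"
 by (rule poly_eqI) (simp add: coeff_map_poly coeff_sum)

lemma nth_subst_monomial:
 "fps_nth (subst_monomial m) n =
  (if Poly_Mapping.lookup m 0 + (\<Sum>i\<in>Poly_Mapping.keys m - {0}. Poly_Mapping.lookup m i) = n
   then \<Prod>i\<in>Poly_Mapping.keys m - {0}. q_factor (Poly_Mapping.lookup m i) else 0)"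
proof -
 let ?K = "Poly_Mapping.keys m - {0}"
 have "(\<Prod>i\<in>A. fps_const (q_factor (Poly_Mapping.lookup m i)) * fps_X ^ Poly_Mapping.lookup m i) =
   fps_const (\<Prod>i\<in>A. q_factor (Poly_Mapping.lookup m i)) * fps_X ^ (\<Sum>i\<in>A. Poly_Mapping.lookup m i)"
  if "finite A" for A
  using that by (induct A) (simp_all add: power_add mult.left_commute mult.assoc flip: fps_const_mult)
 hence "subst_monomial m = fps_const (\<Prod>i\<in>?K. q_factor (Poly_Mapping.lookup m i)) *
   fps_X ^ (Poly_Mapping.lookup m 0 + (\<Sum>i\<in>?K. Poly_Mapping.lookup m i))"
  by (simp add: subst_monomial_def power_add mult.left_commute)
 thus ?thesis by (simp add: fps_X_power_nth)
qed

section \<open>Isomorphism classes, representatives and labellings\<close>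

lemma diso_refl: "diso id Gr Gr"
 by (simp add: diso_def map_prod.id)

lemma diso_trans: "diso f Gr De ==> diso g De \<Theta> ==> diso (g o f) Gr \<Theta>"
 unfolding diso_def map_prod_compose image_comp[symmetric] by (auto intro: bij_betw_trans)

lemma diso_sym:
 assumes "forest Gr" "diso f Gr De"
 shows "diso (inv_into (fst Gr) f) De Gr"
proof -
 interpret forest_graph Gr by unfold_locales fact
 let ?g = "inv_into V f"
 have f: "bij_betw f V (fst De)" "snd De = map_prod f f ` E" using assms(2) by (auto simp: diso_def)
 have g: "?g (f v) = v" if "v : V" for v using f(1) that by (simp add: bij_betw_def)
 have "map_prod ?g ?g ` snd De = (%e. e) ` E"
  unfolding f(2) image_image using g edge_in_V by (intro image_cong refl) auto
 thus ?thesis using bij_betw_inv_into[OF f(1)] by (simp add: diso_def)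
qed

lemma forest_iso_iff: "forest_isomorphic Gr De \<longleftrightarrow> (EX f. diso f Gr De)"
 by (simp add: forest_isomorphic_def diso_def)

lemma forest_isomorphic_cong:
 assumes "forest Gr" "diso f Gr Gr'"
 shows "forest_isomorphic Gr De \<longleftrightarrow> forest_isomorphic Gr' De"
proof
 assume "forest_isomorphic Gr De"
 then obtain g where "diso g Gr De" unfolding forest_iso_iff ..
 hence "diso (g o inv_into (fst Gr) f) Gr' De" by (rule diso_trans[OF diso_sym[OF assms]])
 thus "forest_isomorphic Gr' De" unfolding forest_iso_iff by (rule exI[of "%f. diso f Gr' De"])
next
 assume "forest_isomorphic Gr' De"
 then obtain g where "diso g Gr' De" unfolding forest_iso_iff ..
 hence "diso (g o f) Gr De" by (rule diso_trans[OF assms(2)])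
 thus "forest_isomorphic Gr De" unfolding forest_iso_iff by (rule exI[of "%f. diso f Gr De"])
qed

lemma minimal_classD:
 assumes "C : minimal_forest_classes"
 shows "forest (class_rep C)" "~ has_trivial_tail (class_rep C)" "2 <= card (leaves (class_rep C))"
  "C = {De. forest_isomorphic (class_rep C) De}"
proof -
 obtain Gr where G: "forest Gr" "~ has_trivial_tail Gr" "2 <= card (leaves Gr)" and C: "C = {De. forest_isomorphic Gr De}"
  using assms unfolding minimal_forest_classes_def quotient_def by auto
 have "Gr : C" using C diso_refl forest_iso_iff by blast
 hence "class_rep C : C" unfolding class_rep_def by (rule someI)
 then obtain f where f: "diso f Gr (class_rep C)" using C forest_iso_iff by auto
 interpret ftransport Gr "class_rep C" f
  using G(1) f by unfold_locales
 show "forest (class_rep C)" by (rule forest_target)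
 show "~ has_trivial_tail (class_rep C)" using has_trivial_tail_transport G(2) by simp
 show "2 <= card (leaves (class_rep C))" using card_leaves_transport G(3) by simp
 have "forest_isomorphic Gr De \<longleftrightarrow> forest_isomorphic (class_rep C) De" for De
  by (rule forest_isomorphic_cong[OF G(1) f])
 hence "{De. forest_isomorphic Gr De} = {De. forest_isomorphic (class_rep C) De}" by (simp only:)
 with C show "C = {De. forest_isomorphic (class_rep C) De}" by (rule trans)
qed

lemma minimal_class_exists:
 assumes "forest Gr" "~ has_trivial_tail Gr" "2 <= card (leaves Gr)"
 shows "EX C f. C : minimal_forest_classes & diso f (class_rep C) Gr"
proof -
 define C where "C = {De. forest_isomorphic Gr De}"
 have C: "C : minimal_forest_classes"
  unfolding minimal_forest_classes_def
 proof (rule quotientI[THEN back_subst[of "%X. X : _"]])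
  show "Gr : {Gr. forest Gr & ~ has_trivial_tail Gr & 2 <= card (leaves Gr)}" using assms by simp
  show "{(Gr, De). forest_isomorphic Gr De} `` {Gr} = C" by (auto simp: C_def)
 qed
 have "Gr : C" unfolding C_def using diso_refl forest_iso_iff by blast
 hence "Gr : {De. forest_isomorphic (class_rep C) De}" using equalityD1[OF minimal_classD(4)[OF C]] by (rule subsetD[rotated])
 then obtain f where "diso f (class_rep C) Gr" unfolding forest_iso_iff by blast
 thus ?thesis using C by blast
qed

lemma minimal_class_eqI:
 assumes "C : minimal_forest_classes" "D : minimal_forest_classes" "diso f (class_rep C) (class_rep D)"
 shows "C = D"
proof -
 have "forest_isomorphic (class_rep C) De \<longleftrightarrow> forest_isomorphic (class_rep D) De" for De
  by (rule forest_isomorphic_cong[OF minimal_classD(1)[OF assms(1)] assms(3)])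
 hence "{De. forest_isomorphic (class_rep C) De} = {De. forest_isomorphic (class_rep D) De}" by simp
 thus ?thesis unfolding minimal_classD(4)[OF assms(1), symmetric] minimal_classD(4)[OF assms(2), symmetric] .
qed

definition labellings :: "digraph => nat set => (nat => nat) set" where
 "labellings Gr I = {l : extensional (leaves Gr). bij_betw l (leaves Gr) I}"

lemma card_labellings_fact:
 assumes "finite I" "finite (leaves Gr)" "card (leaves Gr) = card I"
 shows "card (labellings Gr I) = fact (card I)" "finite (labellings Gr I)"
proof -
 obtain b where b: "bij_betw b (leaves Gr) I" using finite_same_card_bij[OF assms(2,1,3)] by blast
 have "bij_betw (%p. restrict (p o b) (leaves Gr)) {p. p permutes I} (labellings Gr I)"
 proof (rule bij_betw_imageI)
  show "inj_on (%p. restrict (p o b) (leaves Gr)) {p. p permutes I}"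
  proof (rule inj_onI, rule ext)
   fix p p' i assume p: "p : {p. p permutes I}" "p' : {p. p permutes I}"
    and eq: "restrict (p o b) (leaves Gr) = restrict (p' o b) (leaves Gr)"
   show "p i = p' i"
   proof (cases "i : I")
    case True
    then obtain x where "x : leaves Gr" "i = b x" using b by (auto simp: bij_betw_def)
    thus ?thesis using fun_cong[OF eq, of x] by simp
   next
    case False
    thus ?thesis using p by (simp add: permutes_def)
   qed
  qed
  show "(%p. restrict (p o b) (leaves Gr)) ` {p. p permutes I} = labellings Gr I"
  proof (intro equalityI subsetI)
   fix l assume "l : (%p. restrict (p o b) (leaves Gr)) ` {p. p permutes I}"
   then obtain p where p: "p permutes I" "l = restrict (p o b) (leaves Gr)" by blast
   have "bij_betw (p o b) (leaves Gr) I" by (rule bij_betw_trans[OF b permutes_imp_bij[OF p(1)]])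
   thus "l : labellings Gr I" unfolding labellings_def p(2) by (simp cong: bij_betw_cong)
  next
   fix l assume l: "l : labellings Gr I"
   define p where "p i = (if i : I then l (inv_into (leaves Gr) b i) else i)" for i
   have "bij_betw (l o inv_into (leaves Gr) b) I I"
    using l by (intro bij_betw_trans[OF bij_betw_inv_into[OF b]]) (simp add: labellings_def)
   hence "bij_betw p I I" by (simp add: p_def cong: bij_betw_cong)
   hence "p permutes I" by (rule bij_imp_permutes) (simp add: p_def)
   moreover have "l = restrict (p o b) (leaves Gr)"
   proof
    fix x
    show "l x = restrict (p o b) (leaves Gr) x"
    proof (cases "x : leaves Gr")
     case True
     hence "b x : I" "inv_into (leaves Gr) b (b x) = x" using b by (auto simp: bij_betw_def)
     thus ?thesis using True by (simp add: p_def)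
    next
     case False
     thus ?thesis using l by (simp add: labellings_def extensional_def)
    qed
   qed
   ultimately show "l : (%p. restrict (p o b) (leaves Gr)) ` {p. p permutes I}" by blast
  qed
 qed
 thus "card (labellings Gr I) = fact (card I)" "finite (labellings Gr I)"
  using card_permutations[OF refl assms(1)] finite_permutations[OF assms(1)]
  by (auto dest: bij_betw_same_card bij_betw_finite)
qed

text \<open>The \<open>fact (card I)\<close> labellings are sorted by their block families; by
  \<open>card_labellings\<close> each fibre has as many members as there are automorphisms.\<close>

lemma card_automorphisms:
 assumes "forest Gr" "finite I" "card (leaves Gr) = card I"
 shows "card (lblocks Gr ` labellings Gr I) * card (automorphisms Gr) = fact (card I)"
proof -
 interpret forest_graph Gr by unfold_locales fact
 note L = card_labellings_fact[OF assms(2) finite_leaves assms(3)]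
 have "card {l : labellings Gr I. lblocks Gr l = T} = card (automorphisms Gr)"
  if T: "T : lblocks Gr ` labellings Gr I" for T
 proof -
  obtain l0 where l0: "l0 : labellings Gr I" "T = lblocks Gr l0" using T by blast
  hence "bij_betw l0 (leaves Gr) I" by (simp add: labellings_def)
  from card_labellings[OF assms(1) this] show ?thesis
   unfolding l0(2) labellings_def by (simp add: conj_assoc)
 qed
 hence "(\<Sum>T\<in>lblocks Gr ` labellings Gr I. card {l : labellings Gr I. lblocks Gr l = T}) =
   card (lblocks Gr ` labellings Gr I) * card (automorphisms Gr)" by simp
 moreover have "card (labellings Gr I) = (\<Sum>T\<in>lblocks Gr ` labellings Gr I. card {l : labellings Gr I. lblocks Gr l = T})"
  using sum.image_gen[OF L(2), of "%_. 1::nat" "lblocks Gr"] by simp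
 ultimately show ?thesis using L(1) by simp
qed

definition depth :: "(nat => nat => nat) => nat" where
 "depth F = card {d. F d ~= id}"

text \<open>The chain weight as a function of the block family alone, the length of the chain being
  read off by \<open>depth\<close>, so that it can be summed over families.\<close>

definition bweight :: "(nat \<times> nat set) set => rat poly" where
 "bweight T = map_poly of_nat (cweight qsum (depth (fchain T)) (fchain T))"

lemma depth_level_chain:
 assumes "F : lchains I k id"
 shows "depth F = k"
proof -
 have "F d ~= id" if d: "d : {1..k}" for d
 proof
  assume id: "F d = id"
  have "F d o F (Suc d) = F d" "F d ~= F (Suc d)" using assms d unfolding lchains_def by blast+
  thus False using id by simp
 qed
 moreover have "F d = id" if "d = 0 | d > k" for d
  using that assms unfolding lchains_def by blast
 moreover have "d : {1..k} | d = 0 | d > k" for d by auto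
 ultimately have "{d. F d ~= id} = {1..k}" by blast
 thus ?thesis by (simp add: depth_def)
qed

text \<open>The total degree is \<open>card I\<close>: the exponent of \<open>g_0\<close> is the
  number of blocks of the first flat, and the other exponents are the rank jumps, which add up to
  the rank of that flat. The factors \<open>q_factor\<close> then multiply to the weight of the
  chain.\<close>

lemma nth_subst_forest:
 assumes G: "forest Gr" "~ has_trivial_tail Gr" and I: "finite I" "I ~= {}" and l: "bij_betw l (leaves Gr) I"
 shows "~ bad_monomial (forest_monomial Gr) \<longleftrightarrow> (EX k. fchain (lblocks Gr l) : lchains I k id)"
  "~ bad_monomial (forest_monomial Gr) ==> fps_nth (subst_monomial (forest_monomial Gr)) n =
   (if n = card I then bweight (lblocks Gr l) else 0)"
proof -
 interpret forest_graph Gr by unfold_locales (rule G(1))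
 let ?F = "fchain (lblocks Gr l)" and ?m = "forest_monomial Gr"
 note F = fchain_in[OF I(1) lfamily_blocks[OF G(2) l]]
 note lk = lookup_forest_monomial_chain[OF G(2) l F]
 show bad: "~ bad_monomial ?m \<longleftrightarrow> (EX k. ?F : lchains I k id)"
  by (rule not_bad_iff_level_chain[OF F(1) I(1) lk(2)])
 assume "~ bad_monomial ?m"
 then obtain k where k: "?F : lchains I k id" using bad by blast
 have keys: "Poly_Mapping.keys ?m - {0} = {1..k}"
 proof -
  have "d : Poly_Mapping.keys ?m \<longleftrightarrow> d <= k" if "d >= 1" for d
   using lchains_drop[OF k I(1) that] lk(2)[OF that] by (simp add: in_keys_iff)
  hence "d : Poly_Mapping.keys ?m - {0} \<longleftrightarrow> d : {1..k}" for d
   by (cases "d = 0") (auto simp: Suc_le_eq)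
  thus ?thesis by blast
 qed
 have "(\<Sum>i = 1..k. Poly_Mapping.lookup ?m i) = card (moved (?F 1))"
  using sum_rank_drop[OF k I(1)] lk(2) by simp
 hence deg: "Poly_Mapping.lookup ?m 0 + (\<Sum>i = 1..k. Poly_Mapping.lookup ?m i) = card I"
  using lk(1) lchains_bound(2)[OF k I] by simp
 have "(\<Prod>i = 1..k. q_factor (Poly_Mapping.lookup ?m i)) = (\<Prod>i = 1..k. map_poly of_nat (qsum (rank_drop ?F i)))"
 proof (rule prod.cong[OF refl])
  fix i assume "i : {1..k}"
  hence "i >= 1" "rank_drop ?F i > 0" using lchains_drop[OF k I(1)] by auto
  thus "q_factor (Poly_Mapping.lookup ?m i) = map_poly of_nat (qsum (rank_drop ?F i))"
   using lk(2) by (simp add: q_factor_eq Suc_le_eq)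
 qed
 also have "... = bweight (lblocks Gr l)"
  unfolding bweight_def depth_level_chain[OF k] cweight_def rank_drop_def of_nat_poly_prod ..
 finally show "fps_nth (subst_monomial ?m) n = (if n = card I then bweight (lblocks Gr l) else 0)"
  unfolding nth_subst_monomial keys deg by simp
qed

lemma labelling_exists:
 assumes "forest Gr"
 shows "EX l. bij_betw l (leaves Gr) {..<card (leaves Gr)}"
proof -
 interpret forest_graph Gr by unfold_locales fact
 show ?thesis using finite_same_card_bij[OF finite_leaves, of "{..<card (leaves Gr)}"] by simp
qed

lemma class_rep_degree:
 assumes C: "C : minimal_forest_classes" and nb: "~ bad_monomial (forest_monomial (class_rep C))"
  and n: "fps_nth (subst_monomial (forest_monomial (class_rep C))) n ~= 0"
 shows "card (leaves (class_rep C)) = n"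
proof -
 note D = minimal_classD[OF C]
 obtain l where l: "bij_betw l (leaves (class_rep C)) {..<card (leaves (class_rep C))}"
  using labelling_exists[OF D(1)] by blast
 have "{..<card (leaves (class_rep C))} ~= {}" using D(3) by (auto simp: lessThan_empty_iff)
 from nth_subst_forest(2)[OF D(1,2) _ this l nb, of n] n show ?thesis
  by (simp split: if_splits)
qed

lemma subst_monomial_single: "fps_nth (subst_monomial (Poly_Mapping.single 0 (Suc 0))) n = (if n = 1 then 1 else 0)"
 by (simp add: nth_subst_monomial)

lemma not_bad_single: "~ bad_monomial (Poly_Mapping.single 0 1)"
 by (auto simp: bad_monomial_def)

lemma small_coefficients:
 assumes "n < 2"
 shows "fps_nth (subst_series (remove_bad ptilde_A)) n = (if n = 1 then 1 else 0)"
proof -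
 have p: "remove_bad ptilde_A m = (if m = Poly_Mapping.single 0 1 then 1 else 0)"
  if m: "fps_nth (subst_monomial m) n ~= 0" for m
 proof (cases "bad_monomial m")
  case True
  thus ?thesis using not_bad_single by (auto simp: remove_bad_def)
 next
  case False
  have none: "{C. C : minimal_forest_classes & forest_monomial (class_rep C) = m} = {}"
  proof (rule ccontr)
   assume "{C. C : minimal_forest_classes & forest_monomial (class_rep C) = m} ~= {}"
   then obtain C where C: "C : minimal_forest_classes" "forest_monomial (class_rep C) = m" by blast
   hence "card (leaves (class_rep C)) = n" using class_rep_degree m False by blast
   thus False using minimal_classD(3)[OF C(1)] assms by simp
  qed
  thus ?thesis using False by (simp add: remove_bad_def ptilde_A_def none)
 qed
 let ?M = "{m. remove_bad ptilde_A m ~= 0 & fps_nth (subst_monomial m) n ~= 0}"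
 have M: "?M = {m. m = Poly_Mapping.single 0 1 & fps_nth (subst_monomial m) n ~= 0}"
  using p by (auto split: if_splits)
 show ?thesis
 proof (cases "n = 1")
  case True
  hence "?M = {Poly_Mapping.single 0 1}" unfolding M by (auto simp: subst_monomial_single)
  hence "fps_nth (subst_series (remove_bad ptilde_A)) n =
    Polynomial.smult (remove_bad ptilde_A (Poly_Mapping.single 0 1)) (fps_nth (subst_monomial (Poly_Mapping.single 0 1)) n)"
   by (simp only: subst_series_def fps_nth_Abs_fps) simp
  thus ?thesis using True p[of "Poly_Mapping.single 0 1"] by (simp add: subst_monomial_single)
 next
  case False
  hence "?M = {}" unfolding M by (auto simp: subst_monomial_single)
  thus ?thesis using False by (simp only: subst_series_def fps_nth_Abs_fps) simp
 qed
qed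

text \<open>Absence of bad monomials makes the chain of a labelled forest strict. Conversely, the
  blocks of a strict chain are realised by some forest, and its labelling is pulled back to the
  representative of the class.\<close>

lemma lblocks_union:
 assumes n: "2 <= n"
 defines "Cs \<equiv> {C : minimal_forest_classes. card (leaves (class_rep C)) = n & ~ bad_monomial (forest_monomial (class_rep C))}"
  and "TT \<equiv> %C. lblocks (class_rep C) ` labellings (class_rep C) {..<n}"
 shows "(\<Union>C\<in>Cs. TT C) = cblocks {..<n} ` (\<Union>k<n. lchains {..<n} k id)"
proof (intro equalityI subsetI)
 let ?I = "{..<n}"
 have I: "finite ?I" "?I ~= {}" "card ?I = n" using n by (auto simp: lessThan_empty_iff)
 fix T assume "T : (\<Union>C\<in>Cs. TT C)"
 then obtain C where C: "C : Cs" "T : TT C" by blast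
 then obtain l where l: "l : labellings (class_rep C) ?I" "T = lblocks (class_rep C) l" unfolding TT_def by blast
 have bl: "bij_betw l (leaves (class_rep C)) ?I" using l(1) by (simp add: labellings_def)
 have Cm: "C : minimal_forest_classes" and nb: "~ bad_monomial (forest_monomial (class_rep C))"
  using C(1) by (auto simp: Cs_def)
 note D = minimal_classD[OF Cm]
 interpret forest_graph "class_rep C" by unfold_locales (rule D(1))
 obtain k where k: "fchain T : lchains ?I k id"
  using nth_subst_forest(1)[OF D(1,2) I(1,2) bl] nb l(2) by blast
 have "T = cblocks ?I (fchain T)"
  using fchain_in(2)[OF I(1) lfamily_blocks[OF D(2) bl]] l(2) by simp
 moreover have "k < n" using lchains_bound(1)[OF k I(1,2)] I(3) by simp
 ultimately show "T : cblocks ?I ` (\<Union>k<n. lchains ?I k id)" using k by blast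
next
 let ?I = "{..<n}"
 have I: "finite ?I" "?I ~= {}" "card ?I = n" using n by (auto simp: lessThan_empty_iff)
 fix T assume "T : cblocks ?I ` (\<Union>k<n. lchains ?I k id)"
 then obtain k F where F: "F : lchains ?I k id" "T = cblocks ?I F" by blast
 note Fc = lchains_coarsening[OF F(1)]
 have "lfamily ?I T" unfolding F(2) by (rule lfamily_cblocks[OF I(1) Fc])
 from lfamily_realized[OF I(1) this] obtain Gr l where
  G: "forest Gr" "~ has_trivial_tail Gr" "bij_betw l (leaves Gr) ?I" "lblocks Gr l = T" by blast
 have "card (leaves Gr) = n" using bij_betw_same_card[OF G(3)] by simp
 then obtain C f where C: "C : minimal_forest_classes" "diso f (class_rep C) Gr"
  using minimal_class_exists[OF G(1,2)] n by auto
 note D = minimal_classD[OF C(1)]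
 interpret ftransport "class_rep C" Gr f using D(1) C(2) by unfold_locales
 define l' where "l' = restrict (l o f) (leaves (class_rep C))"
 have "bij_betw f (leaves (class_rep C)) (leaves Gr)"
  unfolding bij_betw_def using f_leaves f_inj leaves_in_V by (auto intro!: inj_onI)
 hence "bij_betw (l o f) (leaves (class_rep C)) ?I" using G(3) by (rule bij_betw_trans)
 hence bl: "bij_betw l' (leaves (class_rep C)) ?I" unfolding l'_def by (simp cong: bij_betw_cong)
 hence l': "l' : labellings (class_rep C) ?I" by (simp add: labellings_def l'_def)
 have T: "lblocks (class_rep C) l' = T"
  unfolding G(4)[symmetric] lblocks_transport by (rule lblocks_cong) (simp add: l'_def)
 have "card (leaves (class_rep C)) = n" using bij_betw_same_card[OF bl] by simp
 moreover have "fchain T = F" unfolding F(2) by (rule fchain_cblocks[OF I(1) Fc])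
 hence "~ bad_monomial (forest_monomial (class_rep C))"
  using nth_subst_forest(1)[OF D(1,2) I(1,2) bl] F(1) T by blast
 ultimately have "C : Cs" using C(1) by (simp add: Cs_def)
 moreover have "T : TT C" unfolding TT_def using l' T by blast
 ultimately show "T : (\<Union>C\<in>Cs. TT C)" by blast
qed

text \<open>Double counting: the reciprocal of the number of automorphisms of a class is its number
  of block families divided by \<open>fact n\<close>. The sum over classes becomes one over block
  families, that is over strict chains, where \<open>flat_poly_chains\<close> applies.\<close>

lemma subst_series_coefficient:
 assumes n: "2 <= n"
 shows "fps_nth (subst_series (remove_bad ptilde_A)) n =
  Polynomial.smult (1 / fact n) (map_poly of_nat (flat_poly {..<n}))"
proof -
 let ?I = "{..<n}"
 have I: "finite ?I" "?I ~= {}" "card ?I = n" using n by (auto simp: lessThan_empty_iff)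
 define mono where "mono C = forest_monomial (class_rep C)" for C
 define s where "s m = fps_nth (subst_monomial m) n" for m
 define p where "p = remove_bad ptilde_A"
 define a where "a C = (1 / of_nat (card (automorphisms (class_rep C))) :: rat)" for C
 define Cs where "Cs = {C : minimal_forest_classes. card (leaves (class_rep C)) = n & ~ bad_monomial (forest_monomial (class_rep C))}"
 define TT where "TT C = lblocks (class_rep C) ` labellings (class_rep C) ?I" for C
 define U where "U = (\<Union>k<n. lchains ?I k id)"
 have union: "(\<Union>C\<in>Cs. TT C) = cblocks ?I ` U"
  unfolding Cs_def TT_def U_def by (rule lblocks_union[OF n])
 have finU: "finite U" unfolding U_def using finite_lchains[OF I(1)] by blast
 have CsD: "forest (class_rep C)" "~ has_trivial_tail (class_rep C)" "card (leaves (class_rep C)) = card ?I"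
   "C : minimal_forest_classes" "~ bad_monomial (mono C)" if "C : Cs" for C
  using that minimal_classD by (auto simp: Cs_def mono_def)
 have finL: "finite (labellings (class_rep C) ?I) & card (labellings (class_rep C) ?I) = fact n" if C: "C : Cs" for C
 proof -
  interpret forest_graph "class_rep C" by unfold_locales (rule CsD(1)[OF C])
  show ?thesis using card_labellings_fact[OF I(1) finite_leaves CsD(3)[OF C]] I(3) by simp
 qed
 have finT: "finite (TT C)" "TT C ~= {}" if C: "C : Cs" for C
 proof -
  show "finite (TT C)" using finL[OF C] by (simp add: TT_def)
  have "card (labellings (class_rep C) ?I) ~= 0" using finL[OF C] by simp
  thus "TT C ~= {}" unfolding TT_def by force
 qed
 have disj: "C = C'" if h: "C : Cs" "C' : Cs" "T : TT C" "T : TT C'" for C C' T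
 proof -
  obtain l where l: "bij_betw l (leaves (class_rep C)) ?I" "lblocks (class_rep C) l = T"
   using h(3) unfolding TT_def labellings_def by blast
  obtain l' where l': "bij_betw l' (leaves (class_rep C')) ?I" "lblocks (class_rep C') l' = T"
   using h(4) unfolding TT_def labellings_def by blast
  obtain f where "diso f (class_rep C) (class_rep C')"
   using label_isomorphism[OF CsD(1)[OF h(1)] CsD(1)[OF h(2)] l(1) l'(1)] l(2) l'(2) by blast
  thus ?thesis by (rule minimal_class_eqI[OF CsD(4)[OF h(1)] CsD(4)[OF h(2)]])
 qed
 \<comment> \<open>The sets \<open>TT C\<close> are nonempty, pairwise disjoint and contained in the
   image of the finite set \<open>U\<close>, so there are finitely many classes.\<close>
 have finCs: "finite Cs"
 proof (rule finite_imageD)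
  have "finite (\<Union>(TT ` Cs))" using union finU by simp
  thus "finite (TT ` Cs)" by (rule finite_UnionD)
  show "inj_on TT Cs"
  proof (rule inj_onI)
   fix C C' assume "C : Cs" "C' : Cs" "TT C = TT C'"
   moreover obtain T where "T : TT C" using finT(2)[OF `C : Cs`] by blast
   ultimately show "C = C'" using disj[of C C' T] by simp
  qed
 qed
 have weight: "s (mono C) = bweight T" if C: "C : Cs" and T: "T : TT C" for C T
 proof -
  obtain l where l: "bij_betw l (leaves (class_rep C)) ?I" "lblocks (class_rep C) l = T"
   using T unfolding TT_def labellings_def by blast
  from nth_subst_forest(2)[OF CsD(1,2)[OF C] I(1,2) l(1), of n] CsD(5)[OF C] I(3) l(2)
  show ?thesis by (simp add: s_def mono_def)
 qed
 have pm: "p m = (\<Sum>C\<in>{C : Cs. mono C = m}. a C)" if m: "~ bad_monomial m" "s m ~= 0" for m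
 proof -
  have "m ~= Poly_Mapping.single 0 1" using m(2) n by (auto simp: s_def subst_monomial_single)
  moreover have "{C. C : minimal_forest_classes & forest_monomial (class_rep C) = m} = {C : Cs. mono C = m}"
   using class_rep_degree[of _ n] m by (auto simp: Cs_def mono_def s_def)
  ultimately show ?thesis using m(1) by (simp add: p_def remove_bad_def ptilde_A_def a_def)
 qed
 have bad0: "p m = 0" if "bad_monomial m" for m using that by (simp add: p_def remove_bad_def)
 have "fps_nth (subst_series (remove_bad ptilde_A)) n = (\<Sum>m | p m ~= 0 & s m ~= 0. Polynomial.smult (p m) (s m))"
  by (simp add: subst_series_def p_def s_def)
 also have "... = (\<Sum>m\<in>mono ` Cs. Polynomial.smult (\<Sum>C\<in>{C : Cs. mono C = m}. a C) (s m))"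
 proof (rule sum.mono_neutral_cong_left)
  show "finite (mono ` Cs)" using finCs by simp
  show "{m. p m ~= 0 & s m ~= 0} \<subseteq> mono ` Cs"
  proof
   fix m assume "m : {m. p m ~= 0 & s m ~= 0}"
   hence m: "p m ~= 0" "s m ~= 0" by auto
   hence nb: "~ bad_monomial m" using bad0[of m] by blast
   have "{C : Cs. mono C = m} ~= {}"
   proof
    assume "{C : Cs. mono C = m} = {}"
    hence "p m = 0" unfolding pm[OF nb m(2)] by (simp only: sum.empty)
    thus False using m(1) by blast
   qed
   thus "m : mono ` Cs" by blast
  qed
  show "\<forall>m\<in>mono ` Cs - {m. p m ~= 0 & s m ~= 0}. Polynomial.smult (\<Sum>C\<in>{C : Cs. mono C = m}. a C) (s m) = 0"
  proof
   fix m assume m: "m : mono ` Cs - {m. p m ~= 0 & s m ~= 0}"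
   hence "~ bad_monomial m" using CsD(5) by blast
   thus "Polynomial.smult (\<Sum>C\<in>{C : Cs. mono C = m}. a C) (s m) = 0"
    using m pm[of m] by (cases "s m = 0") auto
  qed
  fix m assume "m : {m. p m ~= 0 & s m ~= 0}"
  hence m: "p m ~= 0" "s m ~= 0" by auto
  hence "p m = (\<Sum>C\<in>{C : Cs. mono C = m}. a C)" using pm[OF _ m(2)] bad0[of m] by blast
  thus "Polynomial.smult (p m) (s m) = Polynomial.smult (\<Sum>C\<in>{C : Cs. mono C = m}. a C) (s m)" by (simp only:)
 qed
 also have "... = (\<Sum>m\<in>mono ` Cs. \<Sum>C\<in>{C : Cs. mono C = m}. Polynomial.smult (a C) (s (mono C)))"
  by (intro sum.cong refl) (simp add: smult_sum)
 also have "... = (\<Sum>C\<in>Cs. Polynomial.smult (a C) (s (mono C)))"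
  by (rule sum.image_gen[OF finCs, symmetric])
 also have "... = (\<Sum>C\<in>Cs. Polynomial.smult (1 / fact n) (\<Sum>T\<in>TT C. bweight T))"
 proof (rule sum.cong[OF refl])
  fix C assume C: "C : Cs"
  have prod: "card (TT C) * card (automorphisms (class_rep C)) = fact n"
   using card_automorphisms[OF CsD(1)[OF C] I(1) CsD(3)[OF C]] by (simp add: TT_def)
  hence nz: "card (automorphisms (class_rep C)) ~= 0" by (metis fact_nonzero mult_0_right)
  have "of_nat (card (TT C)) * of_nat (card (automorphisms (class_rep C))) = (fact n :: rat)"
   by (simp flip: of_nat_mult add: prod)
  hence aC: "a C = 1 / fact n * of_nat (card (TT C))"
   using nz by (simp add: a_def field_simps)
  have "(\<Sum>T\<in>TT C. bweight T) = (\<Sum>T\<in>TT C. s (mono C))"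
   using weight[OF C] by simp
  also have "... = Polynomial.smult (of_nat (card (TT C))) (s (mono C))"
   by (simp add: of_nat_poly)
  finally show "Polynomial.smult (a C) (s (mono C)) = Polynomial.smult (1 / fact n) (\<Sum>T\<in>TT C. bweight T)"
   by (simp add: aC)
 qed
 also have "... = Polynomial.smult (1 / fact n) (\<Sum>C\<in>Cs. \<Sum>T\<in>TT C. bweight T)"
  by (rule poly_eqI) (simp only: coeff_sum coeff_smult sum_distrib_left)
 also have "(\<Sum>C\<in>Cs. \<Sum>T\<in>TT C. bweight T) = (\<Sum>T\<in>(\<Union>C\<in>Cs. TT C). bweight T)"
  by (rule sum.UNION_disjoint[symmetric]) (use finCs finT(1) disj in blast)+
 also have "... = (\<Sum>F\<in>U. bweight (cblocks ?I F))"
  unfolding union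
 proof (rule sum.reindex[unfolded comp_def])
  show "inj_on (cblocks ?I) U"
  proof (rule inj_on_inverseI)
   fix F assume "F : U"
   thus "fchain (cblocks ?I F) = F"
    unfolding U_def using fchain_cblocks[OF I(1)] lchains_coarsening by blast
  qed
 qed
 also have "... = (\<Sum>k<n. \<Sum>F\<in>lchains ?I k id. bweight (cblocks ?I F))"
  unfolding U_def
 proof (rule sum.UNION_disjoint)
  show "\<forall>i\<in>{..<n}. \<forall>j\<in>{..<n}. i ~= j --> lchains ?I i id Int lchains ?I j id = {}"
   using depth_level_chain by blast
 qed (use finite_lchains[OF I(1)] in auto)
 also have "... = (\<Sum>k<n. \<Sum>F\<in>lchains ?I k id. map_poly of_nat (cweight qsum k F))"
 proof (intro sum.cong refl)
  fix k F assume F: "F : lchains ?I k id"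
  have "fchain (cblocks ?I F) = F"
   by (rule fchain_cblocks[OF I(1) lchains_coarsening[OF F]])
  thus "bweight (cblocks ?I F) = map_poly of_nat (cweight qsum k F)"
   by (simp add: bweight_def depth_level_chain[OF F])
 qed
 also have "... = map_poly of_nat (\<Sum>k<n. \<Sum>F\<in>lchains ?I k id. cweight qsum k F)"
  by (simp only: of_nat_poly_sum)
 also have "(\<Sum>k<n. \<Sum>F\<in>lchains ?I k id. cweight qsum k F) = flat_poly ?I"
  using flat_poly_chains[OF I(1) id_in_flats, of n] n by (simp add: I(3))
 finally show ?thesis .
qed

section \<open>Coordinates on complex vector spaces\<close>

lemma class_ring_ring: "ring (class_ring :: complex ring)"
 using class_field field.is_ring by blast

lemma dual_simps:
 "carrier (dual_space V) = {f : carrier V \<rightarrow>\<^sub>E UNIV.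
   (\<forall>v\<in>carrier V. \<forall>w\<in>carrier V. f (v \<oplus>\<^bsub>V\<^esub> w) = f v + f w) \<and>
   (ALL c. \<forall>v\<in>carrier V. f (c \<odot>\<^bsub>V\<^esub> v) = c * f v)}"
 "f \<oplus>\<^bsub>dual_space V\<^esub> g = (\<lambda>v\<in>carrier V. f v + g v)"
 "c \<odot>\<^bsub>dual_space V\<^esub> f = (\<lambda>v\<in>carrier V. c * f v)"
 "\<zero>\<^bsub>dual_space V\<^esub> = (\<lambda>v\<in>carrier V. 0)"
 by (simp_all add: dual_space_def ring.func_space_def[OF class_ring_ring] class_ring_simps)

text \<open>A linear isomorphism onto \<open>coords K\<close>. Closure under the operations is part
  of the condition, so that a quotient by a kernel takes the same form as the space it comes
  from.\<close>

definition coordinatized :: "'v cspace => ('v => cvec) => nat set => bool" where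
 "coordinatized V ph K \<longleftrightarrow> finite K & bij_betw ph (carrier V) (coords K) \<and>
   (\<forall>v\<in>carrier V. \<forall>w\<in>carrier V. v \<oplus>\<^bsub>V\<^esub> w : carrier V & ph (v \<oplus>\<^bsub>V\<^esub> w) = (%i. ph v i + ph w i)) \<and>
   (ALL c. \<forall>v\<in>carrier V. c \<odot>\<^bsub>V\<^esub> v : carrier V & ph (c \<odot>\<^bsub>V\<^esub> v) = vscale c (ph v)) \<and>
   \<zero>\<^bsub>V\<^esub> : carrier V & ph \<zero>\<^bsub>V\<^esub> = zvec"

locale coordinates =
 fixes V :: "'v cspace" (structure) and ph :: "'v => cvec" and K :: "nat set"
 assumes coordinatized: "coordinatized V ph K"
begin

lemma finite_K: "finite K" and bij: "bij_betw ph (carrier V) (coords K)"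
 and add_closed: "v : carrier V ==> w : carrier V ==> v \<oplus> w : carrier V"
 and phi_add: "v : carrier V ==> w : carrier V ==> ph (v \<oplus> w) = (%i. ph v i + ph w i)"
 and smult_closed: "v : carrier V ==> c \<odot> v : carrier V"
 and phi_smult: "v : carrier V ==> ph (c \<odot> v) = vscale c (ph v)"
 and zero_closed: "\<zero> : carrier V" and phi_zero: "ph \<zero> = zvec"
 using coordinatized unfolding coordinatized_def by simp_all

definition ps :: "cvec => 'v" where
 "ps = inv_into (carrier V) ph"

lemma psi_phi: "v : carrier V ==> ps (ph v) = v"
 using bij by (simp add: ps_def bij_betw_def)

lemma phi_psi: "x : coords K ==> ph (ps x) = x"
 using bij by (simp add: ps_def bij_betw_def f_inv_into_f)

lemma phi_in: "v : carrier V ==> ph v : coords K"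
 using bij by (auto simp: bij_betw_def)

lemma psi_in: "x : coords K ==> ps x : carrier V"
 using bij inv_into_into unfolding ps_def bij_betw_def by metis

lemma phi_eq_iff: "v : carrier V ==> w : carrier V ==> ph v = ph w \<longleftrightarrow> v = w"
 using psi_phi by metis

definition basis :: "nat => cvec" where
 "basis k = (%i. if i = k then 1 else 0)"

lemma functional_expansion:
 assumes f: "f : carrier (dual_space V)" and x: "x : coords K"
 shows "f (ps x) = (\<Sum>k\<in>K. x k * f (ps (basis k)))"
proof -
 have fl: "!!v w. v : carrier V ==> w : carrier V ==> f (v \<oplus> w) = f v + f w"
  "!!c v. v : carrier V ==> f (c \<odot> v) = c * f v"
  using f by (simp_all add: dual_simps)
 have f0: "f \<zero> = 0"
 proof -
  have "\<zero> \<oplus> \<zero> = \<zero>"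
   using phi_eq_iff[OF add_closed[OF zero_closed zero_closed] zero_closed] phi_add[OF zero_closed zero_closed] phi_zero by simp
  thus ?thesis using fl(1)[OF zero_closed zero_closed] by simp
 qed
 have "f (ps (%i. if i : A then x i else 0)) = (\<Sum>k\<in>A. x k * f (ps (basis k)))" if "A \<subseteq> K" for A
  using finite_subset[OF that finite_K] that
 proof (induct A)
  case empty
  have "ps zvec = \<zero>" using psi_phi[OF zero_closed] phi_zero by simp
  thus ?case using f0 by simp
 next
  case (insert k A)
  let ?y = "%i. if i : A then x i else 0"
  have y: "?y : coords K" "basis k : coords K" using insert(4) by (auto simp: coords_def basis_def)
  have e: "ph (x k \<odot> ps (basis k) \<oplus> ps ?y) = (%i. if i : insert k A then x i else 0)"
   using insert(2) y psi_in smult_closed by (auto simp: phi_add phi_smult phi_psi vscale_def basis_def fun_eq_iff)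
  have "ps (%i. if i : insert k A then x i else 0) = x k \<odot> ps (basis k) \<oplus> ps ?y"
   by (subst e[symmetric], intro psi_phi add_closed smult_closed psi_in y)
  thus ?case using insert y psi_in smult_closed by (simp add: fl)
 qed
 moreover have "(%i. if i : K then x i else 0) = x" using x by (auto simp: coords_def)
 ultimately show ?thesis by (metis subset_refl)
qed

lemma coordinate_functional:
 "(\<lambda>v\<in>carrier V. ph v i) : carrier (dual_space V)"
 by (auto simp: dual_simps add_closed smult_closed phi_add phi_smult vscale_def)

lemma topspace_cspace: "topspace (cspace_topology V) = carrier V"
proof -
 have "{v : carrier V. (\<lambda>v\<in>carrier V. ph v 0) v : UNIV} : {{v : carrier V. f v : U} | f U. f : carrier (dual_space V) & open U}"
  using coordinate_functional[of 0] open_UNIV by blast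
 hence "carrier V : {{v : carrier V. f v : U} | f U. f : carrier (dual_space V) & open U}" by simp
 thus ?thesis unfolding cspace_topology_def topology_generated_by_topspace by blast
qed

text \<open>Coordinates are linear functionals, hence continuous. Conversely every functional is a
  finite combination of coordinates, so preimages of the generating open sets are open.\<close>

lemma homeo_coordinates:
 "homeomorphic_maps (cspace_topology V) (top_of_set (coords K)) ph ps"
 unfolding homeomorphic_maps_def
proof (intro conjI ballI)
 have "continuous_map (cspace_topology V) euclidean ph"
 proof -
  have "continuous_map (cspace_topology V) euclidean (%v. ph v i)" for i
   unfolding continuous_map_def
  proof (intro conjI allI impI)
   fix U :: "complex set" assume "openin euclidean U"
   hence U: "open U" by simp
   have "{v : carrier V. (\<lambda>v\<in>carrier V. ph v i) v : U} : {{v : carrier V. f v : U} | f U. f : carrier (dual_space V) & open U}"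
    using coordinate_functional[of i] U by blast
   hence "openin (cspace_topology V) {v : carrier V. (\<lambda>v\<in>carrier V. ph v i) v : U}"
    unfolding cspace_topology_def by (rule topology_generated_by_Basis)
   moreover have "{v : carrier V. (\<lambda>v\<in>carrier V. ph v i) v : U} = {v : topspace (cspace_topology V). ph v i : U}"
    unfolding topspace_cspace by auto
   ultimately show "openin (cspace_topology V) {v : topspace (cspace_topology V). ph v i : U}" by simp
  qed simp
  thus ?thesis by (simp add: continuous_map_componentwise_UNIV flip: euclidean_product_topology)
 qed
 thus "continuous_map (cspace_topology V) (top_of_set (coords K)) ph"
  using phi_in by (auto simp: continuous_map_in_subtopology topspace_cspace)
 show "continuous_map (top_of_set (coords K)) (cspace_topology V) ps"
  unfolding cspace_topology_def
 proof (rule continuous_on_generated_topo)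
  fix W assume "W : {{v : carrier V. f v : U} | f U. f : carrier (dual_space V) & open U}"
  then obtain f U where W: "W = {v : carrier V. f v : U}" "f : carrier (dual_space V)" "open U" by blast
  have eq: "ps -` W Int topspace (top_of_set (coords K)) =
    {x : topspace (top_of_set (coords K)). (\<Sum>k\<in>K. x k * f (ps (basis k))) : U}"
   using functional_expansion[OF W(2)] psi_in by (auto simp: W(1))
  have "continuous_on (coords K) (%x. \<Sum>k\<in>K. x k * f (ps (basis k)))"
   by (intro continuous_on_sum continuous_on_mult_right continuous_on_coordD[OF continuous_on_id])
  hence "continuous_map (top_of_set (coords K)) euclidean (%x. \<Sum>k\<in>K. x k * f (ps (basis k)))" by simp
  thus "openin (top_of_set (coords K)) (ps -` W Int topspace (top_of_set (coords K)))"
   unfolding eq by (rule openin_continuous_map_preimage) (use W(3) in simp)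
 next
  have "carrier V \<subseteq> \<Union> {{v : carrier V. f v : U} | f U. f : carrier (dual_space V) & open U}"
   using topspace_cspace unfolding cspace_topology_def topology_generated_by_topspace by simp
  thus "ps ` topspace (top_of_set (coords K)) \<subseteq> \<Union> {{v : carrier V. f v : U} | f U. f : carrier (dual_space V) & open U}"
   using psi_in by auto
 qed
 show "ps (ph v) = v" if "v : topspace (cspace_topology V)" for v using that psi_phi by (simp add: topspace_cspace)
 show "ph (ps x) = x" if "x : topspace (top_of_set (coords K))" for x using that phi_psi by simp
qed

end

text \<open>A quotient space is the space of values of a linear map with the given kernel.\<close>

locale coordinate_quotient = coordinates +
 fixes L :: "cvec => cvec" and K' :: "nat set"
 assumes K': "finite K'"
  and L_add: "!!x y. L (%i. x i + y i) = (%i. L x i + L y i)"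
  and L_scale: "!!c x. L (vscale c x) = vscale c (L x)"
  and L_onto: "L ` coords K = coords K'"
begin

lemma L_diff: "L (%i. x i - y i) = (%i. L x i - L y i)"
 using L_add[of x "vscale (-1) y"] by (simp add: L_scale) (simp add: vscale_def)

lemma phi_diff: "v : carrier V ==> w : carrier V ==> ph (w \<oplus> ((-1) \<odot> v)) = (%i. ph w i - ph v i)"
 by (simp add: phi_add phi_smult smult_closed vscale_def)

definition ker :: "'a set" where
 "ker = {v : carrier V. L (ph v) = zvec}"

lemma coset_eq:
 assumes v: "v : carrier V"
 shows "ker +> v = {w : carrier V. L (ph w) = L (ph v)}"
proof (intro equalityI subsetI)
 fix w assume "w : ker +> v"
 then obtain h where h: "h : carrier V" "L (ph h) = zvec" "w = h \<oplus> v"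
  unfolding a_r_coset_def' ker_def by blast
 thus "w : {w : carrier V. L (ph w) = L (ph v)}"
  using v by (simp add: add_closed phi_add L_add)
next
 fix w assume "w : {w : carrier V. L (ph w) = L (ph v)}"
 hence w: "w : carrier V" "L (ph w) = L (ph v)" by auto
 let ?h = "w \<oplus> ((-1) \<odot> v)"
 have hc: "?h : carrier V" using w v by (simp add: add_closed smult_closed)
 have "L (ph ?h) = zvec"
  using w v by (simp only: phi_diff L_diff) simp
 moreover have "ph (?h \<oplus> v) = ph w"
  unfolding phi_add[OF hc v] phi_diff[OF v w(1)] by simp
 hence "w = ?h \<oplus> v" using phi_eq_iff[OF add_closed[OF hc v] w(1)] by simp
 ultimately show "w : ker +> v" using hc unfolding a_r_coset_def' ker_def by blast
qed

definition quot_phi :: "'a set => cvec" where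
 "quot_phi X = L (ph (SOME v. v : X))"

lemma quot_phi_coset: "v : carrier V ==> quot_phi (ker +> v) = L (ph v)"
proof -
 assume v: "v : carrier V"
 hence "v : ker +> v" by (simp add: coset_eq)
 hence "(SOME w. w : ker +> v) : ker +> v" by (rule someI)
 thus ?thesis unfolding quot_phi_def using coset_eq[OF v] by simp
qed

lemma quot_carrier: "carrier (quotient_space V ker) = (%v. ker +> v) ` carrier V"
 by (auto simp: quotient_space_def A_RCOSETS_def')

lemma coordinatized_quotient: "coordinatized (quotient_space V ker) quot_phi K'"
 unfolding coordinatized_def
proof (intro conjI ballI allI)
 let ?Q = "quotient_space V ker"
 show "finite K'" by (rule K')
 show "bij_betw quot_phi (carrier ?Q) (coords K')"
 proof (rule bij_betw_imageI)
  show "inj_on quot_phi (carrier ?Q)"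
  proof (rule inj_onI)
   fix X Y assume "X : carrier ?Q" "Y : carrier ?Q" and eq: "quot_phi X = quot_phi Y"
   then obtain v w where v: "v : carrier V" "X = ker +> v" and w: "w : carrier V" "Y = ker +> w"
    unfolding quot_carrier by blast
   have "L (ph v) = L (ph w)" using eq unfolding v(2) w(2) quot_phi_coset[OF v(1)] quot_phi_coset[OF w(1)] .
   thus "X = Y" unfolding v(2) w(2) coset_eq[OF v(1)] coset_eq[OF w(1)] by simp
  qed
  have "quot_phi ` carrier ?Q = (%v. L (ph v)) ` carrier V"
   unfolding quot_carrier image_image by (intro image_cong refl) (simp add: quot_phi_coset)
  also have "... = L ` ph ` carrier V" by (simp only: image_image)
  also have "... = L ` coords K" using bij by (simp only: bij_betw_def)
  finally show "quot_phi ` carrier ?Q = coords K'" using L_onto by simp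
 qed
 have addQ: "(ker +> v) \<oplus>\<^bsub>?Q\<^esub> (ker +> w) = ker +> (v \<oplus> w)"
  if vw: "v : carrier V" "w : carrier V" for v w
 proof (intro equalityI subsetI)
  fix u assume "u : (ker +> v) \<oplus>\<^bsub>?Q\<^esub> (ker +> w)"
  then obtain a b where "a : carrier V" "L (ph a) = L (ph v)" "b : carrier V" "L (ph b) = L (ph w)" "u = a \<oplus> b"
   by (auto simp: quotient_space_def set_add_def' coset_eq[OF vw(1)] coset_eq[OF vw(2)])
  thus "u : ker +> (v \<oplus> w)"
   using vw by (simp add: coset_eq add_closed phi_add L_add)
 next
  fix u assume u: "u : ker +> (v \<oplus> w)"
  let ?b = "u \<oplus> ((-1) \<odot> v)"
  have uc: "u : carrier V" "L (ph u) = (%i. L (ph v) i + L (ph w) i)"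
   using u vw by (simp_all add: coset_eq add_closed phi_add L_add)
  have bc: "?b : carrier V" using uc vw by (simp add: add_closed smult_closed)
  have "L (ph ?b) = L (ph w)"
   unfolding phi_diff[OF vw(1) uc(1)] L_diff uc(2) by simp
  hence "?b : ker +> w" using bc vw by (simp add: coset_eq)
  moreover have "v : ker +> v" using vw by (simp add: coset_eq)
  moreover have "ph (v \<oplus> ?b) = ph u"
   unfolding phi_add[OF vw(1) bc] phi_diff[OF vw(1) uc(1)] by simp
  hence "u = v \<oplus> ?b" using phi_eq_iff[OF add_closed[OF vw(1) bc] uc(1)] by simp
  ultimately show "u : (ker +> v) \<oplus>\<^bsub>?Q\<^esub> (ker +> w)"
   unfolding quotient_space_def by (simp add: set_add_def') blast
 qed
 have smultQ: "c \<odot>\<^bsub>?Q\<^esub> (ker +> v) = ker +> (c \<odot> v)" if v: "v : carrier V" for c v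
 proof -
  have "c \<odot>\<^bsub>?Q\<^esub> (ker +> v) = (\<Union>x\<in>ker +> v. ker +> (c \<odot> x))"
   by (simp add: quotient_space_def)
  also have "... = (\<Union>x\<in>ker +> v. ker +> (c \<odot> v))"
  proof (rule SUP_cong[OF refl])
   fix x assume "x : ker +> v"
   hence "x : carrier V" "L (ph x) = L (ph v)" using v by (simp_all add: coset_eq)
   thus "ker +> (c \<odot> x) = ker +> (c \<odot> v)"
    using v by (simp add: coset_eq smult_closed phi_smult L_scale)
  qed
  also have "... = ker +> (c \<odot> v)" using v coset_eq[OF v] by auto
  finally show ?thesis .
 qed
 fix X assume X: "X : carrier ?Q"
 then obtain v where v: "v : carrier V" "X = ker +> v" unfolding quot_carrier by blast
 show "c \<odot>\<^bsub>?Q\<^esub> X : carrier ?Q" "quot_phi (c \<odot>\<^bsub>?Q\<^esub> X) = vscale c (quot_phi X)" for c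
  using v by (simp_all add: smultQ quot_carrier smult_closed quot_phi_coset phi_smult L_scale)
 fix Y assume "Y : carrier ?Q"
 then obtain w where w: "w : carrier V" "Y = ker +> w" unfolding quot_carrier by blast
 show "X \<oplus>\<^bsub>?Q\<^esub> Y : carrier ?Q" "quot_phi (X \<oplus>\<^bsub>?Q\<^esub> Y) = (%i. quot_phi X i + quot_phi Y i)"
  using v w by (simp_all add: addQ quot_carrier add_closed quot_phi_coset phi_add L_add)
next
 have Lz: "L zvec = zvec" using L_scale[of 0 zvec] by simp
 have ker0: "ker +> \<zero> = ker"
  using coset_eq[OF zero_closed] by (simp only: phi_zero Lz ker_def[symmetric])
 have zQ: "\<zero>\<^bsub>quotient_space V ker\<^esub> = ker" by (simp add: quotient_space_def)
 show "\<zero>\<^bsub>quotient_space V ker\<^esub> : carrier (quotient_space V ker)"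
  unfolding zQ quot_carrier using imageI[OF zero_closed, of "%v. ker +> v"] by (simp only: ker0)
 show "quot_phi \<zero>\<^bsub>quotient_space V ker\<^esub> = zvec"
  unfolding zQ using quot_phi_coset[OF zero_closed] by (simp add: ker0 phi_zero Lz)
qed

end

section \<open>Projective spaces in coordinates\<close>

locale coordinates_proj = coordinates V ph K + projective N
 for V :: "'v cspace" (structure) and ph K N +
 assumes KN: "K \<subseteq> {..<N}"
begin

lemma line_eq_iff:
 assumes v: "v : carrier V" "v ~= \<zero>" and w: "w : carrier V" "w ~= \<zero>"
 shows "line V v = line V w \<longleftrightarrow> pr (ph v) = pr (ph w)"
proof -
 have nz: "ph v ~= zvec" "ph w ~= zvec"
  using v w phi_eq_iff[OF _ zero_closed] phi_zero by simp_all
 have "w : line V w"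
 proof -
  have "1 \<odot> w = w" using phi_eq_iff[OF smult_closed[OF w(1)] w(1), of 1] phi_smult[OF w(1), of 1] by simp
  thus ?thesis unfolding line_def by (intro CollectI exI[of _ 1]) simp
 qed
 show ?thesis
 proof
  assume "line V v = line V w"
  hence "w : line V v" using `w : line V w` by simp
  then obtain c where "w = c \<odot> v" by (auto simp: line_def)
  hence c: "ph w = vscale c (ph v)" using phi_smult[OF v(1)] by simp
  hence "c ~= 0" using nz(2) by auto
  thus "pr (ph v) = pr (ph w)" unfolding c by (rule pr_vscale[symmetric])
 next
  assume "pr (ph v) = pr (ph w)"
  then obtain c where c: "c ~= 0" "ph w = vscale c (ph v)"
   using pr_eqD[of "ph v" "ph w" K K] phi_in[OF v(1)] phi_in[OF w(1)] KN nz by blast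
  have "ph w = ph (c \<odot> v)" by (simp add: c(2) phi_smult[OF v(1)])
  hence wc: "w = c \<odot> v" using phi_eq_iff[OF w(1) smult_closed[OF v(1)]] by simp
  have "d \<odot> (c \<odot> v) = (d * c) \<odot> v" for d
  proof (subst phi_eq_iff[symmetric])
   show "ph (d \<odot> (c \<odot> v)) = ph ((d * c) \<odot> v)"
    by (simp add: phi_smult smult_closed v(1))
  qed (intro smult_closed v(1))+
  hence *: "line V w = {(d * c) \<odot> v | d. True}" unfolding line_def wc by simp
  have "line V v = {(d * c) \<odot> v | d. True}"
   unfolding line_def
  proof (intro equalityI subsetI)
   fix u assume "u : {d \<odot> v | d. True}"
   then obtain d where "u = d \<odot> v" by blast
   hence "u = ((d / c) * c) \<odot> v" using c(1) by simp
   thus "u : {(d * c) \<odot> v | d. True}" by blast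
  qed blast
  thus "line V v = line V w" using * by simp
 qed
qed

definition domain0 :: "'v topology" where
 "domain0 = subtopology (cspace_topology V) (carrier V - {\<zero>})"

lemma topspace_domain0: "topspace domain0 = carrier V - {\<zero>}"
 by (auto simp: domain0_def topspace_cspace)

lemma quotient_map_line: "quotient_map domain0 (projective_space V) (line V)"
 unfolding projective_space_def domain0_def by (rule quotient_map_quotient_topology)

definition line_pr :: "'v set => cmat" where
 "line_pr l = pr (ph (SOME v. v : carrier V - {\<zero>} & line V v = l))"

definition pr_line :: "cmat => 'v set" where
 "pr_line M = line V (ps (SOME x. x : coords K - {zvec} & pr x = M))"

lemma line_pr_line: "v : carrier V - {\<zero>} ==> line_pr (line V v) = pr (ph v)"
proof -
 assume v: "v : carrier V - {\<zero>}"
 let ?w = "SOME w. w : carrier V - {\<zero>} & line V w = line V v"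
 have "?w : carrier V - {\<zero>} & line V ?w = line V v" by (rule someI[of _ v]) (use v in simp)
 thus ?thesis unfolding line_pr_def using line_eq_iff[of ?w v] v by blast
qed

lemma psi_nonzero: "x : coords K - {zvec} ==> ps x : carrier V - {\<zero>}"
 using psi_in[of x] phi_psi[of x] phi_zero by auto

lemma phi_nonzero: "v : carrier V - {\<zero>} ==> ph v : coords K - {zvec}"
 using phi_in[of v] phi_eq_iff[of v "\<zero>"] zero_closed phi_zero by auto

lemma pr_line_pr: "x : coords K - {zvec} ==> pr_line (pr x) = line V (ps x)"
proof -
 assume x: "x : coords K - {zvec}"
 let ?y = "SOME y. y : coords K - {zvec} & pr y = pr x"
 have y: "?y : coords K - {zvec} & pr ?y = pr x" by (rule someI[of _ x]) (use x in simp)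
 hence "ps ?y : carrier V - {\<zero>}" "ps x : carrier V - {\<zero>}" using psi_nonzero x by blast+
 moreover have "pr (ph (ps ?y)) = pr (ph (ps x))" using y x phi_psi by simp
 ultimately show ?thesis unfolding pr_line_def using line_eq_iff by blast
qed

text \<open>One direction descends through the quotient map. For the other, column \<open>k\<close>
  of a projector with nonzero diagonal entry at \<open>k\<close> spans its line; this is a
  continuous choice of representative on an open set, and these sets cover.\<close>

lemma homeomorphic_maps_projective:
 "homeomorphic_maps (projective_space V) (top_of_set (points K)) line_pr pr_line"
 unfolding homeomorphic_maps_def
proof (intro conjI ballI)
 have top: "topspace (projective_space V) = line V ` (carrier V - {\<zero>})"
  using quotient_map_line topspace_domain0 by (simp add: quotient_map_def)
 have "continuous_map domain0 (top_of_set (points K)) (line_pr o line V)"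
 proof -
  have "continuous_map domain0 (top_of_set (coords K - {zvec})) ph"
   using homeo_coordinates phi_nonzero unfolding homeomorphic_maps_def domain0_def
   by (auto simp: continuous_map_in_subtopology continuous_map_from_subtopology topspace_cspace)
  moreover have "continuous_map (top_of_set (coords K - {zvec})) (top_of_set (points K)) pr"
  proof -
   have "continuous_on (coords K - {zvec}) (%x. pr x)"
    by (rule continuous_on_pr[OF continuous_on_id]) (use sqnorm_pos KN in blast)
   thus ?thesis by (auto simp: points_def)
  qed
  ultimately have "continuous_map domain0 (top_of_set (points K)) (pr o ph)" by (rule continuous_map_compose)
  thus ?thesis
   by (rule continuous_map_eq) (simp add: topspace_domain0 line_pr_line)
 qed
 thus "continuous_map (projective_space V) (top_of_set (points K)) line_pr"
  by (rule continuous_compose_quotient_map[OF quotient_map_line])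
 show "continuous_map (top_of_set (points K)) (projective_space V) pr_line"
 proof (rule pasting_lemma[where I = K and T = "%k. {M : points K. M k k ~= 0}" and f = "%_. pr_line"])
  fix k assume k: "k : K"
  have "continuous_on (points K) (%M :: cmat. M k k)"
   by (rule cont_matrixD[OF continuous_on_id])
  hence "openin (top_of_set (points K)) {x : topspace (top_of_set (points K)). x k k : - {0}}"
   by (intro openin_continuous_map_preimage[where Y = euclidean]) auto
  thus "openin (top_of_set (points K)) {M : points K. M k k ~= 0}" by simp
  let ?T = "{M : points K. M k k ~= 0}"
  have col: "(%i. M i k) : coords K - {zvec} & pr (%i. M i k) = M" if M: "M : ?T" for M
  proof -
   obtain x where x: "x : coords K" "x ~= zvec" "M = pr x" using M by (auto simp: points_def)
   have eq: "(%i. M i k) = vscale (cnj (x k) / of_real (sqnorm x)) x"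
    by (auto simp: x(3) pr_def vscale_def)
   have nz: "(%i. M i k) ~= zvec" using M by (auto simp: fun_eq_iff)
   hence "cnj (x k) / of_real (sqnorm x) ~= 0" using eq by auto
   from pr_vscale[OF this, of x] vscale_coords[OF x(1), of "cnj (x k) / of_real (sqnorm x)"]
   have "(%i. M i k) : coords K" "pr (%i. M i k) = pr x" unfolding eq by blast+
   thus ?thesis using nz x(3) by blast
  qed
  have "continuous_on ?T (%M i. M i k)"
   by (rule continuous_on_funI, rule cont_matrixD[OF continuous_on_id])
  hence "continuous_map (top_of_set ?T) (top_of_set (coords K)) (%M i. M i k)"
   using col by auto
  hence "continuous_map (top_of_set ?T) (cspace_topology V) (ps o (%M i. M i k))"
   by (rule continuous_map_compose) (use homeo_coordinates in \<open>simp only: homeomorphic_maps_def\<close>)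
  moreover have "ps (%i. M i k) : carrier V - {\<zero>}" if "M : ?T" for M
   using psi_nonzero col[OF that] by blast
  ultimately have "continuous_map (top_of_set ?T) domain0 (ps o (%M i. M i k))"
   unfolding domain0_def continuous_map_in_subtopology by (simp add: image_subset_iff Pi_iff)
  hence "continuous_map (top_of_set ?T) (projective_space V) (line V o (ps o (%M i. M i k)))"
   using quotient_imp_continuous_map[OF quotient_map_line] by (rule continuous_map_compose)
  hence "continuous_map (top_of_set ?T) (projective_space V) pr_line"
  proof (rule continuous_map_eq)
   fix M assume "M : topspace (top_of_set ?T)"
   hence M: "M : ?T" by simp
   show "(line V o (ps o (%M i. M i k))) M = pr_line M"
    using pr_line_pr[of "%i. M i k"] col[OF M] by simp
  qed
  moreover have "subtopology (top_of_set (points K)) ?T = top_of_set ?T"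
   by (simp add: subtopology_subtopology Int_absorb1)
  ultimately show "continuous_map (subtopology (top_of_set (points K)) ?T) (projective_space V) pr_line" by simp
 next
  fix M assume "M : topspace (top_of_set (points K))"
  then obtain x where x: "x : coords K" "x ~= zvec" "M = pr x" by (auto simp: points_def)
  then obtain k where k: "x k ~= 0" by auto
  hence "k : K" using x(1) by (auto simp: coords_def)
  moreover have "M k k ~= 0" using k sqnorm_pos[OF x(1) KN x(2)] by (simp add: x(3) pr_def)
  ultimately show "EX j. j : K & M : {M : points K. M j j ~= 0} & pr_line M = pr_line M"
   using x by (auto simp: points_def)
 qed simp
 show "pr_line (line_pr l) = l" if "l : topspace (projective_space V)" for l
  using that phi_nonzero psi_phi by (auto simp: top line_pr_line pr_line_pr)
 show "line_pr (pr_line M) = M" if "M : topspace (top_of_set (points K))" for M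
  using that psi_nonzero phi_psi by (auto simp: points_def line_pr_line pr_line_pr)
qed

end

section \<open>The root arrangement of type A\<close>

lemma (in coordinates) dual_module: "module (class_ring :: complex ring) (dual_space V)"
proof -
 let ?F = "ring.func_space (class_ring :: complex ring) (carrier V)"
 have cr: "cring (class_ring :: complex ring)" using class_field by (rule field.axioms(1)[THEN domain.axioms(1)])
 interpret F: module "class_ring :: complex ring" ?F by (rule cring.func_space_is_module[OF cr])
 have "submodule class_ring (carrier (dual_space V)) ?F"
 proof (unfold_locales)
  show "carrier (dual_space V) \<subseteq> carrier ?F"
   by (auto simp: dual_simps ring.func_space_def[OF class_ring_ring] class_ring_simps)
  show "\<zero>\<^bsub>?F\<^esub> : carrier (dual_space V)"
   by (auto simp: dual_simps ring.func_space_def[OF class_ring_ring] class_ring_simps add_closed smult_closed)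
  show "f \<oplus>\<^bsub>?F\<^esub> g : carrier (dual_space V)" if "f : carrier (dual_space V)" "g : carrier (dual_space V)" for f g
   using that by (auto simp: dual_simps ring.func_space_def[OF class_ring_ring] class_ring_simps add_closed smult_closed algebra_simps)
  show "c \<odot>\<^bsub>?F\<^esub> f : carrier (dual_space V)" if "c : carrier class_ring" "f : carrier (dual_space V)" for c f
   using that by (auto simp: dual_simps ring.func_space_def[OF class_ring_ring] class_ring_simps add_closed smult_closed algebra_simps)
 qed
 from F.submodule_is_module[OF this] show ?thesis by (simp add: dual_space_def dual_simps(1))
qed

definition vec_coords :: "nat => complex vec => cvec" where
 "vec_coords n z = (%i. if i < n then z $ i else 0)"

lemma along_add: "along r (%i. x i + y i) = (%i. along r x i + along r y i)"
 by (simp add: along_def algebra_simps)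

lemma along_onto:
 assumes "r : flats I" "moved r \<subseteq> K"
 shows "along r ` coords K = coords (moved r)"
proof (intro equalityI subsetI)
 fix x assume x: "x : coords (moved r)"
 hence "x = along r x" by (rule along_self[OF assms(1), symmetric])
 moreover have "x : coords K" using x coords_mono[OF assms(2)] by blast
 ultimately show "x : along r ` coords K" by blast
qed (use along_in in blast)

lemma coordinatized_vec: "coordinatized (module_vec TYPE(complex) n) (vec_coords n) {..<n}"
 unfolding coordinatized_def
proof (intro conjI ballI allI)
 show "bij_betw (vec_coords n) (carrier (module_vec TYPE(complex) n)) (coords {..<n})"
  by (rule bij_betwI[where g = "vec n"]) (auto simp: module_vec_simps vec_coords_def coords_def)
qed (auto simp: module_vec_simps vec_coords_def vscale_def)

locale typeA =
 fixes n :: nat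
 assumes n: "2 <= n"
begin

abbreviation "I \<equiv> {..<n}"
abbreviation "topI \<equiv> top_flat {..<n}"

lemma finite_I: "finite I" and I_nonempty: "I ~= {}" and Min_I: "Min I = 0"
proof -
 show "I ~= {}" using n by (auto simp: lessThan_empty_iff)
 show "Min I = 0" using n by (intro Min_eqI) auto
qed simp

lemma top_in: "topI : flats I"
 by (rule top_flat_in) (rule finite_I)

lemma moved_flat: "p : flats I ==> moved p \<subseteq> moved topI"
 using coarser_fixed[OF top_in _ top_flat_coarser] by (auto simp: moved_def)

text \<open>The diagonal consists of the vectors constant on the single block of
  \<open>topI\<close>, so the quotient by it is coordinatized by the differences with coordinate
  0.\<close>

sublocale Z: coordinate_quotient "module_vec TYPE(complex) n" "vec_coords n" "{..<n}" "along (top_flat {..<n})" "moved (top_flat {..<n})"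
proof unfold_locales
 show "coordinatized (module_vec TYPE(complex) n) (vec_coords n) {..<n}" by (rule coordinatized_vec)
 show "finite (moved topI)" using moved_subset[OF top_in] finite_I finite_subset by blast
 show "along topI ` coords {..<n} = coords (moved topI)"
  by (rule along_onto[OF top_in moved_subset[OF top_in]])
qed (rule along_add along_vscale)+

abbreviation "V \<equiv> typeA_space n"
abbreviation "Ph \<equiv> Z.quot_phi"

lemma top_apply: "i < n ==> topI i = 0" "~ i < n ==> topI i = i"
 by (simp_all add: top_flat_def Min_I)

lemma along_top:
 "along topI (vec_coords n w) = (%k. if k < n then w $ k - w $ 0 else 0)"
proof
 fix k
 have "0 < n" using n by simp
 thus "along topI (vec_coords n w) k = (if k < n then w $ k - w $ 0 else 0)"
  by (cases "k < n") (simp_all add: along_def vec_coords_def top_apply)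
qed

lemma ker_diagonal: "Z.ker = diagonal n"
proof -
 have "along topI (vec_coords n z) = zvec \<longleftrightarrow> (\<forall>i<n. \<forall>j<n. z $ i = z $ j)" for z :: "complex vec"
 proof
  assume 0: "along topI (vec_coords n z) = zvec"
  have "z $ i = z $ 0" if "i < n" for i
   using fun_cong[OF 0, of i] that by (simp add: along_top)
  thus "\<forall>i<n. \<forall>j<n. z $ i = z $ j" by metis
 next
  assume h: "\<forall>i<n. \<forall>j<n. z $ i = z $ j"
  have "0 < n" using n by simp
  have "(if k < n then z $ k - z $ 0 else 0) = 0" for k
  proof (cases "k < n")
   case True
   hence "z $ k = z $ 0" using h `0 < n` by blast
   thus ?thesis by (simp only: diff_self if_cancel)
  qed simp
  thus "along topI (vec_coords n z) = zvec" unfolding along_top by (rule ext)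
 qed
 thus ?thesis unfolding Z.ker_def diagonal_def module_vec_simps by blast
qed

lemma V_eq: "V = quotient_space (module_vec TYPE(complex) n) Z.ker"
 by (simp add: typeA_space_def ker_diagonal)

sublocale V: coordinates "typeA_space n" "Z.quot_phi" "moved (top_flat {..<n})"
 by unfold_locales (unfold V_eq, rule Z.coordinatized_quotient)

lemma quotient_at:
 assumes "p : flats I"
 shows "coordinate_quotient V Ph (moved topI) (along p) (moved p)"
proof unfold_locales
 show "finite (moved p)" using moved_subset[OF assms] finite_I finite_subset by blast
 show "along p ` coords (moved topI) = coords (moved p)"
  by (rule along_onto[OF assms moved_flat[OF assms]])
qed (rule along_add along_vscale)+

lemma root_eq:
 assumes ij: "i < n" "j < n"
 shows "typeA_root n i j = (\<lambda>X\<in>carrier V. Ph X i - Ph X j)"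
proof -
 have "the_elem ((%z. z $ i - z $ j) ` X) = Ph X i - Ph X j" if X: "X : carrier V" for X
 proof -
  obtain z where z: "z : carrier (module_vec TYPE(complex) n)" "X = Z.ker +>\<^bsub>module_vec TYPE(complex) n\<^esub> z"
   using X unfolding V_eq Z.quot_carrier by blast
  have PX: "Ph X = along topI (vec_coords n z)" unfolding z(2) by (rule Z.quot_phi_coset[OF z(1)])
  have Xset: "X = {w : carrier (module_vec TYPE(complex) n). along topI (vec_coords n w) = along topI (vec_coords n z)}"
   unfolding z(2) by (rule Z.coset_eq[OF z(1)])
  have co: "w $ k - w $ 0 = Ph X k" if w: "w : X" and k: "k < n" for w k
  proof -
   have "along topI (vec_coords n w) = Ph X"
    using w unfolding PX by (subst (asm) Xset) blast
   from fun_cong[OF this, of k] show ?thesis using k by (simp add: along_top)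
  qed
  have "w $ i - w $ j = Ph X i - Ph X j" if w: "w : X" for w
  proof -
   have "w $ i - w $ j = (w $ i - w $ 0) - (w $ j - w $ 0)" by simp
   thus ?thesis unfolding co[OF w ij(1)] co[OF w ij(2)] .
  qed
  moreover have "z : X" by (subst Xset) (use z(1) in blast)
  ultimately have "(%z. z $ i - z $ j) ` X = {Ph X i - Ph X j}" by auto
  thus ?thesis by simp
 qed
 thus ?thesis unfolding typeA_root_def by (intro ext) simp
qed

abbreviation "D \<equiv> dual_space V"
abbreviation "dspan \<equiv> module.span (class_ring :: complex ring) D"

sublocale D: module "class_ring :: complex ring" "dual_space (typeA_space n)"
 by (rule V.dual_module)

lemma root_in_dual: "i < n ==> j < n ==> typeA_root n i j : carrier D"
 unfolding root_eq
 by (auto simp: dual_simps V.add_closed V.smult_closed V.phi_add V.phi_smult vscale_def algebra_simps)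

definition generators :: "(nat => nat) => (complex vec set => complex) set" where
 "generators p = {typeA_root n i j | i j. i < n & j < n & p i = p j}"

lemma generatorsI: "i < n ==> j < n ==> p i = p j ==> typeA_root n i j : generators p"
 unfolding generators_def by blast

definition fspace :: "(nat => nat) => (complex vec set => complex) set" where
 "fspace p = dspan (generators p)"

lemma generators_in: "generators p \<subseteq> carrier D"
 using root_in_dual by (auto simp: generators_def)

lemma submodule_span: "S \<subseteq> carrier D ==> submodule class_ring (dspan S) D"
 by (rule D.span_is_submodule)

text \<open>This makes \<open>along p\<close> a coordinate map on the quotient by the annihilator.
  For one inclusion the roots joining \<open>i\<close> to \<open>p i\<close> are tested; for the
  other, the functionals vanishing at \<open>X\<close> form a submodule, so the generators
  suffice.\<close>

lemma annihilator_fspace: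
 assumes p: "p : flats I"
 shows "annihilator V (fspace p) = {X : carrier V. along p (Ph X) = zvec}"
proof (intro equalityI subsetI)
 fix X assume X: "X : annihilator V (fspace p)"
 hence Xc: "X : carrier V" by (simp add: annihilator_def)
 have gen: "generators p \<subseteq> fspace p" unfolding fspace_def by (rule D.in_own_span[OF generators_in])
 have "along p (Ph X) i = 0" for i
 proof (cases "i < n")
  case True
  hence "p i < n" "p (p i) = p i" using flatsD(1)[OF p, of i] flatsD(3)[OF p, of i] by auto
  hence "typeA_root n i (p i) : generators p" using True by (intro generatorsI) simp_all
  hence "typeA_root n i (p i) X = 0" using X gen by (auto simp: annihilator_def)
  thus ?thesis using Xc True `p i < n` by (simp add: root_eq along_def)
 next
  case False
  thus ?thesis using flatsD(4)[OF p, of i] by (simp add: along_def)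
 qed
 thus "X : {X : carrier V. along p (Ph X) = zvec}" using Xc by auto
next
 fix X assume "X : {X : carrier V. along p (Ph X) = zvec}"
 hence X: "X : carrier V" "Ph X o p = Ph X" using along_zero_iff by auto
 let ?N = "{f : carrier D. f X = 0}"
 have "submodule class_ring ?N D"
 proof unfold_locales
  show "\<zero>\<^bsub>D\<^esub> : ?N" using D.zero_closed X(1) by (simp add: dual_simps(4))
  show "f \<oplus>\<^bsub>D\<^esub> g : ?N" if "f : ?N" "g : ?N" for f g
   using that D.a_closed X(1) by (simp add: dual_simps(2))
  show "c \<odot>\<^bsub>D\<^esub> f : ?N" if "c : carrier class_ring" "f : ?N" for c f
   using that D.smult_closed X(1) by (simp add: dual_simps(3))
 qed auto
 moreover have "generators p \<subseteq> ?N"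
 proof
  fix f assume "f : generators p"
  then obtain i j where ij: "f = typeA_root n i j" "i < n" "j < n" "p i = p j" by (auto simp: generators_def)
  have "Ph X i = Ph X j" using fun_cong[OF X(2), of i] fun_cong[OF X(2), of j] ij(4) by simp
  thus "f : ?N" using ij root_in_dual X(1) by (simp add: root_eq)
 qed
 ultimately have "fspace p \<subseteq> ?N" unfolding fspace_def by (intro D.span_is_subset)
 thus "X : annihilator V (fspace p)" using X(1) by (auto simp: annihilator_def)
qed

lemma fspace_inj: "inj_on fspace (pflats I)"
proof (rule inj_onI)
 have half: "p o p' = p" if h: "p : flats I" "p' : flats I" "fspace p = fspace p'" for p p'
 proof
  fix i
  show "(p o p') i = p i"
  proof (cases "i : I")
   case False
   thus ?thesis using flatsD(4)[OF h(2)] by simp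
  next
   case True
   \<comment> \<open>The indicator of the block of \<open>i\<close>, normalised by
     \<open>along topI\<close> to be a coordinate vector of \<open>V\<close>. It is annihilated by
     \<open>fspace p\<close>, hence by \<open>fspace p'\<close>, so \<open>i\<close> and
     \<open>p' i\<close> lie in the same block of \<open>p\<close>.\<close>
   define x where "x = (%j. if p j = p i then 1 else 0 :: complex)"
   define y where "y = along topI x"
   have y: "y : coords (moved topI)" unfolding y_def by (rule along_in)
   have tp: "topI (p j) = topI j" "topI (p' j) = topI j" for j
    using top_flat_coarser[OF h(1)] top_flat_coarser[OF h(2)] by (simp_all add: fun_eq_iff)
   have "along p y = zvec"
    by (auto simp: along_def y_def x_def tp flatsD(1)[OF h(1)])
   hence "V.ps y : annihilator V (fspace p)"
    unfolding annihilator_fspace[OF h(1)] using V.psi_in[OF y] V.phi_psi[OF y] by simp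
   hence "V.ps y : annihilator V (fspace p')" using h(3) by simp
   hence "along p' y = zvec"
    unfolding annihilator_fspace[OF h(2)] using V.phi_psi[OF y] by simp
   from fun_cong[OF this, of i] have "x (p' i) = x i" by (simp add: along_def y_def tp)
   thus ?thesis by (auto simp: x_def split: if_splits)
  qed
 qed
 fix p p' assume "p : pflats I" "p' : pflats I" "fspace p = fspace p'"
 thus "p = p'" using half[of p p'] half[of p' p] finer_antisym[of p I p'] by (simp add: pflats_def)
qed

lemma root_in_line: "i < n ==> j < n ==> typeA_root n i j : line D (typeA_root n i j)"
proof -
 assume "i < n" "j < n"
 hence "\<one>\<^bsub>class_ring\<^esub> \<odot>\<^bsub>D\<^esub> typeA_root n i j = typeA_root n i j" by (intro D.smult_one root_in_dual)
 thus ?thesis unfolding line_def by (intro CollectI exI[of _ 1]) (simp add: class_ring_simps)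
qed

lemma root_add:
 "i < n ==> j < n ==> k < n ==> typeA_root n i j \<oplus>\<^bsub>D\<^esub> typeA_root n j k = typeA_root n i k"
 by (auto simp: dual_simps(2) root_eq fun_eq_iff)

lemma root_neg: "i < n ==> j < n ==> (-1) \<odot>\<^bsub>D\<^esub> typeA_root n i j = typeA_root n j i"
 by (auto simp: dual_simps(3) root_eq fun_eq_iff)

lemma root_self: "i < n ==> typeA_root n i i = \<zero>\<^bsub>D\<^esub>"
 by (auto simp: dual_simps(4) root_eq fun_eq_iff)

text \<open>A collection of lines is a graph on the indices. By \<open>root_add\<close> and
  \<open>root_neg\<close> its span contains the root of every pair joined by a path, so it depends
  only on the partition into connected components.\<close>

lemma building_set_eq: "typeA_building_set n = fspace ` pflats I"
proof (intro equalityI subsetI)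
 fix A assume "A : typeA_building_set n"
 then obtain LL where L: "LL \<subseteq> typeA_lines n" "LL ~= {}" "A = dspan (\<Union>LL)"
  unfolding typeA_building_set_def by blast
 define R where "R = {(i, j). i < n & j < n & i ~= j & line D (typeA_root n i j) : LL}"
 define p where "p = min_rep R"
 have p: "p : flats I" unfolding p_def by (rule min_rep_flat) (auto simp: R_def)
 have pR: "p i = p j" if "(i, j) : R" for i j
  unfolding p_def by (rule min_rep_eq) (use that in blast)
 have "LL \<subseteq> Pow (carrier D)"
  using L(1) D.smult_closed root_in_dual by (force simp: typeA_lines_def line_def class_ring_simps)
 hence UL: "\<Union>LL \<subseteq> carrier D" by blast
 have smA: "submodule class_ring A D" and smB: "submodule class_ring (fspace p) D"
  unfolding L(3) fspace_def by (intro submodule_span UL generators_in)+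
 have "\<Union>LL \<subseteq> fspace p"
 proof
  fix f assume "f : \<Union>LL"
  then obtain l where l: "l : LL" "f : l" by blast
  then obtain i j where ij: "l = line D (typeA_root n i j)" "i < n" "j < n" "i ~= j" using L(1) by (auto simp: typeA_lines_def)
  hence "p i = p j" using pR[of i j] l(1) by (simp add: R_def)
  hence "typeA_root n i j : generators p" unfolding generators_def using ij by blast
  hence "typeA_root n i j : fspace p" unfolding fspace_def using D.in_own_span[OF generators_in] by blast
  moreover obtain c where "f = c \<odot>\<^bsub>D\<^esub> typeA_root n i j" using l(2) ij(1) by (auto simp: line_def)
  ultimately show "f : fspace p" using submodule.smult_closed[OF smB, of c] by (simp add: class_ring_simps)
 qed
 hence 1: "A \<subseteq> fspace p" unfolding L(3) by (rule D.span_is_subset[OF _ smB])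
 have inA: "typeA_root n i j : A" if h: "(i, j) : R" for i j
 proof -
  have "typeA_root n i j : \<Union>LL" using h root_in_line[of i j] by (auto simp: R_def)
  thus ?thesis unfolding L(3) using D.in_own_span[OF UL] by blast
 qed
 have inA': "typeA_root n i j : A" if h: "(i, j) : R Un R\<inverse>" for i j
 proof (cases "(i, j) : R")
  case False
  hence ji: "(j, i) : R" using h by blast
  hence "(-1) \<odot>\<^bsub>D\<^esub> typeA_root n j i : A" using submodule.smult_closed[OF smA, of "-1"] inA[OF ji] by (simp add: class_ring_simps)
  thus ?thesis using root_neg[of j i] ji by (simp add: R_def)
 qed (rule inA)
 have path: "j < n & typeA_root n i j : A" if h: "(i, j) : (R Un R\<inverse>)\<^sup>*" and i: "i < n" for i j
  using h
 proof (induct rule: rtrancl_induct)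
  case base
  show ?case using i root_self[OF i] submodule.zero_closed[OF smA] by simp
 next
  case (step j k)
  have k: "k < n" using step(2) by (auto simp: R_def)
  have "typeA_root n i j \<oplus>\<^bsub>D\<^esub> typeA_root n j k : A"
   using submodule.m_closed[OF smA] step(3) inA'[OF step(2)] by blast
  thus ?case using root_add[OF i _ k, of j] step(3) k by simp
 qed
 have "generators p \<subseteq> A"
 proof
  fix f assume "f : generators p"
  then obtain i j where ij: "f = typeA_root n i j" "i < n" "j < n" "p i = p j" by (auto simp: generators_def)
  hence "(i, j) : (R Un R\<inverse>)\<^sup>*" unfolding p_def min_rep_eq_iff by simp
  thus "f : A" using path ij by blast
 qed
 hence "fspace p \<subseteq> A" unfolding fspace_def by (rule D.span_is_subset[OF _ smA])
 hence A: "A = fspace p" using 1 by blast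
 obtain l where l: "l : LL" using L(2) by blast
 then obtain i j where ij: "l = line D (typeA_root n i j)" "i < n" "j < n" "i ~= j" using L(1) by (auto simp: typeA_lines_def)
 hence "p i = p j" using pR[of i j] l by (simp add: R_def)
 hence "p ~= id" using ij(4) by auto
 thus "A : fspace ` pflats I" using A p by (simp add: pflats_def)
next
 fix A assume "A : fspace ` pflats I"
 then obtain p where p: "p : flats I" "p ~= id" "A = fspace p" by (auto simp: pflats_def)
 define LL where "LL = {line D (typeA_root n i j) | i j. i < n & j < n & i ~= j & p i = p j}"
 have sub: "LL \<subseteq> typeA_lines n" by (auto simp: LL_def typeA_lines_def)
 obtain i where i: "p i ~= i" using p(2) by (auto simp: fun_eq_iff)
 hence "i < n" using flatsD(4)[OF p(1), of i] by auto
 hence "p i < n" "p (p i) = p i" using flatsD(1)[OF p(1), of i] flatsD(3)[OF p(1), of i] by auto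
 hence "line D (typeA_root n i (p i)) : LL" unfolding LL_def using i `i < n`
  by (intro CollectI exI[of _ i] exI[of _ "p i"] conjI refl) simp_all
 hence ne: "LL ~= {}" by blast
 have UL: "\<Union>LL \<subseteq> carrier D"
  using D.smult_closed root_in_dual by (force simp: LL_def line_def class_ring_simps)
 have smA: "submodule class_ring (dspan (\<Union>LL)) D" and smB: "submodule class_ring (fspace p) D"
  unfolding fspace_def by (intro submodule_span UL generators_in)+
 have "\<Union>LL \<subseteq> fspace p"
 proof
  fix f assume "f : \<Union>LL"
  then obtain i j c where f: "f = c \<odot>\<^bsub>D\<^esub> typeA_root n i j" "i < n" "j < n" "p i = p j" by (auto simp: LL_def line_def)
  hence "typeA_root n i j : generators p" unfolding generators_def by blast
  hence "typeA_root n i j : fspace p" unfolding fspace_def using D.in_own_span[OF generators_in] by blast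
  thus "f : fspace p" using submodule.smult_closed[OF smB, of c] f(1) by (simp add: class_ring_simps)
 qed
 hence 1: "dspan (\<Union>LL) \<subseteq> fspace p" by (rule D.span_is_subset[OF _ smB])
 have "generators p \<subseteq> dspan (\<Union>LL)"
 proof
  fix f assume "f : generators p"
  then obtain i j where ij: "f = typeA_root n i j" "i < n" "j < n" "p i = p j" by (auto simp: generators_def)
  show "f : dspan (\<Union>LL)"
  proof (cases "i = j")
   case True
   thus ?thesis using ij root_self submodule.zero_closed[OF smA] by simp
  next
   case False
   hence "line D f : LL" unfolding LL_def using ij by blast
   hence "f : \<Union>LL" using root_in_line ij by blast
   thus ?thesis using D.in_own_span[OF UL] by blast
  qed
 qed
 hence "fspace p \<subseteq> dspan (\<Union>LL)" unfolding fspace_def by (rule D.span_is_subset[OF _ smA])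
 hence "A = dspan (\<Union>LL)" using 1 p(3) by blast
 thus "A : typeA_building_set n" unfolding typeA_building_set_def using sub ne by blast
qed

end

section \<open>The model as a closure\<close>

lemma tendsto_funI:
 fixes f :: "'a => 'i => 'b :: topological_space"
 assumes "!!i. ((%m. f m i) \<longlongrightarrow> l i) F"
 shows "(f \<longlongrightarrow> l) F"
proof -
 have "limitin (product_topology (%i. euclidean) UNIV) f l F"
  unfolding limitin_componentwise using assms by simp
 thus ?thesis by (simp add: euclidean_product_topology)
qed

context projective begin

text \<open>The ambient product of the vector space with the projective spaces, in
  coordinates.\<close>

definition model_space :: "nat set => (nat => nat) set => model_point set" where
 "model_space I S = {(v, M). v : coords (moved (top_flat I)) \<and>
   (\<forall>p\<in>S. M p : points (moved p)) & (ALL p. p ~: S --> M p = (%_. zvec))}"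

definition open_part :: "nat set => (nat => nat) set => cvec set" where
 "open_part I S = {x : coords (moved (top_flat I)). \<forall>p\<in>S. along p x ~= zvec}"

definition embed :: "(nat => nat) set => cvec => model_point" where
 "embed S x = (x, lines_of S (%p. along p x))"

lemma config_open_part: "x : open_part I S ==> config I S x (%p. along p x)"
 unfolding config_def open_part_def
 using along_in along_along by (auto intro!: exI[of _ 1])

lemma embed_in_model: "x : open_part I S ==> embed S x : model I S"
 using config_open_part unfolding model_def embed_def by blast

text \<open>The columns of a projector lie in its line and at least one of them spans it, so testing
  the columns expresses incidence of lines by closed equations, without a choice of
  representatives.\<close>

definition incidence :: "(nat => nat) set => model_point set" where
 "incidence S = (\<Inter>p\<in>S. {z. in_line (along p (fst z)) (snd z p)}) \<inter>
   (\<Inter>p\<in>S. \<Inter>s\<in>{s : S. p o s = p}. \<Inter>k. {z. in_line (along s (%i. snd z p i k)) (snd z s)})"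

lemma closed_incidence: "closed (incidence S)"
proof -
 have c1: "continuous_on UNIV (%z :: model_point. fst z i)" for i
  by (rule continuous_on_coordD[OF continuous_on_fst[OF continuous_on_id]])
 have c2: "continuous_on UNIV (%z :: model_point. snd z p i k)" for p i k
  by (rule cont_matrixD[OF continuous_on_coordD[OF continuous_on_snd[OF continuous_on_id]]])
 have "closed {z :: model_point. in_line (u z) (snd z s)}" if u: "!!i. continuous_on UNIV (%z. u z i)" for u s
 proof -
  have "{z :: model_point. in_line (u z) (snd z s)} = (\<Inter>i. {z. (\<Sum>k<N. snd z s i k * u z k) = u z i})"
   by (auto simp: in_line_def)
  moreover have "closed {z. (\<Sum>k<N. snd z s i k * u z k) = u z i}" for i
   by (intro closed_Collect_eq continuous_on_sum continuous_on_mult c2 u)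
  ultimately show ?thesis by (simp add: closed_INT)
 qed
 note cl = this
 have "closed {z :: model_point. in_line (along p (fst z)) (snd z p)}" for p
  by (rule cl) (simp only: along_def, intro continuous_on_diff c1)
 moreover have "closed {z :: model_point. in_line (along s (%i. snd z p i k)) (snd z s)}" for p s k
  by (rule cl) (simp only: along_def, intro continuous_on_diff c2)
 ultimately show ?thesis
  unfolding incidence_def by (intro closed_Int closed_INT ballI) auto
qed

lemma pr_column: "(%i. pr x i k) = vscale (cnj (x k) / of_real (sqnorm x)) x"
 by (auto simp: pr_def vscale_def)

lemma model_eq:
 assumes S: "S \<subseteq> flats I" and I: "I \<subseteq> {..<N}"
 shows "model I S = model_space I S Int incidence S"
proof -
 have mN: "moved p \<subseteq> {..<N}" if "p : S" for p using moved_subset[of p I] that S I by blast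
 show ?thesis
 proof (intro equalityI subsetI)
  fix z assume "z : model I S"
  then obtain v X where z: "z = (v, lines_of S X)" and c: "config I S v X" by (auto simp: model_def)
  have il: "in_line u (pr (X p)) \<longleftrightarrow> (EX c. u = vscale c (X p))" if "p : S" for p u
   using in_line_pr[OF configD(2)[OF c that] mN[OF that] configD(3)[OF c that]] .
  have "z : model_space I S"
   using configD[OF c] by (auto simp: z model_space_def lines_of_def points_def)
  moreover have "in_line (along p v) (pr (X p))" if "p : S" for p
   using il[OF that] configD(4)[OF c that] by blast
  moreover have "in_line (along s (%i. pr (X p) i k)) (pr (X s))" if h: "p : S" "s : S" "p o s = p" for p s k
  proof -
   obtain c' where "along s (X p) = vscale c' (X s)" using configD(5)[OF c h] by blast
   thus ?thesis unfolding pr_column along_vscale il[OF h(2)] by auto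
  qed
  ultimately show "z : model_space I S Int incidence S" by (auto simp: z incidence_def lines_of_def)
 next
  fix z assume z: "z : model_space I S Int incidence S"
  obtain v M where vM: "z = (v, M)" by (cases z)
  have v: "v : coords (moved (top_flat I))" and Mp: "!!p. p : S ==> M p : points (moved p)" and M0: "!!p. p ~: S ==> M p = (%_. zvec)"
   using z by (auto simp: vM model_space_def)
  have i1: "in_line (along p v) (M p)" if "p : S" for p
   using z that by (auto simp: vM incidence_def)
  have i2: "in_line (along s (%i. M p i k)) (M s)" if "p : S" "s : S" "p o s = p" for p s k
   using z that by (auto simp: vM incidence_def)
  have "EX X. \<forall>p\<in>S. X p : coords (moved p) & X p ~= zvec & M p = pr (X p)"
   by (rule bchoice) (use Mp in \<open>auto simp: points_def\<close>)
  then obtain X where X: "!!p. p : S ==> X p : coords (moved p)" "!!p. p : S ==> X p ~= zvec" "!!p. p : S ==> M p = pr (X p)"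
   by blast
  have il: "in_line u (M p) \<longleftrightarrow> (EX c. u = vscale c (X p))" if "p : S" for p u
   unfolding X(3)[OF that] using in_line_pr[OF X(1)[OF that] mN[OF that] X(2)[OF that]] .
  have "EX c. along s (X p) = vscale c (X s)" if h: "p : S" "s : S" "p o s = p" for p s
  proof -
   \<comment> \<open>Column \<open>k\<close> of the projector at \<open>p\<close> is the
     representative times the nonzero number \<open>?a\<close>, so the incidence of this column
     yields that of \<open>X p\<close>.\<close>
   obtain k where k: "X p k ~= 0" using X(2)[OF h(1)] by auto
   let ?a = "cnj (X p k) / of_real (sqnorm (X p))"
   have a: "?a ~= 0" using k sqnorm_pos[OF X(1)[OF h(1)] mN[OF h(1)] X(2)[OF h(1)]] by simp
   have "in_line (vscale ?a (along s (X p))) (M s)"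
    using i2[OF h, of k] unfolding X(3)[OF h(1)] pr_column along_vscale .
   then obtain c where c: "vscale ?a (along s (X p)) = vscale c (X s)" using il[OF h(2)] by blast
   have "along s (X p) = vscale (1 / ?a) (vscale ?a (along s (X p)))" using a by simp
   thus ?thesis unfolding c by auto
  qed
  hence "config I S v X"
   unfolding config_def using v X i1 il by blast
  moreover have "M = lines_of S X" using X(3) M0 by (auto simp: lines_of_def fun_eq_iff)
  ultimately show "z : model I S" unfolding vM model_def by blast
 qed
qed

definition approaches :: "(nat => cvec) => ((nat => nat) => cvec) => (nat => nat) => bool" where
 "approaches u X s \<longleftrightarrow> (\<forall>\<^sub>F m in sequentially. along s (u m) ~= zvec) \<and>
   (ALL i j. (%m. pr (along s (u m)) i j) \<longlonglongrightarrow> pr (X s) i j)"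

lemma pr_tendsto:
 assumes w: "!!i. (%m. w m i) \<longlonglongrightarrow> x i" and x: "x : coords K" "K \<subseteq> {..<N}" "x ~= zvec"
 shows "(%m. pr (w m) i j) \<longlonglongrightarrow> pr x i j" "\<forall>\<^sub>F m in sequentially. w m ~= zvec"
proof -
 have "(%m. sqnorm (w m)) \<longlonglongrightarrow> sqnorm x"
  unfolding sqnorm_def by (intro tendsto_intros w)
 thus "(%m. pr (w m) i j) \<longlonglongrightarrow> pr x i j"
  unfolding pr_def using sqnorm_pos[OF x] by (intro tendsto_intros w) auto
 obtain k where "x k ~= 0" using x(3) by auto
 hence "\<forall>\<^sub>F m in sequentially. w m k ~= 0" using w[of k] by (rule tendsto_imp_eventually_ne[rotated])
 thus "\<forall>\<^sub>F m in sequentially. w m ~= zvec" by (rule eventually_mono) auto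
qed

text \<open>Where \<open>along s w\<close> is nonzero, it dominates in the limit and spans the line
  at \<open>s\<close> by incidence. Where it is zero, only the scaled term is left, and scaling does
  not change its line.\<close>

lemma approaches_perturb:
 assumes u: "!!i. (%m. u m i) \<longlonglongrightarrow> l i"
  and T: "!!s. s : T ==> X s : coords (moved s) & moved s \<subseteq> {..<N} & X s ~= zvec & (EX c. along s w = vscale c (X s))"
  and Z: "!!s. s : T ==> along s w = zvec ==> approaches u X s"
 defines "u' \<equiv> %m i. w i + of_real (inverse (real (Suc m))) * u m i"
 shows "(%m. u' m i) \<longlonglongrightarrow> w i" "s : T ==> approaches u' X s"
proof -
 have lim: "(%m. u' m i) \<longlonglongrightarrow> w i" for i
 proof -
  have "(%m. w i + of_real (inverse (real (Suc m))) * u m i) \<longlonglongrightarrow> w i + of_real 0 * l i"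
   by (intro tendsto_add tendsto_mult tendsto_const tendsto_of_real LIMSEQ_inverse_real_of_nat u)
  thus ?thesis by (simp add: u'_def)
 qed
 thus "(%m. u' m i) \<longlonglongrightarrow> w i" .
 assume s: "s : T"
 show "approaches u' X s"
 proof (cases "along s w = zvec")
  case True
  have "along s (u' m) = vscale (of_real (inverse (real (Suc m)))) (along s (u m))" for m
   using fun_cong[OF True] by (auto simp: along_def u'_def vscale_def algebra_simps fun_eq_iff)
  hence eq: "along s (u' m) = vscale (of_real (inverse (real (Suc m)))) (along s (u m))" for m .
  have nz: "complex_of_real (inverse (real (Suc m))) ~= 0" for m
   by (simp only: of_real_eq_0_iff inverse_nonzero_iff_nonzero of_nat_eq_0_iff nat.simps not_False_eq_True)
  have "pr (along s (u' m)) = pr (along s (u m))" for m unfolding eq by (rule pr_vscale[OF nz])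
  moreover have "along s (u' m) ~= zvec \<longleftrightarrow> along s (u m) ~= zvec" for m
   unfolding eq vscale_eq_0_iff using nz by blast
  ultimately show ?thesis using Z[OF s True] unfolding approaches_def by (simp only: simp_thms)
 next
  case False
  obtain c where c: "along s w = vscale c (X s)" using T[OF s] by blast
  hence "c ~= 0" using False by auto
  hence prX: "pr (along s w) = pr (X s)" unfolding c by (rule pr_vscale)
  have "(%m. along s (u' m) i) \<longlonglongrightarrow> along s w i" for i
   unfolding along_def by (intro tendsto_diff lim)
  from pr_tendsto[OF this along_in _ False] show ?thesis
   unfolding approaches_def prX using T[OF s] by blast
 qed
qed

text \<open>The members of \<open>Z\<close>, the flats of \<open>S\<close> finer than
  \<open>t\<close> on whose blocks \<open>w\<close> is constant, are closed under joins; if there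
  are any, there is a coarsest one \<open>r\<close>. Vectors that approximate the lines of the flats
  finer than \<open>r\<close>, provided by \<open>IH\<close>, are added to \<open>w\<close> with a
  factor tending to zero.\<close>

lemma approaches_lift:
 assumes I: "I \<subseteq> {..<N}" and S: "S = pflats I" and c: "config I S v X"
  and t: "t : flats I" and w: "w : coords (moved t)"
  and tw: "!!s. s : S ==> t o s = t ==> EX c. along s w = vscale c (X s)"
  and IH: "!!r. r : S ==> t o r = t ==> w o r = w ==> EX u l. (ALL m. u m : coords (moved r)) \<and>
    (ALL i. (%m. u m i) \<longlonglongrightarrow> l i) & (\<forall>s\<in>S. r o s = r --> approaches u X s)"
 shows "EX u. (ALL m. u m : coords (moved t)) & (ALL i. (%m. u m i) \<longlonglongrightarrow> w i) \<and>
  (\<forall>s\<in>S. t o s = t --> approaches u X s)"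
proof -
 have finI: "finite I" using I finite_subset by blast
 have SF: "s : flats I" "s ~= id" if "s : S" for s using that S by (auto simp: pflats_def)
 define T where "T = {s : S. t o s = t}"
 define Z where "Z = {s : T. w o s = w}"
 have TX: "X s : coords (moved s) & moved s \<subseteq> {..<N} & X s ~= zvec & (EX c. along s w = vscale c (X s))"
  if "s : T" for s
  using that configD(2,3)[OF c] tw SF moved_subset I unfolding T_def by blast
 have "EX u l. (ALL m. u m : coords (moved t)) & (ALL i. (%m. u m i) \<longlonglongrightarrow> l i) & (\<forall>s\<in>Z. approaches u X s)"
 proof (cases "Z = {}")
  case True
  have "(%m::nat. zvec i) \<longlonglongrightarrow> zvec i" for i by simp
  moreover have "zvec : coords (moved t)" by (simp add: coords_def)
  ultimately show ?thesis using True by (intro exI[of _ "%_. zvec"] exI[of _ zvec]) simp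
 next
  case False
  have ZF: "Z \<subseteq> flats I" using SF by (auto simp: Z_def T_def)
  have "finite Z" using finite_subset[OF ZF finite_flats[OF finI]] .
  hence "Max ((%s. card (moved s)) ` Z) : (%s. card (moved s)) ` Z" using False by (intro Max_in) auto
  then obtain r where r0: "r : Z" "card (moved r) = Max ((%s. card (moved s)) ` Z)" by auto
  have r: "r : Z" "!!s. s : Z ==> card (moved s) <= card (moved r)"
   using r0 Max_ge[of "(%s. card (moved s)) ` Z"] `finite Z` by auto
  have rS: "r : S" "t o r = t" "w o r = w" using r(1) by (auto simp: Z_def T_def)
  \<comment> \<open>The join of \<open>r\<close> with another member is again in \<open>Z\<close>
    and has at least the rank of \<open>r\<close>, so by maximality it is \<open>r\<close>.\<close>
  have coarse: "r o s = r" if s: "s : Z" for s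
  proof -
   let ?j = "join r s"
   have sS: "s : S" "t o s = t" "w o s = w" using s by (auto simp: Z_def T_def)
   have jF: "?j : flats I" by (rule join_flat[OF SF(1)[OF rS(1)] SF(1)[OF sS(1)]])
   have "?j ~= id"
   proof
    assume "?j = id"
    hence "r = id" using join_coarser(1)[of r s] by simp
    thus False using SF(2)[OF rS(1)] by simp
   qed
   hence "?j : Z" unfolding Z_def T_def S pflats_def
    using jF join_least[OF rS(2) sS(2)] join_least[OF rS(3) sS(3)] by blast
   hence "card (moved ?j) <= card (moved r)" by (rule r(2))
   moreover have "card (moved r) <= card (moved ?j)"
    by (rule moved_coarser(1)[OF jF SF(1)[OF rS(1)] join_coarser(1) finI])
   ultimately have "?j = r"
    by (intro moved_coarser(2)[OF jF SF(1)[OF rS(1)] join_coarser(1) finI]) simp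
   thus ?thesis using join_coarser(2)[of r s] by simp
  qed
  obtain u l where u: "!!m. u m : coords (moved r)" "!!i. (%m. u m i) \<longlonglongrightarrow> l i"
    "!!s. s : S ==> r o s = r ==> approaches u X s"
   using IH[OF rS] by blast
  have "moved r \<subseteq> moved t" using coarser_fixed[OF t SF(1)[OF rS(1)] rS(2)] by (auto simp: moved_def)
  hence "u m : coords (moved t)" for m using u(1)[of m] coords_mono by blast
  moreover have "approaches u X s" if "s : Z" for s using u(3) coarse[OF that] that by (simp add: Z_def T_def)
  ultimately show ?thesis using u(2) by blast
 qed
 then obtain u l where u: "!!m. u m : coords (moved t)" "!!i. (%m. u m i) \<longlonglongrightarrow> l i" "!!s. s : Z ==> approaches u X s"
  by blast
 have "approaches u X s" if "s : T" "along s w = zvec" for s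
  using u(3) that by (simp add: Z_def along_zero_iff)
 note pert = approaches_perturb[of u l T X w, OF u(2) TX this]
 define u' where "u' = (%m i. w i + of_real (inverse (real (Suc m))) * u m i)"
 have "u' m : coords (moved t)" for m
  using u(1)[of m] w by (simp add: u'_def coords_def)
 moreover have "(%m. u' m i) \<longlonglongrightarrow> w i" for i unfolding u'_def by (rule pert(1))
 moreover have "approaches u' X s" if "s : S" "t o s = t" for s
  unfolding u'_def by (rule pert(2)) (use that in \<open>simp_all add: T_def\<close>)
 ultimately show ?thesis by blast
qed

text \<open>The recursion descends in rank: the nonzero representative \<open>X p\<close> is not
  constant on the blocks of \<open>p\<close>, so any flat \<open>r\<close> under which it is
  constant differs from \<open>p\<close>.\<close>

lemma approaches_exists:
 assumes I: "I \<subseteq> {..<N}" and S: "S = pflats I" and c: "config I S v X" and p: "p : S"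
 shows "EX u l. (ALL m. u m : coords (moved p)) & (ALL i. (%m. u m i) \<longlonglongrightarrow> l i) \<and>
  (\<forall>s\<in>S. p o s = p --> approaches u X s)"
 using p
proof (induct p rule: measure_induct_rule[of "%p. card (moved p)"])
 case (less p)
 have finI: "finite I" using I finite_subset by blast
 have SF: "s : flats I" if "s : S" for s using that S by (auto simp: pflats_def)
 have "EX u. (ALL m. u m : coords (moved p)) & (ALL i. (%m. u m i) \<longlonglongrightarrow> X p i) \<and>
  (\<forall>s\<in>S. p o s = p --> approaches u X s)"
 proof (rule approaches_lift[OF I S c SF[OF less(2)] configD(2)[OF c less(2)]])
  show "EX c. along s (X p) = vscale c (X s)" if "s : S" "p o s = p" for s
   using configD(5)[OF c less(2) that] .
  fix r assume r: "r : S" "p o r = p" "X p o r = X p"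
  have "X p o p ~= X p"
   by (rule nonzero_not_invariant[OF SF[OF less(2)] configD(2,3)[OF c less(2)]])
  hence "p ~= r" using r(3) by auto
  hence "card (moved r) < card (moved p)"
   using moved_coarser[OF SF[OF less(2)] SF[OF r(1)] r(2) finI] by (meson le_neq_implies_less)
  thus "EX u l. (ALL m. u m : coords (moved r)) & (ALL i. (%m. u m i) \<longlonglongrightarrow> l i) \<and>
    (\<forall>s\<in>S. r o s = r --> approaches u X s)"
   by (rule less(1)[OF _ r(1)])
 qed
 thus ?case by blast
qed

text \<open>Incidence is closed, which bounds the closure. For density,
  \<open>approaches_lift\<close> is applied to \<open>v\<close> and the one-block partition
  \<open>top_flat I\<close>, to which all flats of \<open>S\<close> are finer; the resulting vectors
  are eventually in the open part.\<close>

lemma model_closure: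
 assumes I: "I \<subseteq> {..<N}" and S: "S = pflats I"
 shows "top_of_set (model_space I S) closure_of (embed S ` open_part I S) = model I S"
proof (rule equalityI)
 have finI: "finite I" using I finite_subset by blast
 have SF: "S \<subseteq> flats I" by (auto simp: S pflats_def)
 have meq: "model I S = model_space I S Int incidence S" by (rule model_eq[OF SF I])
 show "top_of_set (model_space I S) closure_of (embed S ` open_part I S) \<subseteq> model I S"
 proof (rule closure_of_minimal)
  show "embed S ` open_part I S \<subseteq> model I S" using embed_in_model by blast
  show "closedin (top_of_set (model_space I S)) (model I S)"
   unfolding meq by (rule closedin_closed_Int[OF closed_incidence])
 qed
 show "model I S \<subseteq> top_of_set (model_space I S) closure_of (embed S ` open_part I S)"
 proof
  fix z assume zm: "z : model I S"
  then obtain v X where z: "z = (v, lines_of S X)" and c: "config I S v X" by (auto simp: model_def)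
  have "EX u. (ALL m. u m : coords (moved (top_flat I))) & (ALL i. (%m. u m i) \<longlonglongrightarrow> v i) \<and>
   (\<forall>s\<in>S. top_flat I o s = top_flat I --> approaches u X s)"
  proof (rule approaches_lift[OF I S c top_flat_in[OF finI] configD(1)[OF c]])
   show "EX c. along s v = vscale c (X s)" if "s : S" for s using configD(4)[OF c that] .
   show "EX u l. (ALL m. u m : coords (moved r)) & (ALL i. (%m. u m i) \<longlonglongrightarrow> l i) \<and>
    (\<forall>s\<in>S. r o s = r --> approaches u X s)" if "r : S" for r
    by (rule approaches_exists[OF I S c that])
  qed
  then obtain u where u: "!!m. u m : coords (moved (top_flat I))" "!!i. (%m. u m i) \<longlonglongrightarrow> v i"
    "!!s. s : S ==> approaches u X s"
   using top_flat_coarser SF by blast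
  have finS: "finite S" using finite_subset[OF SF finite_flats[OF finI]] .
  have "\<forall>\<^sub>F m in sequentially. \<forall>s\<in>S. along s (u m) ~= zvec"
   by (rule eventually_ball_finite[OF finS]) (use u(3) in \<open>auto simp: approaches_def\<close>)
  hence ev: "\<forall>\<^sub>F m in sequentially. u m : open_part I S"
   by (rule eventually_mono) (use u(1) in \<open>simp add: open_part_def\<close>)
  have "(%m. lines_of S (%p. along p (u m)) p i j) \<longlonglongrightarrow> lines_of S X p i j" for p i j
   using u(3)[of p] by (cases "p : S") (auto simp: lines_of_def approaches_def)
  hence "(%m. lines_of S (%p. along p (u m))) \<longlonglongrightarrow> lines_of S X"
   by (intro tendsto_funI)
  moreover have "u \<longlonglongrightarrow> v" by (rule tendsto_funI) (rule u(2))
  ultimately have lim: "(%m. embed S (u m)) \<longlonglongrightarrow> z"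
   unfolding embed_def z by (intro tendsto_Pair)
  show "z : top_of_set (model_space I S) closure_of (embed S ` open_part I S)"
   unfolding in_closure_of
  proof (intro conjI allI impI)
   show "z : topspace (top_of_set (model_space I S))" using zm meq by simp
   fix T assume T: "z : T & openin (top_of_set (model_space I S)) T"
   then obtain U where U: "open U" "T = model_space I S Int U" by (auto simp: openin_open)
   have "\<forall>\<^sub>F m in sequentially. embed S (u m) : U"
    by (rule topological_tendstoD[OF lim U(1)]) (use T U(2) in blast)
   hence "\<forall>\<^sub>F m in sequentially. embed S (u m) : U & u m : open_part I S"
    using ev by (rule eventually_conj)
   then obtain m where m: "embed S (u m) : U" "u m : open_part I S"
    using eventually_happens'[OF sequentially_bot] by blast
   moreover have "embed S (u m) : model_space I S" using embed_in_model[OF m(2)] meq by blast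
   ultimately show "EX y. y : embed S ` open_part I S & y : T" using U(2) by blast
  qed
 qed
qed

end

section \<open>Comparison with the model of De Concini and Procesi\<close>

text \<open>In the definition of the model the lines are indexed by subspaces, in coordinates by
  flats. The injection \<open>F\<close> translates between the two, and \<open>z\<close> pads the
  values outside \<open>S\<close>.\<close>

lemma homeomorphic_maps_product_reindex:
 fixes T :: "'p => 'b :: topological_space set"
 assumes inj: "inj_on F S" and h: "!!p. p : S ==> homeomorphic_maps (X (F p)) (top_of_set (T p)) (f p) (g p)"
 shows "homeomorphic_maps (product_topology X (F ` S))
  (top_of_set {M. (\<forall>p\<in>S. M p : T p) & (ALL p. p ~: S --> M p = z)})
  (%L p. if p : S then f p (L (F p)) else z)
  (%M. \<lambda>A\<in>F ` S. g (inv_into S F A) (M (inv_into S F A)))"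
  (is "homeomorphic_maps ?P (top_of_set ?B) ?f ?g")
proof -
 have fc: "continuous_map (X (F p)) (top_of_set (T p)) (f p)" and gc: "continuous_map (top_of_set (T p)) (X (F p)) (g p)"
  and gf: "!!x. x : topspace (X (F p)) ==> g p (f p x) = x" and fg: "!!y. y : T p ==> f p (g p y) = y"
  if "p : S" for p using h[OF that] by (auto simp: homeomorphic_maps_def)
 have fT: "f p x : T p" if "p : S" "x : topspace (X (F p))" for p x
  using continuous_map_funspace[OF fc[OF that(1)]] that(2) by auto
 have inv: "inv_into S F (F p) = p" if "p : S" for p using inv_into_f_f[OF inj that] .
 have top: "L (F p) : topspace (X (F p))" if "L : topspace ?P" "p : S" for L p
  using that by (auto simp: PiE_iff)
 have "continuous_map ?P euclidean (%L. ?f L p)" for p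
 proof (cases "p : S")
  case True
  have "continuous_map ?P (X (F p)) (%L. L (F p))" by (rule continuous_map_product_projection) (use True in blast)
  moreover have "continuous_map (X (F p)) euclidean (f p)" using fc[OF True] continuous_map_into_fulltopology by blast
  ultimately have "continuous_map ?P euclidean (f p o (%L. L (F p)))" by (rule continuous_map_compose)
  thus ?thesis using True by (simp add: comp_def)
 qed simp
 hence "continuous_map ?P euclidean ?f"
  by (simp only: continuous_map_componentwise_UNIV flip: euclidean_product_topology) simp
 moreover have "?f L : ?B" if "L : topspace ?P" for L using fT top[OF that] by simp
 ultimately have 1: "continuous_map ?P (top_of_set ?B) ?f"
  unfolding continuous_map_in_subtopology by blast
 have c: "continuous_map (top_of_set ?B) (X (F p)) (%M. g p (M p))" if p: "p : S" for p
 proof -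
  have "continuous_on ?B (%M. M p)" by (rule continuous_on_coordD[OF continuous_on_id])
  hence "continuous_map (top_of_set ?B) (top_of_set (T p)) (%M. M p)" using p by auto
  from continuous_map_compose[OF this gc[OF p]] show ?thesis by (simp only: comp_def)
 qed
 have 2: "continuous_map (top_of_set ?B) ?P ?g"
  unfolding continuous_map_componentwise
 proof (intro conjI ballI)
  show "?g ` topspace (top_of_set ?B) \<subseteq> extensional (F ` S)" by blast
  fix A assume "A : F ` S"
  then obtain p where p: "p : S" "A = F p" by blast
  thus "continuous_map (top_of_set ?B) (X A) (%M. ?g M A)" using c[OF p(1)] inv[OF p(1)] by simp
 qed
 have "?g (?f L) = L" if "L : topspace ?P" for L
 proof
  fix A
  show "?g (?f L) A = L A"
  proof (cases "A : F ` S")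
   case True
   then obtain p where p: "p : S" "A = F p" by blast
   have "?g (?f L) (F p) = g p (f p (L (F p)))" using p(1) by (simp only: restrict_apply' imageI inv[OF p(1)] if_True)
   thus ?thesis by (simp only: p(2) gf[OF p(1) top[OF that p(1)]])
  next
   case False
   thus ?thesis using PiE_arb[OF that[unfolded topspace_product_topology] False] by (simp only: restrict_apply if_False)
  qed
 qed
 moreover have "?f (?g M) = M" if "M : ?B" for M
 proof
  fix p
  show "?f (?g M) p = M p"
  proof (cases "p : S")
   case True
   hence "M p : T p" using that by blast
   thus ?thesis using True inv[OF True] fg[OF True] by simp
  next
   case False
   thus ?thesis using that by simp
  qed
 qed
 ultimately show ?thesis unfolding homeomorphic_maps_def using 1 2 by simp
qed

context typeA begin

sublocale P: projective n .

abbreviation "S \<equiv> pflats {..<n}"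

lemma projective_at:
 assumes p: "p : S"
 defines "K \<equiv> annihilator V (fspace p)"
 shows "EX f g. homeomorphic_maps (projective_space (quotient_space V K)) (top_of_set (P.points (moved p))) f g \<and>
  (\<forall>X\<in>carrier V. along p (Ph X) ~= zvec -->
    line (quotient_space V K) (K +>\<^bsub>V\<^esub> X) : topspace (projective_space (quotient_space V K)) \<and>
    f (line (quotient_space V K) (K +>\<^bsub>V\<^esub> X)) = P.pr (along p (Ph X)))"
proof -
 have pF: "p : flats I" using p by (simp add: pflats_def)
 interpret Q: coordinate_quotient V Ph "moved topI" "along p" "moved p" by (rule quotient_at[OF pF])
 have K: "K = Q.ker" unfolding K_def Q.ker_def by (rule annihilator_fspace[OF pF])
 interpret R: coordinates_proj "quotient_space V K" Q.quot_phi "moved p" n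
 proof unfold_locales
  show "coordinatized (quotient_space V K) Q.quot_phi (moved p)" unfolding K by (rule Q.coordinatized_quotient)
  show "moved p \<subseteq> {..<n}" by (rule moved_subset[OF pF])
 qed
 have "line (quotient_space V K) (K +>\<^bsub>V\<^esub> X) : topspace (projective_space (quotient_space V K)) \<and>
   R.line_pr (line (quotient_space V K) (K +>\<^bsub>V\<^esub> X)) = P.pr (along p (Ph X))"
  if X: "X : carrier V" "along p (Ph X) ~= zvec" for X
 proof -
  have q: "Q.quot_phi (K +>\<^bsub>V\<^esub> X) = along p (Ph X)" unfolding K by (rule Q.quot_phi_coset[OF X(1)])
  hence "K +>\<^bsub>V\<^esub> X ~= \<zero>\<^bsub>quotient_space V K\<^esub>" using X(2) R.phi_zero by auto
  moreover have "K +>\<^bsub>V\<^esub> X : carrier (quotient_space V K)" using X(1) by (simp add: K Q.quot_carrier)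
  ultimately have "K +>\<^bsub>V\<^esub> X : carrier (quotient_space V K) - {\<zero>\<^bsub>quotient_space V K\<^esub>}" by blast
  moreover have "topspace (projective_space (quotient_space V K)) =
    line (quotient_space V K) ` (carrier (quotient_space V K) - {\<zero>\<^bsub>quotient_space V K\<^esub>})"
   using R.quotient_map_line R.topspace_domain0 by (simp add: quotient_map_def)
  ultimately show ?thesis using R.line_pr_line[of "K +>\<^bsub>V\<^esub> X"] q by (simp only: imageI simp_thms)
 qed
 thus ?thesis using R.homeomorphic_maps_projective by blast
qed

lemma complement_eq: "dcp_complement V (fspace ` S) = {X : carrier V. \<forall>p\<in>S. along p (Ph X) ~= zvec}"
 using annihilator_fspace unfolding dcp_complement_def pflats_def by auto

text \<open>A homeomorphism of the ambient spaces that matches the two embeddings of the complement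
  also matches the closures of their images.\<close>

lemma typeA_model_homeomorphic: "typeA_model n homeomorphic_space top_of_set (P.model I S)"
proof -
 let ?Q = "%A. quotient_space V (annihilator V A)"
 have "EX f g. \<forall>p\<in>S. homeomorphic_maps (projective_space (?Q (fspace p))) (top_of_set (P.points (moved p))) (f p) (g p) \<and>
   (\<forall>X\<in>carrier V. along p (Ph X) ~= zvec -->
     line (?Q (fspace p)) (annihilator V (fspace p) +>\<^bsub>V\<^esub> X) : topspace (projective_space (?Q (fspace p))) \<and>
     f p (line (?Q (fspace p)) (annihilator V (fspace p) +>\<^bsub>V\<^esub> X)) = P.pr (along p (Ph X)))"
  using projective_at by metis
 then obtain f g where fg: "!!p. p : S ==> homeomorphic_maps (projective_space (?Q (fspace p))) (top_of_set (P.points (moved p))) (f p) (g p)"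
  and fl: "!!p X. p : S ==> X : carrier V ==> along p (Ph X) ~= zvec ==>
    f p (line (?Q (fspace p)) (annihilator V (fspace p) +>\<^bsub>V\<^esub> X)) = P.pr (along p (Ph X))"
  and tl: "!!p X. p : S ==> X : carrier V ==> along p (Ph X) ~= zvec ==>
    line (?Q (fspace p)) (annihilator V (fspace p) +>\<^bsub>V\<^esub> X) : topspace (projective_space (?Q (fspace p)))"
  by blast
 let ?G = "fspace ` S"
 let ?M = "P.model_space I S"
 let ?F = "%L p. if p : S then f p (L (fspace p)) else (%_. zvec)"
 let ?\<Theta> = "%(X, L). (Ph X, ?F L)"
 let ?E = "dcp_embedding V ?G ` dcp_complement V ?G"
 have ambient: "dcp_ambient V ?G = prod_topology (cspace_topology V) (product_topology (%A. projective_space (?Q A)) ?G)"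
  by (rule dcp_ambient_def)
 have Meq: "?M = coords (moved topI) \<times> {M. (\<forall>p\<in>S. M p : P.points (moved p)) & (ALL p. p ~: S --> M p = (%_. zvec))}"
  unfolding P.model_space_def by auto
 have "homeomorphic_map (dcp_ambient V ?G) (top_of_set ?M) ?\<Theta>"
  unfolding ambient Meq prod_topology_subtopology_eu[symmetric] homeomorphic_map_maps
  using V.homeo_coordinates
   homeomorphic_maps_product_reindex[where X = "%A. projective_space (?Q A)" and T = "%p. P.points (moved p)" and z = "%_. zvec",
    OF fspace_inj fg]
  by (intro exI) (rule homeomorphic_maps_prod[THEN iffD2], blast)
 note hom = this
 have emb: "?\<Theta> (dcp_embedding V ?G X) = P.embed S (Ph X)" if "X : dcp_complement V ?G" for X
  using fl that unfolding complement_eq by (auto simp: dcp_embedding_def P.embed_def P.lines_of_def fun_eq_iff)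
 have "?\<Theta> ` ?E = P.embed S ` Ph ` dcp_complement V ?G"
  unfolding image_image using emb by (intro image_cong refl)
 also have "Ph ` dcp_complement V ?G = P.open_part I S"
 proof (intro equalityI subsetI)
  fix x assume "x : P.open_part I S"
  hence x: "x : coords (moved topI)" "\<forall>p\<in>S. along p x ~= zvec" by (auto simp: P.open_part_def)
  hence "V.ps x : dcp_complement V ?G" unfolding complement_eq using V.psi_in V.phi_psi by simp
  thus "x : Ph ` dcp_complement V ?G" using V.phi_psi[OF x(1)] by (metis imageI)
 qed (use V.phi_in in \<open>auto simp: complement_eq P.open_part_def\<close>)
 finally have img: "?\<Theta> ` ?E = P.embed S ` P.open_part I S" .
 have sub: "?E \<subseteq> topspace (dcp_ambient V ?G)"
 proof
  fix z assume "z : ?E"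
  then obtain X where X: "X : dcp_complement V ?G" "z = dcp_embedding V ?G X" by blast
  have Xc: "X : carrier V" and nz: "!!p. p : S ==> along p (Ph X) ~= zvec" using X(1) by (auto simp: complement_eq)
  have "line (?Q (fspace p)) (annihilator V (fspace p) +>\<^bsub>V\<^esub> X) : topspace (projective_space (?Q (fspace p)))"
   if p: "p : S" for p
   by (rule tl[OF p Xc nz[OF p]])
  thus "z : topspace (dcp_ambient V ?G)"
   using Xc by (auto simp: X(2) dcp_embedding_def ambient V.topspace_cspace)
 qed
 have cl: "top_of_set ?M closure_of (P.embed S ` P.open_part I S) = P.model I S"
  by (rule P.model_closure) simp_all
 hence closure: "?\<Theta> ` (dcp_ambient V ?G closure_of ?E) = P.model I S"
  using homeomorphic_map_closure_of[OF hom sub] img by simp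
 have mM: "P.model I S \<subseteq> ?M" using closure_of_subset_topspace[of "top_of_set ?M"] cl by force
 have "homeomorphic_map (subtopology (dcp_ambient V ?G) (dcp_ambient V ?G closure_of ?E))
   (subtopology (top_of_set ?M) (P.model I S)) ?\<Theta>"
 proof (rule homeomorphic_map_subtopologies[OF hom])
  have "topspace (dcp_ambient V ?G) Int (dcp_ambient V ?G closure_of ?E) = dcp_ambient V ?G closure_of ?E"
   by (rule Int_absorb1[OF closure_of_subset_topspace])
  moreover have "topspace (top_of_set ?M) Int P.model I S = P.model I S"
   by (simp only: topspace_euclidean_subtopology Int_absorb1[OF mM])
  ultimately show "?\<Theta> ` (topspace (dcp_ambient V ?G) Int (dcp_ambient V ?G closure_of ?E)) = topspace (top_of_set ?M) Int P.model I S"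
   by (simp only: closure)
 qed
 hence "homeomorphic_map (typeA_model n) (subtopology (top_of_set ?M) (P.model I S)) ?\<Theta>"
  by (simp only: dcp_model_def building_set_eq)
 moreover have "subtopology (top_of_set ?M) (P.model I S) = top_of_set (P.model I S)"
  by (simp only: subtopology_subtopology Int_absorb1[OF mM])
 ultimately have "homeomorphic_map (typeA_model n) (top_of_set (P.model I S)) ?\<Theta>" by (simp only:)
 thus ?thesis by (rule homeomorphic_map_imp_homeomorphic_space)
qed

lemma poincare_polynomial_typeA_model: "poincare_polynomial (typeA_model n) = map_poly of_nat (flat_poly {..<n})"
proof (rule poincare_polynomial_even_hom)
 have "top_of_set (P.model I S) homeomorphic_space typeA_model n"
  using typeA_model_homeomorphic homeomorphic_space_sym by blast
 from even_hom_homeomorphic[OF P.even_hom_model[OF subset_refl I_nonempty] this]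
 show "even_hom (typeA_model n) (%p. if p < 0 then 0 else Polynomial.coeff (flat_poly {..<n}) (nat (p div 2)))"
  unfolding even_coeff_def .
qed

end

theorem theorem3p1:
  shows "subst_series (remove_bad ptilde_A) =
    fps_X + Abs_fps (\<lambda>n. if n \<ge> 2
      then Polynomial.smult (1 / fact n) (poincare_polynomial (typeA_model n)) else 0)"
proof (rule fps_ext)
 fix n
 show "fps_nth (subst_series (remove_bad ptilde_A)) n = fps_nth (fps_X + Abs_fps (%n. if n >= 2
   then Polynomial.smult (1 / fact n) (poincare_polynomial (typeA_model n)) else 0)) n"
 proof (cases "2 <= n")
  case True
  hence "poincare_polynomial (typeA_model n) = map_poly of_nat (flat_poly {..<n})"
   by (intro typeA.poincare_polynomial_typeA_model typeA.intro)
  thus ?thesis using True subst_series_coefficient[OF True] by simp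
 next
  case False
  thus ?thesis using small_coefficients[of n] by (simp add: fps_X_nth)
 qed
qed

end
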